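(* Let $p$ be a prime number, let $n$ be a positive integer, and let $\mathcal{E}$ be an elliptic curve defined over a number field $k$. Suppose that $k$ does not contain $\mathbb{Q}(\zeta_p+\overline{\zeta_p})$, and that $\mathcal{E}$ does not admit any $k$-rational torsion point of exact order $p$. Then $H^1_{\rm loc}(G_n,\mathcal{E}[p^n])=0$.
   Context: $\zeta_p$ is a primitive $p$-th root of unity and $\overline{\zeta_p}=\zeta_p^{-1}$. $\mathcal{E}[p^n]$ is the $p^n$-torsion subgroup of $\mathcal{E}$ (over an algebraic closure), $K_n=k(\mathcal{E}[p^n])$ is the field generated over $k$ by the coordinates of the $p^n$-torsion points, and $G_n=\mathrm{Gal}(K_n/k)$, acting on $\mathcal{E}[p^n]$. For a group $\Sigma$ and a $\Sigma$-module $M$, $H^1_{\rm loc}(\Sigma,M)$ is the subgroup of $H^1(\Sigma,M)$ formed by the classes of cocycles $\{Z_\sigma\}_{\sigma\in\Sigma}$ such that for every $\sigma\in\Sigma$ there is $W_\sigma\in M$ with $Z_\sigma=(\sigma-1)W_\sigma$; equivalently, it is the intersection of the kernels of the restriction maps $H^1(\Sigma,M)\to H^1(C,M)$ as $C$ runs over all cyclic subgroups of $\Sigma$. *)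

theory Defs
  imports "HOL-Algebra.Algebra" "HOL-Algebra.Algebraic_Closure_Type"
begin

section \<open>Fields\<close>

text \<open>
  All fields are subfields of an ambient field given by a type. The library expresses subfields,
  generated fields, dimensions and algebraic closures for ring records, so the type is viewed as
  the record \<^const>\<open>ring_of_type_algebra\<close> with carrier \<^const>\<open>UNIV\<close>.
\<close>

definition number_field :: "'a::field_char_0 set \<Rightarrow> bool" where
  "number_field k \<longleftrightarrow>
     subfield k ring_of_type_algebra \<and> ring.finite_dimension ring_of_type_algebra \<rat> k"

definition primitive_root_of_unity :: "nat \<Rightarrow> 'a::field \<Rightarrow> bool" where
  "primitive_root_of_unity m z \<longleftrightarrow> m > 0 \<and> z ^ m = 1 \<and> (\<forall>j. 0 < j \<and> j < m \<longrightarrow> z ^ j \<noteq> 1)"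

definition adjoin :: "'a::field set \<Rightarrow> 'a set \<Rightarrow> 'a set" where
  "adjoin k S = generate_field ring_of_type_algebra (k \<union> S)"

text \<open>
  Elements of the Galois group are extensional functions on \<^term>\<open>K\<close> (\<^const>\<open>undefined\<close> elsewhere);
  the product is composition, the right factor being applied first.
\<close>

definition galois_group :: "'a::field set \<Rightarrow> 'a set \<Rightarrow> ('a \<Rightarrow> 'a) monoid" where
  "galois_group K k = (BijGroup K)
     \<lparr>carrier := {\<sigma> \<in> Bij K.
        \<sigma> \<in> ring_hom (ring_of_type_algebra\<lparr>carrier := K\<rparr>) (ring_of_type_algebra\<lparr>carrier := K\<rparr>) \<and>
        (\<forall>x\<in>k. \<sigma> x = x)}\<rparr>"


section \<open>Elliptic curves\<close>

text \<open>The curve \<open>y\<^sup>2 + a1 x y + a3 y = x\<^sup>3 + a2 x\<^sup>2 + a4 x + a6\<close>.\<close>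

datatype 'a weierstrass = Weierstrass 'a 'a 'a 'a 'a

datatype 'a point = Infinity | Affine 'a 'a

fun discriminant :: "'a::field weierstrass \<Rightarrow> 'a" where
  "discriminant (Weierstrass a1 a2 a3 a4 a6) =
     (let b2 = a1^2 + 4 * a2;
          b4 = 2 * a4 + a1 * a3;
          b6 = a3^2 + 4 * a6;
          b8 = a1^2 * a6 + 4 * a2 * a6 - a1 * a3 * a4 + a2 * a3^2 - a4^2
      in - (b2^2 * b8) - 8 * b4^3 - 27 * b6^2 + 9 * b2 * b4 * b6)"

definition elliptic_curve_over :: "'a::field set \<Rightarrow> 'a weierstrass \<Rightarrow> bool" where
  "elliptic_curve_over k E \<longleftrightarrow> set_weierstrass E \<subseteq> k \<and> discriminant E \<noteq> 0"

fun on_curve :: "'a::field weierstrass \<Rightarrow> 'a point \<Rightarrow> bool" where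
  "on_curve E Infinity \<longleftrightarrow> True"
| "on_curve (Weierstrass a1 a2 a3 a4 a6) (Affine x y) \<longleftrightarrow>
     y^2 + a1 * x * y + a3 * y = x^3 + a2 * x^2 + a4 * x + a6"

text \<open>
  Chord and tangent law: \<open>l\<close> is the slope of the line through the two points (the tangent line if
  they coincide). The negative of \<open>(x, y)\<close> is \<open>(x, - y - a1 x - a3)\<close>.
\<close>

fun point_add :: "'a::field weierstrass \<Rightarrow> 'a point \<Rightarrow> 'a point \<Rightarrow> 'a point" where
  "point_add E Infinity Q = Q"
| "point_add E (Affine x1 y1) Infinity = Affine x1 y1"
| "point_add (Weierstrass a1 a2 a3 a4 a6) (Affine x1 y1) (Affine x2 y2) =
     (if x1 = x2 \<and> y1 + y2 + a1 * x2 + a3 = 0 then Infinity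
      else
        let l = (if x1 = x2
                 then (3 * x1^2 + 2 * a2 * x1 + a4 - a1 * y1) / (2 * y1 + a1 * x1 + a3)
                 else (y2 - y1) / (x2 - x1));
            x3 = l^2 + a1 * l - a2 - x1 - x2
        in Affine x3 (- (l * (x3 - x1) + y1) - a1 * x3 - a3))"

text \<open>
  The group of points with coordinates in \<open>F\<close>. As for all groups of the library it is written
  multiplicatively, so \<open>m P\<close> is \<open>P [^] m\<close>.
\<close>

definition point_group :: "'a::field weierstrass \<Rightarrow> 'a set \<Rightarrow> 'a point monoid" where
  "point_group E F =
     \<lparr>carrier = {P. on_curve E P \<and> set_point P \<subseteq> F}, monoid.mult = point_add E, one = Infinity\<rparr>"

text \<open>The torsion is that over the whole ambient field, which will be an algebraic closure.\<close>

definition torsion_group :: "'a::field weierstrass \<Rightarrow> nat \<Rightarrow> 'a point monoid" where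
  "torsion_group E m = (point_group E UNIV)
     \<lparr>carrier := {P \<in> carrier (point_group E UNIV).
        P [^]\<^bsub>point_group E UNIV\<^esub> m = \<one>\<^bsub>point_group E UNIV\<^esub>}\<rparr>"

definition torsion_field :: "'a::field set \<Rightarrow> 'a weierstrass \<Rightarrow> nat \<Rightarrow> 'a set" where
  "torsion_field k E m = adjoin k (\<Union>P\<in>carrier (torsion_group E m). set_point P)"


section \<open>First local cohomology\<close>

text \<open>
  Here \<open>G\<close> is a group acting on the abelian group \<open>M\<close> by \<open>act\<close>. As \<open>M\<close> is written
  multiplicatively, \<open>(\<sigma> - 1) W\<close> is \<open>act \<sigma> W \<otimes> inv W\<close>.
\<close>

definition cocycles ::
  "('g, 'c) monoid_scheme \<Rightarrow> ('m, 'd) monoid_scheme \<Rightarrow> ('g \<Rightarrow> 'm \<Rightarrow> 'm) \<Rightarrow> ('g \<Rightarrow> 'm) monoid" where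
  "cocycles G M act =
     \<lparr>carrier = {Z \<in> carrier G \<rightarrow>\<^sub>E carrier M.
        \<forall>\<sigma>\<in>carrier G. \<forall>\<tau>\<in>carrier G. Z (\<sigma> \<otimes>\<^bsub>G\<^esub> \<tau>) = Z \<sigma> \<otimes>\<^bsub>M\<^esub> act \<sigma> (Z \<tau>)},
      monoid.mult = (\<lambda>Y Z. \<lambda>\<sigma>\<in>carrier G. Y \<sigma> \<otimes>\<^bsub>M\<^esub> Z \<sigma>),
      one = (\<lambda>\<sigma>\<in>carrier G. \<one>\<^bsub>M\<^esub>)\<rparr>"

definition coboundaries ::
  "('g, 'c) monoid_scheme \<Rightarrow> ('m, 'd) monoid_scheme \<Rightarrow> ('g \<Rightarrow> 'm \<Rightarrow> 'm) \<Rightarrow> ('g \<Rightarrow> 'm) set" where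
  "coboundaries G M act =
     {\<lambda>\<sigma>\<in>carrier G. act \<sigma> W \<otimes>\<^bsub>M\<^esub> inv\<^bsub>M\<^esub> W | W. W \<in> carrier M}"

definition H1 ::
  "('g, 'c) monoid_scheme \<Rightarrow> ('m, 'd) monoid_scheme \<Rightarrow> ('g \<Rightarrow> 'm \<Rightarrow> 'm) \<Rightarrow> ('g \<Rightarrow> 'm) set monoid"
  where "H1 G M act = cocycles G M act Mod coboundaries G M act"

definition H1_loc ::
  "('g, 'c) monoid_scheme \<Rightarrow> ('m, 'd) monoid_scheme \<Rightarrow> ('g \<Rightarrow> 'm \<Rightarrow> 'm) \<Rightarrow> ('g \<Rightarrow> 'm) set set"
  where "H1_loc G M act =
     {coboundaries G M act #>\<^bsub>cocycles G M act\<^esub> Z | Z.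
        Z \<in> carrier (cocycles G M act) \<and>
        (\<forall>\<sigma>\<in>carrier G. \<exists>W\<in>carrier M. Z \<sigma> = act \<sigma> W \<otimes>\<^bsub>M\<^esub> inv\<^bsub>M\<^esub> W)}"

end

theory Submission
  imports Defs "HOL-Number_Theory.Euler_Criterion"
begin

text \<open>
  For \<open>p \<le> 3\<close> the number \<open>\<zeta> + \<zeta>\<^sup>-\<^sup>1\<close> is rational, so \<open>p \<ge> 5\<close>. By the Weil pairing the determinant of the Galois
  action on the \<open>p\<close>-torsion is the action on the \<open>p\<close>-th roots of unity; as \<open>\<zeta> + \<zeta>\<^sup>-\<^sup>1 \<notin> k\<close>, the group contains some
  \<open>\<gamma>\<close> with determinant different from \<open>\<plusminus>1\<close> modulo \<open>p\<close>. There remains a statement about a finite group of matrices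
  modulo \<open>q = p\<^sup>n\<close> which fixes no nonzero vector modulo \<open>p\<close>, and a cocycle \<open>Z\<close> which is a coboundary on every
  cyclic subgroup.

  An element that is a nontrivial scalar modulo \<open>p\<close> has a power that is a scalar modulo \<open>q\<close>, hence central, and
  then \<open>Z\<close> is a coboundary. Otherwise \<open>\<gamma>\<close> is diagonalisable modulo \<open>q\<close>, with eigenvalues \<open>l1 \<noteq> \<plusminus>l2\<close> modulo \<open>p\<close>,
  and one may assume \<open>Z\<^sub>\<gamma> = 0\<close>. Let \<open>N\<close> be the kernel of reduction modulo \<open>p\<close>. Comparing \<open>Z\<close> at \<open>g \<in> N\<close>, at
  \<open>\<gamma> g \<gamma>\<^sup>-\<^sup>1\<close> and at powers of \<open>g\<close> one pushes the off-diagonal entries of \<open>g\<close> to higher and higher valuation and finds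
  \<open>Z = 0\<close> on \<open>N\<close>. Elements of \<open>p\<close>-power order are unipotent modulo \<open>p\<close>. If two of them had distinct axes they would
  generate \<open>-1\<close>, so all are, say, upper triangular; one of them lifts to a transvection \<open>u\<close> modulo \<open>q\<close> with
  \<open>Z\<^sub>u = 0\<close>, and a Sylow \<open>p\<close>-subgroup consists of products of powers of \<open>u\<close> with elements of \<open>N\<close>. Thus \<open>Z\<close> vanishes
  there and is a coboundary. This uses that \<open>\<gamma>\<close> can be chosen without eigenvalue \<open>1\<close>. If it cannot, then all
  elements have the eigenvalue \<open>1\<close> and are triangular modulo \<open>p\<close>, and since no vector is fixed the group again
  contains a transvection \<open>u\<close>, for which \<open>Z\<^sub>u = 0\<close> can be arranged.
\<close>

section \<open>The coordinate ring and the group law\<close>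

text \<open>Both signs of the determinant are excluded for one reason. Conjugation by a diagonal
  matrix multiplies the two off-diagonal entries by \<open>l1 / l2\<close> and
  \<open>l2 / l1\<close>, and the entries can be treated separately only if these factors differ,
  that is if \<open>l1^2\<close> and \<open>l2^2\<close> differ modulo \<open>p\<close>. If
  \<open>l1 = - l2\<close>, the square of the matrix is the scalar \<open>- det\<close>, and in the
  absence of nontrivial scalars the determinant is \<open>-1\<close>. Of the Weil pairing only
  formal properties enter: it is bilinear and alternating, commutes with the automorphisms of the
  closure that fix the curve, and is not identically 1. Hence it is built as a commutator of
  translation operators on functions with poles only at infinity. Bilinearity and equivariance are
  then inherited from composition and transport of structure, and a trivial pairing would mean
  commuting operators, which have a common eigenvector.\<close>

abbreviation "SW A B \<equiv> Weierstrass 0 0 0 A (B::'a::field)"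

lemma on_curve_short [simp]: "on_curve (SW A B) (Affine u v) \<longleftrightarrow> v^2 = u^3 + A * u + B"
  by simp

lemma point_add_short:
  "point_add (SW A B) (Affine x1 y1) (Affine x2 y2) =
     (if x1 = x2 \<and> y1 + y2 = 0 then Infinity
      else let l = (if x1 = x2 then (3 * x1^2 + A) / (2 * y1) else (y2 - y1) / (x2 - x1));
               x3 = l^2 - x1 - x2
           in Affine x3 (- (l * (x3 - x1) + y1)))"
  by (simp add: Let_def)

text \<open>The slope is described by two equations without division, so that chord and tangent are
  one case: the second equation is the first, multiplied by \<open>y1 + y2\<close> and divided by
  \<open>x2 - x1\<close>, and for equal points it is the tangent. An integral domain is allowed
  because the lemma is applied both to coordinates in the field and to the function
  \<open>gx\<close> in the Laurent series.\<close>

lemma line_cubic: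
  fixes t :: "'b::idom"
  assumes "l * (x2 - x1) = y2 - y1" "l * (y1 + y2) = x1^2 + x1 * x2 + x2^2 + a"
    "y1^2 = x1^3 + a * x1 + b" "x3 = l^2 - x1 - x2"
  shows "t^3 + a * t + b - (y1 + l * (t - x1))^2 = (t - x1) * (t - x2) * (t - x3)"
proof -
  have "t^3 + a * t + b - (y1 + l * (t - x1))^2 - (t - x1) * (t - x2) * (t - (l^2 - x1 - x2)) =
    - (t - x1) * ((l * (y1 + y2) - (x1^2 + x1 * x2 + x2^2 + a)) + l * (l * (x2 - x1) - (y2 - y1)))
    - (y1^2 - (x1^3 + a * x1 + b))"
    by (simp add: algebra_simps power2_eq_square power3_eq_cube)
  also have "\<dots> = 0" using assms(1-3) by simp
  finally show ?thesis using assms(4) by simp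
qed

locale short_curve =
  fixes A B :: "'a::field_char_0"
  assumes disc: "4 * A^3 + 27 * B^2 \<noteq> 0"
begin

abbreviation "E \<equiv> SW A B"

definition f_poly :: "'a poly" where "f_poly = [:B, A, 0, 1:]"

text \<open>The coordinate ring is realised inside the Laurent series at infinity, with \<open>x = t\<^sup>-\<^sup>2\<close>; the pole order of a
  function is then minus its \<^const>\<open>fls_subdegree\<close>. As \<open>x\<close> and \<open>y\<close> have pole orders \<open>2\<close> and \<open>3\<close>, the pole order
  of \<open>a(x) + b(x) y\<close> has the parity of the dominating summand.\<close>

definition gx :: "'a fls" where "gx = fls_X_inv ^ 2"

lemma gx_subdegree: "fls_subdegree gx = -2"
  by (simp add: gx_def fls_subdegree_pow)

lemma gx_nonzero: "gx \<noteq> 0"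
  using gx_subdegree by force

definition emb :: "'a poly \<Rightarrow> 'a fls" where "emb q = poly (map_poly fls_const q) gx"

lemma fls_const_hom_add: "fls_const (a + b) = fls_const a + fls_const (b::'a)"
  by (simp add: fls_plus_const)
lemma fls_const_hom_mult: "fls_const (a * b) = fls_const a * fls_const (b::'a)"
  by simp

lemma emb_pCons: "emb (pCons a q) = fls_const a + gx * emb q"
  by (cases "pCons a q = 0") (auto simp: emb_def map_poly_pCons)

lemma emb_0 [simp]: "emb 0 = 0" by (simp add: emb_def)
lemma emb_1 [simp]: "emb 1 = 1" by (simp add: emb_def)
lemma emb_const: "emb [:a:] = fls_const a" by (simp add: emb_pCons)

lemma emb_add: "emb (p + q) = emb p + emb q"
proof (induction p arbitrary: q)
  case (pCons a p)
  obtain b q' where "q = pCons b q'" by (cases q) auto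
  then show ?case by (simp only: add_pCons emb_pCons fls_const_hom_add pCons.IH) (simp add: algebra_simps)
qed simp

lemma emb_smult: "emb (smult a q) = fls_const a * emb q"
  by (induction q) (simp_all add: emb_pCons algebra_simps)

lemma emb_mult: "emb (p * q) = emb p * emb q"
  by (induction p) (simp_all add: emb_pCons emb_add emb_smult algebra_simps)

lemma emb_uminus: "emb (- q) = - emb q"
  using emb_smult[of "-1" q] by simp

lemma emb_diff: "emb (p - q) = emb p - emb q"
  using emb_add[of p "- q"] by (simp add: emb_uminus)

lemma emb_subdegree: "q \<noteq> 0 \<Longrightarrow> emb q \<noteq> 0 \<and> fls_subdegree (emb q) = - 2 * int (degree q)"
proof (induction q)
  case (pCons a q)
  show ?case
  proof (cases "q = 0")
    case True
    then show ?thesis using pCons by (simp add: emb_pCons)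
  next
    case False
    have *: "emb q \<noteq> 0" "fls_subdegree (emb q) = - 2 * int (degree q)" using pCons False by auto
    have s: "fls_subdegree (gx * emb q) = - 2 - 2 * int (degree q)"
      using * gx_nonzero gx_subdegree by simp
    have nz: "gx * emb q \<noteq> 0" using * gx_nonzero by simp
    have "fls_subdegree (fls_const a + gx * emb q) = - 2 - 2 * int (degree q)"
      using fls_subdegree_add_eq2[OF nz, of "fls_const a"] s by simp
    then show ?thesis using False by (auto simp: emb_pCons)
  qed
qed simp

text \<open>With \<open>x = t^-2\<close> the equation reads
  \<open>y^2 = t^-6 * (1 + A t^4 + B t^6)\<close>; the bracket has constant term 1 and therefore a
  square root as a power series in characteristic 0.\<close>

lemma gy_exists: "\<exists>y. y^2 = emb f_poly \<and> fls_subdegree y = -3"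
proof -
  define g :: "'a fps" where "g = 1 + fps_const A * fps_X^4 + fps_const B * fps_X^6"
  define s where "s = fps_radical (\<lambda>_ _. 1) (Suc 1) g"
  have g0: "fps_nth g 0 = 1" by (simp add: g_def)
  have s2: "s ^ Suc 1 = g" unfolding s_def
    by (subst power_radical[symmetric]) (use g0 in auto)
  have s0: "fps_nth s 0 = 1" unfolding s_def by simp
  define y where "y = fps_to_fls s * fls_X_inv ^ 3"
  have "y ^ 2 = fps_to_fls g * fls_X_inv ^ 6"
    using s2 by (simp add: y_def power_mult_distrib flip: power_mult fps_to_fls_power power2_eq_square)
  also have "\<dots> = emb f_poly"
  proof -
    have *: "fls_X ^ 4 * fls_X_inv ^ 6 = (gx :: 'a fls)" "fls_X ^ 6 * fls_X_inv ^ 6 = (1::'a fls)"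
    proof -
      have "fls_X * fls_X_inv = (1 :: 'a fls)" by (simp flip: fls_inverse_X)
      then have "(fls_X * fls_X_inv) ^ n = (1 :: 'a fls)" for n by simp
      then have n: "fls_X ^ n * fls_X_inv ^ n = (1 :: 'a fls)" for n by (simp add: power_mult_distrib)
      show "fls_X ^ 6 * fls_X_inv ^ 6 = (1::'a fls)" by (rule n)
      have "fls_X ^ 4 * fls_X_inv ^ 6 = fls_X ^ 4 * fls_X_inv ^ 4 * (fls_X_inv ^ 2 :: 'a fls)"
        by (simp only: mult.assoc flip: power_add) simp
      then show "fls_X ^ 4 * fls_X_inv ^ 6 = (gx :: 'a fls)" by (simp add: n gx_def)
    qed
    have "fps_to_fls g * fls_X_inv ^ 6 =
        fls_X_inv ^ 6 + fls_const A * (fls_X ^ 4 * fls_X_inv ^ 6) + fls_const B * (fls_X ^ 6 * fls_X_inv ^ 6)"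
      by (simp add: g_def fls_times_fps_to_fls fps_to_fls_power algebra_simps)
    also have "\<dots> = gx ^ 3 + fls_const A * gx + fls_const B"
      unfolding * by (simp add: gx_def flip: power_mult)
    finally show ?thesis by (simp add: f_poly_def emb_pCons power3_eq_cube algebra_simps)
  qed
  finally have 1: "y^2 = emb f_poly" .
  have "subdegree s = 0" using s0 by (simp)
  moreover have "s \<noteq> 0" using s0 by auto
  ultimately have "fls_subdegree y = -3"
    unfolding y_def by (subst fls_subdegree_mult) (auto simp: fls_subdegree_fls_to_fps fls_subdegree_pow)
  with 1 show ?thesis by blast
qed

definition gy :: "'a fls" where "gy = (SOME y. y^2 = emb f_poly \<and> fls_subdegree y = -3)"

lemma gy2: "gy^2 = emb f_poly" and gy_subdegree: "fls_subdegree gy = -3"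
  using someI_ex[OF gy_exists] unfolding gy_def by auto

definition el :: "'a poly \<Rightarrow> 'a poly \<Rightarrow> 'a fls" where "el a b = emb a + emb b * gy"

abbreviation cst :: "'a \<Rightarrow> 'a fls" where "cst \<equiv> fls_const"

lemma gy_eq: "gy^2 = gx^3 + cst A * gx + cst B"
  by (simp add: gy2 f_poly_def emb_pCons algebra_simps power3_eq_cube)

lemma gy_nonzero: "gy \<noteq> 0" using gy_subdegree by force

lemma subdegree_emb_gy: "b \<noteq> 0 \<Longrightarrow> emb b * gy \<noteq> 0 \<and> fls_subdegree (emb b * gy) = - 2 * int (degree b) - 3"
  using emb_subdegree[of b] gy_nonzero gy_subdegree by simp

lemma subdegree_el:
  assumes "a \<noteq> 0 \<or> b \<noteq> 0"
  shows "el a b \<noteq> 0" and "a \<noteq> 0 \<Longrightarrow> fls_subdegree (el a b) \<le> - 2 * int (degree a)"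
    and "b \<noteq> 0 \<Longrightarrow> fls_subdegree (el a b) \<le> - 2 * int (degree b) - 3"
proof -
  let ?f = "emb a" and ?g = "emb b * gy"
  consider "a = 0" "b \<noteq> 0" | "a \<noteq> 0" "b = 0" | "a \<noteq> 0" "b \<noteq> 0" using assms by blast
  then have "el a b \<noteq> 0 \<and> (a \<noteq> 0 \<longrightarrow> fls_subdegree (el a b) \<le> - 2 * int (degree a))
     \<and> (b \<noteq> 0 \<longrightarrow> fls_subdegree (el a b) \<le> - 2 * int (degree b) - 3)"
  proof cases
    case 1
    then show ?thesis using subdegree_emb_gy[of b] by (simp add: el_def)
  next
    case 2
    then show ?thesis using emb_subdegree[of a] by (simp add: el_def)
  next
    case 3
    note f = emb_subdegree[OF 3(1)] and g = subdegree_emb_gy[OF 3(2)]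
    consider "fls_subdegree ?f < fls_subdegree ?g" | "fls_subdegree ?g < fls_subdegree ?f"
      using f g by (metis diff_gt_0_iff_gt linorder_less_linear mult_minus_left dvd_diff_right_iff dvd_minus_iff dvd_triv_left odd_numeral_BitM odd_numeral semiring_norm(26) uminus_add_conv_diff)
    then show ?thesis
    proof cases
      case 1
      then have "fls_subdegree (?f + ?g) = fls_subdegree ?f" using f fls_subdegree_add_eq1 by blast
      moreover have "?f + ?g \<noteq> 0" using 1 by (metis add_eq_0_iff fls_uminus_subdegree less_irrefl)
      ultimately show ?thesis using f g 1 by (simp add: el_def)
    next
      case 2
      then have "fls_subdegree (?f + ?g) = fls_subdegree ?g" using g fls_subdegree_add_eq2 by blast
      moreover have "?f + ?g \<noteq> 0" using 2 by (metis add_eq_0_iff fls_uminus_subdegree less_irrefl)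
      ultimately show ?thesis using f g 2 by (simp add: el_def)
    qed
  qed
  then show "el a b \<noteq> 0" and "a \<noteq> 0 \<Longrightarrow> fls_subdegree (el a b) \<le> - 2 * int (degree a)"
    and "b \<noteq> 0 \<Longrightarrow> fls_subdegree (el a b) \<le> - 2 * int (degree b) - 3" by auto
qed

lemma el_diff: "el a b - el a' b' = el (a - a') (b - b')"
  by (simp add: el_def emb_diff algebra_simps)

lemma el_add: "el a b + el a' b' = el (a + a') (b + b')"
  by (simp add: el_def emb_add algebra_simps)

lemma el_mult: "el a b * el a' b' = el (a * a' + b * b' * f_poly) (a * b' + a' * b)"
  by (simp add: el_def emb_add emb_mult algebra_simps power2_eq_square flip: gy2)

lemma el_eq_iff: "el a b = el a' b' \<longleftrightarrow> a = a' \<and> b = b'"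
proof -
  have "el a b = el a' b' \<longleftrightarrow> el (a - a') (b - b') = 0" by (simp flip: el_diff)
  also have "\<dots> \<longleftrightarrow> a - a' = 0 \<and> b - b' = 0"
    using subdegree_el(1)[of "a - a'" "b - b'"] by (auto simp: el_def)
  finally show ?thesis by simp
qed

section \<open>The coordinate ring and evaluation at points\<close>

definition coord_ring :: "'a fls set" where "coord_ring = {el a b | a b. True}"

abbreviation "R \<equiv> coord_ring"

lemma R_el [simp, intro]: "el a b \<in> R" by (auto simp: coord_ring_def)
lemma R_add [intro]: "f \<in> R \<Longrightarrow> g \<in> R \<Longrightarrow> f + g \<in> R" by (auto simp: coord_ring_def el_add) blast
lemma R_mult [intro]: "f \<in> R \<Longrightarrow> g \<in> R \<Longrightarrow> f * g \<in> R" by (auto simp: coord_ring_def el_mult) blast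
lemma R_diff [intro]: "f \<in> R \<Longrightarrow> g \<in> R \<Longrightarrow> f - g \<in> R" by (auto simp: coord_ring_def el_diff) blast
lemma el_cst: "cst a = el [:a:] 0" by (simp add: el_def emb_const)
lemma el_gx: "gx = el [:0,1:] 0" by (simp add: el_def emb_pCons)
lemma el_gy: "gy = el 0 1" by (simp add: el_def)
lemma R_cst [simp, intro]: "cst a \<in> R" by (simp add: el_cst)
lemma R_gx [simp, intro]: "gx \<in> R" by (simp add: el_gx)
lemma R_gy [simp, intro]: "gy \<in> R" by (simp add: el_gy)
lemma R_0 [simp, intro]: "0 \<in> R" using R_cst[of 0] by simp
lemma R_1 [simp, intro]: "1 \<in> R" using R_cst[of 1] by simp
lemma R_power [intro]: "f \<in> R \<Longrightarrow> f ^ n \<in> R" by (induction n) auto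

text \<open>The representation \<open>el a b\<close> is unique, so \<open>THE\<close> is well
  defined on \<open>R\<close>. At \<open>Infinity\<close> the value 0 is a default: sums and
  products are respected there but constants are not, and later arguments leave this point
  out.\<close>

fun ev :: "'a point \<Rightarrow> 'a fls \<Rightarrow> 'a" where
  "ev (Affine u v) h = (THE e. \<exists>a b. h = el a b \<and> e = poly a u + poly b u * v)"
| "ev Infinity h = 0"

lemma ev_el: "ev (Affine u v) (el a b) = poly a u + poly b u * v"
  by (auto simp: el_eq_iff)

lemma ev_add: "f \<in> R \<Longrightarrow> g \<in> R \<Longrightarrow> ev P (f + g) = ev P f + ev P g"
  by (cases P) (auto simp: coord_ring_def el_add ev_el algebra_simps simp del: ev.simps(1))
lemma ev_diff: "f \<in> R \<Longrightarrow> g \<in> R \<Longrightarrow> ev P (f - g) = ev P f - ev P g"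
  by (cases P) (auto simp: coord_ring_def el_diff ev_el algebra_simps simp del: ev.simps(1))
lemma ev_mult:
  assumes "f \<in> R" "g \<in> R" "on_curve E P" shows "ev P (f * g) = ev P f * ev P g"
proof (cases P)
  case (Affine u v)
  have v: "v * v = poly f_poly u" using assms(3) Affine by (simp add: f_poly_def power2_eq_square power3_eq_cube algebra_simps)
  obtain a b a' b' where "f = el a b" "g = el a' b'" using assms by (auto simp: coord_ring_def)
  moreover have "poly (b * b' * f_poly) u = poly b u * poly b' u * (v * v)" by (simp add: v)
  ultimately show ?thesis using Affine
    by (simp add: el_mult ev_el algebra_simps del: ev.simps(1) poly_mult)
       (simp add: algebra_simps)
qed simp
lemma ev_cst [simp]: "ev (Affine u v) (cst a) = a" by (simp add: el_cst ev_el del: ev.simps(1))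
lemma ev_gx [simp]: "ev (Affine u v) gx = u" by (simp add: el_gx ev_el del: ev.simps(1))
lemma ev_gy [simp]: "ev (Affine u v) gy = v" by (simp add: el_gy ev_el del: ev.simps(1))

declare ev.simps(1) [simp del]

text \<open>The product of the maximal ideals of the listed points.\<close>

fun ideal_of :: "'a point list \<Rightarrow> 'a fls set" where
  "ideal_of [] = R"
| "ideal_of (Infinity # Ps) = ideal_of Ps"
| "ideal_of (Affine u v # Ps) = {(gx - cst u) * f + (gy - cst v) * g | f g. f \<in> ideal_of Ps \<and> g \<in> ideal_of Ps}"

lemma in_ideal_of_Cons:
  "h \<in> ideal_of (Affine u v # Ps) \<longleftrightarrow>
     (\<exists>f\<in>ideal_of Ps. \<exists>g\<in>ideal_of Ps. h = (gx - cst u) * f + (gy - cst v) * g)"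
  by auto

lemma ideal_of_ConsI:
  "f \<in> ideal_of Ps \<Longrightarrow> g \<in> ideal_of Ps \<Longrightarrow> (gx - cst u) * f + (gy - cst v) * g \<in> ideal_of (Affine u v # Ps)"
  by auto

lemma ideal_of_R: "f \<in> ideal_of Ps \<Longrightarrow> f \<in> R"
  by (induction Ps arbitrary: f rule: ideal_of.induct) auto

lemma ideal_of_add: "f \<in> ideal_of Ps \<Longrightarrow> g \<in> ideal_of Ps \<Longrightarrow> f + g \<in> ideal_of Ps"
proof (induction Ps arbitrary: f g rule: ideal_of.induct)
  case (3 u v Ps)
  obtain f1 f2 where f: "f1 \<in> ideal_of Ps" "f2 \<in> ideal_of Ps" "f = (gx - cst u) * f1 + (gy - cst v) * f2"
    using 3(3) unfolding in_ideal_of_Cons by (elim bexE)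
  obtain g1 g2 where g: "g1 \<in> ideal_of Ps" "g2 \<in> ideal_of Ps" "g = (gx - cst u) * g1 + (gy - cst v) * g2"
    using 3(4) unfolding in_ideal_of_Cons by (elim bexE)
  have "f + g = (gx - cst u) * (f1 + g1) + (gy - cst v) * (f2 + g2)"
    unfolding f(3) g(3) by (simp add: algebra_simps)
  then show ?case unfolding in_ideal_of_Cons using 3(1)[OF f(1) g(1)] 3(1)[OF f(2) g(2)] by blast
qed auto

lemma ideal_of_mult: "r \<in> R \<Longrightarrow> f \<in> ideal_of Ps \<Longrightarrow> r * f \<in> ideal_of Ps"
proof (induction Ps arbitrary: f rule: ideal_of.induct)
  case (3 u v Ps)
  obtain f1 f2 where f: "f1 \<in> ideal_of Ps" "f2 \<in> ideal_of Ps" "f = (gx - cst u) * f1 + (gy - cst v) * f2"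
    using 3(4) unfolding in_ideal_of_Cons by (elim bexE)
  have "r * f = (gx - cst u) * (r * f1) + (gy - cst v) * (r * f2)"
    unfolding f(3) by (simp add: algebra_simps)
  then show ?case unfolding in_ideal_of_Cons using 3(1)[OF 3(3) f(1)] 3(1)[OF 3(3) f(2)] by blast
qed auto

lemma ideal_of_gen:
  "f \<in> ideal_of Ps \<Longrightarrow> (gx - cst u) * f \<in> ideal_of (Affine u v # Ps)"
  "f \<in> ideal_of Ps \<Longrightarrow> (gy - cst v) * f \<in> ideal_of (Affine u v # Ps)"
  using ideal_of_mult[of 0 f Ps] by force+

lemma ideal_of_swap: "ideal_of (P # Q # Ps) = ideal_of (Q # P # Ps)"
proof -
  have "ideal_of (P # Q # Ps) \<subseteq> ideal_of (Q # P # Ps)" for P Q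
  proof (cases P; cases Q)
    fix u v u' v' assume PQ: "P = Affine u v" "Q = Affine u' v'"
    show ?thesis
    proof
      fix h assume "h \<in> ideal_of (P # Q # Ps)"
      then obtain f g where fg: "f \<in> ideal_of (Q # Ps)" "g \<in> ideal_of (Q # Ps)" "h = (gx - cst u) * f + (gy - cst v) * g"
        unfolding PQ in_ideal_of_Cons[of _ u] by (elim bexE)
      obtain f1 f2 where f: "f1 \<in> ideal_of Ps" "f2 \<in> ideal_of Ps" "f = (gx - cst u') * f1 + (gy - cst v') * f2"
        using fg(1) unfolding PQ in_ideal_of_Cons by (elim bexE)
      obtain g1 g2 where g: "g1 \<in> ideal_of Ps" "g2 \<in> ideal_of Ps" "g = (gx - cst u') * g1 + (gy - cst v') * g2"
        using fg(2) unfolding PQ in_ideal_of_Cons by (elim bexE)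
      have "h = (gx - cst u') * ((gx - cst u) * f1 + (gy - cst v) * g1) + (gy - cst v') * ((gx - cst u) * f2 + (gy - cst v) * g2)"
        unfolding fg(3) f(3) g(3) by (simp add: algebra_simps)
      then show "h \<in> ideal_of (Q # P # Ps)"
        unfolding PQ using f(1,2) g(1,2) by (metis ideal_of_ConsI)
    qed
  qed auto
  then show ?thesis by blast
qed

lemma ev_ideal_of:
  assumes "h \<in> ideal_of (Affine u v # Ps)" "on_curve E (Affine u v)" shows "ev (Affine u v) h = 0"
  using assms by (auto simp: ev_add ev_diff ev_mult ideal_of_R R_diff R_mult simp del: on_curve_short)

section \<open>Chords, tangents and products of maximal ideals\<close>

fun sz :: "'a point \<Rightarrow> int" where "sz Infinity = 0" | "sz (Affine u v) = 1"

lemma slope: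
  assumes "on_curve E (Affine x1 y1)" "on_curve E (Affine x2 y2)" "\<not> (x1 = x2 \<and> y1 + y2 = 0)"
  obtains l where "l * (x2 - x1) = y2 - y1" "l * (y1 + y2) = x1^2 + x1 * x2 + x2^2 + A"
    "point_add E (Affine x1 y1) (Affine x2 y2) = Affine (l^2 - x1 - x2) (- (l * ((l^2 - x1 - x2) - x1) + y1))"
proof -
  define l where "l = (if x1 = x2 then (3 * x1^2 + A) / (2 * y1) else (y2 - y1) / (x2 - x1))"
  have c: "y1^2 = x1^3 + A * x1 + B" "y2^2 = x2^3 + A * x2 + B" using assms by simp_all
  have "l * (x2 - x1) = y2 - y1 \<and> l * (y1 + y2) = x1^2 + x1 * x2 + x2^2 + A"
  proof (cases "x1 = x2")
    case True
    then have "y1^2 = y2^2" using c by simp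
    then have y: "y2 = y1" using assms(3) True by (auto simp: power2_eq_iff)
    moreover have "y1 \<noteq> 0" using assms(3) y True by auto
    ultimately show ?thesis using True by (simp add: l_def power2_eq_square field_simps)
  next
    case False
    then have l: "l * (x2 - x1) = y2 - y1" by (simp add: l_def)
    have "(x2 - x1) * (l * (y1 + y2)) = (x2 - x1) * (x1^2 + x1 * x2 + x2^2 + A)"
      using l c by Groebner_Basis.algebra
    then show ?thesis using l False by simp
  qed
  moreover have "point_add E (Affine x1 y1) (Affine x2 y2) = Affine (l^2 - x1 - x2) (- (l * ((l^2 - x1 - x2) - x1) + y1))"
    using assms(3) unfolding point_add_short l_def Let_def by auto
  ultimately show ?thesis using that by blast
qed

lemma point_add_closed:
  assumes "on_curve E P" "on_curve E Q" shows "on_curve E (point_add E P Q)"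
proof (cases P; cases Q)
  fix x1 y1 x2 y2 assume PQ: "P = Affine x1 y1" "Q = Affine x2 y2"
  show ?thesis
  proof (cases "x1 = x2 \<and> y1 + y2 = 0")
    case True
    then show ?thesis using PQ by (simp add: point_add_short)
  next
    case False
    obtain l where l: "l * (x2 - x1) = y2 - y1" "l * (y1 + y2) = x1^2 + x1 * x2 + x2^2 + A"
      "point_add E (Affine x1 y1) (Affine x2 y2) = Affine (l^2 - x1 - x2) (- (l * ((l^2 - x1 - x2) - x1) + y1))"
      using slope[OF _ _ False] assms PQ by metis
    show ?thesis
      using line_cubic[OF l(1,2) _ refl, of B "l^2 - x1 - x2"] assms
      unfolding PQ l(3) by (simp add: algebra_simps power2_eq_square)
  qed
qed (use assms in auto)

text \<open>The relation \<open>[Q] + [Q'] \<sim> [Q + Q'] + [\<infinity>]\<close> of divisor classes: \<open>c\<close> is the quotient of the vertical line through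
  \<open>Q + Q'\<close> by the line through \<open>Q\<close> and \<open>Q'\<close>.\<close>

lemma point_class_relation:
  assumes "on_curve E Q" "on_curve E Q'"
  shows "\<exists>c. c \<noteq> 0 \<and> fls_subdegree c = sz Q + sz Q' - sz (point_add E Q Q') \<and>
    (\<forall>Ps f. f \<in> ideal_of (Q # Q' # Ps) \<longleftrightarrow> c * f \<in> ideal_of (point_add E Q Q' # Ps))"
proof (cases Q; cases Q')
  assume "Q = Infinity" "Q' = Infinity"
  then show ?thesis by (intro exI[of _ 1]) auto
next
  fix u v assume *: "Q = Infinity" "Q' = Affine u v"
  then show ?thesis by (intro exI[of _ 1]) (simp del: ideal_of.simps(3))
next
  fix u v assume *: "Q' = Infinity" "Q = Affine u v"
  then show ?thesis using ideal_of_swap[of Q Q'] by (intro exI[of _ 1]) (simp del: ideal_of.simps(3))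
next
  fix x1 y1 x2 y2 assume PQ: "Q = Affine x1 y1" "Q' = Affine x2 y2"
  define w1 w2 where "w1 = gx - cst x1" "w2 = gx - cst x2"
  have gyc: "gy^2 = gx^3 + cst A * gx + cst B" by (rule gy_eq)
  have c1: "cst y1^2 = cst x1^3 + cst A * cst x1 + cst B"
    using assms(1) unfolding PQ on_curve_short by (metis fls_const_hom_add fls_const_hom_mult fls_const_power)
  have wnz: "gx - cst u \<noteq> 0 \<and> fls_subdegree (gx - cst u) = -2" for u
  proof -
    have "gx - cst u = el [:-u, 1:] 0" by (simp add: el_gx el_cst el_diff)
    then show ?thesis using emb_subdegree[of "[:-u, 1:]"] by (simp add: el_def)
  qed
  show ?thesis
  proof (cases "x1 = x2 \<and> y1 + y2 = 0")
    case True
    then have y2: "cst y2 = - cst y1" by (metis add.inverse_unique fls_const_uminus)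
    have y2': "y2 = - y1" using True by (metis add.inverse_unique)
    have s: "point_add E Q Q' = Infinity" using True PQ by (simp add: point_add_short)
    have prod: "(gy - cst y1) * (gy - cst y2) = w1 * (gx^2 + gx * cst x1 + cst x1^2 + cst A)"
      unfolding y2 w1_w2_def using gyc c1 by Groebner_Basis.algebra
    \<comment> \<open>The two points are opposite, and the product of their maximal ideals is the
      principal ideal of the vertical line \<open>w1\<close>.\<close>
    have "f \<in> ideal_of (Q # Q' # Ps) \<longleftrightarrow> f / w1 \<in> ideal_of Ps" for f Ps
    proof
      assume "f \<in> ideal_of (Q # Q' # Ps)"
      then obtain g h where gh: "g \<in> ideal_of (Q' # Ps)" "h \<in> ideal_of (Q' # Ps)" "f = w1 * g + (gy - cst y1) * h"
        unfolding PQ in_ideal_of_Cons[of _ x1] w1_w2_def by (elim bexE)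
      obtain h1 h2 where h: "h1 \<in> ideal_of Ps" "h2 \<in> ideal_of Ps" "h = w1 * h1 + (gy - cst y2) * h2"
        using gh(2) True unfolding PQ in_ideal_of_Cons w1_w2_def by (metis (no_types))
      obtain g1 g2 where g: "g1 \<in> ideal_of Ps" "g2 \<in> ideal_of Ps" "g = w1 * g1 + (gy - cst y2) * g2"
        using gh(1) True unfolding PQ in_ideal_of_Cons w1_w2_def by (metis (no_types))
      have "f = w1 * ((w1 * g1 + (gy - cst y2) * g2) + (gy - cst y1) * h1 + (gx^2 + gx * cst x1 + cst x1^2 + cst A) * h2)"
        unfolding gh(3) g(3) h(3) using prod by Groebner_Basis.algebra
      then have "f / w1 = (w1 * g1 + (gy - cst y2) * g2) + (gy - cst y1) * h1 + (gx^2 + gx * cst x1 + cst x1^2 + cst A) * h2"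
        using wnz[of x1] by (simp add: w1_w2_def)
      then show "f / w1 \<in> ideal_of Ps"
        using g h by (auto simp: w1_w2_def intro!: ideal_of_add ideal_of_mult R_add R_mult R_power R_diff)
    next
      assume a: "f / w1 \<in> ideal_of Ps"
      define j where "j = f / w1"
      have f: "f = w1 * j" using wnz[of x1] by (simp add: j_def w1_w2_def)
      have j: "j \<in> ideal_of Ps" using a j_def by simp
      show "f \<in> ideal_of (Q # Q' # Ps)"
      proof (cases "y1 = 0")
        case False
        \<comment> \<open>The difference of \<open>gy - cst y2\<close> and
          \<open>gy - cst y1\<close> is the constant \<open>2 * y1\<close>, a unit of
          \<open>R\<close> when \<open>y1 \<noteq> 0\<close>; this exhibits \<open>w1\<close> as an
          element of the product.\<close>
        define k where "k = cst (inverse (2 * y1)) * j"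
        have k: "k \<in> ideal_of Ps" using j by (simp only: k_def ideal_of_mult R_cst)
        have jk: "j = 2 * cst y1 * k" using False by (simp add: k_def flip: fls_const_numeral mult.assoc)
        have "f = w1 * ((gy - cst y2) * k) + (gy - cst y1) * (w2 * (- 1 * k))"
          unfolding f jk y2 using True by (simp add: w1_w2_def algebra_simps)
        then show ?thesis unfolding PQ w1_w2_def
          using ideal_of_ConsI[OF ideal_of_gen(2)[OF k] ideal_of_gen(1)[OF ideal_of_mult[OF _ k, of "-1"]]]
            R_cst[of "-1"] by (simp del: ideal_of.simps(3))
      next
        case y0: True
        \<comment> \<open>A point of order 2. Here \<open>d\<close> is the derivative of the cubic
          at \<open>x1\<close>, nonzero by the discriminant, and
          \<open>gy^2 = w1 * (d + w1 * (gx + 2 * cst x1))\<close> is solved for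
          \<open>d * w1\<close>.\<close>
        define d where "d = 3 * x1^2 + A"
        have x1: "x1^3 + A * x1 + B = 0" using assms(1) y0 PQ by simp
        have d0: "d \<noteq> 0"
        proof
          assume "d = 0"
          then have "4 * A^3 + 27 * B^2 = 0" using x1 unfolding d_def by Groebner_Basis.algebra
          with disc show False by simp
        qed
        define k where "k = cst (inverse d) * j"
        have k: "k \<in> ideal_of Ps" using j by (simp only: k_def ideal_of_mult R_cst)
        have jk: "j = cst d * k" using d0 by (simp add: k_def flip: mult.assoc)
        have cd: "cst d = 3 * cst x1^2 + cst A" by (simp add: d_def flip: fls_const_numeral fls_const_power fls_const_hom_add)
        have "f = w1 * (w1 * ((- (gx + 2 * cst x1)) * k)) + (gy - cst y1) * ((gy - cst y2) * k)"
          using prod unfolding f jk cd w1_w2_def by Groebner_Basis.algebra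
        moreover have "- (gx + 2 * cst x1) \<in> R"
        proof -
          have "- (gx + 2 * cst x1) = 0 - (gx + cst 2 * cst x1)" by (simp flip: fls_const_numeral)
          also have "\<dots> \<in> R" by (intro R_diff R_add R_mult R_cst R_gx R_0)
          finally show ?thesis .
        qed
        ultimately show ?thesis unfolding PQ w1_w2_def
          using ideal_of_ConsI[OF ideal_of_gen(1)[OF ideal_of_mult[OF _ k]] ideal_of_gen(2)[OF k]] True
           by (simp del: ideal_of.simps(3))
      qed
    qed
    then show ?thesis using s PQ wnz[of x1] by (intro exI[of _ "inverse w1"]) (simp add: w1_w2_def divide_inverse mult.commute)
  next
    case False
    obtain l where l: "l * (x2 - x1) = y2 - y1" "l * (y1 + y2) = x1^2 + x1 * x2 + x2^2 + A"
      "point_add E (Affine x1 y1) (Affine x2 y2) = Affine (l^2 - x1 - x2) (- (l * ((l^2 - x1 - x2) - x1) + y1))"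
      using slope[OF _ _ False] assms PQ by metis
    define x3 y3 where "x3 = l^2 - x1 - x2" "y3 = - (l * (x3 - x1) + y1)"
    have s: "point_add E Q Q' = Affine x3 y3" using l(3) PQ x3_y3_def by simp
    define k where "k = cst l"
    have l1: "k * (cst x2 - cst x1) = cst y2 - cst y1" using l(1) by (simp add: k_def fls_minus_const)
    have l2: "k * (cst y1 + cst y2) = cst x1^2 + cst x1 * cst x2 + cst x2^2 + cst A"
      using arg_cong[OF l(2), of cst] by (simp add: k_def fls_plus_const flip: fls_const_power)
    have x3: "cst x3 = k^2 - cst x1 - cst x2" by (simp add: x3_y3_def(1) k_def fls_minus_const flip: fls_const_power)
    have y3: "cst y3 = - (k * (cst x3 - cst x1) + cst y1)" by (simp only: x3_y3_def(2) k_def fls_const_uminus fls_const_hom_mult fls_const_hom_add fls_minus_const[symmetric])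
    define w3 where "w3 = gx - cst x3"
    \<comment> \<open>\<open>lin\<close> is the line through \<open>Q\<close> and \<open>Q'\<close>;
      \<open>nl\<close> is, up to sign, its image under \<open>y \<mapsto> - y\<close>, and vanishes
      at the sum of the points. Their product is a cubic in \<open>gx\<close>, which
      \<open>line_cubic\<close> factors.\<close>
    define lin nl where "lin = gy - cst y1 - k * w1" "nl = gy + cst y1 + k * w1"
    have H1: "lin * nl = w1 * w2 * w3"
      using line_cubic[OF l1 l2 c1 x3, of gx] gyc unfolding lin_nl_def w1_w2_def w3_def by Groebner_Basis.algebra
    have H2: "lin = gy - cst y2 - k * w2" using l1 unfolding lin_nl_def w1_w2_def by Groebner_Basis.algebra
    have H3: "nl = (gy - cst y3) + k * w3" unfolding lin_nl_def w1_w2_def w3_def y3 by Groebner_Basis.algebra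
    have lin: "lin \<noteq> 0 \<and> fls_subdegree lin = -3"
    proof -
      have "lin = el [:l * x1 - y1, - l:] 1"
        by (simp add: lin_nl_def w1_w2_def k_def el_def emb_pCons algebra_simps fls_minus_const[symmetric])
      then have "lin \<noteq> 0" "fls_subdegree lin \<le> - 3" using subdegree_el(1,3)[where b = 1] by auto
      moreover have "fls_subdegree lin \<ge> -3"
      proof -
        have "fls_subdegree (k * w1) \<ge> -2" if "k * w1 \<noteq> 0" using that wnz[of x1] by (simp add: w1_w2_def k_def)
        then have "fls_subdegree (gy - (cst y1 + k * w1)) \<ge> -3"
          by (smt (verit) gy_subdegree fls_const_subdegree add.right_neutral diff_zero fls_plus_subdegree fls_subdegree_minus add_0 fls_zero_subdegree calculation(1) diff_diff_eq lin_nl_def(1) add_cancel_left_left)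
        then show ?thesis by (simp add: lin_nl_def diff_diff_eq)
      qed
      ultimately show ?thesis by simp
    qed
    have Rs: "w1 \<in> R" "w2 \<in> R" "w3 \<in> R" "k \<in> R" "lin \<in> R"
      by (auto simp: w1_w2_def w3_def k_def lin_nl_def)
    define c where "c = w3 / lin"
    have w3: "w3 \<noteq> 0" "fls_subdegree w3 = -2" using wnz[of x3] by (auto simp: w3_def)
    have c: "c \<noteq> 0" "fls_subdegree c = 1" using lin w3 by (auto simp: c_def fls_divide_subdegree)
    have cl: "c * lin = w3" using lin by (simp add: c_def)
    have cw: "c * w1 * w2 = nl" using H1 lin w3 by (simp add: c_def field_simps)
    have "f \<in> ideal_of (Q # Q' # Ps) \<longleftrightarrow> c * f \<in> ideal_of (Affine x3 y3 # Ps)" for f Ps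
    proof
      assume "f \<in> ideal_of (Q # Q' # Ps)"
      then obtain g h where gh: "g \<in> ideal_of (Q' # Ps)" "h \<in> ideal_of (Q' # Ps)" "f = w1 * g + (gy - cst y1) * h"
        unfolding PQ in_ideal_of_Cons[of _ x1] w1_w2_def by (elim bexE)
      obtain h1 h2 where h: "h1 \<in> ideal_of Ps" "h2 \<in> ideal_of Ps" "h = w2 * h1 + (gy - cst y2) * h2"
        using gh(2) unfolding PQ in_ideal_of_Cons w1_w2_def by (metis (no_types))
      obtain g1 g2 where g: "g1 \<in> ideal_of Ps" "g2 \<in> ideal_of Ps" "g = w2 * g1 + (gy - cst y2) * g2"
        using gh(1) unfolding PQ in_ideal_of_Cons w1_w2_def by (metis (no_types))
      define K where "K = g1 + k * g2 + k * h1 + k * (k * h2)"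
      define M where "M = w1 * g2 + w2 * h1 + (lin + k * w1 + k * w2) * h2"
      have yy: "gy - cst y1 = lin + k * w1" by (simp add: lin_nl_def)
      have yy': "gy - cst y2 = lin + k * w2" by (simp add: H2)
      have "c * f = nl * K + w3 * M"
        unfolding gh(3) g(3) h(3) yy yy' K_def M_def cw[symmetric] cl[symmetric] by Groebner_Basis.algebra
      also have "\<dots> = w3 * (M + k * K) + (gy - cst y3) * K" unfolding H3 by Groebner_Basis.algebra
      finally have cf: "c * f = w3 * (M + k * K) + (gy - cst y3) * K" .
      have K: "K \<in> ideal_of Ps" unfolding K_def using g h Rs by (intro ideal_of_add ideal_of_mult)
      have M: "M \<in> ideal_of Ps" unfolding M_def using g h Rs by (intro ideal_of_add ideal_of_mult R_add R_mult)
      show "c * f \<in> ideal_of (Affine x3 y3 # Ps)"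
        unfolding cf w3_def using K M Rs by (intro ideal_of_ConsI ideal_of_add ideal_of_mult)
    next
      assume "c * f \<in> ideal_of (Affine x3 y3 # Ps)"
      then obtain g h where gh: "g \<in> ideal_of Ps" "h \<in> ideal_of Ps" "c * f = w3 * g + (gy - cst y3) * h"
        unfolding in_ideal_of_Cons w3_def by (elim bexE)
      have "w3 * f = lin * (c * f)" using lin by (simp add: c_def)
      also have "\<dots> = w3 * (lin * (g - k * h) + w1 * w2 * h)"
        unfolding gh(3) using H1 H3 by Groebner_Basis.algebra
      finally have f: "f = lin * (g - k * h) + w1 * w2 * h" using w3 by simp
      \<comment> \<open>It remains to see that \<open>lin\<close> lies in the product of the two
        maximal ideals. For a tangent this uses the second slope equation and the unit
        \<open>2 * y1\<close>; for a chord the difference of \<open>w1\<close> and \<open>w2\<close>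
        is a nonzero constant.\<close>
      have lj: "lin * j \<in> ideal_of (Q # Q' # Ps)" if j: "j \<in> ideal_of Ps" for j
      proof (cases "x1 = x2")
        case xx: True
        have y12: "y2 = y1" using l(1) xx by simp
        have y0: "y1 \<noteq> 0" using False xx y12 by auto
        define i where "i = cst (inverse (2 * y1)) * j"
        have i: "i \<in> ideal_of Ps" using j by (simp add: i_def ideal_of_mult)
        have ji: "j = 2 * cst y1 * i" using y0 by (simp add: i_def flip: fls_const_numeral)
        have "lin * j = w1 * (w2 * ((gx + cst 2 * cst x1) * i)) + (gy - cst y1) * ((gy - cst y2) * (cst (-1) * i))"
          using l2 gyc c1 unfolding ji lin_nl_def w1_w2_def xx y12 fls_const_numeral fls_const_uminus fls_const_1 by Groebner_Basis.algebra
        then show ?thesis unfolding PQ w1_w2_def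
          using ideal_of_ConsI[OF ideal_of_gen(1)[OF ideal_of_mult[OF _ i]] ideal_of_gen(2)[OF ideal_of_mult[OF _ i]]]
          by (metis R_add R_cst R_gx R_mult)
      next
        case xx: False
        define i where "i = cst (inverse (x2 - x1)) * j"
        have i: "i \<in> ideal_of Ps" using j by (simp add: i_def ideal_of_mult)
        have "cst (x2 - x1) * i = j" using xx by (simp add: i_def mult.assoc[symmetric])
        then have ji: "j = (cst x2 - cst x1) * i" by (simp add: fls_minus_const)
        have "lin * j = w1 * ((gy - cst y2) * i) + (gy - cst y1) * (w2 * (cst (-1) * i))"
          using l1 unfolding ji lin_nl_def w1_w2_def fls_const_uminus fls_const_1 by Groebner_Basis.algebra
        then show ?thesis unfolding PQ w1_w2_def
          using ideal_of_ConsI[OF ideal_of_gen(2)[OF i] ideal_of_gen(1)[OF ideal_of_mult[OF _ i]]]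
          by (metis R_cst)
      qed
      have "g - k * h = g + cst (-1) * (k * h)" by simp
      then have "g - k * h \<in> ideal_of Ps"
        using gh Rs by (metis R_cst ideal_of_add ideal_of_mult)
      moreover have "w1 * w2 * h \<in> ideal_of (Q # Q' # Ps)"
        unfolding PQ w1_w2_def mult.assoc by (intro ideal_of_gen gh)
      ultimately show "f \<in> ideal_of (Q # Q' # Ps)" unfolding f by (intro ideal_of_add lj)
    qed
    then show ?thesis using s PQ c by (intro exI[of _ c]) simp
  qed
qed

section \<open>Divisor classes of points and associativity\<close>

lemma low_degree_el:
  assumes "h \<in> R" "h \<noteq> 0" "fls_subdegree h \<ge> - 2"
  obtains s t where "h = el [:s, t:] 0"
proof -
  obtain a b where h: "h = el a b" using assms(1) by (auto simp: coord_ring_def)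
  have b: "b = 0"
  proof (rule ccontr)
    assume "b \<noteq> 0"
    then have "fls_subdegree h \<le> -3" using subdegree_el(3)[of a b] h by auto
    then show False using assms(3) by simp
  qed
  have "degree a \<le> 1"
  proof (cases "a = 0")
    case False
    then show ?thesis using subdegree_el(2)[of a b] h assms(3) by auto
  qed simp
  then obtain s t where "a = [:s, t:]" by (metis degree1_coeffs degree_0_id le_Suc_eq One_nat_def le_zero_eq pCons_0_0 coeff_pCons_0 degree_pCons_eq_if pCons_cases)
  with h b that show thesis by blast
qed

fun neg :: "'a point \<Rightarrow> 'a point" where "neg Infinity = Infinity" | "neg (Affine u v) = Affine u (- v)"

lemma on_curve_neg [simp]: "on_curve E (neg P) = on_curve E P"
  by (cases P) auto

lemma neg_neg [simp]: "neg (neg P) = P" by (cases P) auto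

lemma point_add_neg [simp]: "point_add E P (neg P) = Infinity"
  by (cases P) (auto simp: point_add_short)

lemma point_add_Infinity [simp]: "point_add E P Infinity = P"
  by (cases P) auto

lemma point_add_commute:
  assumes "on_curve E P" "on_curve E Q" shows "point_add E P Q = point_add E Q P"
proof (cases P; cases Q)
  fix x1 y1 x2 y2 assume PQ: "P = Affine x1 y1" "Q = Affine x2 y2"
  show ?thesis
  proof (cases "x1 = x2")
    case True
    then have "y1^2 = y2^2" using assms PQ by simp
    then have "y1 = y2 \<or> y1 + y2 = 0" by (metis power2_eq_iff add.left_inverse)
    then show ?thesis using True PQ by (auto simp: point_add_short add.commute)
  next
    case False
    define l where "l = (y2 - y1) / (x2 - x1)"
    have l': "(y1 - y2) / (x1 - x2) = l" using False by (simp add: l_def divide_simps) (simp add: algebra_simps)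
    have "l * (x2 - x1) = y2 - y1" using False by (simp add: l_def)
    then have "l * ((l^2 - x1 - x2) - x1) + y1 = l * ((l^2 - x1 - x2) - x2) + y2" by Groebner_Basis.algebra
    then show ?thesis using False unfolding PQ point_add_short Let_def l'
      by (simp add: algebra_simps flip: l_def)
  qed
qed auto

text \<open>At a point with \<open>v \<noteq> 0\<close> the function \<open>x - u\<close> is a local
  parameter, so a polynomial in \<open>x\<close> lying in the square of the maximal ideal has a
  double zero at \<open>u\<close>; of degree at most 1 it is 0. The argument differentiates the two
  coordinates of the membership relation at \<open>u\<close>.\<close>

lemma vertical_not_in_square:
  assumes "on_curve E (Affine u v)" "v \<noteq> 0"
  shows "el [:s, t:] 0 \<in> ideal_of [Affine u v, Affine u v] \<Longrightarrow> el [:s, t:] 0 = 0"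
proof -
  assume "el [:s, t:] 0 \<in> ideal_of [Affine u v, Affine u v]"
  then obtain f g where fg: "f \<in> ideal_of [Affine u v]" "g \<in> ideal_of [Affine u v]"
     and e: "el [:s, t:] 0 = (gx - cst u) * f + (gy - cst v) * g"
    unfolding in_ideal_of_Cons[of _ u v "[Affine u v]"] by (elim bexE)
  have R: "f \<in> R" "g \<in> R" using fg ideal_of_R by auto
  obtain a b where f: "f = el a b" using R by (auto simp: coord_ring_def)
  obtain c d where g: "g = el c d" using R by (auto simp: coord_ring_def)
  have f0: "poly a u + poly b u * v = 0" using ev_ideal_of[OF fg(1) assms(1)] by (simp add: f ev_el)
  have g0: "poly c u + poly d u * v = 0" using ev_ideal_of[OF fg(2) assms(1)] by (simp add: g ev_el)
  have gxu: "gx - cst u = el [:-u, 1:] 0" and gyv: "gy - cst v = el [:-v:] 1"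
    by (simp_all add: el_gx el_gy el_cst el_diff)
  have "el [:s, t:] 0 = el ([:-u,1:] * a + [:-v:] * c + d * f_poly) ([:-u,1:] * b + c + [:-v:] * d)"
    unfolding e f g gxu gyv by (simp add: el_mult el_add algebra_simps)
  then have e1: "[:s, t:] = [:-u,1:] * a + [:-v:] * c + d * f_poly" and e2: "[:-u,1:] * b + c + [:-v:] * d = 0"
    unfolding el_eq_iff by auto
  have v2: "v^2 = poly f_poly u" using assms(1) by (simp add: f_poly_def power2_eq_square power3_eq_cube algebra_simps)
  have "poly c u = v * poly d u" using arg_cong[OF e2, of "\<lambda>q. poly q u"] by (simp add: algebra_simps add_eq_0_iff)
  then have d0: "poly d u = 0" and c0: "poly c u = 0" using g0 assms(2) by (auto simp: algebra_simps)
  have st: "s + t * u = 0" using arg_cong[OF e1, of "\<lambda>q. poly q u"] c0 d0 by (simp add: algebra_simps)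
  have p1: "t = poly a u - v * poly (pderiv c) u + poly (pderiv d) u * v^2"
  proof -
    have "t = poly (pderiv [:s, t:]) u" by (simp add: pderiv_pCons)
    also have "\<dots> = poly a u - v * poly (pderiv c) u + poly (pderiv d) u * v^2"
      unfolding e1 pderiv_add pderiv_mult poly_add poly_mult using d0 by (simp add: pderiv_pCons v2 mult.commute)
    finally show ?thesis .
  qed
  have p2: "poly b u + poly (pderiv c) u - v * poly (pderiv d) u = 0"
  proof -
    have "0 = poly (pderiv ([:-u,1:] * b + c + [:-v:] * d)) u" unfolding e2 by simp
    also have "\<dots> = poly b u + poly (pderiv c) u - v * poly (pderiv d) u"
      unfolding pderiv_add pderiv_mult poly_add poly_mult by (simp add: pderiv_pCons)
    finally show ?thesis by simp
  qed
  have "t = poly a u + v * poly b u" using p1 p2 by Groebner_Basis.algebra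
  then have "t = 0" using f0 by (simp add: mult.commute)
  then show ?thesis using st by (simp add: el_def)
qed

lemma ideal_of_rotate: "ideal_of (P # Q # S # Ps) = ideal_of (Q # S # P # Ps)"
proof -
  have cong: "ideal_of Ps = ideal_of Qs \<Longrightarrow> ideal_of (Q # Ps) = ideal_of (Q # Qs)" for Q Ps Qs
    by (cases Q) simp_all
  have "ideal_of (P # Q # S # Ps) = ideal_of (Q # P # S # Ps)" by (rule ideal_of_swap)
  also have "\<dots> = ideal_of (Q # S # P # Ps)" by (rule cong) (rule ideal_of_swap)
  finally show ?thesis .
qed

lemma vertical_in_ideal:
  assumes "on_curve E P"
  shows "\<exists>h. h \<noteq> 0 \<and> fls_subdegree h = - 2 * sz P \<and> h \<in> ideal_of [P, neg P]"
proof -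
  obtain c where c: "c \<noteq> 0" "fls_subdegree c = sz P + sz (neg P)"
    "\<And>Ps f. f \<in> ideal_of (P # neg P # Ps) \<longleftrightarrow> c * f \<in> ideal_of (Infinity # Ps)"
    using point_class_relation[OF assms, of "neg P"] assms by auto
  have "sz (neg P) = sz P" by (cases P) auto
  then show ?thesis using c(1,2) c(3)[of "inverse c" "[]"] by (intro exI[of _ "inverse c"]) auto
qed

text \<open>Linearly equivalent points are equal; this is where the genus enters. A pole of order at
  most 2 forces \<open>h = s + t x\<close>, whose zeros form a pair of opposite points, and at a
  doubled point \<open>vertical_not_in_square\<close> applies.\<close>

lemma ideal_pair_unique:
  assumes "on_curve E P" "on_curve E Q" "h \<noteq> 0" "fls_subdegree h \<ge> - sz P - sz Q" "h \<in> ideal_of [P, neg Q]"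
  shows "P = Q"
proof -
  have hR: "h \<in> R" using assms(5) ideal_of_R by blast
  have sub: "fls_subdegree h \<ge> -2" using assms(4) by (cases P; cases Q) auto
  obtain s t where h: "h = el [:s, t:] 0" using low_degree_el[OF hR assms(3) sub] .
  have st: "[:s, t:] \<noteq> 0" using h assms(3) by (auto simp: el_def)
  have swap: "h \<in> ideal_of [neg Q, P]" using assms(5) ideal_of_swap by blast
  have t0: "t = 0 \<or> fls_subdegree h \<le> -2" using subdegree_el(2)[of "[:s,t:]" 0] h st by auto
  show ?thesis
  proof (cases P; cases Q)
    fix u v assume PQ: "P = Affine u v" "Q = Infinity"
    then have t: "t = 0" using t0 assms(4) by auto
    have "ev (Affine u v) h = 0" using ev_ideal_of assms(1,5) PQ by metis
    then have "s = 0" using h t by (simp add: ev_el)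
    then show ?thesis using st t by simp
  next
    fix u v assume PQ: "Q = Affine u v" "P = Infinity"
    then have t: "t = 0" using t0 assms(4) by auto
    have "ev (Affine u (-v)) h = 0" using ev_ideal_of[of h u "-v" "[P]"] assms(2) swap PQ by simp
    then have "s = 0" using h t by (simp add: ev_el)
    then show ?thesis using st t by simp
  next
    fix u v u' v' assume PQ: "P = Affine u v" "Q = Affine u' v'"
    have e1: "s + t * u = 0"
      using ev_ideal_of[of h u v "[neg Q]"] assms(1,5) PQ h by (simp add: ev_el mult.commute del: ideal_of.simps)
    have e2: "s + t * u' = 0"
      using ev_ideal_of[of h u' "-v'" "[P]"] assms(2) swap PQ h by (simp add: ev_el mult.commute del: ideal_of.simps)
    have "t \<noteq> 0" using e1 st by auto
    then have u: "u = u'" using e1 e2 by (metis add_left_cancel mult_cancel_left)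
    have "v^2 = v'^2" using assms(1,2) PQ u by simp
    then consider "v = v'" | "v = - v'" "v \<noteq> 0"
      by (cases "v = 0") (auto simp: power2_eq_iff)
    then show ?thesis
    proof cases
      case 2
      then have "neg Q = P" using PQ u by simp
      then have "h = 0" using vertical_not_in_square[of u v s t] assms(1,5) 2 PQ h by simp
      then show ?thesis using assms(3) by simp
    qed (use PQ u in simp)
  qed auto
qed

text \<open>Both sums represent the class of the three points. The vertical line through
  \<open>a\<close> is moved back along the quotients \<open>c1\<close>, \<open>c2\<close> to the
  ideal of \<open>P\<close>, \<open>Q\<close>, \<open>S\<close>, \<open>neg a\<close>, and forward
  along \<open>c3\<close>, \<open>c4\<close> to the ideal of \<open>b\<close>, \<open>neg a\<close>;
  then \<open>ideal_pair_unique\<close> identifies \<open>a\<close> with \<open>b\<close>.\<close>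

theorem point_add_assoc:
  assumes "on_curve E P" "on_curve E Q" "on_curve E S"
  shows "point_add E (point_add E P Q) S = point_add E P (point_add E Q S)"
proof -
  define U where "U = point_add E P Q"
  define V where "V = point_add E Q S"
  define a where "a = point_add E U S"
  define b where "b = point_add E P V"
  have c: "on_curve E U" "on_curve E V" "on_curve E a" "on_curve E b"
    using assms by (auto simp: U_def V_def a_def b_def intro!: point_add_closed)
  obtain h where h: "h \<noteq> 0" "fls_subdegree h = - 2 * sz a" "h \<in> ideal_of [a, neg a]"
    using vertical_in_ideal[OF c(3)] by blast
  obtain c1 where c1: "c1 \<noteq> 0" "fls_subdegree c1 = sz P + sz Q - sz U"
    "\<And>Ps f. f \<in> ideal_of (P # Q # Ps) \<longleftrightarrow> c1 * f \<in> ideal_of (U # Ps)"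
    using point_class_relation[OF assms(1,2)] by (auto simp: U_def)
  obtain c2 where c2: "c2 \<noteq> 0" "fls_subdegree c2 = sz U + sz S - sz a"
    "\<And>Ps f. f \<in> ideal_of (U # S # Ps) \<longleftrightarrow> c2 * f \<in> ideal_of (a # Ps)"
    using point_class_relation[OF c(1) assms(3)] by (auto simp: a_def)
  obtain c3 where c3: "c3 \<noteq> 0" "fls_subdegree c3 = sz Q + sz S - sz V"
    "\<And>Ps f. f \<in> ideal_of (Q # S # Ps) \<longleftrightarrow> c3 * f \<in> ideal_of (V # Ps)"
    using point_class_relation[OF assms(2,3)] by (auto simp: V_def)
  obtain c4 where c4: "c4 \<noteq> 0" "fls_subdegree c4 = sz P + sz V - sz b"
    "\<And>Ps f. f \<in> ideal_of (P # V # Ps) \<longleftrightarrow> c4 * f \<in> ideal_of (b # Ps)"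
    using point_class_relation[OF assms(1) c(2)] by (auto simp: b_def)
  define g where "g = inverse c1 * (inverse c2 * h)"
  have "c2 * (inverse c2 * h) = h" using c2 by (simp flip: mult.assoc)
  then have "inverse c2 * h \<in> ideal_of (U # S # [neg a])" using c2(3) h(3) by metis
  moreover have "c1 * g = inverse c2 * h" using c1 by (simp add: g_def flip: mult.assoc)
  ultimately have "g \<in> ideal_of (P # Q # S # [neg a])" using c1(3) by metis
  then have "c3 * g \<in> ideal_of (V # P # [neg a])" using c3(3) ideal_of_rotate by metis
  then have "c4 * (c3 * g) \<in> ideal_of (b # [neg a])" using c4(3) ideal_of_swap by metis
  moreover have "c4 * (c3 * g) \<noteq> 0" using c1 c2 c3 c4 h by (simp add: g_def)
  moreover have "fls_subdegree (c4 * (c3 * g)) = - sz b - sz a"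
    using c1(1,2) c2(1,2) c3(1,2) c4(1,2) h(1,2) by (simp add: g_def)
  ultimately have "b = a" using ideal_pair_unique[OF c(4,3), of "c4 * (c3 * g)"] by linarith
  then show ?thesis by (simp add: a_def b_def U_def V_def)
qed

section \<open>The group of points and functions attached to torsion points\<close>

abbreviation "EG \<equiv> point_group E UNIV"
abbreviation multiple (infixl "\<up>" 75) where "P \<up> m \<equiv> P [^]\<^bsub>EG\<^esub> m"

lemma carrier_EG: "carrier EG = {P. on_curve E P}" by (simp add: point_group_def)
lemma mult_EG: "P \<otimes>\<^bsub>EG\<^esub> Q = point_add E P Q" by (simp add: point_group_def)
lemma one_EG: "\<one>\<^bsub>EG\<^esub> = Infinity" by (simp add: point_group_def)
lemmas EG_simps = carrier_EG mult_EG one_EG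

lemma comm_group_EG: "comm_group EG"
proof (rule comm_groupI)
  fix P assume P: "P \<in> carrier EG"
  show "\<exists>Q\<in>carrier EG. Q \<otimes>\<^bsub>EG\<^esub> P = \<one>\<^bsub>EG\<^esub>"
    using P point_add_neg[of P] point_add_commute[of P "neg P"] by (intro bexI[of _ "neg P"]) (auto simp: EG_simps)
qed (auto simp: EG_simps point_add_closed point_add_assoc intro: point_add_commute)

lemma unmerge_multiple:
  assumes "on_curve E Q" "f \<noteq> 0" "f \<in> ideal_of [Q \<up> m]"
  shows "\<exists>g. g \<noteq> 0 \<and> g \<in> ideal_of (replicate m Q) \<and>
     fls_subdegree g = fls_subdegree f + sz (Q \<up> m) - int m * sz Q"
proof -
  interpret EG: comm_group EG by (rule comm_group_EG)
  have *: "\<exists>g. g \<noteq> 0 \<and> g \<in> ideal_of (replicate m Q @ Ps) \<and>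
     fls_subdegree g = fls_subdegree f + sz (Q \<up> m) - int m * sz Q"
    if "f \<noteq> 0" "f \<in> ideal_of ((Q \<up> m) # Ps)" for f Ps
    using that
  proof (induction m arbitrary: f Ps)
    case 0
    then show ?case by (auto simp: one_EG)
  next
    case (Suc m)
    let ?M = "Q \<up> m"
    have M: "on_curve E ?M" using EG.nat_pow_closed[of Q m] assms(1) by (simp add: carrier_EG)
    obtain c where c: "c \<noteq> 0" "fls_subdegree c = sz ?M + sz Q - sz (Q \<up> Suc m)"
      "\<And>Ps f. f \<in> ideal_of (?M # Q # Ps) \<longleftrightarrow> c * f \<in> ideal_of ((Q \<up> Suc m) # Ps)"
      using point_class_relation[OF M assms(1)] by (auto simp: mult_EG)
    have "c * (inverse c * f) = f" using c(1) by (simp flip: mult.assoc)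
    then have 1: "inverse c * f \<in> ideal_of (?M # Q # Ps)" using c(3) Suc.prems(2) by metis
    obtain g where g: "g \<noteq> 0" "g \<in> ideal_of (replicate m Q @ Q # Ps)"
      "fls_subdegree g = fls_subdegree (inverse c * f) + sz ?M - int m * sz Q"
      using Suc.IH[OF _ 1] c(1) Suc.prems(1) by auto
    have "replicate m Q @ Q # Ps = replicate (Suc m) Q @ Ps" by (simp add: replicate_app_Cons_same)
    moreover have "fls_subdegree g = fls_subdegree f + sz (Q \<up> Suc m) - int (Suc m) * sz Q"
      using g(3) c(1,2) Suc.prems(1) by (simp add: algebra_simps)
    ultimately show ?case using g by metis
  qed
  then show ?thesis using *[of f "[]"] assms by simp
qed

text \<open>The function with divisor \<open>m [Q] - m [\<infinity>]\<close>. It is obtained from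
  the constant 1, which lies in the ideal of the multiple \<open>Infinity\<close>, by splitting off
  one copy of \<open>Q\<close> at a time.\<close>

lemma function_of_torsion_point:
  assumes "on_curve E Q" "Q \<up> m = Infinity" "Q \<noteq> Infinity"
  obtains f where "f \<noteq> 0" "f \<in> ideal_of (replicate m Q)" "fls_subdegree f = - int m"
  using unmerge_multiple[of Q 1 m] assms by (cases Q) auto

end

section \<open>Polynomials over an algebraically closed field\<close>

lemma bezout_of_no_common_root:
  fixes p q :: "'a::field poly"
  assumes ac: "\<And>r :: 'a poly. degree r > 0 \<Longrightarrow> \<exists>z. poly r z = 0"
    and "\<And>z. \<not> (poly p z = 0 \<and> poly q z = 0)"
  shows "\<exists>r s. r * p + s * q = 1"
  using assms(2)
proof (induction "if q = 0 then 0 else Suc (degree q)" arbitrary: p q rule: less_induct)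
  case less
  show ?case
  proof (cases "q = 0")
    case True
    then have "degree p = 0" "p \<noteq> 0" using ac[of p] less.prems by auto
    then obtain c where "p = [:c:]" "c \<noteq> 0" by (metis degree_0_id pCons_0_0)
    then have "[:inverse c:] * p + 0 * q = 1" by (simp add: one_pCons)
    then show ?thesis by blast
  next
    case False
    have "\<exists>r s. r * q + s * (p mod q) = 1"
    proof (rule less.hyps)
      show "(if p mod q = 0 then 0 else Suc (degree (p mod q))) < (if q = 0 then 0 else Suc (degree q))"
        using False degree_mod_less[of q p] by auto
      show "\<not> (poly q z = 0 \<and> poly (p mod q) z = 0)" for z
      proof
        assume a: "poly q z = 0 \<and> poly (p mod q) z = 0"
        have "p = p div q * q + p mod q" by simp
        then have "poly p z = poly (p div q) z * poly q z + poly (p mod q) z" by (metis poly_add poly_mult)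
        then show False using a less.prems[of z] by simp
      qed
    qed
    then obtain r s where "r * q + s * (p mod q) = 1" by blast
    moreover have "p mod q = p - p div q * q" by (simp add: minus_div_mult_eq_mod)
    ultimately have "s * p + (r - s * (p div q)) * q = 1" by (simp add: algebra_simps)
    then show ?thesis by blast
  qed
qed

lemma degree_diff_eq_left:
  fixes p q :: "'a::ring poly"
  assumes "degree q < degree p" shows "degree (p - q) = degree p"
  using degree_add_eq_left[of "- q" p] assms by simp

lemma card_roots_no_double_root:
  fixes q :: "'a::field_char_0 poly"
  assumes ac: "\<And>r :: 'a poly. degree r > 0 \<Longrightarrow> \<exists>z. poly r z = 0"
    and "q \<noteq> 0" "\<And>z. \<not> (poly q z = 0 \<and> poly (pderiv q) z = 0)"
  shows "card {z. poly q z = 0} = degree q"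
  using assms(2,3)
proof (induction "degree q" arbitrary: q)
  case 0
  then obtain c where "q = [:c:]" "c \<noteq> 0" by (metis degree_0_id pCons_0_0)
  then show ?case by simp
next
  case (Suc n)
  then obtain z where z: "poly q z = 0" using ac[of q] by auto
  then obtain s where s: "q = [:-z, 1:] * s" by (metis poly_eq_0_iff_dvd dvdE)
  have s0: "s \<noteq> 0" using Suc.prems(1) s by auto
  have der: "pderiv q = s + [:-z, 1:] * pderiv s" unfolding s by (simp only: pderiv_mult) (simp add: pderiv_pCons)
  have sz: "poly s z \<noteq> 0" using Suc.prems(2)[of z] z der by auto
  have deg: "degree q = Suc (degree s)" unfolding s by (subst degree_mult_eq) (use s0 in auto)
  have "card {z. poly s z = 0} = degree s"
  proof (rule Suc.hyps)
    show "\<not> (poly s w = 0 \<and> poly (pderiv s) w = 0)" for w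
      using Suc.prems(2)[of w] der s by auto
  qed (use deg Suc.hyps(2) s0 in auto)
  moreover have "{w. poly q w = 0} = insert z {w. poly s w = 0}" unfolding s by auto
  ultimately show ?case using sz deg poly_roots_finite[OF s0] by simp
qed

section \<open>Multiplication by an integer\<close>

locale ac_curve = short_curve +
  assumes ac: "\<And>r :: 'a poly. degree r > 0 \<Longrightarrow> \<exists>z. poly r z = 0"
begin

lemma point_over: "\<exists>v. on_curve E (Affine u v)"
proof -
  obtain z where "poly [:- (u^3 + A * u + B), 0, 1:] z = 0" using ac[of "[:- (u^3 + A * u + B), 0, 1:]"] by auto
  moreover have "poly [:- (u^3 + A * u + B), 0, 1:] z = z^2 - (u^3 + A * u + B)"
    by (simp add: power2_eq_square)
  ultimately have "on_curve E (Affine u z)" by simp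
  then show ?thesis by blast
qed

lemma finite_points_over: "finite F \<Longrightarrow> finite {Affine u v | u v. on_curve E (Affine u v) \<and> u \<in> F}"
proof -
  assume F: "finite F"
  have "{Affine u v | u v. on_curve E (Affine u v) \<and> u \<in> F} \<subseteq>
    (\<Union>u\<in>F. (\<lambda>v. Affine u v) ` {v. poly [:- (u^3 + A * u + B), 0, 1:] v = 0})"
    by (auto simp: power2_eq_square)
  moreover have "finite {v. poly [:- (u^3 + A * u + B), 0, 1:] v = 0}" for u by (rule poly_roots_finite) simp
  ultimately show ?thesis using F by (meson finite_UN_I finite_imageI finite_subset)
qed

text \<open>The sign of \<open>v'\<close> interchanges the two points, so the sum and product of
  their x-coordinates contain \<open>v\<close> and \<open>v'\<close> only through their squares.
  This gives a recursion for the x-coordinates of multiples that does not involve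
  y-coordinates.\<close>

lemma add_sub_x:
  assumes "on_curve E (Affine u v)" "on_curve E (Affine u' v')" "u \<noteq> u'"
  shows "\<exists>s w w' t. point_add E (Affine u v) (Affine u' v') = Affine s w \<and>
     point_add E (Affine u v) (neg (Affine u' v')) = Affine t w' \<and>
     (u - u')^2 * (s + t) = 2 * ((u + u') * (A + u * u') + 2 * B) \<and>
     (u - u')^2 * (s * t) = (u * u' - A)^2 - 4 * B * (u + u')"
proof -
  define l where "l = (v' - v) / (u' - u)"
  define k where "k = (- v' - v) / (u' - u)"
  define d where "d = u' - u"
  have d: "d \<noteq> 0" using assms(3) by (simp add: d_def)
  have l: "l * d = v' - v" and k: "k * d = - v' - v" using d by (simp_all add: l_def k_def d_def)
  have c: "v^2 = u^3 + A * u + B" "v'^2 = u'^3 + A * u' + B" using assms by simp_all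
  have du: "u' = u + d" by (simp add: d_def)
  have "(u - u')^2 * ((l^2 - u - u') + (k^2 - u - u')) = (l * d)^2 + (k * d)^2 - 2 * d^2 * (u + u')"
    by (simp add: d_def) Groebner_Basis.algebra
  also have "\<dots> = 2 * ((u + u') * (A + u * u') + 2 * B)"
    unfolding l k unfolding d_def using c by Groebner_Basis.algebra
  finally have 1: "(u - u')^2 * ((l^2 - u - u') + (k^2 - u - u')) = 2 * ((u + u') * (A + u * u') + 2 * B)" .
  have "d^2 * (d^2 * ((l^2 - u - u') * (k^2 - u - u'))) = ((l * d)^2 - d^2 * (u + u')) * ((k * d)^2 - d^2 * (u + u'))"
    by Groebner_Basis.algebra
  also have "\<dots> = d^2 * ((u * u' - A)^2 - 4 * B * (u + u'))"
    unfolding l k unfolding d_def using c by Groebner_Basis.algebra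
  finally have "d^2 * ((l^2 - u - u') * (k^2 - u - u')) = (u * u' - A)^2 - 4 * B * (u + u')"
    using mult_left_cancel[OF power_not_zero[OF d, of 2]] by blast
  then have "(u - u')^2 * ((l^2 - u - u') * (k^2 - u - u')) = (u * u' - A)^2 - 4 * B * (u + u')"
    by (simp only: d_def power2_commute[of u])
  with 1 show ?thesis using assms(3) by (simp add: point_add_short Let_def flip: l_def k_def)
qed

text \<open>Multiplication by \<open>m\<close> acts on x-coordinates as the rational function
  \<open>a / b\<close> in lowest terms, of degree \<open>m^2\<close>. Finitely many \<open>u\<close>
  are left out, so that no special case of the addition law has to be traced; the degree is what
  counts torsion points later.\<close>

definition mult_polys :: "nat \<Rightarrow> 'a poly \<Rightarrow> 'a poly \<Rightarrow> bool" where
  "mult_polys m a b \<longleftrightarrow> degree a = m^2 \<and> degree b < m^2 \<and> b \<noteq> 0 \<and>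
     (\<forall>z. \<not> (poly a z = 0 \<and> poly b z = 0)) \<and>
     (\<exists>F. finite F \<and> (\<forall>u v. on_curve E (Affine u v) \<longrightarrow> u \<notin> F \<longrightarrow> poly b u \<noteq> 0 \<and>
        (\<exists>w. Affine u v \<up> m = Affine (poly a u / poly b u) w)))"

lemma no_common_root_f: "\<not> (z^3 + A * z + B = 0 \<and> 3 * z^2 + A = 0)"
proof
  assume "z^3 + A * z + B = 0 \<and> 3 * z^2 + A = 0"
  then have "4 * A^3 + 27 * B^2 = 0" by Groebner_Basis.algebra
  with disc show False by simp
qed

lemma mult_polys_1: "mult_polys 1 [:0,1:] 1"
proof -
  interpret EG: comm_group EG by (rule comm_group_EG)
  have "Affine u v \<up> Suc 0 = Affine u v" if "on_curve E (Affine u v)" for u v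
    using that EG.nat_pow_eone by (simp add: carrier_EG del: on_curve.simps)
  then show ?thesis by (auto simp: mult_polys_def simp del: on_curve_short intro!: exI[of _ "{}"])
qed

lemma mult_polys_2: "\<exists>a b. mult_polys 2 a b"
proof -
  interpret EG: comm_group EG by (rule comm_group_EG)
  \<comment> \<open>Numerator and denominator of the duplication formula
    \<open>((3 u^2 + A)^2 - 8 u v^2) / (4 v^2)\<close>, with \<open>v^2\<close> replaced by the
    cubic.\<close>
  define a where "a = [:A^2, - 8 * B, - 2 * A, 0, 1:]"
  define b where "b = smult 4 f_poly"
  have pb: "poly b u = 4 * (u^3 + A * u + B)" for u by (simp add: b_def f_poly_def algebra_simps power3_eq_cube)
  have pa: "poly a u = u^4 - 2 * A * u^2 - 8 * B * u + A^2" for u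
    by (simp add: a_def algebra_simps power2_eq_square power4_eq_xxxx)
  have "mult_polys 2 a b"
    unfolding mult_polys_def
  proof (intro conjI allI)
    show "degree a = 2^2" by (simp add: a_def)
    show "degree b < 2^2" "b \<noteq> 0" by (simp_all add: b_def f_poly_def)
    show "\<not> (poly a z = 0 \<and> poly b z = 0)" for z
    proof
      assume "poly a z = 0 \<and> poly b z = 0"
      then have "z^4 - 2 * A * z^2 - 8 * B * z + A^2 = 0" "z^3 + A * z + B = 0"
        by (metis pa, metis pb mult_eq_0_iff zero_neq_numeral)
      \<comment> \<open>Modulo the cubic the numerator is the square of the derivative of the
        cubic.\<close>
      then have "(3 * z^2 + A)^2 = 0" by Groebner_Basis.algebra
      then show False using no_common_root_f[of z] \<open>z^3 + A * z + B = 0\<close> by simp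
    qed
    show "\<exists>F. finite F \<and> (\<forall>u v. on_curve E (Affine u v) \<longrightarrow> u \<notin> F \<longrightarrow> poly b u \<noteq> 0 \<and>
        (\<exists>w. Affine u v \<up> (2::nat) = Affine (poly a u / poly b u) w))"
    proof (intro exI[of _ "{u. poly b u = 0}"] conjI allI impI)
      show "finite {u. poly b u = 0}" by (rule poly_roots_finite) (simp add: b_def f_poly_def)
      fix u v assume uv: "on_curve E (Affine u v)" "u \<notin> {u. poly b u = 0}"
      then show b0: "poly b u \<noteq> 0" by simp
      have v2: "v^2 = u^3 + A * u + B" using uv by simp
      have "poly b u = 4 * v^2" by (simp only: pb v2)
      then have v0: "v \<noteq> 0" using b0 by auto
      have P: "Affine u v \<up> (2::nat) = point_add E (Affine u v) (Affine u v)"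
        using uv by (simp add: numeral_2_eq_2 EG_simps)
      have "((3 * u^2 + A) / (2 * v))^2 - u - u = poly a u / poly b u"
      proof -
        have "((3 * u^2 + A) / (2 * v))^2 - u - u = ((3 * u^2 + A)^2 - 2 * u * (2 * v)^2) / (2 * v)^2"
          using v0 by (simp add: divide_simps power2_eq_square)
        also have "(2 * v)^2 = poly b u" by (simp add: pb v2 power_mult_distrib)
        also have "(3 * u^2 + A)^2 - 2 * u * poly b u = poly a u" unfolding pa pb by Groebner_Basis.algebra
        finally show ?thesis .
      qed
      then show "\<exists>w. Affine u v \<up> (2::nat) = Affine (poly a u / poly b u) w"
        unfolding P point_add_short Let_def using v0 by simp
    qed
  qed
  then show ?thesis by blast
qed

lemma infinite_field: "infinite (UNIV :: 'a set)" by (rule infinite_UNIV_char_0)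

lemma poly_eq_0_cofinite:
  fixes q :: "'a poly"
  assumes "finite F" "\<And>u. u \<notin> F \<Longrightarrow> poly q u = 0" shows "q = 0"
proof (rule ccontr)
  assume "q \<noteq> 0"
  then have "finite ({u. poly q u = 0} \<union> F)" using assms poly_roots_finite by blast
  moreover have "{u. poly q u = 0} \<union> F = UNIV" using assms by auto
  ultimately show False using infinite_field by simp
qed

text \<open>\<open>x(P + Q) + x(P - Q)\<close> and \<open>x(P + Q) x(P - Q)\<close> are rational functions of \<open>x(P)\<close> and \<open>x(Q)\<close>. For \<open>Q\<close> a multiple of \<open>P\<close>
  their common denominator is \<open>U\<close> and their numerators are \<open>S\<close> and \<open>T\<close>.\<close>

lemma mult_polys_step:
  assumes "mult_polys m a b" "mult_polys (Suc m) c d" "m \<ge> 1"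
  shows "\<exists>a b. mult_polys (Suc (Suc m)) a b"
proof -
  interpret EG: comm_group EG by (rule comm_group_EG)
  define x where "x = ([:0, 1:] :: 'a poly)"
  define kA kB where "kA = [:A:]" "kB = [:B:]"
  define U where "U = (c - x * d)^2"
  define S where "S = 2 * ((c + x * d) * (kA * d + x * c) + 2 * kB * d^2)"
  define T where "T = (c * x - kA * d)^2 - 4 * kB * d * (c + x * d)"
  have deg: "degree a = m^2" "degree b < m^2" "b \<noteq> 0" "degree c = (Suc m)^2" "degree d < (Suc m)^2" "d \<noteq> 0"
    and ncr: "\<And>z. \<not> (poly a z = 0 \<and> poly b z = 0)" "\<And>z. \<not> (poly c z = 0 \<and> poly d z = 0)"
    using assms(1,2) by (auto simp: mult_polys_def)
  have a0: "a \<noteq> 0" "c \<noteq> 0" using deg assms(3) by auto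
  obtain F1 where F1: "finite F1" "\<And>u v. on_curve E (Affine u v) \<Longrightarrow> u \<notin> F1 \<Longrightarrow> poly b u \<noteq> 0 \<and>
        (\<exists>w. Affine u v \<up> m = Affine (poly a u / poly b u) w)"
    using assms(1) unfolding mult_polys_def by blast
  obtain F2 where F2: "finite F2" "\<And>u v. on_curve E (Affine u v) \<Longrightarrow> u \<notin> F2 \<Longrightarrow> poly d u \<noteq> 0 \<and>
        (\<exists>w. Affine u v \<up> Suc m = Affine (poly c u / poly d u) w)"
    using assms(2) unfolding mult_polys_def by blast
  have cx: "c - x * d \<noteq> 0"
  proof
    assume "c - x * d = 0"
    then have cd: "c = x * d" by simp
    have "degree d = 0"
    proof (rule ccontr)
      assume "degree d \<noteq> 0"
      then obtain z where "poly d z = 0" using ac[of d] by auto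
      then show False using ncr(2)[of z] cd by simp
    qed
    then have "degree c = 1" using cd deg by (simp add: degree_mult_eq x_def)
    then show False using deg(4) assms(3) by (simp add: power2_eq_square)
  qed
  have U0: "U \<noteq> 0" using cx by (simp add: U_def)
  define F where "F = F1 \<union> F2 \<union> {u. poly U u = 0}"
  have F: "finite F" using F1 F2 poly_roots_finite[OF U0] by (simp add: F_def)
  have pts: "\<exists>s w. Affine u v \<up> Suc (Suc m) = Affine s w \<and>
      poly U u * (s + poly a u / poly b u) = poly S u \<and> poly U u * (s * (poly a u / poly b u)) = poly T u"
    if uv: "on_curve E (Affine u v)" "u \<notin> F" for u v
  proof -
    obtain w where w: "Affine u v \<up> m = Affine (poly a u / poly b u) w" using F1 uv F_def by blast
    obtain w' where w': "Affine u v \<up> Suc m = Affine (poly c u / poly d u) w'" and d0: "poly d u \<noteq> 0" using F2 uv F_def by blast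
    define xm where "xm = poly c u / poly d u"
    have P: "Affine u v \<in> carrier EG" using uv by (simp add: carrier_EG)
    have c1: "on_curve E (Affine xm w')" using EG.nat_pow_closed[OF P, of "Suc m"] w' by (simp add: carrier_EG xm_def)
    have "poly U u \<noteq> 0" using uv F_def by auto
    then have Xu: "xm \<noteq> u" using d0 by (auto simp: U_def xm_def x_def field_simps)
    obtain s y y' t where st: "point_add E (Affine xm w') (Affine u v) = Affine s y"
     "point_add E (Affine xm w') (neg (Affine u v)) = Affine t y'"
     "(xm - u)^2 * (s + t) = 2 * ((xm + u) * (A + xm * u) + 2 * B)"
     "(xm - u)^2 * (s * t) = (xm * u - A)^2 - 4 * B * (xm + u)"
      using add_sub_x[OF c1 uv(1) Xu] by blast
    have "point_add E (Affine xm w') (neg (Affine u v)) = Affine u v \<up> m"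
    proof -
      have M: "on_curve E (Affine u v \<up> m)" using EG.nat_pow_closed[OF P, of m] by (simp add: carrier_EG)
      have "point_add E (Affine xm w') (neg (Affine u v)) =
        point_add E (point_add E (Affine u v \<up> m) (Affine u v)) (neg (Affine u v))"
        using w' by (simp add: xm_def mult_EG del: neg.simps)
      also have "\<dots> = Affine u v \<up> m"
        using point_add_assoc[OF M uv(1), of "neg (Affine u v)"] uv(1) by (simp del: neg.simps on_curve_short)
      finally show ?thesis .
    qed
    then have t: "t = poly a u / poly b u" using st(2) w by simp
    have "Affine u v \<up> Suc (Suc m) = point_add E (Affine xm w') (Affine u v)"
      using w' by (simp add: xm_def mult_EG EG.nat_pow_Suc[of _ "Suc m"] del: nat_pow_Suc)
    then have Ps: "Affine u v \<up> Suc (Suc m) = Affine s y" using st(1) by simp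
    have cX: "poly c u = xm * poly d u" using d0 by (simp add: xm_def)
    have pU: "poly U u = (xm - u)^2 * poly d u^2" by (simp add: U_def x_def cX) Groebner_Basis.algebra
    have pS: "poly S u = 2 * ((xm + u) * (A + xm * u) + 2 * B) * poly d u^2"
      by (simp add: S_def x_def cX kA_kB_def) Groebner_Basis.algebra
    have pT: "poly T u = ((xm * u - A)^2 - 4 * B * (xm + u)) * poly d u^2"
      by (simp add: T_def x_def cX kA_kB_def) Groebner_Basis.algebra
    have "poly U u * (s + t) = poly S u" "poly U u * (s * t) = poly T u"
      unfolding pU pS pT st(3)[symmetric] st(4)[symmetric] by (simp_all add: algebra_simps)
    then show ?thesis using Ps t by blast
  qed
  \<comment> \<open>\<open>x(m P) = a / b\<close> is a root of the quadratic
    \<open>U X^2 - S X + T\<close>. As \<open>a\<close> and \<open>b\<close> are coprime,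
    \<open>b\<close> divides \<open>U\<close> and \<open>a\<close> divides \<open>T\<close>, as for
    any rational root; the cofactors \<open>b2\<close> and \<open>a2\<close> are the denominator and
    numerator of the other root \<open>x((m + 2) P)\<close>.\<close>
  have quad: "U * a^2 - S * a * b + T * b^2 = 0"
  proof (rule poly_eq_0_cofinite[OF F])
    fix u assume u: "u \<notin> F"
    obtain v where v: "on_curve E (Affine u v)" using point_over by blast
    obtain s w where s: "poly U u * (s + poly a u / poly b u) = poly S u" "poly U u * (s * (poly a u / poly b u)) = poly T u"
      using pts[OF v u] by blast
    have b0: "poly b u \<noteq> 0" using F1 u v F_def by blast
    define xm where "xm = poly a u / poly b u"
    note s = s[folded xm_def]
    have aX: "poly a u = xm * poly b u" using b0 by (simp add: xm_def)
    show "poly (U * a^2 - S * a * b + T * b^2) u = 0"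
      unfolding poly_add poly_diff poly_mult poly_power s[symmetric] aX by Groebner_Basis.algebra
  qed
  obtain r s where rs: "r * a + s * b = 1" using bezout_of_no_common_root[OF ac ncr(1)] by blast
  have "U = b * (U * s * (r * a + 1) + r^2 * S * a - r^2 * T * b)"
    using quad rs by Groebner_Basis.algebra
  then obtain b2 where b2: "U = b * b2" by blast
  have "b * (b2 * a^2 - S * a + T * b) = 0" using quad b2 by Groebner_Basis.algebra
  then have quad2: "b2 * a^2 - S * a + T * b = 0" using deg by simp
  have "T = a * (T * r + s * S - s * b2 * a)" using quad2 rs by Groebner_Basis.algebra
  then obtain a2 where a2: "T = a * a2" by blast
  have "a * (b2 * a + a2 * b - S) = 0" using quad2 a2 by Groebner_Basis.algebra
  then have S: "S = b2 * a + a2 * b" using a0 by simp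
  have b20: "b2 \<noteq> 0" using U0 b2 by auto
  have degx: "degree x = 1" "x \<noteq> 0" by (simp_all add: x_def)
  have dk: "degree (kA * d) \<le> degree d" "degree (kB * d) \<le> degree d" by (auto simp: kA_kB_def degree_smult_le)
  define M where "M = (Suc m)^2"
  \<comment> \<open>The degree of \<open>a2\<close> comes from \<open>T\<close>, whose leading part
    is that of \<open>(c x)^2\<close>: since \<open>2 (m + 1)^2 + 2 = m^2 + (m + 2)^2\<close>,
    division by \<open>a\<close> leaves \<open>(m + 2)^2\<close>.\<close>
  have degT: "degree T = 2 * M + 2"
  proof -
    have "degree (c * x - kA * d) = M + 1"
    proof -
      have "degree (c * x) = M + 1" using a0 degx deg by (simp add: degree_mult_eq M_def)
      moreover have "degree (kA * d) < M + 1" using dk deg M_def by linarith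
      ultimately show ?thesis using degree_diff_eq_left by metis
    qed
    then have 1: "degree ((c * x - kA * d)^2) = 2 * M + 2"
      by (subst degree_power_eq) auto
    have "degree (x * d) \<le> M" using degree_mult_le[of x d] degx deg M_def by linarith
    then have "degree (c + x * d) \<le> M" using deg M_def by (simp add: degree_add_le)
    then have "degree (kB * d * (c + x * d)) \<le> 2 * M"
      using degree_mult_le[of "kB * d" "c + x * d"] dk deg M_def by linarith
    then have "degree (4 * kB * d * (c + x * d)) \<le> 2 * M"
      using degree_mult_le[of 4 "kB * d * (c + x * d)"] by (simp add: mult.assoc)
    then have "degree (4 * kB * d * (c + x * d)) < degree ((c * x - kA * d)^2)" unfolding 1 by linarith
    from degree_diff_eq_left[OF this] show ?thesis unfolding T_def 1 .
  qed
  have degS: "degree S \<le> 2 * M + 1"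
  proof -
    have 1: "degree (x * d) \<le> M" using degree_mult_le[of x d] degx deg M_def by linarith
    have 2: "degree (c + x * d) \<le> M" using 1 deg M_def by (simp add: degree_add_le)
    have "degree (x * c) \<le> M + 1" using degree_mult_le[of x c] degx deg M_def by linarith
    then have 3: "degree (kA * d + x * c) \<le> M + 1" using dk(1) deg M_def by (simp add: degree_add_le)
    have "degree ((c + x * d) * (kA * d + x * c)) \<le> 2 * M + 1"
      using degree_mult_le[of "c + x * d" "kA * d + x * c"] 2 3 by linarith
    moreover have "degree (2 * kB * d^2) \<le> 2 * M + 1"
    proof -
      have "degree (2 * kB * d^2) \<le> degree (kB * d) + degree d"
        using degree_mult_le[of 2 "kB * d * d"] degree_mult_le[of "kB * d" d] by (simp add: power2_eq_square mult.assoc)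
      then show ?thesis using dk deg M_def by linarith
    qed
    ultimately have "degree ((c + x * d) * (kA * d + x * c) + 2 * kB * d^2) \<le> 2 * M + 1" by (simp add: degree_add_le)
    moreover have "degree (2 * r) \<le> degree r" for r :: "'a poly" using degree_mult_le[of 2 r] by simp
    ultimately show ?thesis unfolding S_def using le_trans by blast
  qed
  have MM: "2 * M + 2 = m^2 + (Suc (Suc m))^2" by (simp add: M_def power2_eq_square)
  have a20: "a2 \<noteq> 0" using degT a2 by auto
  have dega2: "degree a2 = (Suc (Suc m))^2" using degT a0 a20 deg MM unfolding a2 by (simp add: degree_mult_eq)
  have degb2: "degree b2 < (Suc (Suc m))^2"
  proof -
    have "degree (a2 * b) \<le> 2 * M + 1" using degree_mult_le[of a2 b] dega2 deg MM by linarith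
    then have "degree (S - a2 * b) \<le> 2 * M + 1" using degS by (simp add: degree_diff_le)
    moreover have "S - a2 * b = b2 * a" using S by simp
    ultimately have "degree b2 + m^2 \<le> 2 * M + 1" using b20 a0 deg by (simp add: degree_mult_eq)
    then show ?thesis using MM by linarith
  qed
  have "mult_polys (Suc (Suc m)) a2 b2"
    unfolding mult_polys_def
  proof (intro conjI allI)
    \<comment> \<open>A common zero of \<open>a2\<close> and \<open>b2\<close> is one of
      \<open>U\<close>, \<open>S\<close> and \<open>T\<close>. There \<open>c = z d\<close>, and up
      to nonzero factors and multiples of the cubic, \<open>S\<close> and \<open>T\<close> become
      the cubic and the square of its derivative.\<close>
    show "\<not> (poly a2 z = 0 \<and> poly b2 z = 0)" for z
    proof
      assume "poly a2 z = 0 \<and> poly b2 z = 0"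
      then have z: "poly U z = 0" "poly S z = 0" "poly T z = 0" using b2 a2 S by auto
      have c: "poly c z = z * poly d z" using z(1) by (simp add: U_def x_def)
      then have d0: "poly d z \<noteq> 0" using ncr(2)[of z] by auto
      have "poly d z^2 * (4 * (z^3 + A * z + B)) = 0" using z(2) by (simp add: S_def x_def kA_kB_def c) Groebner_Basis.algebra
      then have f: "z^3 + A * z + B = 0" using d0 by (metis mult_eq_0_iff power_not_zero zero_neq_numeral)
      have "poly d z^2 * ((z * z - A)^2 - 8 * B * z) = 0" using z(3) by (simp add: T_def x_def kA_kB_def c) Groebner_Basis.algebra
      then have "(z * z - A)^2 - 8 * B * z = 0" using d0 by simp
      then have "(3 * z^2 + A)^2 = 0" using f by Groebner_Basis.algebra
      then show False using no_common_root_f[of z] f by simp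
    qed
    show "\<exists>F. finite F \<and> (\<forall>u v. on_curve E (Affine u v) \<longrightarrow> u \<notin> F \<longrightarrow> poly b2 u \<noteq> 0 \<and>
        (\<exists>w. Affine u v \<up> Suc (Suc m) = Affine (poly a2 u / poly b2 u) w))"
    proof (intro exI[of _ F] conjI allI impI F)
      fix u v assume uv: "on_curve E (Affine u v)" "u \<notin> F"
      have U: "poly U u \<noteq> 0" using uv F_def by auto
      then show b2': "poly b2 u \<noteq> 0" using b2 by auto
      obtain s w where s: "Affine u v \<up> Suc (Suc m) = Affine s w" "poly U u * (s + poly a u / poly b u) = poly S u"
        using pts[OF uv] by blast
      have b': "poly b u \<noteq> 0" using U b2 by auto
      have "s = poly a2 u / poly b2 u"
        using s(2) b' b2' unfolding b2 S by (simp add: field_simps)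
      then show "\<exists>w. Affine u v \<up> Suc (Suc m) = Affine (poly a2 u / poly b2 u) w" using s(1) by simp
    qed
  qed (use dega2 degb2 b20 in auto)
  then show ?thesis by blast
qed

lemma mult_polys_exist: "m \<ge> 1 \<Longrightarrow> \<exists>a b. mult_polys m a b"
proof -
  have "(\<exists>a b. mult_polys (Suc m) a b) \<and> (\<exists>a b. mult_polys (Suc (Suc m)) a b)" for m
  proof (induction m)
    case 0
    then show ?case using mult_polys_1 mult_polys_2 by (auto simp: numeral_2_eq_2)
  next
    case (Suc m)
    then show ?case using mult_polys_step[of "Suc m"] by fastforce
  qed
  then show "m \<ge> 1 \<Longrightarrow> \<exists>a b. mult_polys m a b" by (cases m) auto
qed

lemma carrier_affine:
  assumes "P \<in> carrier EG" obtains "P = \<one>\<^bsub>EG\<^esub>" | u v where "P = Affine u v" "on_curve E (Affine u v)"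
  using assms by (cases P) (auto simp: EG_simps)

lemma inv_EG: "P \<in> carrier EG \<Longrightarrow> inv\<^bsub>EG\<^esub> P = neg P"
proof -
  interpret EG: comm_group EG by (rule comm_group_EG)
  assume P: "P \<in> carrier EG"
  show ?thesis using EG.inv_equality[of "neg P" P] P point_add_commute[of "neg P" P] by (simp add: EG_simps)
qed

lemma same_x_cases:
  assumes "on_curve E (Affine u v)" "on_curve E (Affine u v')" shows "v' = v \<or> v' = - v"
proof -
  have "v'^2 = v^2" using assms by simp
  then show ?thesis by (simp add: power2_eq_iff)
qed

text \<open>Away from critical values \<open>a - c b\<close> has \<open>m^2\<close> distinct roots,
  and over each root exactly one of the two opposite points is mapped to \<open>(c, d)\<close>
  rather than to \<open>(c, - d)\<close>, because \<open>d \<noteq> 0\<close>.\<close>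

lemma generic_fibre:
  assumes m: "m \<ge> 1"
  obtains C where "finite C"
    "\<And>c d. on_curve E (Affine c d) \<Longrightarrow> c \<notin> C \<Longrightarrow> card {P\<in>carrier EG. P \<up> m = Affine c d} = m^2"
proof -
  interpret EG: comm_group EG by (rule comm_group_EG)
  obtain a b where ab: "mult_polys m a b" using mult_polys_exist[OF m] by blast
  have deg: "degree a = m^2" "degree b < m^2" "b \<noteq> 0"
    and ncr: "\<And>z. \<not> (poly a z = 0 \<and> poly b z = 0)"
    using ab by (auto simp: mult_polys_def)
  obtain F where F: "finite F" "\<And>u v. on_curve E (Affine u v) \<Longrightarrow> u \<notin> F \<Longrightarrow> poly b u \<noteq> 0 \<and>
        (\<exists>w. Affine u v \<up> m = Affine (poly a u / poly b u) w)"
    using ab unfolding mult_polys_def by blast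
  obtain r s where rs: "r * a + s * b = 1" using bezout_of_no_common_root[OF ac ncr] by blast
  \<comment> \<open>Numerator of the derivative of \<open>a / b\<close>; its roots are the critical
    points. If it were 0, coprimality would make \<open>b\<close> divide its own derivative.\<close>
  define W where "W = pderiv a * b - a * pderiv b"
  have W0: "W \<noteq> 0"
  proof
    assume "W = 0"
    then have w: "pderiv a * b = a * pderiv b" by (simp add: W_def)
    have "pderiv b = b * (r * pderiv a + s * pderiv b)" using w rs by Groebner_Basis.algebra
    then have "pderiv b = 0" by (metis dvd_triv_left not_dvd_pderiv pderiv_eq_0_iff)
    then have "pderiv a = 0" using w deg by simp
    then have "degree a = 0" by (simp add: pderiv_eq_0_iff)
    then show False using deg m by simp
  qed
  define PF where "PF = {Affine u v | u v. on_curve E (Affine u v) \<and> u \<in> F}"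
  have PF: "finite PF" unfolding PF_def by (rule finite_points_over) (rule F)
  define xs where "xs = (\<lambda>P :: 'a point. case P of Infinity \<Rightarrow> 0 | Affine u v \<Rightarrow> u)"
  \<comment> \<open>Excluded values: the x-coordinates of points of order 2, the critical values,
    and the images of the exceptional points, once by the group law and once by the formula
    \<open>a / b\<close>.\<close>
  define C where "C = {z. poly f_poly z = 0} \<union> (\<lambda>z. poly a z / poly b z) ` {z. poly W z = 0}
     \<union> (\<lambda>P. xs (P \<up> m)) ` PF \<union> (\<lambda>z. poly a z / poly b z) ` F"
  have C: "finite C" using PF poly_roots_finite[OF W0] F(1) poly_roots_finite[of f_poly] by (simp add: C_def f_poly_def)
  have "card {P\<in>carrier EG. P \<up> m = Affine c d} = m^2" if Q: "on_curve E (Affine c d)" "c \<notin> C" for c d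
  proof -
    define q where "q = a - smult c b"
    have "degree (smult c b) < degree a" using degree_smult_le[of c b] deg by linarith
    then have dq: "degree q = m^2" unfolding q_def using deg degree_diff_eq_left by metis
    then have q0: "q \<noteq> 0" using m by auto
    have nd: "\<not> (poly q z = 0 \<and> poly (pderiv q) z = 0)" for z
    proof
      assume z: "poly q z = 0 \<and> poly (pderiv q) z = 0"
      then have z1: "poly a z = c * poly b z" by (simp add: q_def)
      have z2: "poly (pderiv a) z = c * poly (pderiv b) z" using z by (simp add: q_def pderiv_diff pderiv_smult)
      have "poly W z = 0" unfolding W_def by (simp add: z1 z2)
      moreover have "c = poly a z / poly b z" using z1 ncr[of z] by auto
      ultimately show False using Q(2) by (auto simp: C_def)
    qed
    have card_roots: "card {z. poly q z = 0} = m^2" using card_roots_no_double_root[OF ac q0 nd] dq by simp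
    have d0: "d \<noteq> 0"
    proof
      assume "d = 0"
      then have "poly f_poly c = 0" using Q(1) by (simp add: f_poly_def algebra_simps power3_eq_cube)
      then show False using Q(2) by (simp add: C_def)
    qed
    let ?Fib = "{P\<in>carrier EG. P \<up> m = Affine c d}"
    have fib: "\<exists>z v. P = Affine z v \<and> on_curve E (Affine z v) \<and> z \<notin> F \<and> poly q z = 0" if P: "P \<in> ?Fib" for P
    proof -
      from P have "P \<in> carrier EG" by simp
      then show ?thesis
      proof (cases rule: carrier_affine)
        case 1
        then show ?thesis using P by (simp add: one_EG EG.nat_pow_one[unfolded one_EG])
      next
        case (2 z v)
        have "z \<notin> F"
        proof
          assume "z \<in> F"
          then have "P \<in> PF" using 2 unfolding PF_def by blast
          then have "xs (P \<up> m) \<in> C" by (auto simp: C_def)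
          moreover have "xs (P \<up> m) = c" using P by (simp add: xs_def)
          ultimately show False using Q(2) by simp
        qed
        moreover then have "c = poly a z / poly b z" "poly b z \<noteq> 0" using F(2)[OF 2(2)] 2 P by auto
        ultimately show ?thesis using 2 by (auto simp: q_def)
      qed
    qed
    have "bij_betw xs ?Fib {z. poly q z = 0}"
      unfolding bij_betw_def
    proof
      show "inj_on xs ?Fib"
      proof
        fix P P' assume P: "P \<in> ?Fib" "P' \<in> ?Fib" "xs P = xs P'"
        obtain z v where z: "P = Affine z v" "on_curve E (Affine z v)" using fib[OF P(1)] by blast
        obtain z' v' where z': "P' = Affine z' v'" "on_curve E (Affine z' v')" using fib[OF P(2)] by blast
        have zz: "z' = z" using P(3) z z' by (simp add: xs_def)
        show "P = P'"
        proof (rule ccontr)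
          assume "P \<noteq> P'"
          then have "v' = - v" using same_x_cases[of z v v'] z z' zz by auto
          then have "P' = neg P" using z z' zz by simp
          then have "P' = inv\<^bsub>EG\<^esub> P" using P(1) inv_EG by simp
          then have "P' \<up> m = inv\<^bsub>EG\<^esub> (P \<up> m)" using P(1) EG.nat_pow_inv by simp
          then have "Affine c d = inv\<^bsub>EG\<^esub> Affine c d" using P by simp
          also have "\<dots> = Affine c (- d)" using Q(1) inv_EG[of "Affine c d"] by (simp add: carrier_EG)
          finally have "d = - d" by simp
          then show False using d0 by (simp add: eq_neg_iff_add_eq_0 mult_2[symmetric])
        qed
      qed
      show "xs ` ?Fib = {z. poly q z = 0}"
      proof (intro equalityI subsetI)
        fix z assume "z \<in> xs ` ?Fib"
        then show "z \<in> {z. poly q z = 0}" using fib by (fastforce simp: xs_def)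
      next
        fix z assume "z \<in> {z. poly q z = 0}"
        then have az: "poly a z = c * poly b z" by (simp add: q_def)
        then have cz: "c = poly a z / poly b z" using ncr[of z] by auto
        then have zF: "z \<notin> F" using Q(2) by (auto simp: C_def)
        obtain v where v: "on_curve E (Affine z v)" using point_over by blast
        then obtain w where w: "Affine z v \<up> m = Affine c w" using F(2)[OF v zF] cz by auto
        have P: "Affine z v \<in> carrier EG" "neg (Affine z v) \<in> carrier EG" using v by (simp_all add: carrier_EG)
        have "on_curve E (Affine c w)" using EG.nat_pow_closed[OF P(1), of m] w by (simp add: carrier_EG)
        then consider "w = d" | "w = - d" using same_x_cases[OF Q(1)] by blast
        then show "z \<in> xs ` ?Fib"
        proof cases
          case 1
          then show ?thesis using w P(1) by (intro image_eqI[of _ _ "Affine z v"]) (auto simp: xs_def)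
        next
          case 2
          have "neg (Affine z v) \<up> m = neg (Affine c w)"
            using EG.nat_pow_inv[OF P(1), of m] inv_EG[OF P(1)] inv_EG[OF EG.nat_pow_closed[OF P(1), of m]] w by simp
          then show ?thesis using 2 P(2) by (intro image_eqI[of _ _ "neg (Affine z v)"]) (auto simp: xs_def)
        qed
      qed
    qed
    from bij_betw_same_card[OF this] show ?thesis using card_roots by simp
  qed
  with C that show thesis by blast
qed

text \<open>Fibres of a homomorphism are cosets of its kernel, so one generic fibre counts the
  torsion.\<close>

theorem card_torsion:
  assumes "m \<ge> 1"
  shows "card {P\<in>carrier EG. P \<up> m = \<one>\<^bsub>EG\<^esub>} = m^2"
proof -
  interpret EG: comm_group EG by (rule comm_group_EG)
  obtain C where C: "finite C"
    "\<And>c d. on_curve E (Affine c d) \<Longrightarrow> c \<notin> C \<Longrightarrow> card {P\<in>carrier EG. P \<up> m = Affine c d} = m^2"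
    using generic_fibre[OF assms] by blast
  obtain c where c: "c \<notin> C" using C(1) infinite_field by (metis UNIV_I ex_new_if_finite)
  obtain d where d: "on_curve E (Affine c d)" using point_over by blast
  let ?Fib = "{P\<in>carrier EG. P \<up> m = Affine c d}"
  let ?T = "{P\<in>carrier EG. P \<up> m = \<one>\<^bsub>EG\<^esub>}"
  have f: "card ?Fib = m^2" using C(2) c d by blast
  then have "?Fib \<noteq> {}" using assms by (metis card.empty not_one_le_zero power2_eq_square mult_is_0)
  then obtain P0 where P0: "P0 \<in> carrier EG" "P0 \<up> m = Affine c d" by blast
  have "bij_betw (\<lambda>P. P \<otimes>\<^bsub>EG\<^esub> P0) ?T ?Fib"
    unfolding bij_betw_def
  proof
    show "inj_on (\<lambda>P. P \<otimes>\<^bsub>EG\<^esub> P0) ?T" using P0 by (auto intro!: inj_onI)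
    show "(\<lambda>P. P \<otimes>\<^bsub>EG\<^esub> P0) ` ?T = ?Fib"
    proof (intro equalityI subsetI)
      fix P assume "P \<in> (\<lambda>P. P \<otimes>\<^bsub>EG\<^esub> P0) ` ?T"
      then obtain S where "S \<in> ?T" "P = S \<otimes>\<^bsub>EG\<^esub> P0" by blast
      then show "P \<in> ?Fib" using P0 EG.nat_pow_distrib[of S P0 m] EG.nat_pow_closed[of P0 m] by auto
    next
      fix P assume P: "P \<in> ?Fib"
      define S where "S = P \<otimes>\<^bsub>EG\<^esub> inv\<^bsub>EG\<^esub> P0"
      have "S \<in> ?T" using P P0 EG.nat_pow_distrib[of P "inv\<^bsub>EG\<^esub> P0" m] EG.nat_pow_inv[of P0 m] EG.nat_pow_closed[of P0 m]
        by (auto simp: S_def)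
      moreover have "P = S \<otimes>\<^bsub>EG\<^esub> P0" using P P0 by (simp add: S_def EG.m_assoc)
      ultimately show "P \<in> (\<lambda>P. P \<otimes>\<^bsub>EG\<^esub> P0) ` ?T" by blast
    qed
  qed
  from bij_betw_same_card[OF this] show ?thesis using f by simp
qed

lemma infinite_points: "infinite {P. on_curve E P}"
proof
  assume "finite {P. on_curve E P}"
  then have "finite ((\<lambda>P. case P of Infinity \<Rightarrow> 0 | Affine u v \<Rightarrow> u) ` {P. on_curve E P})" by blast
  moreover have "u \<in> (\<lambda>P. case P of Infinity \<Rightarrow> 0 | Affine u v \<Rightarrow> u) ` {P. on_curve E P}" for u
  proof -
    obtain v where "on_curve E (Affine u v)" using point_over by blast
    then show ?thesis by (intro image_eqI[of _ _ "Affine u v"]) auto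
  qed
  ultimately show False using infinite_field by (metis finite_subset subsetI)
qed

text \<open>All but finitely many points are in the image by \<open>generic_fibre\<close>, and in an
  infinite group \<open>Q\<close> is a sum of two of them.\<close>

theorem multiplication_surj:
  fixes m :: nat
  assumes "m \<ge> 1" "Q \<in> carrier EG"
  shows "\<exists>P\<in>carrier EG. P \<up> m = Q"
proof -
  interpret EG: comm_group EG by (rule comm_group_EG)
  obtain C where C: "finite C"
    "\<And>c d. on_curve E (Affine c d) \<Longrightarrow> c \<notin> C \<Longrightarrow> card {P\<in>carrier EG. P \<up> m = Affine c d} = m^2"
    using generic_fibre[OF assms(1)] by blast
  define Bad where "Bad = insert Infinity {Affine u v | u v. on_curve E (Affine u v) \<and> u \<in> C}"
  have Bad: "finite Bad" using finite_points_over[OF C(1)] by (simp add: Bad_def)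
  have good: "\<exists>P\<in>carrier EG. P \<up> m = S" if S: "S \<in> carrier EG" "S \<notin> Bad" for S
  proof -
    obtain c d where cd: "S = Affine c d" "on_curve E (Affine c d)" "c \<notin> C"
      using S by (cases S) (auto simp: Bad_def carrier_EG)
    then have "{P\<in>carrier EG. P \<up> m = S} \<noteq> {}" using C(2)[of c d] assms(1)
      by (metis card.empty not_one_le_zero power2_eq_square mult_is_0)
    then show ?thesis by blast
  qed
  have "finite (Bad \<union> (\<lambda>S. Q \<otimes>\<^bsub>EG\<^esub> inv\<^bsub>EG\<^esub> S) ` (Bad \<inter> carrier EG))" using Bad by simp
  moreover have "infinite (carrier EG)" using infinite_points by (simp add: carrier_EG)
  ultimately obtain S where S: "S \<in> carrier EG" "S \<notin> Bad" "S \<notin> (\<lambda>S. Q \<otimes>\<^bsub>EG\<^esub> inv\<^bsub>EG\<^esub> S) ` (Bad \<inter> carrier EG)"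
    by (metis (no_types, lifting) UnCI finite_subset subsetI)
  define S' where "S' = Q \<otimes>\<^bsub>EG\<^esub> inv\<^bsub>EG\<^esub> S"
  have S': "S' \<in> carrier EG" using S assms by (simp add: S'_def)
  have "Q \<otimes>\<^bsub>EG\<^esub> inv\<^bsub>EG\<^esub> S' = S"
    using S(1) assms(2) by (simp add: S'_def EG.inv_mult_group EG.m_comm[of S] flip: EG.m_assoc)
  then have "S' \<notin> Bad" using S(3) S' by (metis IntI image_eqI)
  then obtain P P' where P: "P \<in> carrier EG" "P \<up> m = S" "P' \<in> carrier EG" "P' \<up> m = S'"
    using good S S' by metis
  have "S' \<otimes>\<^bsub>EG\<^esub> S = Q" using S assms by (simp add: S'_def EG.m_assoc)
  then have "(P' \<otimes>\<^bsub>EG\<^esub> P) \<up> m = Q" using P EG.nat_pow_distrib by simp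
  then show ?thesis using P by blast
qed

end

section \<open>The Weil pairing\<close>

locale weil_curve = ac_curve +
  fixes p :: nat
  assumes p: "Factorial_Ring.prime p" and p5: "p \<ge> 5"
begin

sublocale EG: comm_group EG by (rule comm_group_EG)

definition V :: "'a fls set" where "V = {h \<in> R. fls_subdegree h \<ge> - int p}"

lemma V_R: "h \<in> V \<Longrightarrow> h \<in> R" by (simp add: V_def)

lemma subdegree_add_ge: "fls_subdegree f \<ge> m \<Longrightarrow> fls_subdegree g \<ge> m \<Longrightarrow> m \<le> 0 \<Longrightarrow> fls_subdegree (f + g) \<ge> m"
  for f g :: "'a fls"
  using fls_plus_subdegree[of f g] by (cases "f + g = 0") auto

lemma subdegree_mult_ge: "fls_subdegree f \<ge> m \<Longrightarrow> fls_subdegree g \<ge> n \<Longrightarrow> m + n \<le> 0 \<Longrightarrow> fls_subdegree (f * g) \<ge> m + n"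
  for f g :: "'a fls"
  by (cases "f = 0 \<or> g = 0") auto

lemma V_add: "f \<in> V \<Longrightarrow> g \<in> V \<Longrightarrow> f + g \<in> V"
  unfolding V_def using subdegree_add_ge by auto

lemma V_cst_mult: "f \<in> V \<Longrightarrow> cst c * f \<in> V"
  unfolding V_def using subdegree_mult_ge[of 0 "cst c" "- int p" f] by (auto simp: mult.commute)

lemma V_0: "0 \<in> V" and V_1: "1 \<in> V" by (auto simp: V_def)

lemma V_degrees:
  assumes "el a b \<in> V" shows "a \<noteq> 0 \<Longrightarrow> 2 * degree a \<le> p" "b \<noteq> 0 \<Longrightarrow> 2 * degree b + 3 \<le> p"
  using subdegree_el(2,3)[of a b] assms by (auto simp: V_def)

lemma V_el:
  assumes "a \<noteq> 0 \<Longrightarrow> 2 * degree a \<le> p" "b \<noteq> 0 \<Longrightarrow> 2 * degree b + 3 \<le> p"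
  shows "el a b \<in> V"
proof -
  have "fls_subdegree (emb a) \<ge> - int p" using emb_subdegree[of a] assms(1) by (cases "a = 0") auto
  moreover have "fls_subdegree (emb b * gy) \<ge> - int p" using subdegree_emb_gy[of b] assms(2) by (cases "b = 0") auto
  ultimately have "fls_subdegree (emb a + emb b * gy) \<ge> - int p" using subdegree_add_ge by auto
  then show ?thesis unfolding V_def by (auto simp flip: el_def)
qed

text \<open>For all but finitely many points of the curve. Rational functions are handled through
  their values, so equality in the function field becomes equality almost everywhere; on
  \<open>R\<close> this amounts to equality by \<open>ev_ae_unique\<close>.\<close>

definition ae :: "('a point \<Rightarrow> bool) \<Rightarrow> bool" where
  "ae Q = eventually Q (inf cofinite (principal {P. on_curve E P}))"

lemma ae_iff: "ae Q \<longleftrightarrow> finite {P. on_curve E P \<and> \<not> Q P}"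
  unfolding ae_def eventually_inf_principal eventually_cofinite by (simp add: not_le)

lemma ae_conj: "ae P \<Longrightarrow> ae Q \<Longrightarrow> ae (\<lambda>Y. P Y \<and> Q Y)"
  unfolding ae_def by (rule eventually_conj)

lemma ae_mono: "ae P \<Longrightarrow> (\<And>Y. on_curve E Y \<Longrightarrow> P Y \<Longrightarrow> Q Y) \<Longrightarrow> ae Q"
  unfolding ae_iff by (erule finite_subset[rotated]) auto

lemma ae_mono2: "ae P \<Longrightarrow> ae P' \<Longrightarrow> (\<And>Y. on_curve E Y \<Longrightarrow> P Y \<Longrightarrow> P' Y \<Longrightarrow> Q Y) \<Longrightarrow> ae Q"
  using ae_mono[OF ae_conj[of P P'], of Q] by blast

lemma ae_exists: "ae P \<Longrightarrow> \<exists>Y. on_curve E Y \<and> P Y"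
  using infinite_points unfolding ae_iff by (metis (mono_tags, lifting) finite_subset mem_Collect_eq subsetI)

lemma ae_const: "ae (\<lambda>Y. c) \<longleftrightarrow> c"
  using ae_exists[of "\<lambda>Y. c"] by (auto simp: ae_iff)

abbreviation padd (infixl "\<boxplus>" 65) where "padd \<equiv> point_add E"

lemma ae_translate:
  assumes "ae Q" "on_curve E T" shows "ae (\<lambda>Y. Q (Y \<boxplus> T))"
proof -
  have "{Y. on_curve E Y \<and> \<not> Q (Y \<boxplus> T)} \<subseteq> (\<lambda>W. W \<boxplus> neg T) ` {P. on_curve E P \<and> \<not> Q P}"
  proof
    fix Y assume Y: "Y \<in> {Y. on_curve E Y \<and> \<not> Q (Y \<boxplus> T)}"
    then have "(Y \<boxplus> T) \<boxplus> neg T = Y" using point_add_assoc[of Y T "neg T"] assms(2) by simp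
    then show "Y \<in> (\<lambda>W. W \<boxplus> neg T) ` {P. on_curve E P \<and> \<not> Q P}"
      using Y assms(2) point_add_closed by (metis (mono_tags, lifting) image_eqI mem_Collect_eq)
  qed
  then show ?thesis using assms(1) unfolding ae_iff using finite_subset by blast
qed

text \<open>The norm of \<open>el a b\<close> to the polynomials in \<open>x\<close>, its product
  with the conjugate under \<open>y \<mapsto> - y\<close>. The degree is the pole order of
  \<open>el a b\<close>, and x-coordinates of zeros are roots.\<close>

definition norm_poly :: "'a poly \<Rightarrow> 'a poly \<Rightarrow> 'a poly" where "norm_poly a b = a^2 - b^2 * f_poly"

lemma degree_norm_poly:
  assumes "a \<noteq> 0 \<or> b \<noteq> 0"
  shows "norm_poly a b \<noteq> 0 \<and> degree (norm_poly a b) = (if b = 0 then 2 * degree a else if a = 0 then 2 * degree b + 3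
     else max (2 * degree a) (2 * degree b + 3))"
proof -
  have f: "degree f_poly = 3" "f_poly \<noteq> 0" by (simp_all add: f_poly_def)
  have da: "degree (a^2) = 2 * degree a" if "a \<noteq> 0" for a :: "'a poly" using that by (simp add: degree_power_eq)
  have db: "degree (b^2 * f_poly) = 2 * degree b + 3" if "b \<noteq> 0" using that f by (simp add: degree_mult_eq da)
  consider "a = 0" "b \<noteq> 0" | "b = 0" "a \<noteq> 0" | "a \<noteq> 0" "b \<noteq> 0" using assms by blast
  then show ?thesis
  proof cases
    case 3
    have "even (2 * degree a)" "odd (2 * degree b + 3)" by simp_all
    then have "2 * degree a \<noteq> 2 * degree b + 3" by metis
    then consider "2 * degree a < 2 * degree b + 3" | "2 * degree b + 3 < 2 * degree a" by linarith
    then show ?thesis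
    proof cases
      case 1
      then have "degree (b^2 * f_poly - a^2) = 2 * degree b + 3"
        using degree_diff_eq_left[of "a^2" "b^2 * f_poly"] 3 da db by simp
      then have "degree (norm_poly a b) = 2 * degree b + 3"
        by (metis degree_minus minus_diff_eq norm_poly_def)
      then show ?thesis using 1 3 by auto
    next
      case 2
      then have "degree (norm_poly a b) = 2 * degree a"
        using degree_diff_eq_left[of "b^2 * f_poly" "a^2"] 3 da db by (simp add: norm_poly_def)
      then show ?thesis using 2 3 by auto
    qed
  qed (use da db f in \<open>auto simp: norm_poly_def\<close>)
qed

lemma ev_zero_norm:
  assumes "on_curve E (Affine u v)" "ev (Affine u v) (el a b) = 0" shows "poly (norm_poly a b) u = 0"
proof -
  have v2: "v^2 = poly f_poly u" using assms(1) by (simp add: f_poly_def power2_eq_square power3_eq_cube algebra_simps)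
  have "poly a u = - poly b u * v" using assms(2) by (simp add: ev_el add_eq_0_iff2)
  then show ?thesis by (simp add: norm_poly_def v2[symmetric] power_mult_distrib)
qed

text \<open>Both points over each root of the norm are counted; the resulting \<open>2 * p\<close>
  is still far below the number \<open>p^2\<close> of torsion points.\<close>

lemma zeros_bound:
  assumes "h \<in> V" "h \<noteq> 0"
  shows "finite {P. on_curve E P \<and> P \<noteq> Infinity \<and> ev P h = 0}"
    and "card {P. on_curve E P \<and> P \<noteq> Infinity \<and> ev P h = 0} \<le> 2 * p"
proof -
  obtain a b where h: "h = el a b" using assms(1) by (auto simp: V_def coord_ring_def)
  have ab: "a \<noteq> 0 \<or> b \<noteq> 0" using assms(2) h by (auto simp: el_def)
  define N where "N = norm_poly a b"
  have N: "N \<noteq> 0" "degree N \<le> p" using degree_norm_poly[OF ab] V_degrees[of a b] assms(1) h by (auto simp: N_def split: if_splits)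
  define Z where "Z = {u. poly N u = 0}"
  have Z: "finite Z" "card Z \<le> p" using poly_roots_finite[OF N(1)] card_poly_roots_bound[OF N(1)] N(2) by (auto simp: Z_def)
  define g where "g = (\<lambda>u. SOME v. on_curve E (Affine u v))"
  have g: "on_curve E (Affine u (g u))" for u unfolding g_def using someI_ex[OF point_over] .
  have sub: "{P. on_curve E P \<and> P \<noteq> Infinity \<and> ev P h = 0} \<subseteq> (\<lambda>u. Affine u (g u)) ` Z \<union> (\<lambda>u. Affine u (- g u)) ` Z"
  proof
    fix P assume P: "P \<in> {P. on_curve E P \<and> P \<noteq> Infinity \<and> ev P h = 0}"
    then obtain u v where uv: "P = Affine u v" by (cases P) auto
    then have "u \<in> Z" using P ev_zero_norm[of u v a b] h by (auto simp: Z_def N_def)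
    moreover have "v = g u \<or> v = - g u" using same_x_cases[OF g] P uv by blast
    ultimately show "P \<in> (\<lambda>u. Affine u (g u)) ` Z \<union> (\<lambda>u. Affine u (- g u)) ` Z" using uv by auto
  qed
  then show "finite {P. on_curve E P \<and> P \<noteq> Infinity \<and> ev P h = 0}" using Z finite_subset by blast
  have "card {P. on_curve E P \<and> P \<noteq> Infinity \<and> ev P h = 0} \<le> card ((\<lambda>u. Affine u (g u)) ` Z \<union> (\<lambda>u. Affine u (- g u)) ` Z)"
    by (rule card_mono) (use sub Z in auto)
  also have "\<dots> \<le> card ((\<lambda>u. Affine u (g u)) ` Z) + card ((\<lambda>u. Affine u (- g u)) ` Z)" by (rule card_Un_le)
  also have "\<dots> \<le> card Z + card Z" by (intro add_mono card_image_le Z)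
  finally show "card {P. on_curve E P \<and> P \<noteq> Infinity \<and> ev P h = 0} \<le> 2 * p" using Z by simp
qed

lemma ae_affine: "ae (\<lambda>Y. Y \<noteq> Infinity)"
  unfolding ae_iff by (rule finite_subset[of _ "{Infinity}"]) auto

lemma ae_ev_nonzero:
  assumes "h \<in> R" "h \<noteq> 0" shows "ae (\<lambda>Y. ev Y h \<noteq> 0)"
proof -
  obtain a b where h: "h = el a b" using assms(1) by (auto simp: coord_ring_def)
  then have "a \<noteq> 0 \<or> b \<noteq> 0" using assms(2) by (auto simp: el_def)
  then have "norm_poly a b \<noteq> 0" using degree_norm_poly by blast
  then have fin: "finite {u. poly (norm_poly a b) u = 0}" by (rule poly_roots_finite)
  have "{P. on_curve E P \<and> \<not> ev P h \<noteq> 0} \<subseteq>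
    insert Infinity {Affine u v | u v. on_curve E (Affine u v) \<and> u \<in> {u. poly (norm_poly a b) u = 0}}"
  proof
    fix P assume "P \<in> {P. on_curve E P \<and> \<not> ev P h \<noteq> 0}"
    then show "P \<in> insert Infinity {Affine u v | u v. on_curve E (Affine u v) \<and> u \<in> {u. poly (norm_poly a b) u = 0}}"
      using ev_zero_norm[of _ _ a b] h by (cases P) auto
  qed
  then show ?thesis using finite_points_over[OF fin] unfolding ae_iff by (metis (no_types, lifting) finite_insert finite_subset)
qed

lemma ev_ae_unique:
  assumes "f \<in> R" "g \<in> R" "ae (\<lambda>Y. ev Y f = ev Y g)" shows "f = g"
proof (rule ccontr)
  assume "f \<noteq> g"
  then have "ae (\<lambda>Y. ev Y (f - g) \<noteq> 0)" using ae_ev_nonzero[of "f - g"] R_diff assms by auto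
  then have "ae (\<lambda>Y. False)" using assms(3) by (rule ae_mono2) (use assms ev_diff in auto)
  then show False by (simp add: ae_const)
qed

text \<open>The elements over \<open>T\<close> of the theta group of the divisor \<open>p [\<infinity>]\<close>, whose space of sections is \<open>V\<close>; the pairing
  is the commutator of this group.\<close>

definition multiplier :: "'a point \<Rightarrow> ('a point \<Rightarrow> 'a) \<Rightarrow> bool" where
  "multiplier T \<phi> \<longleftrightarrow> ae (\<lambda>Y. \<phi> Y \<noteq> 0) \<and>
     (\<forall>h\<in>V. \<exists>h'\<in>V. ae (\<lambda>Y. ev Y h' = \<phi> Y * ev (Y \<boxplus> T) h))"

lemma ev_1: "ev (Affine u v) 1 = 1" using ev_cst[of u v 1] by simp

lemma ev_power: "f \<in> R \<Longrightarrow> on_curve E (Affine u v) \<Longrightarrow> ev (Affine u v) (f ^ n) = ev (Affine u v) f ^ n"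
  by (induction n) (simp_all add: ev_1 ev_mult R_power)

lemma subdegree_nonneg_const:
  assumes "h \<in> R" "fls_subdegree h \<ge> 0" shows "\<exists>c. h = cst c"
proof (cases "h = 0")
  case False
  obtain s t where h: "h = el [:s, t:] 0" using low_degree_el[OF assms(1) False] assms(2) by auto
  have "t = 0"
  proof (rule ccontr)
    assume "t \<noteq> 0"
    then show False using subdegree_el(2)[of "[:s, t:]" 0] h assms(2) by auto
  qed
  then show ?thesis using h by (auto simp: el_cst)
qed auto

text \<open>Such a \<open>\<phi>\<close> agrees almost everywhere with a function \<open>g\<close>
  that maps \<open>V\<close> to itself by multiplication. All powers of \<open>g\<close> then lie in
  \<open>V\<close>, whose pole orders are bounded by \<open>p\<close>, so \<open>g\<close> has no
  pole and is constant.\<close>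

lemma multiplier_Infinity:
  assumes "multiplier Infinity \<phi>" obtains c where "c \<noteq> 0" "ae (\<lambda>Y. \<phi> Y = c)"
proof -
  have nz: "ae (\<lambda>Y. \<phi> Y \<noteq> 0)" and st: "\<And>h. h \<in> V \<Longrightarrow> \<exists>h'\<in>V. ae (\<lambda>Y. ev Y h' = \<phi> Y * ev Y h)"
    using assms by (auto simp: multiplier_def)
  obtain g where g: "g \<in> V" "ae (\<lambda>Y. ev Y g = \<phi> Y * ev Y 1)" using st[OF V_1] by blast
  have g1: "ae (\<lambda>Y. ev Y g = \<phi> Y)" using g(2) ae_affine
    by (rule ae_mono2) (metis ev_1 mult.right_neutral point.exhaust)
  have pow: "g ^ n \<in> V" for n
  proof (induction n)
    case (Suc n)
    obtain h' where h': "h' \<in> V" "ae (\<lambda>Y. ev Y h' = \<phi> Y * ev Y (g ^ n))" using st[OF Suc] by blast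
    have subdeg: "g ^ Suc n \<in> R" using V_R[OF g(1)] R_power by blast
    have a: "ae (\<lambda>Y. ev Y h' = ev Y (g ^ Suc n))"
      using h'(2) g1 by (rule ae_mono2) (use V_R[OF g(1)] V_R[OF Suc] in \<open>auto simp: ev_mult\<close>)
    have "h' = g ^ Suc n" using ev_ae_unique[OF V_R[OF h'(1)] subdeg a] .
    then show ?case using h' by simp
  qed (simp add: V_1)
  have "fls_subdegree g \<ge> 0"
  proof (rule ccontr)
    assume "\<not> fls_subdegree g \<ge> 0"
    then have "fls_subdegree (g ^ Suc p) \<le> - int (Suc p)"
      unfolding fls_subdegree_pow using mult_left_mono[of "fls_subdegree g" "-1" "int (Suc p)"] by simp
    then show False using pow[of "Suc p"] by (simp add: V_def)
  qed
  then obtain c where c: "g = cst c" using subdegree_nonneg_const V_R[OF g(1)] by blast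
  have "ae (\<lambda>Y. \<phi> Y = c)" using g1 ae_affine by (rule ae_mono2) (use c in \<open>metis ev_cst point.exhaust\<close>)
  moreover have "c \<noteq> 0" using ae_exists[OF ae_conj[OF nz \<open>ae (\<lambda>Y. \<phi> Y = c)\<close>]] by auto
  ultimately show thesis using that by blast
qed

lemma multiplier_nonzero: "multiplier T \<phi> \<Longrightarrow> ae (\<lambda>Y. \<phi> Y \<noteq> 0)"
  by (simp add: multiplier_def)

lemma multiplier_comp:
  assumes "multiplier S \<phi>" "multiplier T \<psi>" "on_curve E S" "on_curve E T"
  shows "multiplier (S \<boxplus> T) (\<lambda>Y. \<phi> Y * \<psi> (Y \<boxplus> S))"
  unfolding multiplier_def
proof (intro conjI ballI)
  have "ae (\<lambda>Y. \<psi> (Y \<boxplus> S) \<noteq> 0)" using ae_translate[OF multiplier_nonzero[OF assms(2)] assms(3)] .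
  then show "ae (\<lambda>Y. \<phi> Y * \<psi> (Y \<boxplus> S) \<noteq> 0)"
    using multiplier_nonzero[OF assms(1)] by (rule ae_mono2) auto
next
  fix h assume "h \<in> V"
  then obtain h1 where h1: "h1 \<in> V" "ae (\<lambda>Y. ev Y h1 = \<psi> Y * ev (Y \<boxplus> T) h)" using assms(2) by (auto simp: multiplier_def)
  then obtain h2 where h2: "h2 \<in> V" "ae (\<lambda>Y. ev Y h2 = \<phi> Y * ev (Y \<boxplus> S) h1)" using assms(1) by (auto simp: multiplier_def)
  have "ae (\<lambda>Y. ev Y h2 = \<phi> Y * \<psi> (Y \<boxplus> S) * ev (Y \<boxplus> (S \<boxplus> T)) h)"
    using h2(2) ae_translate[OF h1(2) assms(3)]
    by (rule ae_mono2) (use assms(3,4) point_add_assoc in auto)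
  then show "\<exists>h'\<in>V. ae (\<lambda>Y. ev Y h' = \<phi> Y * \<psi> (Y \<boxplus> S) * ev (Y \<boxplus> (S \<boxplus> T)) h)" using h2 by blast
qed

definition tors :: "'a point set" where "tors = {P\<in>carrier EG. P \<up> p = \<one>\<^bsub>EG\<^esub>}"

lemma tors_on_curve: "P \<in> tors \<Longrightarrow> on_curve E P" by (simp add: tors_def carrier_EG)

lemma tors_add: "P \<in> tors \<Longrightarrow> Q \<in> tors \<Longrightarrow> P \<boxplus> Q \<in> tors"
  using EG.nat_pow_distrib[of P Q p] EG.m_closed[of P Q] EG.l_one[OF EG.one_closed]
  by (simp add: tors_def mult_EG[symmetric])

lemma tors_neg: "P \<in> tors \<Longrightarrow> neg P \<in> tors"
  using EG.nat_pow_inv[of P p] by (simp add: tors_def inv_EG[symmetric])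

lemma tors_Infinity: "Infinity \<in> tors"
  using EG.one_closed EG.nat_pow_one[of p] by (simp add: tors_def one_EG)

lemma subdegree_diff_ge: "fls_subdegree f \<ge> m \<Longrightarrow> fls_subdegree g \<ge> m \<Longrightarrow> m \<le> 0 \<Longrightarrow> fls_subdegree (f - g) \<ge> m"
  for f g :: "'a fls"
  using subdegree_add_ge[of m f "- g"] by simp

text \<open>\<open>e\<close> is the value at \<open>(u, v)\<close> of a function that lies in
  \<open>R\<close> after multiplication by a power of \<open>gx - cst u0\<close>. The power stays on
  both sides, so the relation is compatible with sums and products, and \<open>ev_frac_eq\<close>
  reads off the value when \<open>u \<noteq> u0\<close>.\<close>

definition ev_frac :: "'a \<Rightarrow> 'a \<Rightarrow> 'a \<Rightarrow> 'a fls \<Rightarrow> 'a \<Rightarrow> bool" where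
  "ev_frac u0 u v g e \<longleftrightarrow> (\<exists>k. (gx - cst u0)^k * g \<in> R \<and> ev (Affine u v) ((gx - cst u0)^k * g) = (u - u0)^k * e)"

lemma ev_w: "on_curve E (Affine u v) \<Longrightarrow> ev (Affine u v) ((gx - cst u0)^k) = (u - u0)^k"
  by (simp add: ev_power R_diff ev_diff del: on_curve_short)

lemma ev_frac_R: "r \<in> R \<Longrightarrow> ev_frac u0 u v r (ev (Affine u v) r)"
  unfolding ev_frac_def by (intro exI[of _ 0]) simp

lemma ev_frac_mult:
  assumes "on_curve E (Affine u v)" "ev_frac u0 u v g e" "ev_frac u0 u v g' e'"
  shows "ev_frac u0 u v (g * g') (e * e')"
proof -
  let ?w = "gx - cst u0"
  obtain k l where k: "?w^k * g \<in> R" "ev (Affine u v) (?w^k * g) = (u - u0)^k * e"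
    and l: "?w^l * g' \<in> R" "ev (Affine u v) (?w^l * g') = (u - u0)^l * e'"
    using assms(2,3) by (auto simp: ev_frac_def)
  have eq: "?w^(k+l) * (g * g') = (?w^k * g) * (?w^l * g')" by (simp add: power_add algebra_simps)
  show ?thesis unfolding ev_frac_def
  proof (intro exI[of _ "k + l"] conjI)
    show "?w^(k+l) * (g * g') \<in> R" unfolding eq using k l by blast
    show "ev (Affine u v) (?w^(k+l) * (g * g')) = (u - u0)^(k+l) * (e * e')"
      unfolding eq ev_mult[OF k(1) l(1) assms(1)] k(2) l(2) by (simp add: power_add algebra_simps)
  qed
qed

lemma ev_frac_mono:
  assumes "on_curve E (Affine u v)" "(gx - cst u0)^k * g \<in> R" "ev (Affine u v) ((gx - cst u0)^k * g) = (u - u0)^k * e"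
  shows "(gx - cst u0)^(l + k) * g \<in> R \<and> ev (Affine u v) ((gx - cst u0)^(l + k) * g) = (u - u0)^(l + k) * e"
proof -
  have wR: "(gx - cst u0)^l \<in> R" by (intro R_power R_diff) auto
  have eq: "(gx - cst u0)^(l + k) * g = (gx - cst u0)^l * ((gx - cst u0)^k * g)" by (simp add: power_add mult.assoc)
  show ?thesis unfolding eq ev_mult[OF wR assms(2,1)] assms(3) ev_w[OF assms(1)]
    using wR assms(2) by (auto simp: power_add mult.assoc)
qed

lemma ev_frac_add:
  assumes "on_curve E (Affine u v)" "ev_frac u0 u v g e" "ev_frac u0 u v g' e'"
  shows "ev_frac u0 u v (g + g') (e + e')"
proof -
  let ?w = "gx - cst u0"
  obtain k l where k: "?w^k * g \<in> R" "ev (Affine u v) (?w^k * g) = (u - u0)^k * e"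
    and l: "?w^l * g' \<in> R" "ev (Affine u v) (?w^l * g') = (u - u0)^l * e'"
    using assms(2,3) by (auto simp: ev_frac_def)
  note k' = ev_frac_mono[OF assms(1) k, of l]
  have l': "?w^(l + k) * g' \<in> R \<and> ev (Affine u v) (?w^(l + k) * g') = (u - u0)^(l + k) * e'"
    using ev_frac_mono[OF assms(1) l, of k] by (simp add: add.commute)
  show ?thesis unfolding ev_frac_def
  proof (intro exI[of _ "l + k"] conjI)
    show "?w^(l + k) * (g + g') \<in> R" unfolding distrib_left using k' l' by blast
    show "ev (Affine u v) (?w^(l + k) * (g + g')) = (u - u0)^(l + k) * (e + e')"
      unfolding distrib_left using k' l' ev_add by metis
  qed
qed

lemma ev_frac_eq:
  assumes "on_curve E (Affine u v)" "u \<noteq> u0" "ev_frac u0 u v g e" "g \<in> R" shows "ev (Affine u v) g = e"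
proof -
  obtain k where k: "ev (Affine u v) ((gx - cst u0)^k * g) = (u - u0)^k * e" using assms(3) by (auto simp: ev_frac_def)
  have wR: "(gx - cst u0)^k \<in> R" by (intro R_power R_diff) auto
  have "(u - u0)^k * ev (Affine u v) g = (u - u0)^k * e" using k unfolding ev_mult[OF wR assms(4,1)] ev_w[OF assms(1)] .
  then show ?thesis using assms(2) by simp
qed

lemma ideal_of_Cons_subset: "ideal_of (P # Ps) \<subseteq> ideal_of Ps"
proof (cases P)
  case (Affine u v)
  show ?thesis unfolding Affine
    by (auto intro!: ideal_of_add ideal_of_mult R_diff)
qed simp

end

context weil_curve
begin

text \<open>The slope \<open>l\<close> of the line through the generic point and \<open>T\<close> has a simple pole at \<open>- T\<close>, and the translate
  of a function in \<open>V\<close> is a polynomial of degree at most \<open>p\<close> in \<open>l\<close>; so a function vanishing \<open>p\<close> times at \<open>- T\<close>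
  clears its denominator.\<close>

lemma translation_in_V:
  assumes T: "Affine u0 v0 \<in> tors"
  obtains f where "f \<in> V" "f \<noteq> 0" "ev (Affine u0 (- v0)) f = 0"
    "\<And>h. h \<in> V \<Longrightarrow> \<exists>h'\<in>V. \<forall>u v. on_curve E (Affine u v) \<longrightarrow> u \<noteq> u0 \<longrightarrow>
       ev (Affine u v) h' = ev (Affine u v) f * ev (Affine u v \<boxplus> Affine u0 v0) h"
proof -
  \<comment> \<open>The point that translation by \<open>T\<close> sends to infinity, hence the only
    affine pole of translated functions.\<close>
  define N where "N = Affine u0 (- v0)"
  have "N \<in> tors" using tors_neg[OF T] by (simp add: N_def)
  then have N: "on_curve E N" "N \<up> p = Infinity" unfolding tors_def one_EG carrier_EG by blast+
  have N': "N \<noteq> Infinity" by (simp add: N_def)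
  have Tc: "v0^2 = u0^3 + A * u0 + B" using tors_on_curve[OF T] by simp
  obtain f where f: "f \<noteq> 0" "f \<in> ideal_of (replicate p N)" "fls_subdegree f = - int p"
    using function_of_torsion_point[OF N N'] by blast
  have fV: "f \<in> V" using f ideal_of_R by (auto simp: V_def)
  have "p = Suc (p - 1)" using p5 by simp
  then have "replicate p N = N # replicate (p - 1) N" by (metis replicate_Suc)
  then have fN: "ev N f = 0" using ev_ideal_of[of f u0 "- v0"] f(2) N(1) unfolding N_def by metis
  define w where "w = gx - cst u0"
  have w: "w \<noteq> 0" "fls_subdegree w = -2" "w \<in> R"
  proof -
    have we: "w = el [:-u0, 1:] 0" by (simp add: w_def el_gx el_cst el_diff)
    show "w \<in> R" unfolding we by simp
    show "w \<noteq> 0" "fls_subdegree w = -2" using emb_subdegree[of "[:-u0, 1:]"] we by (simp_all add: el_def)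
  qed
  define l where "l = (gy - cst v0) / w"
  have lw: "l * w = gy - cst v0" using w by (simp add: l_def)
  define x3 where "x3 = l^2 - gx - cst u0"
  define y3 where "y3 = - (l * (x3 - cst u0) + cst v0)"
  have c0: "cst v0^2 = cst u0^3 + cst A * cst u0 + cst B"
    using Tc by (metis fls_const_hom_add fls_const_hom_mult fls_const_power)
  \<comment> \<open>Functions with a pole of order at most \<open>m\<close> at \<open>N\<close> and
    no other affine pole, recognised by their action on ideals: multiplication by them uses up at
    most \<open>m\<close> factors of the maximal ideal of \<open>N\<close>.\<close>
  define \<Lambda> where "\<Lambda> m = {g. \<forall>k. \<forall>f\<in>ideal_of (replicate (m + k) N). g * f \<in> ideal_of (replicate k N)}" for m
  have L_mult: "g * h \<in> \<Lambda> (m + n)" if "g \<in> \<Lambda> m" "h \<in> \<Lambda> n" for g h m n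
    unfolding \<Lambda>_def
  proof (intro CollectI allI ballI)
    fix k f assume "f \<in> ideal_of (replicate (m + n + k) N)"
    then have "f \<in> ideal_of (replicate (n + (m + k)) N)" by (simp only: add_ac)
    then have "h * f \<in> ideal_of (replicate (m + k) N)" using that(2) unfolding \<Lambda>_def by blast
    then show "g * h * f \<in> ideal_of (replicate k N)" using that(1) unfolding \<Lambda>_def mult.assoc by blast
  qed
  have L_add: "g + h \<in> \<Lambda> m" if "g \<in> \<Lambda> m" "h \<in> \<Lambda> m" for g h m
    using that unfolding \<Lambda>_def by (auto simp: distrib_right intro!: ideal_of_add)
  have L_Suc: "g \<in> \<Lambda> (Suc m)" if "g \<in> \<Lambda> m" for g m
    using that ideal_of_Cons_subset[of N] unfolding \<Lambda>_def by (auto simp del: ideal_of.simps)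
  have L_mono: "g \<in> \<Lambda> n" if "g \<in> \<Lambda> m" "m \<le> n" for g m n
    using that(2,1) by (induction rule: dec_induct) (auto intro: L_Suc)
  have L_R: "r \<in> \<Lambda> m" if "r \<in> R" for r m
    by (rule L_mono[of _ 0]) (use that in \<open>auto simp: \<Lambda>_def intro: ideal_of_mult\<close>)
  have L_l: "l \<in> \<Lambda> 1"
    unfolding \<Lambda>_def
  proof (intro CollectI allI ballI)
    fix k f assume "f \<in> ideal_of (replicate (1 + k) N)"
    then have "f \<in> ideal_of (Affine u0 (- v0) # replicate k N)" by (simp add: N_def del: ideal_of.simps)
    then obtain g h where gh: "g \<in> ideal_of (replicate k N)" "h \<in> ideal_of (replicate k N)"
      "f = w * g + (gy - cst (- v0)) * h" unfolding in_ideal_of_Cons w_def by (elim bexE)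
    have "w * (l * f) = w * ((gy - cst v0) * g + (gx^2 + gx * cst u0 + cst u0^2 + cst A) * h)"
      using lw gy_eq c0 unfolding gh(3) w_def fls_const_uminus by Groebner_Basis.algebra
    then have "l * f = (gy - cst v0) * g + (gx^2 + gx * cst u0 + cst u0^2 + cst A) * h" using w by simp
    then show "l * f \<in> ideal_of (replicate k N)" using gh(1,2)
      by (auto intro!: ideal_of_add ideal_of_mult R_add R_mult R_diff R_power)
  qed
  have L_neg: "- g \<in> \<Lambda> m" if "g \<in> \<Lambda> m" for g m
    using L_mult[OF L_R[OF R_cst[of "-1"], of 0] that] by simp
  have L_diff: "g - h \<in> \<Lambda> m" if "g \<in> \<Lambda> m" "h \<in> \<Lambda> m" for g h m
    using L_add[OF that(1) L_neg[OF that(2)]] by simp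
  have "l^2 \<in> \<Lambda> 2" using L_mult[OF L_l L_l] by (simp add: power2_eq_square numeral_2_eq_2)
  then have L_x3: "x3 \<in> \<Lambda> 2" unfolding x3_def by (rule L_diff[OF L_diff[OF _ L_R[OF R_gx]] L_R[OF R_cst]])
  have L_y3: "y3 \<in> \<Lambda> 3"
  proof -
    have "l * (x3 - cst u0) \<in> \<Lambda> (1 + 2)" by (intro L_mult L_l L_diff L_x3 L_R) auto
    moreover have "cst v0 \<in> \<Lambda> (1 + 2)" by (intro L_R) auto
    ultimately show ?thesis unfolding y3_def using L_neg[OF L_add] by (simp add: numeral_3_eq_3)
  qed
  have w2: "fls_subdegree (w^2) = -4" using w by (simp add: fls_subdegree_pow)
  have gxs: "fls_subdegree gx \<ge> -2" and gys: "fls_subdegree gy \<ge> -3" using gx_subdegree gy_subdegree by auto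
  \<comment> \<open>Translation carries infinity to the affine point \<open>T\<close>, so
    \<open>x3\<close> and \<open>y3\<close> are regular at infinity. After multiplication by a power
    of \<open>w\<close> the leading terms have cancelled, and the orders can be read off.\<close>
  have O_x3: "fls_subdegree x3 \<ge> 0"
  proof (cases "x3 = 0")
    case False
    have e: "x3 * w^2 = (gx * cst u0 + cst A) * (gx + cst u0) + 2 * cst B - 2 * cst v0 * gy"
      using lw gy_eq c0 unfolding x3_def w_def by Groebner_Basis.algebra
    have "fls_subdegree ((gx * cst u0 + cst A) * (gx + cst u0)) \<ge> (-2) + (-2)"
      using gxs subdegree_mult_ge[of "-2" gx 0 "cst u0"] by (intro subdegree_mult_ge subdegree_add_ge) auto
    moreover have "fls_subdegree (2 * cst B) \<ge> -4" "fls_subdegree (2 * cst v0 * gy) \<ge> -4"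
      using gys subdegree_mult_ge[of 0 "cst (2 * B)" 0 1] subdegree_mult_ge[of 0 "cst (2 * v0)" "-3" gy] by (simp_all flip: fls_const_numeral)
    ultimately have "fls_subdegree (x3 * w^2) \<ge> -4" unfolding e by (intro subdegree_diff_ge subdegree_add_ge) auto
    then show ?thesis using False w w2 by simp
  qed simp
  have O_y3: "fls_subdegree y3 \<ge> 0"
  proof -
    have "fls_subdegree (l * (x3 - cst u0)) \<ge> 0"
    proof (cases "l * (x3 - cst u0) = 0")
      case False
      have e: "l * (x3 - cst u0) * w^3 = (gy - cst v0) * ((3 * cst u0^2 + cst A) * gx + (cst A * cst u0 + 2 * cst B - cst u0^3) - 2 * cst v0 * gy)"
        using lw gy_eq c0 unfolding x3_def w_def by Groebner_Basis.algebra
      have 1: "fls_subdegree (gy - cst v0) \<ge> -3" using gys by (intro subdegree_diff_ge) auto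
      have "fls_subdegree ((3 * cst u0^2 + cst A) * gx) \<ge> -3"
        using gxs subdegree_mult_ge[of 0 "cst (3 * u0^2 + A)" "-2" gx]
        by (simp flip: fls_const_numeral fls_const_power fls_const_hom_add fls_const_hom_mult)
      moreover have s1: "fls_subdegree (cst A * cst u0 + 2 * cst B - cst u0^3) \<ge> -3"
        by (simp add: fls_minus_const fls_plus_const flip: fls_const_numeral fls_const_power)
      moreover have "fls_subdegree (2 * cst v0 * gy) \<ge> -3"
        using gys subdegree_mult_ge[of 0 "cst (2 * v0)" "-3" gy] by (simp flip: fls_const_numeral)
      ultimately have 2: "fls_subdegree ((3 * cst u0^2 + cst A) * gx + (cst A * cst u0 + 2 * cst B - cst u0^3) - 2 * cst v0 * gy) \<ge> -3"
        by (intro subdegree_diff_ge[OF subdegree_add_ge[OF _ s1]]) auto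
      have "fls_subdegree (l * (x3 - cst u0) * w^3) \<ge> (-3) + (-3)" unfolding e using 1 2 by (intro subdegree_mult_ge) auto
      moreover have "fls_subdegree (w^3) = -6" using w by (simp add: fls_subdegree_pow)
      ultimately show ?thesis using False w by (simp del: mult_eq_0_iff)
    next
      case True
      then show ?thesis by (simp only: fls_zero_subdegree)
    qed
    then show ?thesis unfolding y3_def fls_uminus_subdegree by (intro subdegree_add_ge) auto
  qed
  define sub where "sub a = poly (map_poly cst a) x3" for a
  have sub_pCons: "sub (pCons c a) = cst c + x3 * sub a" for c a
    by (cases "pCons c a = 0") (auto simp: sub_def map_poly_pCons)
  have sub_0: "sub 0 = 0" by (simp add: sub_def)
  have O_sub: "fls_subdegree (sub a) \<ge> 0" for a
  proof (induction a)
    case (pCons c a)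
    then show ?case unfolding sub_pCons using O_x3 subdegree_mult_ge[of 0 x3 0 "sub a"] by (intro subdegree_add_ge) auto
  qed (simp add: sub_0)
  have L_sub: "sub a \<in> \<Lambda> (2 * degree a)" for a
  proof (induction a)
    case (pCons c a)
    show ?case
    proof (cases "a = 0")
      case True
      then show ?thesis by (simp add: sub_pCons sub_0 L_R)
    next
      case False
      have "x3 * sub a \<in> \<Lambda> (2 + 2 * degree a)" using L_mult[OF L_x3 pCons(2)] .
      then show ?thesis using False unfolding sub_pCons by (simp add: L_add L_R)
    qed
  qed (simp add: sub_0 L_R)
  show thesis
  proof (rule that[OF fV f(1)])
    show "ev (Affine u0 (- v0)) f = 0" using fN by (simp add: N_def)
    fix h assume hV: "h \<in> V"
    obtain a b where h: "h = el a b" using V_R[OF hV] by (auto simp: coord_ring_def)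
    \<comment> \<open>\<open>g\<close> is the translate of \<open>h\<close>, with \<open>x3\<close>
      and \<open>y3\<close> in place of the coordinates; its pole of order at most \<open>p\<close>
      at \<open>N\<close> is absorbed by \<open>f\<close>.\<close>
    define g where "g = sub a + sub b * y3"
    have "sub a \<in> \<Lambda> p" using L_mono[OF L_sub[of a]] V_degrees(1)[of a b] hV h L_R[of 0] by (cases "a = 0") (auto simp: sub_0)
    moreover have "sub b * y3 \<in> \<Lambda> p"
      using L_mono[OF L_mult[OF L_sub[of b] L_y3]] V_degrees(2)[of a b] hV h L_R[of 0] by (cases "b = 0") (auto simp: sub_0)
    ultimately have "g \<in> \<Lambda> p" unfolding g_def by (rule L_add)
    moreover have "f \<in> ideal_of (replicate (p + 0) N)" using f(2) by simp
    ultimately have "g * f \<in> ideal_of (replicate 0 N)" unfolding \<Lambda>_def by blast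
    then have gfR: "g * f \<in> R" by simp
    have "fls_subdegree g \<ge> 0" unfolding g_def using O_sub O_y3 subdegree_mult_ge[of 0 "sub b" 0 y3] by (intro subdegree_add_ge) auto
    then have gfV: "g * f \<in> V" using gfR subdegree_mult_ge[of 0 g "- int p" f] f(3) by (simp add: V_def)
    show "\<exists>h'\<in>V. \<forall>u v. on_curve E (Affine u v) \<longrightarrow> u \<noteq> u0 \<longrightarrow>
       ev (Affine u v) h' = ev (Affine u v) f * ev (Affine u v \<boxplus> Affine u0 v0) h"
    proof (intro bexI[of _ "g * f"] allI impI gfV)
      fix u v assume uv: "on_curve E (Affine u v)" "u \<noteq> u0"
      note rel_mult = ev_frac_mult[OF uv(1), of u0] and rel_add = ev_frac_add[OF uv(1), of u0]
      have rel_cst: "ev_frac u0 u v (cst c) c" for c using ev_frac_R[OF R_cst, of u0 u v c] by simp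
      define m where "m = (v - v0) / (u - u0)"
      have rel_l: "ev_frac u0 u v l m"
        unfolding ev_frac_def using lw uv(2) by (intro exI[of _ 1]) (auto simp: w_def[symmetric] mult.commute m_def ev_diff)
      define xx where "xx = m^2 - u - u0"
      have "ev_frac u0 u v (l * l + cst (-1) * gx + cst (- u0)) (m * m + (-1) * u + (- u0))"
        using ev_frac_R[OF R_gx, of u0 u v] by (intro rel_mult rel_add rel_l rel_cst) simp
      then have rel_x3: "ev_frac u0 u v x3 xx" by (simp add: x3_def xx_def power2_eq_square)
      define yy where "yy = - (m * (xx - u0) + v0)"
      have "ev_frac u0 u v (cst (-1) * (l * (x3 + cst (- u0)) + cst v0)) ((-1) * (m * (xx + (- u0)) + v0))"
        by (intro rel_mult rel_add rel_l rel_cst rel_x3)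
      then have rel_y3: "ev_frac u0 u v y3 yy" by (simp add: y3_def yy_def)
      have rel_sub: "ev_frac u0 u v (sub c) (poly c xx)" for c
      proof (induction c)
        case 0
        then show ?case using rel_cst[of 0] by (simp add: sub_0)
      next
        case (pCons c q)
        then show ?case unfolding sub_pCons poly_pCons by (intro rel_add rel_mult rel_cst rel_x3)
      qed
      have "ev_frac u0 u v (g * f) ((poly a xx + poly b xx * yy) * ev (Affine u v) f)"
        unfolding g_def using ev_frac_R[OF V_R[OF fV], of u0 u v] by (intro rel_mult rel_add rel_sub rel_y3)
      then have e: "ev (Affine u v) (g * f) = (poly a xx + poly b xx * yy) * ev (Affine u v) f"
        using ev_frac_eq[OF uv _ gfR] by blast
      have "(v0 - v) / (u0 - u) = m" by (simp add: m_def) (metis minus_diff_eq minus_divide_left minus_divide_right)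
      moreover have "m * (u - u0) = v - v0" using uv by (simp add: m_def)
      then have "m * (xx - u) + v = m * (xx - u0) + v0" by Groebner_Basis.algebra
      ultimately have "Affine u v \<boxplus> Affine u0 v0 = Affine xx yy"
        using uv(2) unfolding point_add_short Let_def by (simp add: xx_def yy_def)
      then show "ev (Affine u v) (g * f) = ev (Affine u v) f * ev (Affine u v \<boxplus> Affine u0 v0) h"
        unfolding e h by (simp add: ev_el mult.commute)
    qed
  qed
qed

lemma multiplier_of_function:
  assumes f: "f \<in> V" "f \<noteq> 0"
    and ex: "\<And>h. h \<in> V \<Longrightarrow> \<exists>h'\<in>V. \<forall>u v. on_curve E (Affine u v) \<longrightarrow> u \<noteq> u0 \<longrightarrow>
       ev (Affine u v) h' = ev (Affine u v) f * ev (Affine u v \<boxplus> T) h"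
  shows "ae (\<lambda>Y. \<exists>u v. Y = Affine u v \<and> u \<noteq> u0)" and "multiplier T (\<lambda>Y. ev Y f)"
proof -
  have "{P. on_curve E P \<and> \<not> (\<exists>u v. P = Affine u v \<and> u \<noteq> u0)} \<subseteq> insert Infinity {Affine u v | u v. on_curve E (Affine u v) \<and> u \<in> {u0}}"
  proof
    fix P assume "P \<in> {P. on_curve E P \<and> \<not> (\<exists>u v. P = Affine u v \<and> u \<noteq> u0)}"
    then show "P \<in> insert Infinity {Affine u v | u v. on_curve E (Affine u v) \<and> u \<in> {u0}}" by (cases P) auto
  qed
  then show ae1: "ae (\<lambda>Y. \<exists>u v. Y = Affine u v \<and> u \<noteq> u0)"
    unfolding ae_iff using finite_points_over[of "{u0}"] by (meson finite.emptyI finite_insert finite_subset)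
  show "multiplier T (\<lambda>Y. ev Y f)"
    unfolding multiplier_def
  proof (intro conjI ballI)
    show "ae (\<lambda>Y. ev Y f \<noteq> 0)" using ae_ev_nonzero f V_R by blast
    fix h assume "h \<in> V"
    then obtain h' where h': "h' \<in> V" "\<forall>u v. on_curve E (Affine u v) \<longrightarrow> u \<noteq> u0 \<longrightarrow>
       ev (Affine u v) h' = ev (Affine u v) f * ev (Affine u v \<boxplus> T) h" using ex by blast
    have "ae (\<lambda>Y. ev Y h' = ev Y f * ev (Y \<boxplus> T) h)"
      using ae1 by (rule ae_mono) (use h'(2) in blast)
    then show "\<exists>h'\<in>V. ae (\<lambda>Y. ev Y h' = ev Y f * ev (Y \<boxplus> T) h)" using h'(1) by blast
  qed
qed

lemma multiplier_exists:
  assumes "T \<in> tors" shows "\<exists>\<phi>. multiplier T \<phi>"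
proof (cases T)
  case Infinity
  then have "multiplier T (\<lambda>_. 1)" unfolding multiplier_def using ae_const[of True] by (auto intro!: bexI)
  then show ?thesis by blast
next
  case (Affine u0 v0)
  show ?thesis
    by (rule translation_in_V[OF assms[unfolded Affine]]) (use multiplier_of_function(2) Affine in metis)
qed

text \<open>Composition with a multiplier over \<open>neg T\<close> turns both into multipliers over
  \<open>Infinity\<close>, which are constants.\<close>

lemma multiplier_unique:
  assumes "T \<in> tors" "multiplier T \<phi>" "multiplier T \<psi>"
  shows "\<exists>c. c \<noteq> 0 \<and> ae (\<lambda>Y. \<phi> Y = c * \<psi> Y)"
proof -
  obtain \<chi> where \<chi>: "multiplier (neg T) \<chi>" using multiplier_exists[OF tors_neg[OF assms(1)]] by blast
  have T: "on_curve E T" using assms(1) by (rule tors_on_curve)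
  have m1: "multiplier Infinity (\<lambda>Y. \<phi> Y * \<chi> (Y \<boxplus> T))"
    and m2: "multiplier Infinity (\<lambda>Y. \<psi> Y * \<chi> (Y \<boxplus> T))"
    using multiplier_comp[OF assms(2) \<chi>] multiplier_comp[OF assms(3) \<chi>] T by simp_all
  obtain c where c: "c \<noteq> 0" "ae (\<lambda>Y. \<phi> Y * \<chi> (Y \<boxplus> T) = c)" using multiplier_Infinity[OF m1] .
  obtain d where d: "d \<noteq> 0" "ae (\<lambda>Y. \<psi> Y * \<chi> (Y \<boxplus> T) = d)" using multiplier_Infinity[OF m2] .
  note cd = c(1) d(1) c(2) d(2)
  have "ae (\<lambda>Y. \<phi> Y = c / d * \<psi> Y)" using cd(3,4)
  proof (rule ae_mono2)
    fix Y assume *: "\<phi> Y * \<chi> (Y \<boxplus> T) = c" "\<psi> Y * \<chi> (Y \<boxplus> T) = d"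
    then have "\<chi> (Y \<boxplus> T) \<noteq> 0" using cd by auto
    then show "\<phi> Y = c / d * \<psi> Y" using * cd by (auto simp: field_simps)
  qed
  then show ?thesis using cd by (intro exI[of _ "c / d"]) simp
qed

section \<open>The pairing and its bilinearity\<close>

definition weil :: "'a point \<Rightarrow> 'a point \<Rightarrow> 'a" where
  "weil S T = (SOME c. c \<noteq> 0 \<and> (\<forall>\<phi> \<psi>. multiplier S \<phi> \<longrightarrow> multiplier T \<psi> \<longrightarrow>
     ae (\<lambda>Y. \<phi> Y * \<psi> (Y \<boxplus> S) = c * (\<psi> Y * \<phi> (Y \<boxplus> T)))))"

lemma weil_props:
  assumes S: "S \<in> tors" and T: "T \<in> tors"
  shows "weil S T \<noteq> 0"
    and "multiplier S \<phi> \<Longrightarrow> multiplier T \<psi> \<Longrightarrow> ae (\<lambda>Y. \<phi> Y * \<psi> (Y \<boxplus> S) = weil S T * (\<psi> Y * \<phi> (Y \<boxplus> T)))"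
proof -
  have c: "on_curve E S" "on_curve E T" using S T tors_on_curve by auto
  obtain \<phi>0 \<psi>0 where m: "multiplier S \<phi>0" "multiplier T \<psi>0" using multiplier_exists S T by metis
  have m1: "multiplier (S \<boxplus> T) (\<lambda>Y. \<phi>0 Y * \<psi>0 (Y \<boxplus> S))" by (rule multiplier_comp[OF m c])
  have m2: "multiplier (S \<boxplus> T) (\<lambda>Y. \<psi>0 Y * \<phi>0 (Y \<boxplus> T))"
    using multiplier_comp[OF m(2,1) c(2,1)] point_add_commute[OF c] by simp
  obtain e where e: "e \<noteq> 0" "ae (\<lambda>Y. \<phi>0 Y * \<psi>0 (Y \<boxplus> S) = e * (\<psi>0 Y * \<phi>0 (Y \<boxplus> T)))"
    using multiplier_unique[OF tors_add[OF S T] m1 m2] by blast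
  have all: "ae (\<lambda>Y. \<phi> Y * \<psi> (Y \<boxplus> S) = e * (\<psi> Y * \<phi> (Y \<boxplus> T)))" if \<phi>: "multiplier S \<phi>" and \<psi>: "multiplier T \<psi>" for \<phi> \<psi>
  proof -
    obtain a where a: "ae (\<lambda>Y. \<phi> Y = a * \<phi>0 Y)" using multiplier_unique[OF S \<phi> m(1)] by blast
    obtain b where b: "ae (\<lambda>Y. \<psi> Y = b * \<psi>0 Y)" using multiplier_unique[OF T \<psi> m(2)] by blast
    show ?thesis
      using ae_conj[OF a b] ae_conj[OF e(2) ae_conj[OF ae_translate[OF a c(2)] ae_translate[OF b c(1)]]]
      by (rule ae_mono2) (simp add: algebra_simps)
  qed
  have "weil S T \<noteq> 0 \<and> (\<forall>\<phi> \<psi>. multiplier S \<phi> \<longrightarrow> multiplier T \<psi> \<longrightarrow>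
     ae (\<lambda>Y. \<phi> Y * \<psi> (Y \<boxplus> S) = weil S T * (\<psi> Y * \<phi> (Y \<boxplus> T))))"
    unfolding weil_def by (rule someI[of _ e]) (use e all in blast)
  then show "weil S T \<noteq> 0"
    and "multiplier S \<phi> \<Longrightarrow> multiplier T \<psi> \<Longrightarrow> ae (\<lambda>Y. \<phi> Y * \<psi> (Y \<boxplus> S) = weil S T * (\<psi> Y * \<phi> (Y \<boxplus> T)))"
    by blast+
qed

lemma weil_eqI:
  assumes "S \<in> tors" "T \<in> tors" "multiplier S \<phi>" "multiplier T \<psi>"
    "ae (\<lambda>Y. \<phi> Y * \<psi> (Y \<boxplus> S) = c * (\<psi> Y * \<phi> (Y \<boxplus> T)))"
  shows "weil S T = c"
proof -
  have 1: "ae (\<lambda>Y. \<phi> Y * \<psi> (Y \<boxplus> S) = weil S T * (\<psi> Y * \<phi> (Y \<boxplus> T)))" by (rule weil_props(2)[OF assms(1-4)])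
  have 2: "ae (\<lambda>Y. \<psi> Y \<noteq> 0)" "ae (\<lambda>Y. \<phi> (Y \<boxplus> T) \<noteq> 0)"
    using multiplier_nonzero assms(3,4) ae_translate tors_on_curve[OF assms(2)] by blast+
  have "ae (\<lambda>Y. weil S T = c)"
    using ae_conj[OF 1 assms(5)] ae_conj[OF 2] by (rule ae_mono2) auto
  then show ?thesis by (simp add: ae_const)
qed

lemma weil_self: "S \<in> tors \<Longrightarrow> weil S S = 1"
proof -
  assume S: "S \<in> tors"
  obtain \<phi> where m: "multiplier S \<phi>" using multiplier_exists S by metis
  show ?thesis by (rule weil_eqI[OF S S m m]) (use ae_const[of True] in simp)
qed

lemma weil_swap: "S \<in> tors \<Longrightarrow> T \<in> tors \<Longrightarrow> weil T S = inverse (weil S T)"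
proof -
  assume S: "S \<in> tors" and T: "T \<in> tors"
  obtain \<phi> \<psi> where m: "multiplier S \<phi>" "multiplier T \<psi>" using multiplier_exists S T by metis
  show ?thesis
    by (rule weil_eqI[OF T S m(2,1)], rule ae_mono[OF weil_props(2)[OF S T m]]) (use weil_props(1)[OF S T] in simp)
qed

lemma weil_add_right:
  assumes S: "S \<in> tors" and T: "T \<in> tors" and T': "T' \<in> tors"
  shows "weil S (T \<boxplus> T') = weil S T * weil S T'"
proof -
  have c: "on_curve E S" "on_curve E T" "on_curve E T'" using assms tors_on_curve by auto
  obtain \<phi> \<psi> \<psi>' where m: "multiplier S \<phi>" "multiplier T \<psi>" "multiplier T' \<psi>'" using multiplier_exists S T T' by metis
  show ?thesis
  proof (rule weil_eqI[OF S tors_add[OF T T'] m(1) multiplier_comp[OF m(2,3) c(2,3)]])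
    show "ae (\<lambda>Y. \<phi> Y * (\<psi> (Y \<boxplus> S) * \<psi>' (Y \<boxplus> S \<boxplus> T)) = weil S T * weil S T' * (\<psi> Y * \<psi>' (Y \<boxplus> T) * \<phi> (Y \<boxplus> (T \<boxplus> T'))))"
      using weil_props(2)[OF S T m(1,2)] ae_translate[OF weil_props(2)[OF S T' m(1,3)] c(2)]
    proof (rule ae_mono2)
      fix Y assume Y: "on_curve E Y" and 1: "\<phi> Y * \<psi> (Y \<boxplus> S) = weil S T * (\<psi> Y * \<phi> (Y \<boxplus> T))"
        and 2: "\<phi> (Y \<boxplus> T) * \<psi>' (Y \<boxplus> T \<boxplus> S) = weil S T' * (\<psi>' (Y \<boxplus> T) * \<phi> (Y \<boxplus> T \<boxplus> T'))"
      have e1: "Y \<boxplus> S \<boxplus> T = Y \<boxplus> T \<boxplus> S" using Y c point_add_assoc point_add_commute by metis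
      have e2: "Y \<boxplus> (T \<boxplus> T') = Y \<boxplus> T \<boxplus> T'" using Y c point_add_assoc by metis
      show "\<phi> Y * (\<psi> (Y \<boxplus> S) * \<psi>' (Y \<boxplus> S \<boxplus> T)) = weil S T * weil S T' * (\<psi> Y * \<psi>' (Y \<boxplus> T) * \<phi> (Y \<boxplus> (T \<boxplus> T')))"
        unfolding e1 e2 using 1 2 by Groebner_Basis.algebra
    qed
  qed
qed

lemma weil_add_left:
  assumes S: "S \<in> tors" and T: "T \<in> tors" and T': "T' \<in> tors"
  shows "weil (T \<boxplus> T') S = weil T S * weil T' S"
  using weil_add_right[OF S T T'] weil_swap[of S] tors_add assms by simp

lemma multiple_in_tors: "T \<in> tors \<Longrightarrow> T \<up> (m::nat) \<in> tors"
proof (induction m)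
  case 0
  then show ?case using tors_Infinity by (simp add: one_EG)
next
  case (Suc m)
  then show ?case using tors_add[of "T \<up> m" T] by (simp add: mult_EG)
qed

lemma weil_Infinity_right: "S \<in> tors \<Longrightarrow> weil S Infinity = 1"
  using weil_add_right[of S Infinity Infinity] weil_props(1)[of S Infinity] tors_Infinity by simp

lemma weil_pow_right: "S \<in> tors \<Longrightarrow> T \<in> tors \<Longrightarrow> weil S (T \<up> (m::nat)) = weil S T ^ m"
proof (induction m)
  case 0
  then show ?case using weil_Infinity_right by (simp add: one_EG)
next
  case (Suc m)
  then show ?case using weil_add_right[of S "T \<up> m" T] multiple_in_tors by (simp add: mult_EG)
qed

lemma weil_pow_left: "S \<in> tors \<Longrightarrow> T \<in> tors \<Longrightarrow> weil (S \<up> (m::nat)) T = weil S T ^ m"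
  using weil_pow_right[of T S m] weil_swap[of T] multiple_in_tors by (simp add: power_inverse)

lemma weil_root_of_unity: "S \<in> tors \<Longrightarrow> T \<in> tors \<Longrightarrow> weil S T ^ p = 1"
  using weil_pow_right[of S T p] weil_Infinity_right by (simp add: tors_def one_EG)

end

text \<open>The vectors \<open>q(M) h\<close> for polynomials \<open>q\<close> satisfy a relation
  because \<open>M^m h = c h\<close>. For a relation \<open>q\<close> of least degree and a root
  \<open>w\<close> of \<open>q\<close>, the vector \<open>(q / (X - w))(M) h\<close> is nonzero and
  an eigenvector. An operator that commutes with \<open>M\<close> and multiplies \<open>h\<close> by
  a scalar multiplies the new vector by the same scalar, so eigenvalues found earlier are not
  lost.\<close>

lemma eigenvector_step:
  fixes M :: "'m \<Rightarrow> 'm::comm_ring_1" and smul :: "'a::field \<Rightarrow> 'm"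
  assumes ac: "\<And>r :: 'a poly. degree r > 0 \<Longrightarrow> \<exists>z. poly r z = 0"
    and smul: "\<And>a b. smul (a + b) = smul a + smul b" "\<And>a b. smul (a * b) = smul a * smul b" "smul 1 = 1"
    and V: "\<And>x y. x \<in> V \<Longrightarrow> y \<in> V \<Longrightarrow> x + y \<in> V" "\<And>a x. x \<in> V \<Longrightarrow> smul a * x \<in> V" "\<And>x. x \<in> V \<Longrightarrow> M x \<in> V"
    and M: "\<And>x y. x \<in> V \<Longrightarrow> y \<in> V \<Longrightarrow> M (x + y) = M x + M y" "\<And>a x. x \<in> V \<Longrightarrow> M (smul a * x) = smul a * M x"
    and h: "h \<in> V" "h \<noteq> 0" and per: "m > 0" "(M ^^ m) h = smul c * h"
  obtains w h' where "h' \<in> V" "h' \<noteq> 0" "M h' = smul w * h'"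
    "\<forall>N d. (\<forall>x\<in>V. \<forall>y\<in>V. N (x + y) = N x + N y) \<longrightarrow>
       (\<forall>a. \<forall>x\<in>V. N (smul a * x) = smul a * N x) \<longrightarrow>
       (\<forall>x\<in>V. N (M x) = M (N x)) \<longrightarrow> N h = smul d * h \<longrightarrow> N h' = smul d * h'"
proof -
  have smul0: "smul 0 = 0" using smul(1)[of 0 0] by simp
  have smulm: "smul (- 1) = - 1" using smul(1)[of 1 "- 1"] smul(3) smul0 by (simp add: eq_neg_iff_add_eq_0 add.commute)
  have V0: "0 \<in> V" using V(2)[OF h(1), of 0] smul0 by simp
  have M0: "M 0 = 0" using M(2)[OF V0, of 0] smul0 by simp
  \<comment> \<open>\<open>ap q\<close> is \<open>q(M) h\<close>, evaluated by Horner's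
    scheme.\<close>
  define ap where "ap q = fold_coeffs (\<lambda>a r. smul a * h + M r) q 0" for q :: "'a poly"
  have ap0: "ap 0 = 0" by (simp add: ap_def)
  have ap_pCons: "ap (pCons a q) = smul a * h + M (ap q)" for a q
    by (cases "pCons a q = 0") (auto simp: ap_def smul0 M0)
  have ap_V: "ap q \<in> V" for q by (induction q) (auto simp: ap0 V0 ap_pCons intro!: V h)
  have ap_add: "ap (q + r) = ap q + ap r" for q r
  proof (induction q arbitrary: r)
    case (pCons a q)
    obtain b r' where "r = pCons b r'" by (cases r) auto
    then show ?case by (simp add: ap_pCons pCons.IH smul(1) M ap_V algebra_simps)
  qed (simp add: ap0)
  have ap_smult: "ap (Polynomial.smult a q) = smul a * ap q" for a q
  proof (induction q)
    case (pCons b q)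
    show ?case by (simp only: smult_pCons ap_pCons pCons.IH smul(2) M(2)[OF ap_V]) (simp add: algebra_simps)
  qed (simp add: ap0)
  have ap_monom: "ap (monom 1 k) = (M ^^ k) h" for k
    by (induction k) (simp_all add: monom_0 monom_Suc ap_pCons ap0 smul(3) smul0 M0)
  define q0 where "q0 = monom 1 m - [:c:]"
  have q0: "q0 \<noteq> 0"
  proof
    assume "q0 = 0"
    then have "monom (1::'a) m = [:c:]" by (simp add: q0_def)
    then have "degree (monom (1::'a) m) = 0" by simp
    then show False using per(1) by (simp add: degree_monom_eq)
  qed
  have apc: "ap [:c:] = smul c * h" by (simp add: ap_pCons ap0 M0)
  have "ap q0 + ap [:c:] = ap (monom 1 m)" by (simp add: q0_def flip: ap_add)
  then have "ap q0 = 0" using per(2) ap_monom apc by simp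
  with q0 have ex: "\<exists>n. \<exists>q. q \<noteq> 0 \<and> ap q = 0 \<and> degree q = n" by blast
  define n where "n = (LEAST n. \<exists>q. q \<noteq> 0 \<and> ap q = 0 \<and> degree q = n)"
  obtain q where q: "q \<noteq> 0" "ap q = 0" "degree q = n" using LeastI_ex[OF ex] n_def by blast
  have least: "ap s \<noteq> 0" if "s \<noteq> 0" "degree s < n" for s
    using not_less_Least[of "degree s" "\<lambda>n. \<exists>q. q \<noteq> 0 \<and> ap q = 0 \<and> degree q = n"] that n_def by blast
  have "degree q > 0"
  proof (rule ccontr)
    assume "\<not> degree q > 0"
    then obtain a where a: "q = [:a:]" by (metis degree_0_id not_gr_zero)
    then have "smul a * h = 0" using q(2) by (simp add: ap_pCons ap0 M0)
    then have "smul (inverse a) * (smul a * h) = 0" by simp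
    moreover have "smul (inverse a) * smul a = 1" using a q(1) smul(2,3) by (metis left_inverse pCons_0_0)
    ultimately have "h = 0" by (simp add: mult.assoc[symmetric])
    then show False using h by simp
  qed
  then obtain w where "poly q w = 0" using ac by blast
  then obtain s where s: "q = [:- w, 1:] * s" by (metis poly_eq_0_iff_dvd dvdE)
  have s0: "s \<noteq> 0" using q(1) s by auto
  have "degree s < n" using q(1,3) unfolding s by (subst (asm) degree_mult_eq) (use s0 in auto)
  then have h'0: "ap s \<noteq> 0" using least s0 by blast
  have "[:- w, 1:] * s = pCons 0 s + Polynomial.smult (- 1 * w) s" by simp
  then have "ap q = M (ap s) + smul (- 1 * w) * ap s" unfolding s
    by (simp only: ap_add ap_smult ap_pCons smul0) simp
  then have eig: "M (ap s) = smul w * ap s" using q(2) smulm by (simp only: smul(2)) (simp add: eq_neg_iff_add_eq_0)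
  show thesis
  proof (rule that[OF ap_V h'0 eig], intro allI impI)
    fix N :: "'m \<Rightarrow> 'm" and d
    assume N': "\<forall>x\<in>V. \<forall>y\<in>V. N (x + y) = N x + N y" "\<forall>a. \<forall>x\<in>V. N (smul a * x) = smul a * N x"
      "\<forall>x\<in>V. N (M x) = M (N x)" "N h = smul d * h"
    then have N: "\<And>x y. x \<in> V \<Longrightarrow> y \<in> V \<Longrightarrow> N (x + y) = N x + N y" "\<And>a x. x \<in> V \<Longrightarrow> N (smul a * x) = smul a * N x"
      "\<And>x. x \<in> V \<Longrightarrow> N (M x) = M (N x)" "N h = smul d * h" by blast+
    have N0: "N 0 = 0" using N(2)[OF V0, of 0] smul0 by simp
    have "N (ap r) = smul d * ap r" for r
    proof (induction r)
      case 0
      then show ?case by (simp add: ap0 N0)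
    next
      case (pCons a r)
      have "N (ap (pCons a r)) = smul a * N h + N (M (ap r))"
        unfolding ap_pCons by (subst N(1)) (auto intro: V ap_V h simp: N(2)[OF h(1)])
      also have "\<dots> = smul d * ap (pCons a r)"
        by (simp only: N(3)[OF ap_V] N(4) pCons.IH M(2)[OF ap_V] ap_pCons) (simp add: algebra_simps)
      finally show ?case .
    qed
    then show "N (ap s) = smul d * ap s" .
  qed
qed

context weil_curve
begin

lemma card_tors: "card tors = p^2"
  using card_torsion[of p] p5 by (simp add: tors_def)

lemma finite_tors: "finite tors"
  using card_tors p5 by (metis card.infinite not_numeral_le_zero power_eq_0_iff zero_neq_numeral le_zero_eq)

lemma tors_double_inj:
  assumes "U \<in> tors" "W \<in> tors" "U \<boxplus> U = W \<boxplus> W" shows "U = W"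
proof -
  have "odd p" using p p5 by (simp add: prime_odd_nat)
  then obtain k where k: "p = 2 * k + 1" by (rule oddE)
  have *: "(U \<boxplus> U) \<up> (k + 1) = U" if "U \<in> tors" for U
  proof -
    have U: "U \<in> carrier EG" "U \<up> p = \<one>\<^bsub>EG\<^esub>" using that by (auto simp: tors_def)
    have "U \<boxplus> U = U \<up> (2::nat)" using U(1) by (simp add: numeral_2_eq_2 mult_EG[symmetric])
    then have "(U \<boxplus> U) \<up> (k + 1) = U \<up> (2 * (k + 1))" using EG.nat_pow_pow[OF U(1), of 2 "k + 1"] by (simp only:)
    also have "2 * (k + 1) = p + 1" using k by simp
    also have "U \<up> (p + 1) = U \<up> p \<otimes>\<^bsub>EG\<^esub> U" by simp
    also have "\<dots> = U" using U by simp
    finally show ?thesis .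
  qed
  show ?thesis using *[OF assms(1)] *[OF assms(2)] assms(3) by simp
qed

text \<open>If the pairing is trivial, the translation operators commute. The \<open>p\<close>-th
  iterate of the operator of \<open>U\<close> lies over the \<open>p\<close>-fold multiple of
  \<open>U\<close>, which is \<open>Infinity\<close>, and is a scalar; this is the relation needed
  in \<open>eigenvector_step\<close>. The finitely many \<open>U\<close> are treated one after the
  other.\<close>

lemma common_eigenvector:
  assumes triv: "\<And>S T. S \<in> tors \<Longrightarrow> T \<in> tors \<Longrightarrow> weil S T = 1"
  obtains \<phi> h where "\<And>U. U \<in> tors \<Longrightarrow> multiplier U (\<phi> U)" "h \<in> V" "h \<noteq> 0"
    "\<And>U. U \<in> tors \<Longrightarrow> \<exists>c. ae (\<lambda>Y. \<phi> U Y * ev (Y \<boxplus> U) h = c * ev Y h)"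
proof -
  obtain \<phi> where \<phi>: "\<And>U. U \<in> tors \<Longrightarrow> multiplier U (\<phi> U)" using multiplier_exists by metis
  define M where "M U h = (SOME h'. h' \<in> V \<and> ae (\<lambda>Y. ev Y h' = \<phi> U Y * ev (Y \<boxplus> U) h))" for U h
  have M: "M U h \<in> V \<and> ae (\<lambda>Y. ev Y (M U h) = \<phi> U Y * ev (Y \<boxplus> U) h)" if "U \<in> tors" "h \<in> V" for U h
  proof -
    have "\<exists>h'. h' \<in> V \<and> ae (\<lambda>Y. ev Y h' = \<phi> U Y * ev (Y \<boxplus> U) h)"
      using \<phi>[OF that(1)] that(2) unfolding multiplier_def by blast
    then show ?thesis unfolding M_def by (rule someI_ex)
  qed
  have MV: "M U h \<in> V" and Mae: "ae (\<lambda>Y. ev Y (M U h) = \<phi> U Y * ev (Y \<boxplus> U) h)" if "U \<in> tors" "h \<in> V" for U h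
    using M that by auto
  have uniq: "M U h = g" if "U \<in> tors" "h \<in> V" "g \<in> V" "ae (\<lambda>Y. ev Y g = \<phi> U Y * ev (Y \<boxplus> U) h)" for U h g
    by (rule ev_ae_unique[OF V_R[OF MV] V_R]) (use that in \<open>auto intro: ae_mono2[OF Mae that(4)]\<close>)
  have M_add: "M U (g + h) = M U g + M U h" if "U \<in> tors" "g \<in> V" "h \<in> V" for U g h
  proof (rule uniq)
    show "ae (\<lambda>Y. ev Y (M U g + M U h) = \<phi> U Y * ev (Y \<boxplus> U) (g + h))"
      using Mae[OF that(1,2)] Mae[OF that(1,3)]
      by (rule ae_mono2) (use that V_R MV in \<open>simp add: ev_add algebra_simps\<close>)
  qed (use that MV V_add in auto)
  have ev_c: "ev Y (cst a * g) = a * ev Y g" if "g \<in> R" "on_curve E Y" for Y a g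
    using that by (cases Y) (simp_all add: ev_mult del: on_curve_short)
  have M_cst: "M U (cst a * h) = cst a * M U h" if "U \<in> tors" "h \<in> V" for U a h
  proof (rule uniq)
    show "ae (\<lambda>Y. ev Y (cst a * M U h) = \<phi> U Y * ev (Y \<boxplus> U) (cst a * h))"
      using Mae[OF that(1,2)]
      by (rule ae_mono) (use that V_R MV tors_on_curve point_add_closed in \<open>simp add: ev_c\<close>)
  qed (use that MV V_cst_mult in auto)
  have M_comm: "M U (M W h) = M W (M U h)" if U: "U \<in> tors" and W: "W \<in> tors" and h: "h \<in> V" for U W h
  proof (rule uniq[OF U MV[OF W h] MV[OF W MV[OF U h]]])
    have c: "on_curve E U" "on_curve E W" using U W tors_on_curve by auto
    have "ae (\<lambda>Y. \<phi> U Y * \<phi> W (Y \<boxplus> U) = \<phi> W Y * \<phi> U (Y \<boxplus> W))"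
      using weil_props(2)[OF U W \<phi>[OF U] \<phi>[OF W]] triv[OF U W] by simp
    then have 1: "ae (\<lambda>Y. \<phi> U Y * \<phi> W (Y \<boxplus> U) = \<phi> W Y * \<phi> U (Y \<boxplus> W) \<and> ev Y (M W (M U h)) = \<phi> W Y * ev (Y \<boxplus> W) (M U h))"
      using Mae[OF W MV[OF U h]] by (rule ae_conj)
    show "ae (\<lambda>Y. ev Y (M W (M U h)) = \<phi> U Y * ev (Y \<boxplus> U) (M W h))"
      using 1 ae_conj[OF ae_translate[OF Mae[OF U h] c(2)] ae_translate[OF Mae[OF W h] c(1)]]
    proof (rule ae_mono2)
      fix Y assume Y: "on_curve E Y" and a: "\<phi> U Y * \<phi> W (Y \<boxplus> U) = \<phi> W Y * \<phi> U (Y \<boxplus> W) \<and> ev Y (M W (M U h)) = \<phi> W Y * ev (Y \<boxplus> W) (M U h)"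
        and b: "ev (Y \<boxplus> W) (M U h) = \<phi> U (Y \<boxplus> W) * ev (Y \<boxplus> W \<boxplus> U) h \<and> ev (Y \<boxplus> U) (M W h) = \<phi> W (Y \<boxplus> U) * ev (Y \<boxplus> U \<boxplus> W) h"
      have "Y \<boxplus> W \<boxplus> U = Y \<boxplus> U \<boxplus> W" using Y c point_add_assoc point_add_commute by metis
      then show "ev Y (M W (M U h)) = \<phi> U Y * ev (Y \<boxplus> U) (M W h)" using a b by (simp add: mult.assoc[symmetric])
    qed
  qed
  have M_per: "\<exists>c. (M U ^^ p) h = cst c * h" if U: "U \<in> tors" and h: "h \<in> V" for U h
  proof -
    have "\<exists>\<psi>. multiplier (U \<up> m) \<psi> \<and> (M U ^^ m) h \<in> V \<and> ae (\<lambda>Y. ev Y ((M U ^^ m) h) = \<psi> Y * ev (Y \<boxplus> (U \<up> m)) h)" for m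
    proof (induction m)
      case 0
      have "multiplier Infinity (\<lambda>_. 1)" unfolding multiplier_def using ae_const[of True] by (auto intro!: bexI)
      then show ?case using h ae_const[of True] by (intro exI[of _ "\<lambda>_. 1"]) (simp add: one_EG)
    next
      case (Suc m)
      then obtain \<psi> where \<psi>: "multiplier (U \<up> m) \<psi>" "(M U ^^ m) h \<in> V" "ae (\<lambda>Y. ev Y ((M U ^^ m) h) = \<psi> Y * ev (Y \<boxplus> (U \<up> m)) h)" by blast
      let ?m = "U \<up> m"
      have c: "on_curve E U" "on_curve E ?m" using U tors_on_curve multiple_in_tors by auto
      have e: "U \<up> Suc m = U \<boxplus> ?m" using point_add_commute[OF c] by (simp add: mult_EG)
      have "ae (\<lambda>Y. ev Y (M U ((M U ^^ m) h)) = \<phi> U Y * \<psi> (Y \<boxplus> U) * ev (Y \<boxplus> (U \<boxplus> ?m)) h)"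
        using Mae[OF U \<psi>(2)] ae_translate[OF \<psi>(3) c(1)]
        by (rule ae_mono2) (use c point_add_assoc in simp)
      then show ?case unfolding e using multiplier_comp[OF \<phi>[OF U] \<psi>(1) c] MV[OF U \<psi>(2)]
        by (intro exI[of _ "\<lambda>Y. \<phi> U Y * \<psi> (Y \<boxplus> U)"]) simp
    qed
    from this[of p] obtain \<psi> where \<psi>: "multiplier Infinity \<psi>" "(M U ^^ p) h \<in> V" "ae (\<lambda>Y. ev Y ((M U ^^ p) h) = \<psi> Y * ev Y h)"
      using U by (auto simp: tors_def one_EG)
    obtain c where c: "ae (\<lambda>Y. \<psi> Y = c)" using multiplier_Infinity[OF \<psi>(1)] by blast
    have "(M U ^^ p) h = cst c * h"
    proof (rule ev_ae_unique[OF V_R[OF \<psi>(2)] V_R[OF V_cst_mult[OF h]]])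
      show "ae (\<lambda>Y. ev Y ((M U ^^ p) h) = ev Y (cst c * h))"
        using \<psi>(3) c by (rule ae_mono2) (use V_R[OF h] in \<open>simp add: ev_c\<close>)
    qed
    then show ?thesis by blast
  qed
  have "\<exists>h\<in>V. h \<noteq> 0 \<and> (\<forall>U\<in>F. \<exists>d. M U h = cst d * h)" if "finite F" "F \<subseteq> tors" for F
    using that
  proof (induction F)
    case empty
    then show ?case using V_1 by (intro bexI[of _ 1]) auto
  next
    case (insert U F)
    then obtain h where h: "h \<in> V" "h \<noteq> 0" "\<forall>W\<in>F. \<exists>d. M W h = cst d * h" by auto
    have U: "U \<in> tors" using insert by simp
    obtain c where c: "(M U ^^ p) h = cst c * h" using M_per[OF U h(1)] by blast
    have p0: "p > 0" using p5 by simp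
    obtain w h' where h': "h' \<in> V" "h' \<noteq> 0" "M U h' = cst w * h'"
      "\<forall>N d. (\<forall>x\<in>V. \<forall>y\<in>V. N (x + y) = N x + N y) \<longrightarrow>
       (\<forall>a. \<forall>x\<in>V. N (cst a * x) = cst a * N x) \<longrightarrow>
       (\<forall>x\<in>V. N (M U x) = M U (N x)) \<longrightarrow> N h = cst d * h \<longrightarrow> N h' = cst d * h'"
      by (rule eigenvector_step[OF ac fls_const_hom_add fls_const_hom_mult fls_const_1 V_add V_cst_mult MV[OF U] M_add[OF U] M_cst[OF U] h(1,2) p0 c])
        (assumption | (rule that, assumption, assumption, assumption, assumption))+
    have "\<exists>d. M W h' = cst d * h'" if WF: "W \<in> F" for W
    proof -
      have W: "W \<in> tors" using insert WF by auto
      obtain d where d: "M W h = cst d * h" using bspec[OF h(3) WF] by (rule exE)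
      have "M W h' = cst d * h'"
      proof (rule h'(4)[THEN spec[of _ "M W"], THEN spec[of _ d], THEN mp, THEN mp, THEN mp, THEN mp, OF _ _ _ d])
        show "\<forall>x\<in>V. \<forall>y\<in>V. M W (x + y) = M W x + M W y" using M_add[OF W] by blast
        show "\<forall>a. \<forall>x\<in>V. M W (cst a * x) = cst a * M W x" using M_cst[OF W] by blast
        show "\<forall>x\<in>V. M W (M U x) = M U (M W x)" using M_comm[OF W U] by blast
      qed
      then show ?thesis by (rule exI)
    qed
    then show ?case using h'(1,2,3) by (intro bexI[of _ h'] conjI ballI) auto
  qed
  from this[OF finite_tors subset_refl]
  obtain h where h: "h \<in> V" "h \<noteq> 0" "\<And>U. U \<in> tors \<Longrightarrow> \<exists>d. M U h = cst d * h" by blast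
  show thesis
  proof (rule that[OF \<phi> h(1,2)])
    fix U assume U: "U \<in> tors"
    obtain d where "M U h = cst d * h" using h(3) U by blast
    then have "ae (\<lambda>Y. \<phi> U Y * ev (Y \<boxplus> U) h = d * ev Y h)" using Mae[OF U h(1)]
      by (intro ae_mono[OF Mae[OF U h(1)]]) (use V_R[OF h(1)] in \<open>simp add: ev_c\<close>)
    then show "\<exists>c. ae (\<lambda>Y. \<phi> U Y * ev (Y \<boxplus> U) h = c * ev Y h)" by blast
  qed
qed

text \<open>The zeros of a common eigenvector of all translations would be stable under \<open>p\<close>-torsion, up to at most two
  exceptions; but a function in \<open>V\<close> has too few zeros for that.\<close>

theorem weil_nontrivial: "\<exists>S\<in>tors. \<exists>T\<in>tors. weil S T \<noteq> 1"
proof (rule ccontr)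
  assume "\<not> (\<exists>S\<in>tors. \<exists>T\<in>tors. weil S T \<noteq> 1)"
  then have triv: "\<And>S T. S \<in> tors \<Longrightarrow> T \<in> tors \<Longrightarrow> weil S T = 1" by blast
  obtain \<phi> h where \<phi>: "\<And>U. U \<in> tors \<Longrightarrow> multiplier U (\<phi> U)" and h: "h \<in> V" "h \<noteq> 0"
    and eig: "\<And>U. U \<in> tors \<Longrightarrow> \<exists>c. ae (\<lambda>Y. \<phi> U Y * ev (Y \<boxplus> U) h = c * ev Y h)"
    by (rule common_eigenvector[OF triv]) auto
  have ev_c: "ev Y (cst a * g) = a * ev Y g" if "g \<in> R" "on_curve E Y" for Y a g
    using that by (cases Y) (simp_all add: ev_mult del: on_curve_short)
  \<comment> \<open>The eigenvector relation is needed at every point off \<open>u0\<close>, not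
    only almost everywhere, since single zeros of \<open>h\<close> are to be translated. Hence the
    multiplier is the explicit \<open>f\<close> of \<open>translation_in_V\<close>; \<open>c\<close>
    is nonzero because \<open>f\<close> times a translate of \<open>h\<close> does not vanish
    identically.\<close>
  have exact: "\<exists>f c. f \<in> V \<and> f \<noteq> 0 \<and> c \<noteq> 0 \<and> ev (Affine u0 (- v0)) f = 0 \<and> (\<forall>u v. on_curve E (Affine u v) \<longrightarrow> u \<noteq> u0 \<longrightarrow>
       c * ev (Affine u v) h = ev (Affine u v) f * ev (Affine u v \<boxplus> Affine u0 v0) h)"
    if T: "Affine u0 v0 \<in> tors" for u0 v0
  proof -
    let ?T = "Affine u0 v0"
    obtain f where f: "f \<in> V" "f \<noteq> 0" "ev (Affine u0 (- v0)) f = 0"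
      "\<And>h. h \<in> V \<Longrightarrow> \<exists>h'\<in>V. \<forall>u v. on_curve E (Affine u v) \<longrightarrow> u \<noteq> u0 \<longrightarrow>
       ev (Affine u v) h' = ev (Affine u v) f * ev (Affine u v \<boxplus> ?T) h"
      using translation_in_V[OF T] by metis
    note mf = multiplier_of_function[OF f(1,2,4)]
    obtain h' where h': "h' \<in> V" "\<forall>u v. on_curve E (Affine u v) \<longrightarrow> u \<noteq> u0 \<longrightarrow>
       ev (Affine u v) h' = ev (Affine u v) f * ev (Affine u v \<boxplus> ?T) h" using f(4)[OF h(1)] by blast
    obtain d where d: "ae (\<lambda>Y. \<phi> ?T Y * ev (Y \<boxplus> ?T) h = d * ev Y h)" using eig[OF T] by blast
    obtain e where e: "e \<noteq> 0" "ae (\<lambda>Y. ev Y f = e * \<phi> ?T Y)" using multiplier_unique[OF T mf(2) \<phi>[OF T]] by blast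
    have "ae (\<lambda>Y. ev Y h' = ev Y f * ev (Y \<boxplus> ?T) h)"
    proof (rule ae_mono[OF mf(1)])
      fix Y assume Y: "on_curve E Y" "\<exists>u v. Y = Affine u v \<and> u \<noteq> u0"
      then obtain u v where uv: "Y = Affine u v" "u \<noteq> u0" by blast
      then show "ev Y h' = ev Y f * ev (Y \<boxplus> ?T) h" using h'(2)[rule_format, of u v] Y(1) by blast
    qed
    then have "ae (\<lambda>Y. ev Y h' = ev Y (cst (e * d) * h))"
      using ae_conj[OF d e(2)] by (rule ae_mono2) (use V_R[OF h(1)] in \<open>simp add: ev_c del: fls_const_mult_const\<close>)
    then have hh: "h' = cst (e * d) * h" using ev_ae_unique V_R h' V_cst_mult h(1) by blast
    have "ae (\<lambda>Y. ev Y h' \<noteq> 0)"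
    proof -
      have c: "on_curve E ?T" using tors_on_curve[OF T] .
      have "ae (\<lambda>Y. ev Y h' = ev Y f * ev (Y \<boxplus> ?T) h \<and> ev Y f \<noteq> 0)"
        using \<open>ae (\<lambda>Y. ev Y h' = ev Y f * ev (Y \<boxplus> ?T) h)\<close> multiplier_nonzero[OF mf(2)] by (rule ae_conj)
      then show ?thesis using ae_translate[OF ae_ev_nonzero[OF V_R[OF h(1)] h(2)] c] by (rule ae_mono2) auto
    qed
    then obtain Y where "ev Y h' \<noteq> 0" using ae_exists by blast
    moreover have "ev Y 0 = 0" using ev_cst[of _ _ 0] by (cases Y) simp_all
    ultimately have "h' \<noteq> 0" by metis
    then have "e * d \<noteq> 0" using hh by auto
    moreover have "\<forall>u v. on_curve E (Affine u v) \<longrightarrow> u \<noteq> u0 \<longrightarrow>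
       e * d * ev (Affine u v) h = ev (Affine u v) f * ev (Affine u v \<boxplus> ?T) h"
      using h'(2) V_R[OF h(1)] unfolding hh by (metis ev_c)
    ultimately show ?thesis using f by blast
  qed
  define Z where "Z = {P. on_curve E P \<and> P \<noteq> Infinity \<and> ev P h = 0}"
  have Z: "finite Z" "card Z \<le> 2 * p" using zeros_bound[OF h] by (auto simp: Z_def)
  have pp: "p^2 \<ge> 5 * p" using p5 by (simp add: power2_eq_square)
  show False
  proof (cases "Z = {}")
    case False
    then obtain Q where Q: "on_curve E Q" "Q \<noteq> Infinity" "ev Q h = 0" by (auto simp: Z_def)
    \<comment> \<open>For a zero \<open>Q\<close> and a torsion point \<open>U\<close> the point
      \<open>P = Q - U\<close> is again a zero. The exceptions are \<open>U = Q\<close>, where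
      \<open>P\<close> is infinite, and \<open>2 U = Q\<close>, where \<open>P = U\<close> has the
      excluded x-coordinate.\<close>
    define Bd where "Bd = {U \<in> tors. U \<boxplus> U = Q}"
    have "card Bd \<le> 1" unfolding One_nat_def
      by (subst card_le_Suc0_iff_eq) (use finite_tors tors_double_inj in \<open>auto simp: Bd_def\<close>)
    have inj: "inj_on (\<lambda>U. Q \<boxplus> neg U) (tors - Bd - {Q})"
    proof (rule inj_onI)
      fix U W assume UW: "U \<in> tors - Bd - {Q}" "W \<in> tors - Bd - {Q}" "Q \<boxplus> neg U = Q \<boxplus> neg W"
      have c: "U \<in> carrier EG" "W \<in> carrier EG" "Q \<in> carrier EG" using UW tors_on_curve Q by (auto simp: carrier_EG)
      then have "inv\<^bsub>EG\<^esub> U = inv\<^bsub>EG\<^esub> W" using UW(3) by (simp add: inv_EG[symmetric] mult_EG[symmetric])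
      then show "U = W" using c by (metis EG.inv_inv)
    qed
    have sub: "(\<lambda>U. Q \<boxplus> neg U) ` (tors - Bd - {Q}) \<subseteq> Z"
    proof (rule image_subsetI)
      fix U assume U: "U \<in> tors - Bd - {Q}"
      have Uc: "on_curve E U" using U tors_on_curve by blast
      define P where "P = Q \<boxplus> neg U"
      have Pc: "on_curve E P" using Q Uc by (simp add: P_def point_add_closed)
      have PU: "P \<boxplus> U = Q" unfolding P_def using point_add_assoc[of Q "neg U" U] Q Uc point_add_neg[of "neg U"] by simp
      have "P \<in> Z"
      proof (cases U)
        case Infinity
        then show ?thesis using PU Pc Q by (simp add: Z_def)
      next
        case (Affine u0 v0)
        have "P \<noteq> Infinity" using PU U by auto
        then obtain u v where P: "P = Affine u v" by (cases P) auto
        have "u \<noteq> u0"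
        proof
          assume "u = u0"
          then have "v = v0 \<or> v = - v0" using same_x_cases[of u0 v0 v] Uc Pc Affine P by blast
          then have "P = U \<or> P = neg U" using P Affine \<open>u = u0\<close> by auto
          then have "U \<boxplus> U = Q \<or> Q = Infinity" using PU Uc point_add_neg[of "neg U"] by auto
          then show False using U Q by (auto simp: Bd_def)
        qed
        then obtain f c where "c \<noteq> 0" "c * ev P h = ev P f * ev (P \<boxplus> U) h"
          using exact[of u0 v0] U Affine Pc P by blast
        then show ?thesis using PU Q Pc \<open>P \<noteq> Infinity\<close> by (simp add: Z_def)
      qed
      then show "Q \<boxplus> neg U \<in> Z" by (simp add: P_def)
    qed
    have "card (tors - Bd - {Q}) \<le> card Z" using card_inj_on_le[OF inj sub Z(1)] .
    moreover have "card (tors - Bd - {Q}) \<ge> card tors - card Bd - 1"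
    proof -
      have "card (tors - Bd) \<ge> card tors - card Bd" by (rule diff_card_le_card_Diff) (use finite_tors in \<open>simp add: Bd_def\<close>)
      moreover have "card (tors - Bd - {Q}) \<ge> card (tors - Bd) - card {Q}" by (rule diff_card_le_card_Diff) simp
      ultimately show ?thesis by simp
    qed
    ultimately have "p^2 - 2 \<le> 2 * p" using card_tors \<open>card Bd \<le> 1\<close> Z by linarith
    then show False using pp p5 by linarith
  next
    case True
    \<comment> \<open>Without affine zeros of \<open>h\<close> its norm has no root, so
      \<open>h\<close> is constant. Then \<open>f\<close> is a nonzero constant as well, although it
      vanishes at the opposite of a torsion point.\<close>
    obtain a b where ab: "h = el a b" using V_R[OF h(1)] by (auto simp: coord_ring_def)
    have ab0: "a \<noteq> 0 \<or> b \<noteq> 0" using h ab by (auto simp: el_def)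
    have "degree (norm_poly a b) = 0"
    proof (rule ccontr)
      assume "degree (norm_poly a b) \<noteq> 0"
      then obtain u where u: "poly (norm_poly a b) u = 0" using ac[of "norm_poly a b"] by auto
      obtain v where v: "on_curve E (Affine u v)" using point_over by blast
      have "v^2 = poly f_poly u" using v by (simp add: f_poly_def power2_eq_square power3_eq_cube algebra_simps)
      then have "(poly a u + poly b u * v) * (poly a u - poly b u * v) = 0"
        using u by (simp add: norm_poly_def algebra_simps power2_eq_square)
      then have "ev (Affine u v) h = 0 \<or> ev (Affine u (- v)) h = 0" by (auto simp: ab ev_el)
      then have "Affine u v \<in> Z \<or> Affine u (- v) \<in> Z" using v by (auto simp: Z_def)
      then show False using True by blast
    qed
    then have "b = 0" "degree a = 0" using degree_norm_poly[OF ab0] by (auto split: if_splits)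
    then obtain c where c: "h = cst c" using ab by (metis degree_0_id el_cst)
    have c0: "c \<noteq> 0" using h c by auto
    have "\<not> tors \<subseteq> {Infinity}"
    proof
      assume "tors \<subseteq> {Infinity}"
      then have "card tors \<le> 1" using card_mono[of "{Infinity}" tors] by simp
      then show False using card_tors pp p5 by linarith
    qed
    then obtain u0 v0 where T: "Affine u0 v0 \<in> tors" by (metis insertI1 point.exhaust subsetI)
    obtain f d where f: "f \<in> V" "f \<noteq> 0" "d \<noteq> 0" "ev (Affine u0 (- v0)) f = 0"
      and fd: "\<And>u v. on_curve E (Affine u v) \<Longrightarrow> u \<noteq> u0 \<Longrightarrow>
       d * ev (Affine u v) h = ev (Affine u v) f * ev (Affine u v \<boxplus> Affine u0 v0) h"
      using exact[OF T] by blast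
    have "{P. on_curve E P \<and> \<not> ev P f = ev P (cst d)} \<subseteq> insert Infinity {Affine u v | u v. on_curve E (Affine u v) \<and> u \<in> {u0}}"
    proof
      fix P assume P: "P \<in> {P. on_curve E P \<and> \<not> ev P f = ev P (cst d)}"
      show "P \<in> insert Infinity {Affine u v | u v. on_curve E (Affine u v) \<and> u \<in> {u0}}"
      proof (cases P)
        case (Affine u v)
        have "u = u0"
        proof (rule ccontr)
          assume u: "u \<noteq> u0"
          obtain x y where xy: "Affine u v \<boxplus> Affine u0 v0 = Affine x y" using u by (simp add: point_add_short Let_def)
          have "on_curve E (Affine u v)" using P Affine by blast
          from fd[OF this u] have "d * c = ev (Affine u v) f * c" unfolding xy c ev_cst .
          then show False using P Affine c0 by simp
        qed
        then show ?thesis using P Affine by auto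
      qed simp
    qed
    then have "ae (\<lambda>Y. ev Y f = ev Y (cst d))" unfolding ae_iff using finite_points_over[of "{u0}"]
      by (meson finite.emptyI finite_insert finite_subset)
    then have "f = cst d" using ev_ae_unique V_R[OF f(1)] R_cst by blast
    then show False using f by simp
  qed
qed

end

section \<open>Field automorphisms and equivariance of the pairing\<close>

definition field_automorphism :: "('a::field \<Rightarrow> 'a) \<Rightarrow> bool" where
  "field_automorphism \<tau> \<longleftrightarrow> bij \<tau> \<and> (\<forall>x y. \<tau> (x + y) = \<tau> x + \<tau> y) \<and> (\<forall>x y. \<tau> (x * y) = \<tau> x * \<tau> y)"

lemma field_automorphism_simps:
  assumes "field_automorphism \<tau>"
  shows "\<tau> (x + y) = \<tau> x + \<tau> y" "\<tau> (x * y) = \<tau> x * \<tau> y" "\<tau> 0 = 0" "\<tau> 1 = 1" "\<tau> (- x) = - \<tau> x"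
    "\<tau> (x - y) = \<tau> x - \<tau> y" "\<tau> (x / y) = \<tau> x / \<tau> y" "\<tau> (x ^ n) = \<tau> x ^ n" "\<tau> (numeral k) = numeral k"
    "\<tau> x = \<tau> y \<longleftrightarrow> x = y" "\<tau> x = 0 \<longleftrightarrow> x = 0" "\<tau> (inverse x) = inverse (\<tau> x)"
proof -
  have add: "\<tau> (x + y) = \<tau> x + \<tau> y" and mult: "\<tau> (x * y) = \<tau> x * \<tau> y" and b: "bij \<tau>" for x y
    using assms by (auto simp: field_automorphism_def)
  show "\<tau> (x + y) = \<tau> x + \<tau> y" "\<tau> (x * y) = \<tau> x * \<tau> y" by (rule add, rule mult)
  show z: "\<tau> 0 = 0" by (metis add add_0_right add_left_cancel)
  show inj: "\<tau> x = \<tau> y \<longleftrightarrow> x = y" for x y using b by (simp add: bij_def inj_eq)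
  show iz: "\<tau> x = 0 \<longleftrightarrow> x = 0" for x using inj[of x 0] z by simp
  have "\<tau> 1 * \<tau> 1 = \<tau> 1" using mult[of 1 1] by simp
  then show o: "\<tau> 1 = 1" using iz[of 1] by simp
  show m: "\<tau> (- x) = - \<tau> x" for x using add[of x "- x"] z by (simp add: add_eq_0_iff)
  show "\<tau> (x - y) = \<tau> x - \<tau> y" using add[of x "- y"] m by simp
  show i: "\<tau> (inverse y) = inverse (\<tau> y)" for y
  proof (cases "y = 0")
    case False
    then have "\<tau> y * \<tau> (inverse y) = 1" using mult[of y "inverse y"] o by simp
    then show ?thesis by (metis inverse_unique)
  qed (simp add: z)
  show "\<tau> (x / y) = \<tau> x / \<tau> y" using mult i by (simp add: divide_inverse)
  show "\<tau> (x ^ n) = \<tau> x ^ n" by (induction n) (simp_all add: o mult)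
  have nat: "\<tau> (of_nat n) = of_nat n" for n by (induction n) (simp_all add: z o add)
  show "\<tau> (numeral k) = numeral k" using nat[of "numeral k"] by simp
qed

abbreviation "finv \<equiv> inv_into UNIV"

lemma field_automorphism_inv:
  assumes "field_automorphism \<tau>" shows "field_automorphism (finv \<tau>)"
proof -
  have b: "bij \<tau>" using assms by (simp add: field_automorphism_def)
  then have s: "\<tau> (finv \<tau> x) = x" "finv \<tau> (\<tau> x) = x" for x by (simp_all add: bij_def surj_f_inv_f)
  show ?thesis unfolding field_automorphism_def
    by (metis b bij_imp_bij_inv s field_automorphism_simps(1,2)[OF assms])
qed

lemma field_automorphism_inv_apply:
  assumes "field_automorphism \<tau>" shows "\<tau> (finv \<tau> x) = x" "finv \<tau> (\<tau> x) = x"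
  using assms by (simp_all add: field_automorphism_def bij_def surj_f_inv_f)

context short_curve
begin

context
  fixes \<tau> :: "'a \<Rightarrow> 'a"
  assumes \<tau>: "field_automorphism \<tau>" and fixAB: "\<tau> A = A" "\<tau> B = B"
begin

lemma aut_on_curve: "on_curve E (map_point \<tau> P) \<longleftrightarrow> on_curve E P"
proof (cases P)
  case (Affine u v)
  have "(\<tau> v)^2 = (\<tau> u)^3 + A * \<tau> u + B \<longleftrightarrow> \<tau> (v^2) = \<tau> (u^3 + A * u + B)"
    by (simp add: field_automorphism_simps[OF \<tau>] fixAB)
  then show ?thesis using Affine by (simp add: field_automorphism_simps(10)[OF \<tau>])
qed simp

lemma aut_point_add: "map_point \<tau> (point_add E P Q) = point_add E (map_point \<tau> P) (map_point \<tau> Q)"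
proof (cases P; cases Q)
  fix u v u' v' assume PQ: "P = Affine u v" "Q = Affine u' v'"
  have "\<tau> v + \<tau> v' = 0 \<longleftrightarrow> v + v' = 0"
    using field_automorphism_simps(1,11)[OF \<tau>] by metis
  then show ?thesis unfolding PQ point.map point_add_short Let_def
    by (simp add: field_automorphism_simps[OF \<tau>] fixAB)
qed auto

lemma aut_pow: "map_point \<tau> (P \<up> (m::nat)) = map_point \<tau> P \<up> m"
  by (induction m) (simp_all add: one_EG mult_EG aut_point_add)

lemma ev_map_poly:
  assumes "on_curve E P"
  shows "ev (map_point \<tau> P) (el (map_poly \<tau> a) (map_poly \<tau> b)) = \<tau> (ev P (el a b))"
proof (cases P)
  case (Affine u v)
  have p: "poly (map_poly \<tau> q) (\<tau> x) = \<tau> (poly q x)" for q x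
  proof (induction q)
    case (pCons c q)
    then show ?case by (cases "pCons c q = 0") (simp_all add: map_poly_pCons field_automorphism_simps[OF \<tau>])
  qed (simp add: field_automorphism_simps[OF \<tau>])
  show ?thesis using Affine by (simp add: ev_el p field_automorphism_simps[OF \<tau>])
qed (simp add: field_automorphism_simps[OF \<tau>])

end

end

context weil_curve
begin

context
  fixes \<tau> :: "'a \<Rightarrow> 'a"
  assumes \<tau>: "field_automorphism \<tau>" and fixAB: "\<tau> A = A" "\<tau> B = B"
begin

lemma inv_fixes: "finv \<tau> A = A" "finv \<tau> B = B"
  using field_automorphism_inv_apply(2)[OF \<tau>] fixAB by metis+

abbreviation "pt \<equiv> map_point \<tau>"
abbreviation "pt' \<equiv> map_point (finv \<tau>)"

lemma pt_inv: "pt (pt' P) = P" "pt' (pt P) = P"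
  by (cases P; simp add: field_automorphism_inv_apply[OF \<tau>])+

lemma V_map:
  assumes "h \<in> V" "field_automorphism \<sigma>" "\<sigma> A = A" "\<sigma> B = B"
  obtains g where "g \<in> V" "\<And>P. on_curve E P \<Longrightarrow> ev (map_point \<sigma> P) g = \<sigma> (ev P h)"
proof -
  obtain a b where h: "h = el a b" using V_R[OF assms(1)] by (auto simp: coord_ring_def)
  have "el (map_poly \<sigma> a) (map_poly \<sigma> b) \<in> V"
  proof (rule V_el)
    have d: "degree (map_poly \<sigma> q) \<le> degree q" for q
      by (rule degree_le) (simp add: coeff_map_poly coeff_eq_0 field_automorphism_simps(3)[OF assms(2)])
    have z: "q \<noteq> 0" if "map_poly \<sigma> q \<noteq> 0" for q using that by auto
    show "2 * degree (map_poly \<sigma> a) \<le> p" if "map_poly \<sigma> a \<noteq> 0"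
      using V_degrees(1)[of a b] assms(1) h d[of a] z[OF that] by simp
    show "2 * degree (map_poly \<sigma> b) + 3 \<le> p" if "map_poly \<sigma> b \<noteq> 0"
      using V_degrees(2)[of a b] assms(1) h d[of b] z[OF that] by simp
  qed
  then show thesis using that ev_map_poly[OF assms(2-4)] h by blast
qed

lemma ae_map: "ae Q \<Longrightarrow> ae (\<lambda>Y. Q (pt' Y))"
proof -
  assume a: "ae Q"
  have "{Y. on_curve E Y \<and> \<not> Q (pt' Y)} \<subseteq> pt ` {P. on_curve E P \<and> \<not> Q P}"
  proof
    fix Y assume Y: "Y \<in> {Y. on_curve E Y \<and> \<not> Q (pt' Y)}"
    then have "on_curve E (pt' Y)" using aut_on_curve[OF \<tau> fixAB, of "pt' Y"] pt_inv by simp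
    then show "Y \<in> pt ` {P. on_curve E P \<and> \<not> Q P}" using Y pt_inv by (intro image_eqI[of _ _ "pt' Y"]) auto
  qed
  then show ?thesis using a unfolding ae_iff using finite_subset by blast
qed

lemma multiplier_map:
  assumes "multiplier T \<phi>" "on_curve E T"
  shows "multiplier (pt T) (\<lambda>Y. \<tau> (\<phi> (pt' Y)))"
  unfolding multiplier_def
proof (intro conjI ballI)
  show "ae (\<lambda>Y. \<tau> (\<phi> (pt' Y)) \<noteq> 0)"
    using ae_map[OF multiplier_nonzero[OF assms(1)]] by (simp add: field_automorphism_simps[OF \<tau>])
  fix h assume h: "h \<in> V"
  obtain g where g: "g \<in> V" "\<And>P. on_curve E P \<Longrightarrow> ev (pt' P) g = finv \<tau> (ev P h)"
    using V_map[OF h field_automorphism_inv[OF \<tau>] inv_fixes] by metis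
  obtain g' where g': "g' \<in> V" "ae (\<lambda>Y. ev Y g' = \<phi> Y * ev (Y \<boxplus> T) g)" using assms(1) g(1) by (auto simp: multiplier_def)
  obtain h' where h': "h' \<in> V" "\<And>P. on_curve E P \<Longrightarrow> ev (pt P) h' = \<tau> (ev P g')"
    using V_map[OF g'(1) \<tau> fixAB] by metis
  have "ae (\<lambda>Y. ev Y h' = \<tau> (\<phi> (pt' Y)) * ev (Y \<boxplus> pt T) h)"
    using ae_map[OF g'(2)]
  proof (rule ae_mono)
    fix Y assume Y: "on_curve E Y" and e: "ev (pt' Y) g' = \<phi> (pt' Y) * ev (pt' Y \<boxplus> T) g"
    have Y': "on_curve E (pt' Y)" using aut_on_curve[OF \<tau> fixAB, of "pt' Y"] Y pt_inv by simp
    have c: "on_curve E (Y \<boxplus> pt T)" using Y assms(2) aut_on_curve[OF \<tau> fixAB] point_add_closed by simp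
    have "pt' Y \<boxplus> T = pt' (Y \<boxplus> pt T)"
      using aut_point_add[OF field_automorphism_inv[OF \<tau>] inv_fixes, of Y "pt T"] pt_inv by simp
    then have 1: "\<tau> (ev (pt' Y \<boxplus> T) g) = ev (Y \<boxplus> pt T) h" using g(2)[OF c] field_automorphism_inv_apply[OF \<tau>] by simp
    have "ev Y h' = \<tau> (ev (pt' Y) g')" using h'(2)[OF Y'] pt_inv by simp
    then show "ev Y h' = \<tau> (\<phi> (pt' Y)) * ev (Y \<boxplus> pt T) h" using e 1 by (simp add: field_automorphism_simps[OF \<tau>])
  qed
  then show "\<exists>h'\<in>V. ae (\<lambda>Y. ev Y h' = \<tau> (\<phi> (pt' Y)) * ev (Y \<boxplus> pt T) h)" using h'(1) by blast
qed

lemma tors_map: "T \<in> tors \<Longrightarrow> pt T \<in> tors"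
  using aut_pow[OF \<tau> fixAB, of T p] aut_on_curve[OF \<tau> fixAB, of T] by (simp add: tors_def carrier_EG one_EG)

text \<open>Transport of structure: \<open>\<tau>\<close> carries multipliers over \<open>T\<close>
  to multipliers over \<open>pt T\<close>, and with them the relation that characterises the
  pairing.\<close>

theorem weil_equivariant:
  assumes S: "S \<in> tors" and T: "T \<in> tors" shows "weil (pt S) (pt T) = \<tau> (weil S T)"
proof -
  obtain \<phi> \<psi> where m: "multiplier S \<phi>" "multiplier T \<psi>" using multiplier_exists S T by metis
  have c: "on_curve E S" "on_curve E T" using S T tors_on_curve by auto
  show ?thesis
  proof (rule weil_eqI[OF tors_map[OF S] tors_map[OF T] multiplier_map[OF m(1) c(1)] multiplier_map[OF m(2) c(2)]])
    have a: "pt' (Y \<boxplus> pt S) = pt' Y \<boxplus> S" for Y S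
      using aut_point_add[OF field_automorphism_inv[OF \<tau>] inv_fixes, of Y "pt S"] pt_inv by simp
    show "ae (\<lambda>Y. \<tau> (\<phi> (pt' Y)) * \<tau> (\<psi> (pt' (Y \<boxplus> pt S))) = \<tau> (weil S T) * (\<tau> (\<psi> (pt' Y)) * \<tau> (\<phi> (pt' (Y \<boxplus> pt T)))))"
      unfolding a using ae_map[OF weil_props(2)[OF S T m]]
      by (rule ae_mono) (metis field_automorphism_simps(2)[OF \<tau>])
  qed
qed

end

text \<open>The value is raised to the power \<open>a d - b c\<close>. Exponents are natural
  numbers, so the negative part of the determinant stands on the left.\<close>

lemma weil_determinant:
  fixes a b c d :: nat
  assumes \<tau>: "field_automorphism \<tau>" "\<tau> A = A" "\<tau> B = B" and S: "S \<in> tors" and T: "T \<in> tors"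
    and m: "map_point \<tau> S = S \<up> a \<otimes>\<^bsub>EG\<^esub> T \<up> c" "map_point \<tau> T = S \<up> b \<otimes>\<^bsub>EG\<^esub> T \<up> d"
  shows "\<tau> (weil S T) * weil S T ^ (b * c) = weil S T ^ (a * d)"
proof -
  have nz: "weil S T \<noteq> 0" using weil_props(1)[OF S T] .
  have "\<tau> (weil S T) = weil (S \<up> a \<boxplus> T \<up> c) (S \<up> b \<boxplus> T \<up> d)"
    using weil_equivariant[OF \<tau> S T] m by (simp add: mult_EG)
  also have "\<dots> = weil S T ^ (a * d) * inverse (weil S T) ^ (b * c)"
    using S T by (simp add: weil_add_left weil_add_right tors_add multiple_in_tors weil_pow_left weil_pow_right
        weil_self weil_swap[OF S T] flip: power_mult) (simp add: mult.commute)
  finally show ?thesis using nz by (simp add: power_inverse)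
qed

end

section \<open>Integral two by two matrices\<close>

text \<open>Integer representatives of matrices modulo \<open>p^e\<close>, for all \<open>e\<close>
  at once: the cocycle argument reads the same element modulo every power of \<open>p\<close> up to
  \<open>p^n\<close>, and reduction is just the congruence \<open>mcong\<close>.\<close>

datatype mat2 = Mat (m11: int) (m12: int) (m21: int) (m22: int)

instantiation mat2 :: ring_1
begin
definition "0 = Mat 0 0 0 0"
definition "1 = Mat 1 0 0 1"
definition "P + Q = Mat (m11 P + m11 Q) (m12 P + m12 Q) (m21 P + m21 Q) (m22 P + m22 Q)"
definition "P - Q = Mat (m11 P - m11 Q) (m12 P - m12 Q) (m21 P - m21 Q) (m22 P - m22 Q)"
definition "- P = Mat (- m11 P) (- m12 P) (- m21 P) (- m22 P)"
definition "P * Q = Mat (m11 P * m11 Q + m12 P * m21 Q) (m11 P * m12 Q + m12 P * m22 Q)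
  (m21 P * m11 Q + m22 P * m21 Q) (m21 P * m12 Q + m22 P * m22 Q)"
instance
  by standard (auto simp: zero_mat2_def one_mat2_def plus_mat2_def minus_mat2_def uminus_mat2_def times_mat2_def algebra_simps)
end

lemma mat2_sel [simp]:
  "m11 0 = 0" "m12 0 = 0" "m21 0 = 0" "m22 0 = 0"
  "m11 1 = 1" "m12 1 = 0" "m21 1 = 0" "m22 1 = 1"
  "m11 (P + Q) = m11 P + m11 Q" "m12 (P + Q) = m12 P + m12 Q" "m21 (P + Q) = m21 P + m21 Q" "m22 (P + Q) = m22 P + m22 Q"
  "m11 (P - Q) = m11 P - m11 Q" "m12 (P - Q) = m12 P - m12 Q" "m21 (P - Q) = m21 P - m21 Q" "m22 (P - Q) = m22 P - m22 Q"
  "m11 (- P) = - m11 P" "m12 (- P) = - m12 P" "m21 (- P) = - m21 P" "m22 (- P) = - m22 P"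
  "m11 (P * Q) = m11 P * m11 Q + m12 P * m21 Q" "m12 (P * Q) = m11 P * m12 Q + m12 P * m22 Q"
  "m21 (P * Q) = m21 P * m11 Q + m22 P * m21 Q" "m22 (P * Q) = m21 P * m12 Q + m22 P * m22 Q"
  by (simp_all add: zero_mat2_def one_mat2_def plus_mat2_def minus_mat2_def uminus_mat2_def times_mat2_def)

lemma mat2_eq_iff: "P = Q \<longleftrightarrow> m11 P = m11 Q \<and> m12 P = m12 Q \<and> m21 P = m21 Q \<and> m22 P = m22 Q"
  by (cases P; cases Q) auto

lemma of_int_mat2: "of_int k = Mat k 0 0 k"
proof -
  have n: "of_nat n = Mat (int n) 0 0 (int n)" for n by (induction n) (simp_all add: mat2_eq_iff)
  show ?thesis by (cases k rule: int_cases2) (simp_all add: n mat2_eq_iff)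
qed

lemma of_int_sel [simp]: "m11 (of_int k) = k" "m12 (of_int k) = 0" "m21 (of_int k) = 0" "m22 (of_int k) = k"
  by (simp_all add: of_int_mat2)

lemma numeral_sel [simp]:
  "m11 (numeral k) = numeral k" "m12 (numeral k) = 0" "m21 (numeral k) = 0" "m22 (numeral k) = numeral k"
  using of_int_sel[of "numeral k"] by simp_all

lemma of_nat_sel [simp]: "m11 (of_nat k) = int k" "m12 (of_nat k) = 0" "m21 (of_nat k) = 0" "m22 (of_nat k) = int k"
  using of_int_sel[of "int k"] by simp_all

lemma of_int_power_sel [simp]:
  "m11 (of_int k ^ m) = k ^ m" "m12 (of_int k ^ m) = 0" "m21 (of_int k ^ m) = 0" "m22 (of_int k ^ m) = k ^ m"
  using of_int_sel[of "k ^ m"] by simp_all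

lemma numeral_power_sel [simp]:
  "m11 (numeral k ^ m) = numeral k ^ m" "m12 (numeral k ^ m) = 0" "m21 (numeral k ^ m) = 0" "m22 (numeral k ^ m) = numeral k ^ m"
  using of_int_power_sel[of "numeral k" m] by simp_all

definition det2 :: "mat2 \<Rightarrow> int" where "det2 P = m11 P * m22 P - m12 P * m21 P"
definition adj2 :: "mat2 \<Rightarrow> mat2" where "adj2 P = Mat (m22 P) (- m12 P) (- m21 P) (m11 P)"
definition tr2 :: "mat2 \<Rightarrow> int" where "tr2 P = m11 P + m22 P"

lemma det2_mult: "det2 (P * Q) = det2 P * det2 Q"
  by (simp add: det2_def algebra_simps)

lemma adj2_mult: "adj2 P * P = of_int (det2 P)" "P * adj2 P = of_int (det2 P)"
  by (simp_all add: mat2_eq_iff adj2_def det2_def)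

lemma of_int_comm: "(of_int k :: mat2) * P = P * of_int k"
  by (simp add: mat2_eq_iff)

section \<open>Congruences of matrices and powers modulo a prime power\<close>

definition mcong :: "int \<Rightarrow> mat2 \<Rightarrow> mat2 \<Rightarrow> bool" where
  "mcong M P Q \<longleftrightarrow> M dvd m11 P - m11 Q \<and> M dvd m12 P - m12 Q \<and> M dvd m21 P - m21 Q \<and> M dvd m22 P - m22 Q"

lemma mcong_iff: "mcong M P Q \<longleftrightarrow> (\<exists>C. P = Q + of_int M * C)"
proof
  assume "mcong M P Q"
  then obtain a b c d where "m11 P - m11 Q = M * a" "m12 P - m12 Q = M * b" "m21 P - m21 Q = M * c" "m22 P - m22 Q = M * d"
    unfolding mcong_def dvd_def by blast
  then have "P = Q + of_int M * Mat a b c d" by (simp add: mat2_eq_iff algebra_simps)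
  then show "\<exists>C. P = Q + of_int M * C" by blast
next
  assume "\<exists>C. P = Q + of_int M * C"
  then show "mcong M P Q" by (auto simp: mcong_def)
qed

lemma mcong_refl [simp, intro]: "mcong M P P" by (simp add: mcong_def)
lemma mcong_sym: "mcong M P Q \<Longrightarrow> mcong M Q P" by (simp add: mcong_def dvd_diff_commute)
lemma mcong_trans [trans]: "mcong M P Q \<Longrightarrow> mcong M Q S \<Longrightarrow> mcong M P S"
  unfolding mcong_def by (metis (no_types, opaque_lifting) diff_add_cancel dvd_add add_diff_eq diff_add_eq)
lemma mcong_eq_trans [trans]: "P = Q \<Longrightarrow> mcong M Q S \<Longrightarrow> mcong M P S" "mcong M P Q \<Longrightarrow> Q = S \<Longrightarrow> mcong M P S" by auto
lemma mcong_add: "mcong M P Q \<Longrightarrow> mcong M P' Q' \<Longrightarrow> mcong M (P + P') (Q + Q')"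
  unfolding mcong_def by (simp add: add_diff_add)
lemma mcong_diff: "mcong M P Q \<Longrightarrow> mcong M P' Q' \<Longrightarrow> mcong M (P - P') (Q - Q')"
  unfolding mcong_def mat2_sel by (intro conjI; elim conjE; Groebner_Basis.algebra)
lemma mcong_mult: "mcong M P Q \<Longrightarrow> mcong M P' Q' \<Longrightarrow> mcong M (P * P') (Q * Q')"
  unfolding mcong_def mat2_sel by (intro conjI; elim conjE; Groebner_Basis.algebra)
lemma mcong_pow: "mcong M P Q \<Longrightarrow> mcong M (P ^ k) (Q ^ k)"
  by (induction k) (auto intro: mcong_mult)
lemma mcong_dvd: "mcong M P Q \<Longrightarrow> N dvd M \<Longrightarrow> mcong N P Q"
  unfolding mcong_def using dvd_trans by blast
lemma mcong_diff_0: "mcong M P Q \<longleftrightarrow> mcong M (P - Q) 0"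
  by (simp add: mcong_def)
lemma mcong_det: "mcong M P Q \<Longrightarrow> M dvd det2 P - det2 Q"
  unfolding mcong_def det2_def by (elim conjE) Groebner_Basis.algebra

lemma mcong_absorb: "M dvd x \<Longrightarrow> mcong M (P + of_int x * C) P"
  by (simp add: mcong_def)

lemma mcong_cancel:
  assumes "mcong M (of_int k * P) (of_int k * Q)" "coprime k M" shows "mcong M P Q"
proof -
  have "M dvd k * (m11 P - m11 Q)" "M dvd k * (m12 P - m12 Q)" "M dvd k * (m21 P - m21 Q)" "M dvd k * (m22 P - m22 Q)"
    using assms(1) by (simp_all add: mcong_def right_diff_distrib)
  then show ?thesis using assms(2) by (simp add: mcong_def coprime_dvd_mult_right_iff coprime_commute)
qed

lemma binomial_commute:
  fixes a b :: "'r::ring_1"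
  assumes "a * b = b * a"
  shows "(a + b) ^ n = (\<Sum>k\<le>n. of_nat (n choose k) * (a ^ k * b ^ (n - k)))"
proof (induction n)
  case (Suc n)
  have ab: "a ^ k * b = b * a ^ k" for k using assms by (simp add: power_commuting_commutes)
  have "(a + b) ^ Suc n = a * (\<Sum>k\<le>n. of_nat (n choose k) * (a ^ k * b ^ (n - k))) + b * (\<Sum>k\<le>n. of_nat (n choose k) * (a ^ k * b ^ (n - k)))"
    by (simp add: Suc.IH distrib_right)
  also have "a * (\<Sum>k\<le>n. of_nat (n choose k) * (a ^ k * b ^ (n - k))) = (\<Sum>k\<le>n. of_nat (n choose k) * (a ^ Suc k * b ^ (n - k)))"
    unfolding sum_distrib_left
  proof (rule sum.cong[OF refl])
    fix k
    have "a * (of_nat (n choose k) * (a ^ k * b ^ (n - k))) = (a * of_nat (n choose k)) * (a ^ k * b ^ (n - k))"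
      by (simp only: mult.assoc)
    also have "a * of_nat (n choose k) = of_nat (n choose k) * a" by (rule mult_of_nat_commute[symmetric])
    finally show "a * (of_nat (n choose k) * (a ^ k * b ^ (n - k))) = of_nat (n choose k) * (a ^ Suc k * b ^ (n - k))"
      by (simp only: mult.assoc power_Suc)
  qed
  also have "b * (\<Sum>k\<le>n. of_nat (n choose k) * (a ^ k * b ^ (n - k))) = (\<Sum>k\<le>n. of_nat (n choose k) * (a ^ k * b ^ (Suc n - k)))"
    unfolding sum_distrib_left
  proof (rule sum.cong[OF refl])
    fix k assume "k \<in> {..n}"
    then have "b ^ (Suc n - k) = b * b ^ (n - k)" by (simp add: Suc_diff_le)
    moreover have "b * (of_nat (n choose k) * (a ^ k * b ^ (n - k))) = of_nat (n choose k) * (b * a ^ k * b ^ (n - k))"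
      by (simp only: mult.assoc[symmetric] mult_of_nat_commute[of "n choose k" b])
    ultimately show "b * (of_nat (n choose k) * (a ^ k * b ^ (n - k))) = of_nat (n choose k) * (a ^ k * b ^ (Suc n - k))"
      by (simp add: mult.assoc flip: ab)
  qed
  also have "(\<Sum>k\<le>n. of_nat (n choose k) * (a ^ Suc k * b ^ (n - k))) = (\<Sum>k=1..Suc n. of_nat (n choose (k - 1)) * (a ^ k * b ^ (Suc n - k)))"
    by (rule sum.reindex_bij_witness[of _ "\<lambda>k. k - 1" Suc]) auto
  also have "\<dots> = (\<Sum>k\<le>Suc n. (if k = 0 then 0 else of_nat (n choose (k - 1))) * (a ^ k * b ^ (Suc n - k)))"
    by (rule sum.mono_neutral_cong_left) auto
  also have "(\<Sum>k\<le>n. of_nat (n choose k) * (a ^ k * b ^ (Suc n - k))) = (\<Sum>k\<le>Suc n. of_nat (n choose k) * (a ^ k * b ^ (Suc n - k)))"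
    by (simp add: binomial_eq_0)
  also have "(\<Sum>k\<le>Suc n. (if k = 0 then 0 else of_nat (n choose (k - 1))) * (a ^ k * b ^ (Suc n - k))) +
     (\<Sum>k\<le>Suc n. of_nat (n choose k) * (a ^ k * b ^ (Suc n - k))) = (\<Sum>k\<le>Suc n. of_nat (Suc n choose k) * (a ^ k * b ^ (Suc n - k)))"
    unfolding sum.distrib[symmetric]
  proof (rule sum.cong[OF refl])
    fix k
    show "(if k = 0 then 0 else of_nat (n choose (k - 1))) * (a ^ k * b ^ (Suc n - k)) + of_nat (n choose k) * (a ^ k * b ^ (Suc n - k))
       = of_nat (Suc n choose k) * (a ^ k * b ^ (Suc n - k))"
      by (cases k) (simp_all add: distrib_right)
  qed
  finally show ?case .
qed simp

lemma frobenius_mat2: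
  fixes P Q :: mat2
  assumes "P * Q = Q * P" "Factorial_Ring.prime p"
  shows "mcong (int p) ((P + Q) ^ p) (P ^ p + Q ^ p)"
proof -
  have p0: "p > 0" using assms(2) prime_gt_0_nat by blast
  have dv: "\<exists>C. (\<Sum>k\<in>K. of_nat (p choose k) * (P ^ k * Q ^ (p - k))) = of_int (int p) * C" if "finite K" "K \<subseteq> {0<..<p}" for K
    using that
  proof (induction K)
    case empty
    then show ?case by (intro exI[of _ 0]) simp
  next
    case (insert k K)
    then obtain C where C: "(\<Sum>k\<in>K. of_nat (p choose k) * (P ^ k * Q ^ (p - k))) = of_int (int p) * C" by auto
    have "p dvd (p choose k)" using insert.prems assms(2) by (intro dvd_choose_prime) auto
    then obtain e where "p choose k = p * e" by (elim dvdE)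
    then have "(of_nat (p choose k) :: mat2) = of_int (int p) * of_nat e" by simp
    then have "(\<Sum>k\<in>insert k K. of_nat (p choose k) * (P ^ k * Q ^ (p - k))) = of_int (int p) * (of_nat e * (P ^ k * Q ^ (p - k)) + C)"
      using insert.hyps C by (simp add: distrib_left mult.assoc)
    then show ?case by blast
  qed
  obtain C where C: "(\<Sum>k\<in>{0<..<p}. of_nat (p choose k) * (P ^ k * Q ^ (p - k))) = of_int (int p) * C" using dv[of "{0<..<p}"] by auto
  have "{..p} = insert 0 (insert p {0<..<p})" using p0 by auto
  then have "(P + Q) ^ p = Q ^ p + (P ^ p + of_int (int p) * C)"
    unfolding binomial_commute[OF assms(1)] using p0 C by simp
  then show ?thesis unfolding mcong_iff by (metis add.assoc add.commute)
qed

text \<open>In the expansion of \<open>(l + p^i C)^p\<close> the linear term carries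
  \<open>p * p^i\<close> and the further ones at least \<open>p^(2 i)\<close>. Iterated, this turns
  a scalar modulo \<open>p\<close> into a scalar modulo \<open>p^n\<close> by raising to the power
  \<open>p^(n - 1)\<close>.\<close>

lemma mcong_scalar_pow:
  assumes "mcong (int p ^ i) P (of_int l)" "i \<ge> 1"
  shows "mcong (int p ^ Suc i) (P ^ p) (of_int (l ^ p))"
proof -
  define q where "q = int p ^ i"
  obtain C where C: "P = of_int l + of_int q * C" using assms(1) unfolding mcong_iff q_def by blast
  have "mcong (int p ^ Suc i) (P ^ k) (of_int (l ^ k) + of_int (int k * l ^ (k - 1) * q) * C)" for k
  proof (induction k)
    case (Suc k)
    have expand: "(of_int l + of_int q * C) * (of_int x + of_int (y * q) * C) =
        of_int (l * x) + of_int (y * l * q + x * q) * C + of_int (q * q) * (of_int y * C * C)" for x y :: int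
      by (simp add: mat2_eq_iff algebra_simps)
    have qq: "int p ^ Suc i dvd q * q" unfolding q_def power_add[symmetric] using assms(2) by (intro le_imp_power_dvd) simp
    have k: "int k * l ^ (k - 1) * l = int k * l ^ k" by (cases k) simp_all
    have "P ^ Suc k = (of_int l + of_int q * C) * P ^ k" using C by simp
    also have "mcong (int p ^ Suc i) ((of_int l + of_int q * C) * P ^ k) ((of_int l + of_int q * C) * (of_int (l ^ k) + of_int (int k * l ^ (k - 1) * q) * C))"
      using Suc by (intro mcong_mult) auto
    also have "(of_int l + of_int q * C) * (of_int (l ^ k) + of_int (int k * l ^ (k - 1) * q) * C) =
       of_int (l ^ Suc k) + of_int (int (Suc k) * l ^ k * q) * C + of_int (q * q) * (of_int (int k * l ^ (k - 1)) * C * C)"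
    proof -
      have "(of_int l + of_int q * C) * (of_int (l ^ k) + of_int (int k * l ^ (k - 1) * q) * C) =
        of_int (l ^ Suc k) + of_int ((int k * l ^ (k - 1) * l) * q + l ^ k * q) * C + of_int (q * q) * (of_int (int k * l ^ (k - 1)) * C * C)"
        unfolding expand by (simp add: mult.commute)
      then show ?thesis unfolding k by (simp add: algebra_simps)
    qed
    also have "mcong (int p ^ Suc i) \<dots> (of_int (l ^ Suc k) + of_int (int (Suc k) * l ^ k * q) * C)"
      by (rule mcong_absorb[OF qq])
    finally show ?case by simp
  qed simp
  from this[of p] have "mcong (int p ^ Suc i) (P ^ p) (of_int (l ^ p) + of_int (int p * l ^ (p - 1) * q) * C)" .
  also have "mcong (int p ^ Suc i) \<dots> (of_int (l ^ p))"
    by (rule mcong_absorb) (simp add: q_def)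
  finally show ?thesis .
qed

lemma mcong_scalar_pow_iter:
  assumes "mcong (int p) P (of_int l)"
  shows "mcong (int p ^ Suc i) (P ^ (p ^ i)) (of_int (l ^ (p ^ i)))"
proof (induction i)
  case (Suc i)
  then show ?case using mcong_scalar_pow[OF Suc] by (simp add: power_mult[symmetric] mult.commute)
qed (use assms in simp)

lemma fermat_iter:
  assumes "Factorial_Ring.prime p" shows "int p dvd l ^ (p ^ i) - l"
proof -
  have f: "int p dvd x ^ p - x" for x :: int
  proof (cases "int p dvd x")
    case True
    then show ?thesis using prime_gt_0_nat[OF assms] by (simp add: dvd_power_iff dvd_power_same dvd_diff dvd_trans[OF _ dvd_power])
  next
    case False
    have "coprime x (int p)" using False assms by (metis coprime_commute prime_imp_coprime prime_nat_int_transfer)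
    define y where "y = nat (x mod int p)"
    have y: "int y = x mod int p" using prime_gt_0_nat[OF assms] by (simp add: y_def)
    have "\<not> p dvd y" using False y by (metis dvd_mod_iff of_nat_dvd_iff dvd_refl)
    then have "[y ^ (p - 1) = 1] (mod p)" using assms fermat_theorem by blast
    then have "[int y ^ (p - 1) = 1] (mod int p)" by (metis cong_int_iff of_nat_1 of_nat_power)
    moreover have "[x = int y] (mod int p)" by (simp add: y cong_def)
    ultimately have "[x ^ (p - 1) = 1] (mod int p)" using cong_pow cong_trans by blast
    then have "int p dvd x * (x ^ (p - 1) - 1)" by (simp add: cong_iff_dvd_diff)
    moreover have "x ^ p = x * x ^ (p - 1)" using prime_gt_0_nat[OF assms] by (metis power_eq_if not_gr_zero)
    ultimately show ?thesis by (simp add: algebra_simps)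
  qed
  show ?thesis
  proof (induction i)
    case (Suc i)
    have "l ^ (p ^ Suc i) - l = ((l ^ (p ^ i)) ^ p - l ^ (p ^ i)) + (l ^ (p ^ i) - l)" by (simp add: power_mult[symmetric] mult.commute)
    then show ?case using f[of "l ^ (p ^ i)"] Suc by (metis dvd_add)
  qed simp
qed

section \<open>Eigenvalues and eigenvectors modulo a prime power\<close>

lemma hensel_quadratic:
  fixes t d l :: int
  assumes p: "Factorial_Ring.prime p" and "int p dvd l^2 - t * l + d" "\<not> int p dvd 2 * l - t"
  shows "\<exists>m. int p dvd m - l \<and> int p ^ n dvd m^2 - t * m + d"
proof (induction n)
  case (Suc n)
  show ?case
  proof (cases "n = 0")
    case True
    then show ?thesis using assms(2) by (intro exI[of _ l]) simp
  next
    case False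
    obtain m where m: "int p dvd m - l" "int p ^ n dvd m^2 - t * m + d" using Suc by blast
    obtain e where e: "m^2 - t * m + d = int p ^ n * e" using m(2) by (elim dvdE)
    have "\<not> int p dvd 2 * m - t"
    proof
      assume "int p dvd 2 * m - t"
      then have "int p dvd 2 * l - t" using m(1) by Groebner_Basis.algebra
      then show False using assms(3) by simp
    qed
    then have "coprime (2 * m - t) (int p)" using p by (metis coprime_commute prime_imp_coprime prime_nat_int_transfer)
    then obtain v where v: "[(2 * m - t) * v = 1] (mod int p)" using cong_solve_coprime_int by blast
    define k where "k = - e * v"
    have "int p dvd (2 * m - t) * v - 1" using v by (simp add: cong_iff_dvd_diff)
    then have "int p dvd e + (2 * m - t) * k" unfolding k_def by Groebner_Basis.algebra
    then have 1: "int p ^ Suc n dvd int p ^ n * (e + (2 * m - t) * k)" by (simp add: mult.commute mult_dvd_mono)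
    have 2: "int p ^ Suc n dvd int p ^ n * int p ^ n * k^2"
    proof -
      have "int p ^ Suc n dvd int p ^ (n + n)" using False by (intro le_imp_power_dvd) simp
      then show ?thesis by (simp only: power_add dvd_mult2)
    qed
    have "(m + w * k)^2 - t * (m + w * k) + d = w * (e + (2 * m - t) * k) + w * w * k^2"
      if "m^2 - t * m + d = w * e" for w
      using that by Groebner_Basis.algebra
    from this[OF e] have "int p ^ Suc n dvd (m + int p ^ n * k)^2 - t * (m + int p ^ n * k) + d" using 1 2 by (metis dvd_add)
    moreover have "int p dvd (m + int p ^ n * k) - l"
    proof -
      have "int p dvd int p ^ n * k" using False by (simp add: dvd_power)
      then show ?thesis using m(1) by (metis add_diff_eq add.commute dvd_add)
    qed
    ultimately show ?thesis by blast
  qed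
qed (intro exI[of _ l], simp)

text \<open>By Cayley-Hamilton the columns of \<open>T - l2\<close> are eigenvectors for
  \<open>l1\<close>, and those of \<open>T - l1\<close> for \<open>l2\<close>. Which two columns
  form a basis modulo \<open>p\<close> depends on which entries are units, whence the four choices
  of \<open>Q\<close>; some entries are rewritten by \<open>l1 + l2 = tr2 T\<close>.\<close>

lemma eigenbasis:
  fixes l1 l2 :: int
  assumes p: "Factorial_Ring.prime p" and n: "n > 0" and t: "int p ^ n dvd l1 + l2 - tr2 T" and d: "int p ^ n dvd l1 * l2 - det2 T"
    and ne: "\<not> int p dvd l1 - l2"
  shows "\<exists>Q. \<not> int p dvd det2 Q \<and> mcong (int p ^ n) (T * Q) (Q * Mat l1 0 0 l2)"
proof -
  define a b c e where "a = m11 T" "b = m12 T" "c = m21 T" "e = m22 T"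
  define q where "q = int p ^ n"
  have pq: "int p dvd q" using n by (simp add: q_def)
  have t': "q dvd l1 + l2 - (a + e)" and d': "q dvd l1 * l2 - (a * e - b * c)"
    using t d by (simp_all add: q_def a_b_c_e_def tr2_def det2_def)
  have T: "T = Mat a b c e" by (simp add: a_b_c_e_def)
  have pt: "int p dvd l1 + l2 - (a + e)" and pd: "int p dvd l1 * l2 - (a * e - b * c)" using t' d' pq dvd_trans by blast+
  have pp: "Factorial_Ring.prime (int p)" using p by simp
  have pm: "int p dvd x * y \<longleftrightarrow> int p dvd x \<or> int p dvd y" for x y using pp prime_dvd_mult_iff by blast
  note ne' = ne ne[unfolded dvd_diff_commute[of _ l1 l2]]
  consider "\<not> int p dvd b" | "\<not> int p dvd c" | "int p dvd b" "int p dvd c" by blast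
  then show ?thesis
  proof cases
    case 1
    have "det2 (Mat b b (l1 - a) (l2 - a)) = b * (l2 - l1)" by (simp add: det2_def algebra_simps)
    then have "\<not> int p dvd det2 (Mat b b (l1 - a) (l2 - a))" using 1 ne' by (simp add: pm)
    moreover have "mcong q (T * Mat b b (l1 - a) (l2 - a)) (Mat b b (l1 - a) (l2 - a) * Mat l1 0 0 l2)"
      unfolding mcong_def T mat2_sel mat2.sel using t' d' by - (intro conjI; (Groebner_Basis.algebra | simp add: algebra_simps))
    ultimately show ?thesis unfolding q_def by blast
  next
    case 2
    have "det2 (Mat (l1 - e) (l2 - e) c c) = c * (l1 - l2)" by (simp add: det2_def algebra_simps)
    then have "\<not> int p dvd det2 (Mat (l1 - e) (l2 - e) c c)" using 2 ne' by (simp add: pm)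
    moreover have "mcong q (T * Mat (l1 - e) (l2 - e) c c) (Mat (l1 - e) (l2 - e) c c * Mat l1 0 0 l2)"
      unfolding mcong_def T mat2_sel mat2.sel using t' d' by - (intro conjI; (Groebner_Basis.algebra | simp add: algebra_simps))
    ultimately show ?thesis unfolding q_def by blast
  next
    case 3
    have "int p dvd (l1 - a) * (l1 - e)" using 3 pt pd by Groebner_Basis.algebra
    then consider "int p dvd l1 - a" | "int p dvd l1 - e" by (auto simp: pm)
    then show ?thesis
    proof cases
      case 1
      let ?Q = "Mat (l1 - e) b c (l2 - a)"
      have "\<not> int p dvd det2 ?Q"
      proof
        assume "int p dvd det2 ?Q"
        then have "int p dvd (l1 - e) * (l2 - a) - b * c" by (simp add: det2_def)
        then have "int p dvd (l1 - l2) * (l1 - l2)" using 1 3 pt by Groebner_Basis.algebra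
        then show False using ne by (simp add: pm)
      qed
      moreover have "mcong q (T * ?Q) (?Q * Mat l1 0 0 l2)"
        unfolding mcong_def T mat2_sel mat2.sel using t' d' by - (intro conjI; (Groebner_Basis.algebra | simp add: algebra_simps))
      ultimately show ?thesis unfolding q_def by blast
    next
      case 2
      let ?Q = "Mat b (l2 - e) (l1 - a) c"
      have "\<not> int p dvd det2 ?Q"
      proof
        assume "int p dvd det2 ?Q"
        then have "int p dvd b * c - (l2 - e) * (l1 - a)" by (simp add: det2_def)
        then have "int p dvd (l1 - l2) * (l1 - l2)" using 2 3 pt by Groebner_Basis.algebra
        then show False using ne by (simp add: pm)
      qed
      moreover have "mcong q (T * ?Q) (?Q * Mat l1 0 0 l2)"
        unfolding mcong_def T mat2_sel mat2.sel using t' d' by - (intro conjI; (Groebner_Basis.algebra | simp add: algebra_simps))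
      ultimately show ?thesis unfolding q_def by blast
    qed
  qed
qed

section \<open>Locally trivial cocycles modulo a prime power\<close>

locale local_rep = group G for G (structure) +
  fixes R :: "'a \<Rightarrow> mat2" and p n :: nat
  assumes fin: "finite (carrier G)" and prime: "Factorial_Ring.prime p" and p5: "p \<ge> 5" and n0: "n > 0"
    and hom: "\<And>g h. g \<in> carrier G \<Longrightarrow> h \<in> carrier G \<Longrightarrow> mcong (int p ^ n) (R (g \<otimes> h)) (R g * R h)"
    and rho_one: "mcong (int p ^ n) (R \<one>) 1"
begin

abbreviation "q \<equiv> int p ^ n"

lemma prime_int: "Factorial_Ring.prime (int p)" using prime by simp

lemma p_dvd_mult: "int p dvd x * y \<longleftrightarrow> int p dvd x \<or> int p dvd y"
  using prime_int prime_dvd_mult_iff by blast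

lemma p_dvd_q: "int p dvd q" using n0 by simp

lemma pe_dvd_q: "e \<le> n \<Longrightarrow> int p ^ e dvd q" by (rule le_imp_power_dvd)

lemma cancel: "\<not> int p dvd x \<Longrightarrow> int p ^ e dvd x * y \<Longrightarrow> int p ^ e dvd y"
  using prime_int by (metis coprime_dvd_mult_right_iff coprime_power_left_iff prime_imp_coprime)

lemma p_not_dvd_small: "\<not> int p dvd 2" "\<not> int p dvd 1" "\<not> int p dvd 4" "\<not> int p dvd - 1 - 1"
  using p5 zdvd_imp_le[of "int p"] by (auto dest!: zdvd_imp_le)

lemma exists_nat_mod: "\<exists>m::nat. int p ^ e dvd x - int m"
proof -
  have "int (nat (x mod int p ^ e)) = x mod int p ^ e" using p5 by simp
  then have "int p ^ e dvd x - int (nat (x mod int p ^ e))" by (simp add: minus_mod_eq_mult_div)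
  then show ?thesis by blast
qed

lemma inverse_mod: "\<not> int p dvd x \<Longrightarrow> \<exists>y. int p ^ e dvd x * y - 1"
proof -
  assume "\<not> int p dvd x"
  then have "coprime x (int p ^ e)" using prime_int by (metis coprime_commute coprime_power_left_iff prime_imp_coprime)
  then obtain y where "[x * y = 1] (mod int p ^ e)" using cong_solve_coprime_int by blast
  then show ?thesis by (auto simp: cong_iff_dvd_diff)
qed

lemma homM: "M dvd q \<Longrightarrow> g \<in> carrier G \<Longrightarrow> h \<in> carrier G \<Longrightarrow> mcong M (R (g \<otimes> h)) (R g * R h)"
  using hom mcong_dvd by blast

lemma rho_pow: "M dvd q \<Longrightarrow> g \<in> carrier G \<Longrightarrow> mcong M (R (g [^] (k::nat))) (R g ^ k)"
proof (induction k)
  case 0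
  then show ?case using rho_one mcong_dvd by auto
next
  case (Suc k)
  have "mcong M (R (g [^] k \<otimes> g)) (R (g [^] k) * R g)" using Suc by (intro homM) auto
  also have "mcong M (R (g [^] k) * R g) (R g ^ k * R g)" using Suc by (intro mcong_mult) auto
  finally show ?case by (simp add: power_commutes)
qed

lemma rho_inv:
  assumes "M dvd q" "g \<in> carrier G" shows "mcong M (R (inv g) * R g) 1" "mcong M (R g * R (inv g)) 1"
proof -
  have o: "mcong M (R \<one>) 1" using rho_one assms(1) mcong_dvd by blast
  show "mcong M (R (inv g) * R g) 1" using mcong_trans[OF mcong_sym[OF homM[OF assms(1), of "inv g" g]]] o assms by simp
  show "mcong M (R g * R (inv g)) 1" using mcong_trans[OF mcong_sym[OF homM[OF assms(1), of g "inv g"]]] o assms by simp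
qed

lemma det_unit: "g \<in> carrier G \<Longrightarrow> \<not> int p dvd det2 (R g)"
proof
  assume g: "g \<in> carrier G" and d: "int p dvd det2 (R g)"
  have "int p dvd det2 (R (inv g) * R g) - det2 1" using mcong_det[OF rho_inv(1)[OF p_dvd_q g]] .
  then have "int p dvd det2 (R (inv g)) * det2 (R g) - 1" by (simp add: det2_mult) (simp add: det2_def)
  then have "int p dvd 1" using d by Groebner_Basis.algebra
  then show False using p_not_dvd_small by simp
qed

text \<open>\<open>W\<close> holds two vectors, one in each column.\<close>

definition fixes_no_vector :: bool where
  "fixes_no_vector \<longleftrightarrow> (\<forall>W. (\<forall>g\<in>carrier G. mcong (int p) (R g * W) W) \<longrightarrow> mcong (int p) W 0)"

definition no_scalars :: bool where
  "no_scalars \<longleftrightarrow> (\<forall>s\<in>carrier G. \<forall>l. mcong (int p) (R s) (of_int l) \<longrightarrow> int p dvd l - 1)"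

text \<open>An element of determinant \<open>d \<noteq> 1\<close> modulo \<open>p\<close> without rational eigenvalue has the scalar \<open>d\<close> as its
  \<open>(p + 1)\<close>-st power.\<close>

lemma distinct_eigenvalues:
  assumes ns: no_scalars and g: "g \<in> carrier G" and d: "\<not> int p dvd det2 (R g) - 1"
  shows "\<exists>l1 l2. int p dvd l1 + l2 - tr2 (R g) \<and> int p dvd l1 * l2 - det2 (R g) \<and> \<not> int p dvd l1 - l2"
proof -
  define A t \<delta> where "A = R g" "t = tr2 (R g)" "\<delta> = det2 (R g)"
  define D where "D = t^2 - 4 * \<delta>"
  \<comment> \<open>The traceless part of \<open>2 A\<close>, with square \<open>D\<close>. For
    \<open>p = 2 k + 1\<close> the Frobenius map gives \<open>(2 A)^p = t + D^k N\<close> modulo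
    \<open>p\<close>, and everything depends on whether \<open>D^k\<close> is 0, -1 or 1.\<close>
  define N where "N = of_int 2 * A - of_int t"
  have NN: "N * N = of_int D"
    by (simp add: mat2_eq_iff N_def D_def A_t_\<delta>_def tr2_def det2_def algebra_simps power2_eq_square)
  have "odd p" using prime p5 by (simp add: prime_odd_nat)
  then obtain k where k: "p = 2 * k + 1" by (rule oddE)
  have k0: "k > 0" using k p5 by simp
  have Np: "N ^ p = of_int (D ^ k) * N"
  proof -
    have "N ^ p = N ^ (2 * k) * N" unfolding k by (simp only: power_add power_one_right)
    also have "N ^ (2 * k) = (N * N) ^ k" by (simp only: power_mult power2_eq_square)
    finally show ?thesis by (simp add: NN)
  qed
  have "of_int t + N = of_int 2 * A" by (simp add: N_def)
  then have fr: "mcong (int p) ((of_int 2 * A) ^ p) (of_int (t ^ p) + of_int (D ^ k) * N)"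
    using frobenius_mat2[of "of_int t" N p] prime of_int_comm Np by simp
  have "mcong (int p) (of_int (t ^ p)) (of_int t)" using fermat_iter[OF prime, of t 1] by (simp add: mcong_def del: of_int_power)
  then have fr2: "mcong (int p) ((of_int 2 * A) ^ p) (of_int t + of_int (D ^ k) * N)"
    using mcong_trans[OF fr] mcong_add by blast
  have pow2: "(of_int 2 * A) ^ m = of_int (2 ^ m) * A ^ m" for m
  proof (induction m)
    case (Suc m)
    have "(of_int 2 * A) ^ Suc m = of_int 2 * A * (of_int (2 ^ m) * A ^ m)" using Suc by simp
    also have "\<dots> = of_int (2 ^ Suc m) * A ^ Suc m" by (simp add: mat2_eq_iff algebra_simps)
    finally show ?case .
  qed simp
  have f2: "int p dvd 2 ^ p - 2" using fermat_iter[OF prime, of 2 1] by simp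
  \<comment> \<open>\<open>(p + 1) / 2\<close>, the inverse of 2 modulo \<open>p\<close>.\<close>
  define i where "i = int k + 1"
  have i2: "int p dvd 2 * i - 1" by (simp add: i_def k)
  \<comment> \<open>If \<open>D = 0\<close>, then \<open>A^p\<close> is the scalar
    \<open>t / 2\<close>. If \<open>D\<close> is not a square, \<open>(2 A)^p\<close> is twice the
    adjugate of \<open>A\<close>, and \<open>A^(p + 1)\<close> is the scalar
    \<open>\<delta>\<close>. The absence of nontrivial scalars forces \<open>\<delta> = 1\<close> in
    both cases. If \<open>D = s^2\<close>, the eigenvalues are
    \<open>(t \<plusminus> s) / 2\<close>.\<close>
  consider "int p dvd D" | "\<not> int p dvd D" "\<not> QuadRes (int p) D" | "\<not> int p dvd D" "QuadRes (int p) D" by blast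
  then show ?thesis
  proof cases
    case 1
    then have "int p dvd D ^ k" using k0 by (metis dvd_power dvd_trans dvd_power_same neq0_conv dvd_refl power_one_right le_imp_power_dvd Suc_leI One_nat_def)
    then have "mcong (int p) (of_int t + of_int (D ^ k) * N) (of_int t)" by (rule mcong_absorb)
    with fr2 have "mcong (int p) (of_int (2 ^ p) * A ^ p) (of_int t)" unfolding pow2 by (rule mcong_trans)
    moreover have "mcong (int p) (of_int i * (of_int (2 ^ p) * A ^ p)) (A ^ p)"
    proof -
      have "int p dvd i * w - 1" if "int p dvd w - 2" for w using that i2 by Groebner_Basis.algebra
      from this[OF f2] have "int p dvd i * 2 ^ p - 1" .
      then have "mcong (int p) (of_int (i * 2 ^ p)) (of_int 1)" by (simp add: mcong_def del: of_int_power of_int_mult)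
      then have "mcong (int p) (of_int (i * 2 ^ p) * A ^ p) (of_int 1 * A ^ p)" by (intro mcong_mult) auto
      then show ?thesis by (simp add: mult.assoc)
    qed
    ultimately have "mcong (int p) (A ^ p) (of_int i * of_int t)"
      using mcong_mult[of "int p" "of_int i" "of_int i"] mcong_sym mcong_trans by blast
    then have "mcong (int p) (R (g [^] p)) (of_int (i * t))" using mcong_trans[OF rho_pow[OF p_dvd_q g, of p]] A_t_\<delta>_def by simp
    then have "int p dvd i * t - 1" using ns g unfolding no_scalars_def by blast
    then have "int p dvd 4 * (\<delta> - 1)" using i2 1 unfolding D_def by Groebner_Basis.algebra
    then have "int p dvd \<delta> - 1" unfolding p_dvd_mult using p_not_dvd_small(3) by blast
    then show ?thesis using d A_t_\<delta>_def by simp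
  next
    case 2
    have "[Legendre D (int p) = D ^ ((p - 1) div 2)] (mod int p)" using euler_criterion[of p D] prime p5 by simp
    moreover have "Legendre D (int p) = -1" using 2 by (simp add: Legendre_def cong_0_iff)
    moreover have "(p - 1) div 2 = k" using k by simp
    ultimately have "int p dvd - 1 - D ^ k" by (simp add: cong_iff_dvd_diff)
    then have Dk: "int p dvd D ^ k - (- 1)" by (subst dvd_diff_commute)
    then have "mcong (int p) (of_int (D ^ k)) (of_int (- 1))" by (simp add: mcong_def del: of_int_power)
    then have "mcong (int p) (of_int t + of_int (D ^ k) * N) (of_int t + of_int (- 1) * N)" by (intro mcong_add mcong_mult) auto
    with fr2 have "mcong (int p) ((of_int 2 * A) ^ p) (of_int t + of_int (- 1) * N)" by (rule mcong_trans)
    then have "mcong (int p) ((of_int 2 * A) ^ p * (of_int 2 * A)) ((of_int t + of_int (- 1) * N) * (of_int 2 * A))" by (intro mcong_mult) auto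
    also have "(of_int t + of_int (- 1) * N) * (of_int 2 * A) = of_int (4 * \<delta>)"
      by (simp add: mat2_eq_iff N_def A_t_\<delta>_def tr2_def det2_def algebra_simps)
    finally have 3: "mcong (int p) (of_int (2 ^ (p + 1)) * A ^ (p + 1)) (of_int (4 * \<delta>))"
      unfolding pow2[symmetric] by (simp add: power_commutes)
    have "int p dvd 2 * (2 ^ p - 2)" using f2 by (rule dvd_mult)
    then have "int p dvd 2 ^ (p + 1) - 4" by simp
    then have "mcong (int p) (of_int 4 * A ^ (p + 1)) (of_int (2 ^ (p + 1)) * A ^ (p + 1))"
      by (intro mcong_mult) (auto simp: mcong_def dvd_diff_commute simp del: of_int_power power_Suc)
    then have "mcong (int p) (of_int 4 * A ^ (p + 1)) (of_int 4 * of_int \<delta>)" using 3 mcong_trans by fastforce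
    moreover have "coprime 4 (int p)" using p_not_dvd_small(3) prime_int by (metis coprime_commute prime_imp_coprime)
    ultimately have "mcong (int p) (A ^ (p + 1)) (of_int \<delta>)" by (rule mcong_cancel)
    then have "mcong (int p) (R (g [^] (p + 1))) (of_int \<delta>)" using mcong_trans[OF rho_pow[OF p_dvd_q g, of "p + 1"]] A_t_\<delta>_def by simp
    then have "int p dvd \<delta> - 1" using ns g unfolding no_scalars_def by blast
    then show ?thesis using d A_t_\<delta>_def by simp
  next
    case 3
    then obtain s where "[s ^ 2 = D] (mod int p)" by (auto simp: QuadRes_def)
    then have s: "int p dvd s^2 - D" by (simp add: cong_iff_dvd_diff)
    have s0: "\<not> int p dvd s"
      by (rule contrapos_nn[of "int p dvd D"], use 3 in simp, use s in Groebner_Basis.algebra)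
    have "int p dvd i * (t + s) + i * (t - s) - t" using i2 by Groebner_Basis.algebra
    moreover have "int p dvd i * (t + s) * (i * (t - s)) - \<delta>"
    proof -
      have "i * (t + s) * (i * (t - s)) - \<delta> = (2 * i - 1) * ((2 * i + 1) * \<delta>) - (s^2 - D) * i^2"
        by (simp add: D_def algebra_simps power2_eq_square)
      then show ?thesis using i2 s by (metis dvd_diff dvd_mult2)
    qed
    moreover have "\<not> int p dvd i * (t + s) - i * (t - s)"
      by (rule contrapos_nn[of "int p dvd s"], use s0 in simp, use i2 in Groebner_Basis.algebra)
    ultimately show ?thesis unfolding A_t_\<delta>_def by blast
  qed
qed

text \<open>Two transvections with distinct axes generate \<open>SL\<^sub>2\<close> modulo \<open>p\<close>, in particular \<open>-1\<close>.\<close>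

lemma no_two_transvections:
  assumes ns: no_scalars and s: "s \<in> carrier G" "s' \<in> carrier G"
    and tr: "mcong (int p) (R s) (1 + P)" "mcong (int p) (R s') (1 + Q)" "mcong (int p) (P * P) 0" "mcong (int p) (Q * Q) 0"
    and th: "mcong (int p) (P * Q + Q * P) (of_int \<theta>)"
  shows "int p dvd \<theta>"
proof (rule ccontr)
  assume "\<not> int p dvd \<theta>"
  then obtain y where y: "int p dvd \<theta> * y - 1" using inverse_mod[of \<theta> 1] by auto
  obtain k where k: "int p dvd - y - int k" using exists_nat_mod[of 1 "- y"] by auto
  have kt: "int p dvd int k * \<theta> - (- 1)" using y k by Groebner_Basis.algebra
  have pw: "mcong (int p) (R (s [^] k)) (1 + of_int (int k) * P)" for k :: nat
  proof (induction k)
    case 0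
    then show ?case using rho_one mcong_dvd[OF _ p_dvd_q] by simp
  next
    case (Suc k)
    have "mcong (int p) (R (s [^] k \<otimes> s)) (R (s [^] k) * R s)" using s by (intro homM p_dvd_q) auto
    also have "mcong (int p) \<dots> ((1 + of_int (int k) * P) * (1 + P))" using Suc tr(1) by (intro mcong_mult)
    also have "(1 + of_int (int k) * P) * (1 + P) = (1 + of_int (int (Suc k)) * P) + of_int (int k) * (P * P)"
      by (simp add: algebra_simps mult.assoc)
    also have "mcong (int p) \<dots> ((1 + of_int (int (Suc k)) * P) + of_int (int k) * 0)" by (intro mcong_add mcong_mult tr(3)) auto
    finally show ?case by simp
  qed
  define K where "K = of_int (int k) * P"
  have KK: "mcong (int p) (K * K) 0"
  proof -
    have "K * K = of_int (int k * int k) * (P * P)" by (simp add: K_def mat2_eq_iff algebra_simps)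
    also have "mcong (int p) \<dots> (of_int (int k * int k) * 0)" by (intro mcong_mult tr(3)) auto
    finally show ?thesis by simp
  qed
  have KQ: "mcong (int p) (K * Q + Q * K) (- 1)"
  proof -
    have "K * Q + Q * K = of_int (int k) * (P * Q + Q * P)"
      by (simp add: K_def mat2_eq_iff algebra_simps)
    also have "mcong (int p) \<dots> (of_int (int k) * of_int \<theta>)" by (intro mcong_mult th) auto
    also have "of_int (int k) * of_int \<theta> = (of_int (int k * \<theta>) :: mat2)" by simp
    also have "mcong (int p) \<dots> (of_int (- 1))" using kt by (simp add: mcong_def del: of_int_mult)
    finally show ?thesis by simp
  qed
  \<comment> \<open>With \<open>k * \<theta> = - 1\<close> the product
    \<open>(1 + K) (1 + Q) (1 + K)\<close> collapses to \<open>K + Q\<close>, an analogue of the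
    Weyl element, whose square is -1.\<close>
  define x where "x = s [^] k \<otimes> s' \<otimes> s [^] k"
  have x: "x \<in> carrier G" using s by (simp add: x_def)
  have "mcong (int p) (R x) (R (s [^] k \<otimes> s') * R (s [^] k))" unfolding x_def using s by (intro homM p_dvd_q) auto
  also have "mcong (int p) \<dots> ((R (s [^] k) * R s') * R (s [^] k))" using s by (intro mcong_mult homM p_dvd_q) auto
  also have "mcong (int p) \<dots> (((1 + K) * (1 + Q)) * (1 + K))" unfolding K_def using pw tr by (intro mcong_mult) auto
  also have "((1 + K) * (1 + Q)) * (1 + K) = 1 + K + K + Q + (K * Q + Q * K) + K * K + (K * (K * Q + Q * K) - (K * K) * Q)"
    by (simp add: algebra_simps mult.assoc)
  also have "mcong (int p) \<dots> (1 + K + K + Q + (- 1) + 0 + (K * (- 1) - 0 * Q))"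
    by (intro mcong_add mcong_diff mcong_mult KQ KK) auto
  finally have xr: "mcong (int p) (R x) (K + Q)" by (simp add: algebra_simps)
  have "mcong (int p) (R (x \<otimes> x)) (R x * R x)" using x by (intro homM p_dvd_q)
  also have "mcong (int p) \<dots> ((K + Q) * (K + Q))" by (intro mcong_mult xr)
  also have "(K + Q) * (K + Q) = K * K + Q * Q + (K * Q + Q * K)" by (simp add: algebra_simps)
  also have "mcong (int p) \<dots> (0 + 0 + - 1)" by (intro mcong_add KK tr(4) KQ)
  finally have "mcong (int p) (R (x \<otimes> x)) (of_int (- 1))" by simp
  then have "int p dvd - 1 - 1" using ns x unfolding no_scalars_def by blast
  then show False using p_not_dvd_small by blast
qed

end

text \<open>Each column of \<open>Z\<close> is a cocycle with values in vectors. Matrices stand for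
  vectors so that the action is matrix multiplication; local triviality provides both columns of
  \<open>W\<close> together.\<close>

locale local_cocycle = local_rep +
  fixes Z :: "'a \<Rightarrow> mat2"
  assumes coc: "\<And>g h. g \<in> carrier G \<Longrightarrow> h \<in> carrier G \<Longrightarrow> mcong (int p ^ n) (Z (g \<otimes> h)) (Z g + R g * Z h)"
    and loc: "\<And>g. g \<in> carrier G \<Longrightarrow> \<exists>W. mcong (int p ^ n) (Z g) ((R g - 1) * W)"
begin

definition trivial_cocycle :: bool where
  "trivial_cocycle \<longleftrightarrow> (\<exists>W. \<forall>g\<in>carrier G. mcong q (Z g) ((R g - 1) * W))"

lemma cocM: "M dvd q \<Longrightarrow> g \<in> carrier G \<Longrightarrow> h \<in> carrier G \<Longrightarrow> mcong M (Z (g \<otimes> h)) (Z g + R g * Z h)"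
  using coc mcong_dvd by blast

lemma locM: "M dvd q \<Longrightarrow> g \<in> carrier G \<Longrightarrow> \<exists>W. mcong M (Z g) ((R g - 1) * W)"
  using loc mcong_dvd by blast

lemma Z_kernel: "M dvd q \<Longrightarrow> g \<in> carrier G \<Longrightarrow> mcong M (R g) 1 \<Longrightarrow> mcong M (Z g) 0"
proof -
  assume a: "M dvd q" "g \<in> carrier G" "mcong M (R g) 1"
  obtain W where W: "mcong M (Z g) ((R g - 1) * W)" using locM a by blast
  also have "mcong M \<dots> ((1 - 1) * W)" using a by (intro mcong_mult mcong_diff) auto
  finally show ?thesis by simp
qed

text \<open>On elements that are trivial modulo \<open>M\<close> the cocycle vanishes modulo
  \<open>M\<close> by local triviality. Hence two group elements can be compared as soon as their
  matrices agree at the level considered, even if they differ in \<open>G\<close>.\<close>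

lemma Z_dep:
  assumes "M dvd q" "g \<in> carrier G" "h \<in> carrier G" "mcong M (R g) (R h)" shows "mcong M (Z g) (Z h)"
proof -
  define k where "k = inv h \<otimes> g"
  have k: "k \<in> carrier G" and g: "g = h \<otimes> k" using assms by (auto simp: k_def m_assoc[symmetric])
  have "mcong M (R k) (R (inv h) * R g)" unfolding k_def using assms by (intro homM) auto
  also have "mcong M \<dots> (R (inv h) * R h)" using assms by (intro mcong_mult) auto
  also have "mcong M \<dots> 1" using rho_inv assms by blast
  finally have "mcong M (Z k) 0" using Z_kernel assms k by blast
  have "mcong M (Z g) (Z h + R h * Z k)" unfolding g using assms k by (intro cocM)
  also have "mcong M \<dots> (Z h + R h * 0)" by (intro mcong_add mcong_mult \<open>mcong M (Z k) 0\<close>) auto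
  finally show ?thesis by simp
qed

lemma Z_one: "M dvd q \<Longrightarrow> mcong M (Z \<one>) 0"
  using Z_kernel[of M \<one>] rho_one mcong_dvd by blast

lemma Z_pow_trivial:
  assumes "M dvd q" "g \<in> carrier G" "mcong M (Z g) 0" shows "mcong M (Z (g [^] (k::nat))) 0"
proof (induction k)
  case 0
  then show ?case using Z_one assms by simp
next
  case (Suc k)
  have "mcong M (Z (g [^] k \<otimes> g)) (Z (g [^] k) + R (g [^] k) * Z g)" using assms by (intro cocM) auto
  also have "mcong M \<dots> (0 + R (g [^] k) * 0)" by (intro mcong_add mcong_mult Suc assms) auto
  finally show ?case by simp
qed

lemma shift: "local_cocycle G R p n (\<lambda>g. Z g - (R g - 1) * W)"
proof unfold_locales
  fix g h assume g: "g \<in> carrier G" and h: "h \<in> carrier G"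
  have "mcong q (Z (g \<otimes> h) - (R (g \<otimes> h) - 1) * W) ((Z g + R g * Z h) - (R g * R h - 1) * W)"
    using g h by (intro mcong_diff mcong_mult coc hom) auto
  also have "(Z g + R g * Z h) - (R g * R h - 1) * W = (Z g - (R g - 1) * W) + R g * (Z h - (R h - 1) * W)"
    by (simp add: algebra_simps mult.assoc)
  finally show "mcong q (Z (g \<otimes> h) - (R (g \<otimes> h) - 1) * W) ((Z g - (R g - 1) * W) + R g * (Z h - (R h - 1) * W))" .
next
  fix g assume g: "g \<in> carrier G"
  obtain U where U: "mcong q (Z g) ((R g - 1) * U)" using loc g by blast
  have "mcong q (Z g - (R g - 1) * W) ((R g - 1) * U - (R g - 1) * W)" by (intro mcong_diff U) auto
  then show "\<exists>W'. mcong q (Z g - (R g - 1) * W) ((R g - 1) * W')" by (metis right_diff_distrib)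
qed

lemma shift_trivial:
  assumes "local_cocycle.trivial_cocycle G R p n (\<lambda>g. Z g - (R g - 1) * W)" shows trivial_cocycle
proof -
  interpret S: local_cocycle G R p n "\<lambda>g. Z g - (R g - 1) * W" by (rule shift)
  obtain U where U: "\<And>g. g \<in> carrier G \<Longrightarrow> mcong q (Z g - (R g - 1) * W) ((R g - 1) * U)"
    using assms unfolding S.trivial_cocycle_def by blast
  have "mcong q (Z g) ((R g - 1) * (U + W))" if "g \<in> carrier G" for g
    using mcong_add[OF U[OF that] mcong_refl[of q "(R g - 1) * W"]] by (simp add: distrib_left)
  then show ?thesis unfolding trivial_cocycle_def by blast
qed

text \<open>A nontrivial scalar \<open>l\<close> is central, so \<open>l Z\<^sub>g = Z\<^sub>g\<close> once the cocycle vanishes at it.\<close>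

lemma scalar_trivial:
  assumes "\<not> no_scalars" shows trivial_cocycle
proof -
  obtain s l where s: "s \<in> carrier G" "mcong (int p) (R s) (of_int l)" "\<not> int p dvd l - 1"
    using assms unfolding no_scalars_def by blast
  define k where "k = p ^ (n - 1)"
  define m where "m = l ^ k"
  define x where "x = s [^] k"
  have x: "x \<in> carrier G" using s by (simp add: x_def)
  have "Suc (n - 1) = n" using n0 by simp
  then have "mcong q (R s ^ k) (of_int m)" using mcong_scalar_pow_iter[OF s(2), of "n - 1"] unfolding k_def m_def by simp
  then have xm: "mcong q (R x) (of_int m)" unfolding x_def using mcong_trans[OF rho_pow[OF dvd_refl s(1)]] by blast
  have ml: "\<not> int p dvd m - 1"
  proof
    assume "int p dvd m - 1"
    moreover have "int p dvd m - l" unfolding m_def k_def by (rule fermat_iter[OF prime])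
    ultimately have "int p dvd l - 1" by Groebner_Basis.algebra
    then show False using s by simp
  qed
  obtain W where W: "mcong q (Z x) ((R x - 1) * W)" using loc x by blast
  interpret S: local_cocycle G R p n "\<lambda>g. Z g - (R g - 1) * W" by (rule shift)
  define Y where "Y g = Z g - (R g - 1) * W" for g
  have Yx: "mcong q (Y x) 0" using W unfolding Y_def using mcong_diff_0 by blast
  have "mcong q (Y g) 0" if g: "g \<in> carrier G" for g
  proof -
    have "mcong q (R (x \<otimes> g)) (R x * R g)" using hom x g by blast
    also have "mcong q \<dots> (of_int m * R g)" by (intro mcong_mult xm) auto
    also have "\<dots> = R g * of_int m" by (rule of_int_comm)
    also have "mcong q \<dots> (R g * R x)" by (intro mcong_mult mcong_sym[OF xm]) auto
    also have "mcong q \<dots> (R (g \<otimes> x))" using mcong_sym[OF hom] x g by blast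
    finally have 1: "mcong q (Y (x \<otimes> g)) (Y (g \<otimes> x))" unfolding Y_def using S.Z_dep[OF dvd_refl] x g by blast
    have "mcong q (Y (x \<otimes> g)) (Y x + R x * Y g)" unfolding Y_def by (rule S.coc[OF x g])
    also have "mcong q \<dots> (0 + of_int m * Y g)" by (intro mcong_add mcong_mult Yx xm) auto
    finally have 2: "mcong q (of_int m * Y g) (Y (x \<otimes> g))" using mcong_sym by simp
    also note 1
    also have "mcong q (Y (g \<otimes> x)) (Y g + R g * Y x)" unfolding Y_def by (rule S.coc[OF g x])
    also have "mcong q \<dots> (Y g + R g * 0)" by (intro mcong_add mcong_mult Yx) auto
    finally have "mcong q (of_int m * Y g) (Y g)" by simp
    then have "mcong q (of_int m * Y g - of_int 1 * Y g) 0" using mcong_diff_0 by simp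
    then have "mcong q (of_int (m - 1) * Y g) (of_int (m - 1) * 0)" by (simp add: left_diff_distrib)
    moreover have "coprime (m - 1) q" using ml prime_int by (metis coprime_commute coprime_power_left_iff prime_imp_coprime)
    ultimately show ?thesis by (rule mcong_cancel)
  qed
  then have "S.trivial_cocycle" unfolding S.trivial_cocycle_def Y_def by (intro exI[of _ 0]) simp
  then show ?thesis by (rule shift_trivial)
qed

lemma change_of_basis:
  assumes "\<not> int p dvd det2 Q"
  obtains R' Z' where "local_cocycle G R' p n Z'"
    "local_cocycle.trivial_cocycle G R' p n Z' \<Longrightarrow> trivial_cocycle"
    "\<And>g. g \<in> carrier G \<Longrightarrow> mcong q (Q * R' g) (R g * Q)"
    "no_scalars \<Longrightarrow> local_rep.no_scalars G R' p" "fixes_no_vector \<Longrightarrow> local_rep.fixes_no_vector G R' p"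
proof -
  obtain u where u: "q dvd det2 Q * u - 1" using inverse_mod[OF assms] by blast
  define U where "U = of_int u * adj2 Q"
  have "mcong q (of_int (u * det2 Q)) 1" using u by (simp add: mcong_def mult.commute del: of_int_mult)
  moreover have "U * Q = of_int (u * det2 Q)" "Q * U = of_int (u * det2 Q)"
    by (simp_all add: U_def adj2_mult mult.assoc) (metis adj2_mult(2) mult.assoc of_int_comm of_int_mult)
  ultimately have UQ: "mcong q (U * Q) 1" and QU: "mcong q (Q * U) 1" by simp_all
  define R' where "R' g = U * R g * Q" for g
  define Z' where "Z' g = U * Z g" for g
  have Qr: "mcong q (Q * R' g) (R g * Q)" for g
    using mcong_mult[OF QU mcong_refl[of q "R g * Q"]] by (simp add: R'_def mult.assoc)
  have rU: "mcong q (R' g * U) (U * R g)" for g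
    using mcong_mult[OF mcong_refl[of q "U * R g"] QU] by (simp add: R'_def mult.assoc)
  have LC: "local_cocycle G R' p n Z'"
  proof (unfold_locales)
    fix g h assume g: "g \<in> carrier G" and h: "h \<in> carrier G"
    have "mcong q (R' (g \<otimes> h)) (U * (R g * R h) * Q)" unfolding R'_def by (intro mcong_mult hom g h) auto
    also have "U * (R g * R h) * Q = (U * R g) * (R h * Q)" by (simp add: mult.assoc)
    also have "mcong q \<dots> ((U * R g) * (Q * R' h))" by (intro mcong_mult mcong_sym[OF Qr]) auto
    also have "(U * R g) * (Q * R' h) = R' g * R' h" by (simp add: R'_def mult.assoc)
    finally show "mcong q (R' (g \<otimes> h)) (R' g * R' h)" .
    have "mcong q (Z' (g \<otimes> h)) (U * (Z g + R g * Z h))" unfolding Z'_def by (intro mcong_mult coc g h) auto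
    also have "\<dots> = Z' g + (U * R g) * Z h" by (simp add: Z'_def distrib_left mult.assoc)
    also have "mcong q \<dots> (Z' g + (R' g * U) * Z h)" by (intro mcong_add mcong_mult mcong_sym[OF rU]) auto
    finally show "mcong q (Z' (g \<otimes> h)) (Z' g + R' g * Z' h)" by (simp add: Z'_def mult.assoc)
  next
    have "mcong q (R' \<one>) (U * 1 * Q)" unfolding R'_def by (intro mcong_mult rho_one) auto
    then show "mcong q (R' \<one>) 1" using UQ mcong_trans by simp
  next
    fix g assume g: "g \<in> carrier G"
    obtain W where W: "mcong q (Z g) ((R g - 1) * W)" using loc g by blast
    have "mcong q (Z' g) (U * ((R g - 1) * W))" unfolding Z'_def by (intro mcong_mult W) auto
    also have "\<dots> = (U * R g) * W - U * W" by (simp add: algebra_simps mult.assoc)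
    also have "mcong q \<dots> ((R' g * U) * W - U * W)" by (intro mcong_diff mcong_mult mcong_sym[OF rU]) auto
    also have "(R' g * U) * W - U * W = (R' g - 1) * (U * W)" by (simp add: algebra_simps mult.assoc)
    finally show "\<exists>W. mcong q (Z' g) ((R' g - 1) * W)" by blast
  qed (use fin prime p5 n0 in auto)
  interpret C: local_cocycle G R' p n Z' by (rule LC)
  show thesis
  proof (rule that[OF LC])
    assume "C.trivial_cocycle"
    then obtain W where W: "\<And>g. g \<in> carrier G \<Longrightarrow> mcong q (Z' g) ((R' g - 1) * W)" unfolding C.trivial_cocycle_def by blast
    have "mcong q (Z g) ((R g - 1) * (Q * W))" if g: "g \<in> carrier G" for g
    proof -
      have "mcong q (Z g) ((Q * U) * Z g)" using mcong_mult[OF mcong_sym[OF QU] mcong_refl[of q "Z g"]] by simp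
      also have "(Q * U) * Z g = Q * Z' g" by (simp add: Z'_def mult.assoc)
      also have "mcong q \<dots> (Q * ((R' g - 1) * W))" by (intro mcong_mult W g) auto
      also have "\<dots> = (Q * R' g) * W - Q * W" by (simp add: algebra_simps mult.assoc)
      also have "mcong q \<dots> ((R g * Q) * W - Q * W)" by (intro mcong_diff mcong_mult Qr) auto
      also have "(R g * Q) * W - Q * W = (R g - 1) * (Q * W)" by (simp add: algebra_simps mult.assoc)
      finally show ?thesis .
    qed
    then show trivial_cocycle unfolding trivial_cocycle_def by blast
  next
    fix g show "mcong q (Q * R' g) (R g * Q)" by (rule Qr)
  next
    assume ns: no_scalars
    show "C.no_scalars" unfolding C.no_scalars_def
    proof (intro ballI allI impI)
      fix s l assume s: "s \<in> carrier G" "mcong (int p) (R' s) (of_int l)"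
      note P = mcong_dvd[OF _ p_dvd_q]
      have "mcong (int p) (R s) (R s * (Q * U))" using mcong_mult[OF mcong_refl[of "int p" "R s"] mcong_sym[OF P[OF QU]]] by simp
      also have "R s * (Q * U) = (R s * Q) * U" by (simp add: mult.assoc)
      also have "mcong (int p) \<dots> ((Q * R' s) * U)" by (intro mcong_mult mcong_sym[OF P[OF Qr]]) auto
      also have "mcong (int p) \<dots> ((Q * of_int l) * U)" by (intro mcong_mult s(2)) auto
      also have "(Q * of_int l) * U = of_int l * (Q * U)" by (simp add: of_int_comm mult.assoc)
      also have "mcong (int p) \<dots> (of_int l * 1)" by (intro mcong_mult P[OF QU]) auto
      finally show "int p dvd l - 1" using ns s unfolding no_scalars_def by simp
    qed
  next
    assume nf: fixes_no_vector
    show "C.fixes_no_vector" unfolding C.fixes_no_vector_def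
    proof (intro allI impI)
      fix W assume W: "\<forall>g\<in>carrier G. mcong (int p) (R' g * W) W"
      note P = mcong_dvd[OF _ p_dvd_q]
      have "mcong (int p) (R g * (Q * W)) (Q * W)" if g: "g \<in> carrier G" for g
      proof -
        have "R g * (Q * W) = (R g * Q) * W" by (simp add: mult.assoc)
        also have "mcong (int p) \<dots> ((Q * R' g) * W)" by (intro mcong_mult mcong_sym[OF P[OF Qr]]) auto
        also have "(Q * R' g) * W = Q * (R' g * W)" by (simp add: mult.assoc)
        also have "mcong (int p) \<dots> (Q * W)" using W g by (intro mcong_mult) auto
        finally show ?thesis .
      qed
      then have "mcong (int p) (Q * W) 0" using nf unfolding fixes_no_vector_def by blast
      have "mcong (int p) W ((U * Q) * W)" using mcong_mult[OF mcong_sym[OF P[OF UQ]] mcong_refl[of "int p" W]] by simp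
      also have "(U * Q) * W = U * (Q * W)" by (simp add: mult.assoc)
      also have "mcong (int p) \<dots> (U * 0)" by (intro mcong_mult \<open>mcong (int p) (Q * W) 0\<close>) auto
      finally show "mcong (int p) W 0" by simp
    qed
  qed
qed

end

lemma dvd_from_diff: "a dvd x - y * z \<Longrightarrow> a dvd z \<Longrightarrow> a dvd x" for a :: int
  by (metis diff_add_cancel dvd_add dvd_mult)

text \<open>Multiplication by a number that is 1 modulo \<open>P\<close> does not change multiples
  of \<open>P^k\<close> modulo \<open>P^(k + 1)\<close>. This makes the off-diagonal entries
  additive in products, to first order.\<close>

lemma near_one_add:
  fixes P :: int
  assumes "P ^ Suc k dvd y - (x * a + d * z)" "P ^ k dvd x" "P ^ k dvd z" "P dvd a - 1" "P dvd d - 1"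
  shows "P ^ Suc k dvd y - (x + z)"
proof -
  have "P ^ k * P dvd x * (a - 1)" "P ^ k * P dvd z * (d - 1)" using assms by (auto intro: mult_dvd_mono)
  then have "P ^ Suc k dvd x * (a - 1) + z * (d - 1)" by (simp add: mult.commute)
  from dvd_add[OF assms(1) this] show ?thesis by (simp add: algebra_simps)
qed

lemma additive_iterate:
  fixes P :: int
  assumes "P ^ Suc k dvd f 0" "P ^ k dvd x" "\<And>m. P ^ k dvd f m \<Longrightarrow> P ^ Suc k dvd f (Suc m) - (f m + x)"
  shows "P ^ Suc k dvd f m - int m * x"
proof (induction m)
  case (Suc m)
  then have "P ^ k dvd f m - int m * x" by (meson dvd_trans le_imp_power_dvd le_SucI order_refl)
  then have "P ^ Suc k dvd f (Suc m) - (f m + x)" using assms(2,3) dvd_from_diff by blast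
  from dvd_add[OF this Suc] show ?case by (simp add: algebra_simps)
qed (use assms(1) in simp)

text \<open>\<open>r\<close> and \<open>r'\<close> are \<open>l1 / l2\<close> and
  \<open>l2 / l1\<close> modulo \<open>p^n\<close>, the factors by which conjugation by
  \<open>\<tau>\<close> acts on the off-diagonal entries. \<open>ne\<close> gives
  \<open>r \<noteq> 1\<close> modulo \<open>p\<close>, and together with \<open>ne2\<close> also
  \<open>r \<noteq> r'\<close>. The cocycle is normalised to vanish at
  \<open>\<tau>\<close>.\<close>

locale diagonal_cocycle = local_cocycle +
  fixes \<tau> :: 'a and l1 l2 r r' :: int
  assumes tG: "\<tau> \<in> carrier G" and rt: "mcong (int p ^ n) (R \<tau>) (Mat l1 0 0 l2)"
    and r: "int p ^ n dvd r * l2 - l1" and r': "int p ^ n dvd r' * l1 - l2"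
    and ne: "\<not> int p dvd l1 - l2" and ne2: "\<not> int p dvd l1 + l2"
    and Zt: "mcong (int p ^ n) (Z \<tau>) 0"
begin

lemma l_unit: "\<not> int p dvd l1" "\<not> int p dvd l2"
proof -
  have "q dvd det2 (R \<tau>) - l1 * l2" using mcong_det[OF rt] by (simp add: det2_def)
  then have d: "int p dvd det2 (R \<tau>) - l1 * l2" using p_dvd_q dvd_trans by blast
  show "\<not> int p dvd l1"
  proof
    assume "int p dvd l1"
    then have "int p dvd det2 (R \<tau>)" using d by Groebner_Basis.algebra
    then show False using det_unit tG by blast
  qed
  show "\<not> int p dvd l2"
  proof
    assume "int p dvd l2"
    then have "int p dvd det2 (R \<tau>)" using d by Groebner_Basis.algebra
    then show False using det_unit tG by blast
  qed
qed

lemma rM: "M dvd q \<Longrightarrow> M dvd r * l2 - l1" "M dvd q \<Longrightarrow> M dvd r' * l1 - l2"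
  using r r' dvd_trans by blast+

lemma rr_unit: "\<not> int p dvd r - 1" "\<not> int p dvd r" "\<not> int p dvd r - r'"
proof -
  note rp = rM[OF p_dvd_q]
  show "\<not> int p dvd r - 1"
    by (rule contrapos_nn[of "int p dvd l1 - l2"], use ne in simp, use rp in Groebner_Basis.algebra)
  show "\<not> int p dvd r"
    by (rule contrapos_nn[of "int p dvd l1"], use l_unit in simp, use rp in Groebner_Basis.algebra)
  show "\<not> int p dvd r - r'"
    by (rule contrapos_nn[of "int p dvd (l1 - l2) * (l1 + l2)"], use ne ne2 in \<open>simp add: p_dvd_mult\<close>, use rp in Groebner_Basis.algebra)
qed

definition cj :: "'a \<Rightarrow> 'a" where "cj g = \<tau> \<otimes> g \<otimes> inv \<tau>"

lemma cj_closed [simp]: "g \<in> carrier G \<Longrightarrow> cj g \<in> carrier G"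
  using tG by (simp add: cj_def)

lemma cj_t: "g \<in> carrier G \<Longrightarrow> cj g \<otimes> \<tau> = \<tau> \<otimes> g"
  using tG by (simp add: cj_def m_assoc)

lemma cj_rho:
  assumes M: "M dvd q" and g: "g \<in> carrier G"
  shows "mcong M (R (cj g)) (Mat (m11 (R g)) (r * m12 (R g)) (r' * m21 (R g)) (m22 (R g)))"
proof -
  have "mcong q (R (cj g) * R \<tau>) (R (cj g \<otimes> \<tau>))" using mcong_sym[OF hom] g tG by simp
  also have "R (cj g \<otimes> \<tau>) = R (\<tau> \<otimes> g)" using cj_t g by simp
  also have "mcong q \<dots> (R \<tau> * R g)" using hom g tG by simp
  also have "mcong q \<dots> (Mat l1 0 0 l2 * R g)" by (intro mcong_mult rt) auto
  finally have "mcong q (R (cj g) * Mat l1 0 0 l2) (Mat l1 0 0 l2 * R g)"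
    using mcong_trans[OF mcong_mult[OF mcong_refl mcong_sym[OF rt]]] by blast
  then have e: "q dvd m11 (R (cj g)) * l1 - l1 * m11 (R g)" "q dvd m12 (R (cj g)) * l2 - l1 * m12 (R g)"
    "q dvd m21 (R (cj g)) * l1 - l2 * m21 (R g)" "q dvd m22 (R (cj g)) * l2 - l2 * m22 (R g)"
    unfolding mcong_def by simp_all
  have "q dvd l1 * (m11 (R (cj g)) - m11 (R g))" "q dvd l2 * (m12 (R (cj g)) - r * m12 (R g))"
    "q dvd l1 * (m21 (R (cj g)) - r' * m21 (R g))" "q dvd l2 * (m22 (R (cj g)) - m22 (R g))"
  proof -
    define K where "K = q"
    note e = e[folded K_def] and r = r[folded K_def] and r' = r'[folded K_def]
    show "q dvd l1 * (m11 (R (cj g)) - m11 (R g))" unfolding K_def[symmetric] using e by Groebner_Basis.algebra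
    show "q dvd l2 * (m12 (R (cj g)) - r * m12 (R g))" unfolding K_def[symmetric] using e r by Groebner_Basis.algebra
    show "q dvd l1 * (m21 (R (cj g)) - r' * m21 (R g))" unfolding K_def[symmetric] using e r' by Groebner_Basis.algebra
    show "q dvd l2 * (m22 (R (cj g)) - m22 (R g))" unfolding K_def[symmetric] using e by Groebner_Basis.algebra
  qed
  then have "mcong q (R (cj g)) (Mat (m11 (R g)) (r * m12 (R g)) (r' * m21 (R g)) (m22 (R g)))"
    unfolding mcong_def mat2.sel by (intro conjI) (erule cancel[OF l_unit(1)] cancel[OF l_unit(2)])+
  then show ?thesis using M mcong_dvd by blast
qed

lemma cj_Z:
  assumes M: "M dvd q" and g: "g \<in> carrier G"
  shows "mcong M (Z (cj g)) (Mat l1 0 0 l2 * Z g)"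
proof -
  have "mcong q (Z (cj g) + R (cj g) * 0) (Z (cj g) + R (cj g) * Z \<tau>)" by (intro mcong_add mcong_mult mcong_sym[OF Zt]) auto
  also have "mcong q (Z (cj g) + R (cj g) * Z \<tau>) (Z (cj g \<otimes> \<tau>))" using mcong_sym[OF coc] g tG by simp
  also have "Z (cj g \<otimes> \<tau>) = Z (\<tau> \<otimes> g)" using cj_t g by simp
  also have "mcong q \<dots> (Z \<tau> + R \<tau> * Z g)" using coc g tG by simp
  also have "mcong q \<dots> (0 + Mat l1 0 0 l2 * Z g)" by (intro mcong_add mcong_mult rt Zt) auto
  finally show ?thesis using M mcong_dvd by simp
qed

lemma quotient_eq:
  assumes "M dvd q" "g \<in> carrier G"
  shows "mcong M (R (cj g \<otimes> inv g) * R g) (Mat (m11 (R g)) (r * m12 (R g)) (r' * m21 (R g)) (m22 (R g)))"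
proof -
  have "mcong M (R (cj g \<otimes> inv g) * R g) (R (cj g \<otimes> inv g \<otimes> g))" using assms by (intro mcong_sym[OF homM]) auto
  also have "cj g \<otimes> inv g \<otimes> g = cj g" using assms by (simp add: m_assoc)
  finally show ?thesis using cj_rho[OF assms] mcong_trans by blast
qed

text \<open>If \<open>g\<close> is triangular modulo \<open>p^e\<close>, conjugation by
  \<open>\<tau>\<close> changes only its remaining off-diagonal entry, so the commutator
  \<open>cj g \<otimes> inv g\<close> is unipotent, in the upper triangular case with entry
  \<open>(r - 1) b / d\<close>.\<close>

lemma quotient_triangular:
  assumes e: "e \<le> n" "e > 0" and g: "g \<in> carrier G"
  shows "int p ^ e dvd m21 (R g) \<Longrightarrow> \<exists>x. mcong (int p ^ e) (R (cj g \<otimes> inv g)) (Mat 1 x 0 1) \<and> int p ^ e dvd x * m22 (R g) - (r - 1) * m12 (R g)"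
    and "int p ^ e dvd m12 (R g) \<Longrightarrow> \<exists>x. mcong (int p ^ e) (R (cj g \<otimes> inv g)) (Mat 1 0 x 1)"
proof -
  define M where "M = int p ^ e"
  have M: "M dvd q" "int p dvd M" using e by (simp_all add: M_def pe_dvd_q)
  define y where "y = R (cj g \<otimes> inv g)"
  define a b c d where "a = m11 (R g)" "b = m12 (R g)" "c = m21 (R g)" "d = m22 (R g)"
  have eqs: "M dvd m11 y * a + m12 y * c - a" "M dvd m11 y * b + m12 y * d - r * b"
     "M dvd m21 y * a + m22 y * c - r' * c" "M dvd m21 y * b + m22 y * d - d"
    using quotient_eq[OF M(1) g] unfolding mcong_def y_def[symmetric] a_b_c_d_def by simp_all
  have det: "\<not> int p dvd a * d - b * c" using det_unit[OF g] by (simp add: det2_def a_b_c_d_def)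
  have ad: "\<not> int p dvd a" "\<not> int p dvd d" if "M dvd b * c" using det dvd_trans[OF M(2) that] by auto
  note cn = cancel[of _ e, folded M_def]
  show "\<exists>x. mcong (int p ^ e) (R (cj g \<otimes> inv g)) (Mat 1 x 0 1) \<and> int p ^ e dvd x * m22 (R g) - (r - 1) * m12 (R g)"
    if "int p ^ e dvd m21 (R g)"
  proof -
    have c: "M dvd c" using that by (simp add: M_def a_b_c_d_def)
    note ad = ad[OF dvd_mult[OF c]]
    have "M dvd a * (m11 y - 1)" using eqs(1) c by Groebner_Basis.algebra
    then have y11: "M dvd m11 y - 1" using cn ad by blast
    have "M dvd a * m21 y" using eqs(3) c by Groebner_Basis.algebra
    then have y21: "M dvd m21 y" using cn ad by blast
    have "M dvd d * (m22 y - 1)" using eqs(4) y21 by Groebner_Basis.algebra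
    then have y22: "M dvd m22 y - 1" using cn ad by blast
    have "M dvd m12 y * d - (r - 1) * b" using eqs(2) y11 by Groebner_Basis.algebra
    then show ?thesis using y11 y21 y22 unfolding M_def[symmetric] y_def[symmetric] a_b_c_d_def
      by (intro exI[of _ "m12 y"]) (auto simp: mcong_def)
  qed
  show "\<exists>x. mcong (int p ^ e) (R (cj g \<otimes> inv g)) (Mat 1 0 x 1)" if "int p ^ e dvd m12 (R g)"
  proof -
    have b: "M dvd b" using that by (simp add: M_def a_b_c_d_def)
    note ad = ad[OF dvd_mult2[OF b]]
    have "M dvd d * m12 y" using eqs(2) b by Groebner_Basis.algebra
    then have y12: "M dvd m12 y" using cn ad by blast
    have "M dvd a * (m11 y - 1)" using eqs(1) y12 by Groebner_Basis.algebra
    then have y11: "M dvd m11 y - 1" using cn ad by blast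
    have "M dvd d * (m22 y - 1)" using eqs(4) b by Groebner_Basis.algebra
    then have y22: "M dvd m22 y - 1" using cn ad by blast
    show ?thesis using y11 y12 y22 unfolding M_def[symmetric] y_def[symmetric]
      by (intro exI[of _ "m21 y"]) (auto simp: mcong_def)
  qed
qed

definition upper :: "'a set" where
  "upper = {g \<in> carrier G. int p dvd m11 (R g) - 1 \<and> int p dvd m21 (R g) \<and> int p dvd m22 (R g) - 1}"

lemma upper_mult:
  assumes "g \<in> upper" "h \<in> upper"
  shows "g \<otimes> h \<in> upper" "int p dvd m12 (R (g \<otimes> h)) - (m12 (R g) + m12 (R h))"
proof -
  have c: "g \<in> carrier G" "h \<in> carrier G" using assms by (auto simp: upper_def)
  have a: "int p dvd m11 (R g) - 1" "int p dvd m21 (R g)" "int p dvd m22 (R g) - 1"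
    "int p dvd m11 (R h) - 1" "int p dvd m21 (R h)" "int p dvd m22 (R h) - 1" using assms by (auto simp: upper_def)
  have e: "int p dvd m11 (R (g \<otimes> h)) - (m11 (R g) * m11 (R h) + m12 (R g) * m21 (R h))"
    "int p dvd m12 (R (g \<otimes> h)) - (m11 (R g) * m12 (R h) + m12 (R g) * m22 (R h))"
    "int p dvd m21 (R (g \<otimes> h)) - (m21 (R g) * m11 (R h) + m22 (R g) * m21 (R h))"
    "int p dvd m22 (R (g \<otimes> h)) - (m21 (R g) * m12 (R h) + m22 (R g) * m22 (R h))"
    using homM[OF p_dvd_q c] unfolding mcong_def by simp_all
  have "int p dvd m11 (R (g \<otimes> h)) - 1" using e(1) a by Groebner_Basis.algebra
  moreover have "int p dvd m21 (R (g \<otimes> h))" using e(3) a by Groebner_Basis.algebra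
  moreover have "int p dvd m22 (R (g \<otimes> h)) - 1" using e(4) a by Groebner_Basis.algebra
  ultimately show "g \<otimes> h \<in> upper" using c by (simp add: upper_def)
  show "int p dvd m12 (R (g \<otimes> h)) - (m12 (R g) + m12 (R h))" using e(2) a by Groebner_Basis.algebra
qed

lemma add21:
  assumes g: "g \<in> upper" and h: "h \<in> upper" and k: "Suc k \<le> n" "int p ^ k dvd m21 (R g)" "int p ^ k dvd m21 (R h)"
  shows "int p ^ Suc k dvd m21 (R (g \<otimes> h)) - (m21 (R g) + m21 (R h))"
proof (rule near_one_add[OF _ k(2,3)])
  show "int p ^ Suc k dvd m21 (R (g \<otimes> h)) - (m21 (R g) * m11 (R h) + m22 (R g) * m21 (R h))"
    using homM[OF pe_dvd_q[OF k(1)], of g h] g h by (simp add: mcong_def upper_def)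
qed (use g h in \<open>auto simp: upper_def\<close>)

lemma one_upper: "\<one> \<in> upper"
  using mcong_dvd[OF rho_one p_dvd_q] by (simp add: upper_def mcong_def)

lemma upper_pow:
  assumes g: "g \<in> upper"
  shows "g [^] (m::nat) \<in> upper \<and> int p dvd m12 (R (g [^] m)) - int m * m12 (R g)"
proof (induction m)
  case 0
  then show ?case using one_upper mcong_dvd[OF rho_one p_dvd_q] by (simp add: mcong_def)
next
  case (Suc m)
  then have "int p dvd m12 (R (g [^] m \<otimes> g)) - (m12 (R (g [^] m)) + m12 (R g))" using upper_mult g by blast
  then have "int p dvd m12 (R (g [^] m \<otimes> g)) - (int m + 1) * m12 (R g)" using Suc by Groebner_Basis.algebra
  then show ?case using Suc upper_mult g by (simp add: add.commute)
qed

lemma pow21: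
  assumes g: "g \<in> upper" and k: "Suc k \<le> n" "int p ^ k dvd m21 (R g)"
  shows "int p ^ Suc k dvd m21 (R (g [^] (m::nat))) - int m * m21 (R g)"
proof (rule additive_iterate[OF _ k(2)])
  show "int p ^ Suc k dvd m21 (R (g [^] (0::nat)))" using mcong_dvd[OF rho_one pe_dvd_q[OF k(1)]] by (simp add: mcong_def)
qed (use add21 upper_pow g k in simp)

lemma cj_upper:
  assumes "g \<in> upper"
  shows "cj g \<in> upper" "int p dvd m12 (R (cj g)) - r * m12 (R g)"
    "e \<le> n \<Longrightarrow> int p ^ e dvd m21 (R (cj g)) - r' * m21 (R g)"
proof -
  have g: "g \<in> carrier G" "int p dvd m11 (R g) - 1" "int p dvd m21 (R g)" "int p dvd m22 (R g) - 1" using assms by (auto simp: upper_def)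
  have e: "M dvd m11 (R (cj g)) - m11 (R g)" "M dvd m12 (R (cj g)) - r * m12 (R g)"
    "M dvd m21 (R (cj g)) - r' * m21 (R g)" "M dvd m22 (R (cj g)) - m22 (R g)" if "M dvd q" for M
    using cj_rho[OF that g(1)] by (simp_all add: mcong_def)
  note ep = e[OF p_dvd_q]
  have "int p dvd m11 (R (cj g)) - 1" using ep(1) g(2) by Groebner_Basis.algebra
  moreover have "int p dvd m21 (R (cj g))" using ep(3) g(3) by Groebner_Basis.algebra
  moreover have "int p dvd m22 (R (cj g)) - 1" using ep(4) g(4) by Groebner_Basis.algebra
  ultimately show "cj g \<in> upper" using g by (simp add: upper_def)
  show "int p dvd m12 (R (cj g)) - r * m12 (R g)" by (rule ep)
  show "e \<le> n \<Longrightarrow> int p ^ e dvd m21 (R (cj g)) - r' * m21 (R g)" using e(3) pe_dvd_q by blast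
qed

text \<open>To first order the upper right entry of \<open>g\<close> is multiplied by
  \<open>r + m\<close> and the lower left one by \<open>r' + m\<close>. For \<open>m = - r\<close>
  or \<open>m = - r'\<close> one of them gains a factor \<open>p\<close>.\<close>

definition step :: "'a \<Rightarrow> nat \<Rightarrow> 'a" where "step g m = cj g \<otimes> g [^] m"

lemma step_upper:
  assumes g: "g \<in> upper"
  shows "step g m \<in> upper" "int p dvd m12 (R (step g m)) - (r + int m) * m12 (R g)"
    "Suc k \<le> n \<Longrightarrow> int p ^ k dvd m21 (R g) \<Longrightarrow> int p ^ Suc k dvd m21 (R (step g m)) - (r' + int m) * m21 (R g)"
proof -
  note c = cj_upper[OF g] and u = upper_pow[OF g, of m]
  show "step g m \<in> upper" unfolding step_def using c u upper_mult by blast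
  have "int p dvd m12 (R (step g m)) - (m12 (R (cj g)) + m12 (R (g [^] m)))" unfolding step_def using c u upper_mult by blast
  then show "int p dvd m12 (R (step g m)) - (r + int m) * m12 (R g)"
    using c(2) u by Groebner_Basis.algebra
  assume k: "Suc k \<le> n" "int p ^ k dvd m21 (R g)"
  have c3: "int p ^ Suc k dvd m21 (R (cj g)) - r' * m21 (R g)" using c(3) k by blast
  have p3: "int p ^ Suc k dvd m21 (R (g [^] m)) - int m * m21 (R g)" using pow21[OF g k] .
  have dv: "int p ^ k dvd x" if "int p ^ Suc k dvd x - y * m21 (R g)" for x y
    using dvd_from_diff[OF dvd_trans[OF le_imp_power_dvd that] k(2)] by simp
  have "int p ^ Suc k dvd m21 (R (step g m)) - (m21 (R (cj g)) + m21 (R (g [^] m)))"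
    unfolding step_def using add21[OF c(1) _ k(1) dv[OF c3] dv[OF p3]] u by blast
  from dvd_add[OF dvd_add[OF this c3] p3] show "int p ^ Suc k dvd m21 (R (step g m)) - (r' + int m) * m21 (R g)"
    by (simp add: algebra_simps)
qed

text \<open>Lifting a transvection modulo \<open>p\<close> to one modulo \<open>p\<^sup>n\<close>: the operation \<open>step\<close> raises the valuation of the lower
  left entry, and finally \<open>cj g \<otimes> g\<^sup>-\<^sup>1\<close> is unipotent.\<close>

lemma lift_transvection:
  assumes s: "s \<in> upper" "\<not> int p dvd m12 (R s)"
  obtains u b where "u \<in> carrier G" "mcong q (R u) (Mat 1 b 0 1)" "\<not> int p dvd b"
proof -
  have "k \<le> n \<Longrightarrow> \<exists>g\<in>upper. \<not> int p dvd m12 (R g) \<and> int p ^ k dvd m21 (R g)" for k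
  proof (induction k)
    case 0
    then show ?case using s by auto
  next
    case (Suc k)
    then obtain g where g: "g \<in> upper" "\<not> int p dvd m12 (R g)" "int p ^ k dvd m21 (R g)" by auto
    \<comment> \<open>The choice \<open>m = - r'\<close> modulo \<open>p\<close> raises the
      valuation of the lower left entry; the upper right one is multiplied by the unit
      \<open>r - r'\<close>, so the transvection modulo \<open>p\<close> survives.\<close>
    obtain m :: nat where m: "int p ^ 1 dvd - r' - int m" using exists_nat_mod by blast
    have mm: "int p dvd r' + int m" using m by (metis dvd_minus_iff minus_diff_eq power_one_right diff_minus_eq_add add.commute)
    note st = step_upper[OF g(1), where m = m]
    have "int p ^ k * int p dvd m21 (R g) * (r' + int m)" using g(3) mm by (intro mult_dvd_mono)
    then have "int p ^ Suc k dvd (r' + int m) * m21 (R g)" by (simp add: mult.commute)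
    from dvd_add[OF st(3)[OF Suc.prems g(3)] this] have 1: "int p ^ Suc k dvd m21 (R (step g m))" by simp
    have "\<not> int p dvd m12 (R (step g m))"
      by (rule contrapos_nn[of "int p dvd (r - r') * m12 (R g)"], use g rr_unit in \<open>simp add: p_dvd_mult\<close>, use st(2) mm in Groebner_Basis.algebra)
    then show ?case using 1 st by blast
  qed
  from this[of n] obtain g where g: "g \<in> upper" "\<not> int p dvd m12 (R g)" "q dvd m21 (R g)" by blast
  have gc: "g \<in> carrier G" using g by (simp add: upper_def)
  obtain x where x: "mcong q (R (cj g \<otimes> inv g)) (Mat 1 x 0 1)" "q dvd x * m22 (R g) - (r - 1) * m12 (R g)"
    using quotient_triangular(1)[OF order_refl n0 gc g(3)] by blast
  have "\<not> int p dvd x"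
  proof
    assume "int p dvd x"
    moreover have "int p dvd x * m22 (R g) - (r - 1) * m12 (R g)" using x(2) p_dvd_q dvd_trans by blast
    ultimately have "int p dvd (r - 1) * m12 (R g)" by Groebner_Basis.algebra
    then show False using g rr_unit by (simp add: p_dvd_mult)
  qed
  with x show thesis using that[of "cj g \<otimes> inv g" x] gc by simp
qed

section \<open>The kernel of reduction modulo p\<close>

definition N :: "'a set" where "N = {g \<in> carrier G. mcong (int p) (R g) 1}"

lemma N_upper: "N \<subseteq> upper"
  by (auto simp: N_def upper_def mcong_def)

lemma N_iff: "g \<in> N \<longleftrightarrow> g \<in> upper \<and> int p dvd m12 (R g)"
  by (auto simp: N_def upper_def mcong_def)

lemma N_mult: "g \<in> N \<Longrightarrow> h \<in> N \<Longrightarrow> g \<otimes> h \<in> N"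
proof -
  assume "g \<in> N" "h \<in> N"
  moreover then have "int p dvd m12 (R (g \<otimes> h)) - (m12 (R g) + m12 (R h))" using upper_mult N_upper by blast
  ultimately show ?thesis unfolding N_iff using upper_mult(1) by (metis diff_add_cancel dvd_add)
qed

lemma N_one: "\<one> \<in> N" using mcong_dvd[OF rho_one p_dvd_q] by (simp add: N_def)

lemma N_pow: "g \<in> N \<Longrightarrow> g [^] (m::nat) \<in> N"
  by (induction m) (auto simp: N_one N_mult)

lemma N_cj: "g \<in> N \<Longrightarrow> cj g \<in> N"
  unfolding N_iff using cj_upper(1,2) by (metis diff_add_cancel dvd_add dvd_mult)

lemma N_inv: "g \<in> N \<Longrightarrow> inv g \<in> N"
proof -
  assume g: "g \<in> N"
  then have gc: "g \<in> carrier G" by (simp add: N_def)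
  have "mcong (int p) (R (inv g)) (R (inv g) * R g)"
    using g mcong_mult[OF mcong_refl[of "int p" "R (inv g)"] mcong_sym[of "int p" "R g" 1]] by (simp add: N_def)
  then show ?thesis using rho_inv(1)[OF p_dvd_q gc] mcong_trans gc by (auto simp: N_def)
qed

lemma add12:
  assumes g: "g \<in> N" and h: "h \<in> N" and k: "Suc k \<le> n" "int p ^ k dvd m12 (R g)" "int p ^ k dvd m12 (R h)"
  shows "int p ^ Suc k dvd m12 (R (g \<otimes> h)) - (m12 (R g) + m12 (R h))"
proof (rule near_one_add[OF _ k(2,3)])
  show "int p ^ Suc k dvd m12 (R (g \<otimes> h)) - (m12 (R g) * m22 (R h) + m11 (R g) * m12 (R h))"
    using homM[OF pe_dvd_q[OF k(1)], of g h] g h by (simp add: mcong_def N_def add.commute)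
qed (use g h in \<open>auto simp: N_def mcong_def\<close>)

lemma pow12:
  assumes g: "g \<in> N" and k: "Suc k \<le> n" "int p ^ k dvd m12 (R g)"
  shows "int p ^ Suc k dvd m12 (R (g [^] (m::nat))) - int m * m12 (R g)"
proof (rule additive_iterate[OF _ k(2)])
  show "int p ^ Suc k dvd m12 (R (g [^] (0::nat)))" using mcong_dvd[OF rho_one pe_dvd_q[OF k(1)]] by (simp add: mcong_def)
qed (use add12 N_pow g k in simp)

lemma step_N:
  assumes g: "g \<in> N"
  shows "step g m \<in> N"
    "Suc k \<le> n \<Longrightarrow> int p ^ k dvd m12 (R g) \<Longrightarrow> int p ^ Suc k dvd m12 (R (step g m)) - (r + int m) * m12 (R g)"
proof -
  show "step g m \<in> N" unfolding step_def using N_cj N_pow N_mult g by blast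
  assume k: "Suc k \<le> n" "int p ^ k dvd m12 (R g)"
  have gc: "g \<in> carrier G" using g by (simp add: N_def)
  have c3: "int p ^ Suc k dvd m12 (R (cj g)) - r * m12 (R g)" using cj_rho[OF pe_dvd_q[OF k(1)] gc] by (simp add: mcong_def)
  have p3: "int p ^ Suc k dvd m12 (R (g [^] m)) - int m * m12 (R g)" using pow12[OF g k] .
  have dv: "int p ^ k dvd x" if "int p ^ Suc k dvd x - y * m12 (R g)" for x y
    using dvd_from_diff[OF dvd_trans[OF le_imp_power_dvd that] k(2)] by simp
  have "int p ^ Suc k dvd m12 (R (step g m)) - (m12 (R (cj g)) + m12 (R (g [^] m)))"
    unfolding step_def using add12[OF N_cj[OF g] N_pow[OF g] k(1) dv[OF c3] dv[OF p3]] .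
  from dvd_add[OF dvd_add[OF this c3] p3] show "int p ^ Suc k dvd m12 (R (step g m)) - (r + int m) * m12 (R g)"
    by (simp add: algebra_simps)
qed

lemma step_preserve:
  assumes g: "g \<in> N" and e: "e \<le> n"
  shows "int p ^ e dvd m12 (R g) \<Longrightarrow> int p ^ e dvd m12 (R (step g m))"
    "int p ^ e dvd m21 (R g) \<Longrightarrow> int p ^ e dvd m21 (R (step g m))"
proof -
  have gc: "g \<in> carrier G" using g by (simp add: N_def)
  note M = pe_dvd_q[OF e]
  have "mcong (int p ^ e) (R (step g m)) (R (cj g) * R g ^ m)"
    unfolding step_def using mcong_trans[OF homM[OF M, of "cj g" "g [^] m"] mcong_mult[OF mcong_refl rho_pow[OF M gc]]] gc by simp
  from mcong_trans[OF this mcong_mult[OF cj_rho[OF M gc] mcong_refl]]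
  have st: "int p ^ e dvd m12 (R (step g m)) - (m11 (R g) * m12 (R g ^ m) + r * m12 (R g) * m22 (R g ^ m))"
    "int p ^ e dvd m21 (R (step g m)) - (r' * m21 (R g) * m11 (R g ^ m) + m22 (R g) * m21 (R g ^ m))"
    unfolding mcong_def by simp_all
  show "int p ^ e dvd m12 (R (step g m))" if b: "int p ^ e dvd m12 (R g)"
  proof -
    have "int p ^ e dvd m12 (R g ^ m)" by (induction m) (use b in auto)
    then show ?thesis using st(1) b by (metis diff_add_cancel dvd_add dvd_mult dvd_mult2)
  qed
  show "int p ^ e dvd m21 (R (step g m))" if b: "int p ^ e dvd m21 (R g)"
  proof -
    have "int p ^ e dvd m21 (R g ^ m)" by (induction m) (use b in auto)
    then show ?thesis using st(2) b by (metis diff_add_cancel dvd_add dvd_mult dvd_mult2)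
  qed
qed

lemma transvection_pow:
  assumes "M dvd q" "u \<in> carrier G" "mcong M (R u) (Mat 1 b 0 1)"
  shows "mcong M (R (u [^] (k::nat))) (Mat 1 (int k * b) 0 1)"
proof -
  have "Mat 1 b 0 1 ^ k = Mat 1 (int k * b) 0 1" by (induction k) (simp_all add: mat2_eq_iff algebra_simps)
  then show ?thesis using mcong_trans[OF rho_pow[OF assms(1,2)] mcong_pow[OF assms(3)]] by metis
qed

end

lemma mcong_near_one:
  assumes "mcong (int p) P 1" "mcong (int p ^ j) Y 0" shows "mcong (int p ^ Suc j) (P * Y) Y"
proof -
  obtain C where C: "P = 1 + of_int (int p) * C" using assms(1) unfolding mcong_iff by blast
  define K where "K = int p ^ j"
  obtain D where D: "Y = of_int K * D" using assms(2) unfolding mcong_iff K_def[symmetric] by auto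
  have "P * Y = Y + of_int (int p * K) * (C * D)"
    unfolding C D by (simp add: mat2_eq_iff algebra_simps)
  then have "P * Y = Y + of_int (int p ^ Suc j) * (C * D)" by (simp add: K_def)
  then show ?thesis unfolding mcong_iff by blast
qed

context diagonal_cocycle
begin

lemma N_carrier: "g \<in> N \<Longrightarrow> g \<in> carrier G" by (simp add: N_def)

context
  fixes j :: nat
  assumes jn: "j < n" and small: "\<And>g. g \<in> N \<Longrightarrow> mcong (int p ^ j) (Z g) 0"
begin

lemma Mq: "int p ^ Suc j dvd q" using jn by (intro pe_dvd_q) simp

text \<open>Modulo \<open>p^(j + 1)\<close> the group \<open>N\<close> acts trivially on values
  divisible by \<open>p^j\<close>, so at this level the cocycle is a homomorphism on
  \<open>N\<close>. This is why its vanishing is proved one power of \<open>p\<close> at a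
  time.\<close>

lemma N_add:
  assumes "g \<in> N" "h \<in> N" shows "mcong (int p ^ Suc j) (Z (g \<otimes> h)) (Z g + Z h)"
proof -
  have "mcong (int p ^ Suc j) (Z (g \<otimes> h)) (Z g + R g * Z h)" using assms by (intro cocM Mq) (auto simp: N_carrier)
  also have "mcong (int p ^ Suc j) \<dots> (Z g + Z h)" using assms small by (intro mcong_add mcong_refl mcong_near_one) (auto simp: N_def)
  finally show ?thesis .
qed

lemma N_pow_Z:
  assumes "g \<in> N" shows "mcong (int p ^ Suc j) (Z (g [^] (m::nat))) (of_nat m * Z g)"
proof (induction m)
  case 0
  then show ?case using Z_one[OF Mq] by simp
next
  case (Suc m)
  have "mcong (int p ^ Suc j) (Z (g [^] m \<otimes> g)) (Z (g [^] m) + Z g)" using assms N_pow by (intro N_add)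
  also have "mcong (int p ^ Suc j) \<dots> (of_nat m * Z g + Z g)" by (intro mcong_add Suc) auto
  finally show ?case by (simp add: distrib_right add.commute)
qed

lemma N_step_Z:
  assumes g: "g \<in> N" and m: "q dvd x - int m"
  shows "mcong (int p ^ Suc j) (Z (step g m)) (Mat (l1 + x) 0 0 (l2 + x) * Z g)"
proof -
  have gc: "g \<in> carrier G" using g by (rule N_carrier)
  have x: "mcong (int p ^ Suc j) (of_nat m) (of_int x)"
    using dvd_trans[OF Mq m] by (simp add: mcong_def dvd_diff_commute)
  have "mcong (int p ^ Suc j) (Z (step g m)) (Z (cj g) + Z (g [^] m))" unfolding step_def using g N_cj N_pow by (intro N_add)
  also have "mcong (int p ^ Suc j) \<dots> (Mat l1 0 0 l2 * Z g + of_nat m * Z g)" by (intro mcong_add N_pow_Z g cj_Z Mq gc)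
  also have "mcong (int p ^ Suc j) \<dots> (Mat l1 0 0 l2 * Z g + of_int x * Z g)" by (intro mcong_add mcong_mult x) auto
  also have "\<dots> = Mat (l1 + x) 0 0 (l2 + x) * Z g" by (simp add: mat2_eq_iff algebra_simps)
  finally show ?thesis .
qed

lemma N_quotient_Z:
  assumes g: "g \<in> N"
  shows "mcong (int p ^ Suc j) (Z (cj g \<otimes> inv g)) (Mat (l1 - 1) 0 0 (l2 - 1) * Z g)"
proof -
  have gc: "g \<in> carrier G" using g by (rule N_carrier)
  have "cj g \<otimes> inv g \<otimes> g = cj g" using gc by (simp add: m_assoc)
  moreover have "mcong (int p ^ Suc j) (Z (cj g \<otimes> inv g \<otimes> g)) (Z (cj g \<otimes> inv g) + Z g)"
    using g by (intro N_add N_mult N_cj N_inv)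
  ultimately have "mcong (int p ^ Suc j) (Z (cj g \<otimes> inv g) + Z g) (Mat l1 0 0 l2 * Z g)"
    using mcong_trans[OF mcong_sym cj_Z[OF Mq gc]] by simp
  from mcong_diff[OF this mcong_refl[of _ "Z g"]]
  show ?thesis by (simp add: mcong_def algebra_simps)
qed

text \<open>Induction on \<open>(e - i) + (e - k)\<close>, where \<open>p\<^sup>i\<close> and \<open>p\<^sup>k\<close> divide the off-diagonal entries: \<open>step\<close> with \<open>m \<equiv> - r\<close> or
  \<open>m \<equiv> - r'\<close> raises one of the two exponents and multiplies the rows of \<open>Z\<^sub>g\<close> by \<open>l1 + m\<close> and \<open>l2 + m\<close>.\<close>

lemma N_vanish_Suc:
  assumes l1: "\<not> int p dvd l1 - 1"
    and u: "\<not> int p dvd l2 - 1 \<or> (\<exists>u\<in>carrier G. \<exists>b. mcong q (R u) (Mat 1 b 0 1) \<and> \<not> int p dvd b \<and> mcong q (Z u) 0)"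
    and g: "g \<in> N"
  shows "mcong (int p ^ Suc j) (Z g) 0"
proof -
  define e where "e = Suc j"
  have en: "e \<le> n" "e > 0" using jn by (auto simp: e_def)
  define M where "M = int p ^ e"
  have Mq': "M dvd q" using Mq by (simp add: M_def e_def)
  note cn = cancel[of _ e, folded M_def]
  have pq: "int p dvd r * l2 - l1" "int p dvd r' * l1 - l2" using rM[OF p_dvd_q] by auto
  \<comment> \<open>Powers of \<open>u\<close> realise every upper transvection modulo
    \<open>M\<close>, and the cocycle vanishes at all of them.\<close>
  have uk: "\<exists>k::nat. \<exists>u'\<in>carrier G. mcong M (R u') (Mat 1 (int k * b) 0 1) \<and> M dvd y - int k * b \<and> mcong M (Z u') 0"
    if ub: "u \<in> carrier G" "mcong q (R u) (Mat 1 b 0 1)" "\<not> int p dvd b" "mcong q (Z u) 0" for u b y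
  proof -
    obtain c where c: "M dvd b * c - 1" using inverse_mod[OF ub(3), of e] by (auto simp: M_def)
    obtain k where k: "M dvd y * c - int k" using exists_nat_mod[of e "y * c"] by (auto simp: M_def)
    have "M dvd y - int k * b" using c k by Groebner_Basis.algebra
    moreover have "mcong M (R (u [^] k)) (Mat 1 (int k * b) 0 1)"
      using ub mcong_dvd[OF _ Mq'] by (intro transvection_pow Mq')
    moreover have "mcong M (Z (u [^] k)) 0" using ub mcong_dvd[OF _ Mq'] by (intro Z_pow_trivial Mq')
    ultimately show ?thesis using ub(1) nat_pow_closed by blast
  qed
  have "\<forall>g\<in>N. \<forall>i k. i \<le> e \<longrightarrow> k \<le> e \<longrightarrow> int p ^ i dvd m12 (R g) \<longrightarrow> int p ^ k dvd m21 (R g) \<longrightarrow> (e - i) + (e - k) = d \<longrightarrow> mcong M (Z g) 0" for d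
  proof (induction d rule: less_induct)
    case (less d)
    show ?case
    proof (intro ballI allI impI)
      fix g i k assume g: "g \<in> N" and ik: "i \<le> e" "k \<le> e" "int p ^ i dvd m12 (R g)" "int p ^ k dvd m21 (R g)" "(e - i) + (e - k) = d"
      have gc: "g \<in> carrier G" using g by (rule N_carrier)
      have gp: "int p dvd m11 (R g) - 1" "int p dvd m12 (R g)" "int p dvd m21 (R g)" "int p dvd m22 (R g) - 1"
        using g by (auto simp: N_def mcong_def)
      have up: "mcong M (Mat (l1 - r) 0 0 (l2 - r) * Z g) 0" if "i < e"
      proof -
        obtain m where m: "q dvd - r - int m" using exists_nat_mod by blast
        have "int p dvd - r - int m" using m p_dvd_q dvd_trans by blast
        then have pm: "int p dvd r + int m" by Groebner_Basis.algebra
        have "int p ^ Suc i dvd m12 (R (step g m)) - (r + int m) * m12 (R g)" using that en ik by (intro step_N g) auto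
        moreover have "int p * int p ^ i dvd (r + int m) * m12 (R g)" using pm ik by (intro mult_dvd_mono)
        ultimately have "int p ^ Suc i dvd m12 (R (step g m))" by (metis diff_add_cancel dvd_add power_Suc)
        moreover have "int p ^ k dvd m21 (R (step g m))" using ik en by (intro step_preserve g) auto
        moreover have "(e - Suc i) + (e - k) < d" "Suc i \<le> e" using that ik by auto
        ultimately have "mcong M (Z (step g m)) 0" using less.IH step_N(1)[OF g] ik(2) by blast
        moreover have "mcong M (Z (step g m)) (Mat (l1 + - r) 0 0 (l2 + - r) * Z g)"
          unfolding M_def e_def by (rule N_step_Z[OF g m])
        ultimately show ?thesis using mcong_trans mcong_sym by (metis add_uminus_conv_diff)
      qed
      have low: "mcong M (Mat (l1 - r') 0 0 (l2 - r') * Z g) 0" if "k < e"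
      proof -
        obtain m where m: "q dvd - r' - int m" using exists_nat_mod by blast
        have "int p dvd - r' - int m" using m p_dvd_q dvd_trans by blast
        then have pm: "int p dvd r' + int m" by Groebner_Basis.algebra
        have "int p ^ Suc k dvd m21 (R (step g m)) - (r' + int m) * m21 (R g)"
          using that en ik g N_upper by (intro step_upper(3)) auto
        moreover have "int p * int p ^ k dvd (r' + int m) * m21 (R g)" using pm ik by (intro mult_dvd_mono)
        ultimately have "int p ^ Suc k dvd m21 (R (step g m))" by (metis diff_add_cancel dvd_add power_Suc)
        moreover have "int p ^ i dvd m12 (R (step g m))" using ik en by (intro step_preserve g) auto
        moreover have "(e - i) + (e - Suc k) < d" "Suc k \<le> e" using that ik by auto
        ultimately have "mcong M (Z (step g m)) 0" using less.IH step_N(1)[OF g] ik(1) by blast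
        moreover have "mcong M (Z (step g m)) (Mat (l1 + - r') 0 0 (l2 + - r') * Z g)"
          unfolding M_def e_def by (rule N_step_Z[OF g m])
        ultimately show ?thesis using mcong_trans mcong_sym by (metis add_uminus_conv_diff)
      qed
      have qz: "mcong M (Z (cj g \<otimes> inv g)) (Mat (l1 - 1) 0 0 (l2 - 1) * Z g)"
        unfolding M_def e_def by (rule N_quotient_Z[OF g])
      have yG: "cj g \<otimes> inv g \<in> carrier G" using gc by simp
      obtain W where W: "mcong M (Z (cj g \<otimes> inv g)) ((R (cj g \<otimes> inv g) - 1) * W)" using locM[OF Mq' yG] by blast
      note diagonal = mcong_def mat2_sel mat2.sel diff_0_right mult_zero_left add_0_right add_0_left
      consider "i < e" "k < e" | "i < e" "k = e" | "i = e" "k < e" | "i = e" "k = e" using ik by linarith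
      then show "mcong M (Z g) 0"
      proof cases
        case 1
        \<comment> \<open>In the first row \<open>l1 - r\<close> and \<open>l1 - r'\<close> both
          annihilate \<open>Z g\<close>, in the second row \<open>l2 - r\<close> and
          \<open>l2 - r'\<close>; either way the difference is the unit \<open>r - r'\<close> up to
          sign.\<close>
        from up[OF 1(1)] low[OF 1(2)]
        have "M dvd (r - r') * m11 (Z g)" "M dvd (r - r') * m12 (Z g)" "M dvd (r - r') * m21 (Z g)" "M dvd (r - r') * m22 (Z g)"
          unfolding diagonal by (elim conjE; Groebner_Basis.algebra)+
        then show ?thesis unfolding diagonal using cn[OF rr_unit(3)] by blast
      next
        case 2
        \<comment> \<open>Now \<open>g\<close> is upper triangular modulo \<open>M\<close> and its
          quotient is a transvection, at which local triviality annihilates the second row. The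
          first row is annihilated by \<open>l1 - r = l1 (l2 - 1) / l2\<close>; if this is not a
          unit, the quotient is compared with a power of \<open>u\<close> instead.\<close>
        obtain x where x: "mcong M (R (cj g \<otimes> inv g)) (Mat 1 x 0 1)"
          using quotient_triangular(1)[OF en gc] ik 2 unfolding M_def by blast
        have "mcong M (Z (cj g \<otimes> inv g)) ((Mat 1 x 0 1 - 1) * W)"
          by (rule mcong_trans[OF W]) (intro mcong_mult mcong_diff x mcong_refl)
        from mcong_trans[OF mcong_sym[OF this] qz]
        have 1: "M dvd (l2 - 1) * m21 (Z g)" "M dvd (l2 - 1) * m22 (Z g)"
          unfolding diagonal by simp_all
        from up[OF 2(1)] have 2: "M dvd (l1 - r) * m11 (Z g)" "M dvd (l1 - r) * m12 (Z g)" "M dvd (l2 - r) * m21 (Z g)" "M dvd (l2 - r) * m22 (Z g)"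
          unfolding diagonal by auto
        have "M dvd (r - 1) * m21 (Z g)" "M dvd (r - 1) * m22 (Z g)" using 1 2 by (Groebner_Basis.algebra)+
        then have r2: "M dvd m21 (Z g)" "M dvd m22 (Z g)" using cn[OF rr_unit(1)] by blast+
        have r1: "M dvd m11 (Z g) \<and> M dvd m12 (Z g)"
        proof (cases "int p dvd l2 - 1")
          case False
          have "\<not> int p dvd l1 - r"
            by (rule contrapos_nn[of "int p dvd l1 * (l2 - 1)"], use False l_unit in \<open>simp add: p_dvd_mult\<close>, use pq in Groebner_Basis.algebra)
          from cn[OF this] show ?thesis using 2 by blast
        next
          case True
          with u obtain u b where u: "u \<in> carrier G" "mcong q (R u) (Mat 1 b 0 1)" "\<not> int p dvd b" "mcong q (Z u) 0" by auto
          obtain k' u' where u': "u' \<in> carrier G" "mcong M (R u') (Mat 1 (int k' * b) 0 1)" "M dvd x - int k' * b" "mcong M (Z u') 0"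
            using uk[OF u] by blast
          have "mcong M (Mat 1 x 0 1) (Mat 1 (int k' * b) 0 1)" using u'(3) by (simp add: mcong_def)
          then have "mcong M (R (cj g \<otimes> inv g)) (R u')" using x u'(2) mcong_trans mcong_sym by blast
          then have "mcong M (Z (cj g \<otimes> inv g)) (Z u')" using Z_dep[OF Mq' yG u'(1)] by blast
          then have "mcong M (Mat (l1 - 1) 0 0 (l2 - 1) * Z g) 0" using qz u'(4) mcong_trans mcong_sym by blast
          then have "M dvd (l1 - 1) * m11 (Z g)" "M dvd (l1 - 1) * m12 (Z g)" unfolding diagonal by auto
          then show ?thesis using cn[OF l1] by blast
        qed
        with r2 show ?thesis by (simp add: mcong_def)
      next
        case 3
        obtain x where x: "mcong M (R (cj g \<otimes> inv g)) (Mat 1 0 x 1)"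
          using quotient_triangular(2)[OF en gc] ik 3 unfolding M_def by blast
        have "mcong M (Z (cj g \<otimes> inv g)) ((Mat 1 0 x 1 - 1) * W)"
          by (rule mcong_trans[OF W]) (intro mcong_mult mcong_diff x mcong_refl)
        from mcong_trans[OF mcong_sym[OF this] qz]
        have "M dvd (l1 - 1) * m11 (Z g)" "M dvd (l1 - 1) * m12 (Z g)"
          unfolding diagonal by simp_all
        then have r1: "M dvd m11 (Z g)" "M dvd m12 (Z g)" using cn[OF l1] by blast+
        have "\<not> int p dvd l2 - r'"
          by (rule contrapos_nn[of "int p dvd l2 * (l1 - 1)"], use l1 l_unit in \<open>simp add: p_dvd_mult\<close>, use pq in Groebner_Basis.algebra)
        moreover have "M dvd (l2 - r') * m21 (Z g)" "M dvd (l2 - r') * m22 (Z g)"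
          using low[OF 3(2)] unfolding diagonal by auto
        ultimately have "M dvd m21 (Z g)" "M dvd m22 (Z g)" using cn by blast+
        with r1 show ?thesis by (simp add: mcong_def)
      next
        case 4
        \<comment> \<open>Here \<open>g\<close> is diagonal modulo \<open>M\<close> and commutes
          with \<open>\<tau>\<close>, so \<open>l1 - 1\<close> and \<open>l2 - 1\<close> annihilate
          the two rows of \<open>Z g\<close>. If \<open>l2 = 1\<close> modulo \<open>p\<close>, the
          second row is obtained from a relation \<open>g u = u' g\<close> with \<open>u'\<close> a
          power of \<open>u\<close>.\<close>
        then have bc: "M dvd m12 (R g)" "M dvd m21 (R g)" using ik by (auto simp: M_def)
        have "mcong M (R (cj g)) (R g)"
          by (rule mcong_trans[OF cj_rho[OF Mq' gc]]) (use bc in \<open>auto simp: mcong_def intro!: dvd_diff\<close>)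
        then have "mcong M (Z (cj g)) (Z g)" using Z_dep[OF Mq'] gc by simp
        then have "mcong M (Mat l1 0 0 l2 * Z g) (Z g)" using mcong_trans[OF mcong_sym[OF cj_Z[OF Mq' gc]]] by blast
        then have eq: "M dvd (l1 - 1) * m11 (Z g)" "M dvd (l1 - 1) * m12 (Z g)" "M dvd (l2 - 1) * m21 (Z g)" "M dvd (l2 - 1) * m22 (Z g)"
          by (simp_all add: mcong_def left_diff_distrib)
        then have r1: "M dvd m11 (Z g)" "M dvd m12 (Z g)" using cn[OF l1] by blast+
        have r2: "M dvd m21 (Z g) \<and> M dvd m22 (Z g)"
        proof (cases "int p dvd l2 - 1")
          case False
          from cn[OF this] show ?thesis using eq by blast
        next
          case True
          with u obtain u b where u: "u \<in> carrier G" "mcong q (R u) (Mat 1 b 0 1)" "\<not> int p dvd b" "mcong q (Z u) 0" by auto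
          have pd: "\<not> int p dvd m22 (R g)" "\<not> int p dvd m11 (R g)"
            using gp p_not_dvd_small(2) by (metis dvd_diff minus_diff_eq dvd_minus_iff diff_diff_eq2 add_diff_cancel_left')+
          obtain f where f: "M dvd m22 (R g) * f - 1" using inverse_mod[OF pd(1), of e] by (auto simp: M_def)
          define y where "y = m11 (R g) * b * f"
          obtain k' u' where u': "u' \<in> carrier G" "mcong M (R u') (Mat 1 (int k' * b) 0 1)" "M dvd y - int k' * b" "mcong M (Z u') 0"
            using uk[OF u, of y] by blast
          define t where "t = int k' * b"
          note ub = mcong_dvd[OF u(2) Mq'] and uz = mcong_dvd[OF u(4) Mq']
          have ta: "M dvd t * m22 (R g) - m11 (R g) * b" using u'(3) f unfolding y_def t_def[symmetric] by Groebner_Basis.algebra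
          have "mcong M (R (g \<otimes> u)) (R g * Mat 1 b 0 1)" using mcong_trans[OF homM[OF Mq' gc u(1)] mcong_mult[OF mcong_refl ub]] .
          also have "mcong M \<dots> (Mat 1 t 0 1 * R g)"
          proof -
            have "M dvd m11 (R g) * b + m12 (R g) - (m12 (R g) + t * m22 (R g))" using ta by Groebner_Basis.algebra
            then show ?thesis using bc by (simp add: mcong_def)
          qed
          also have "mcong M \<dots> (R u' * R g)" unfolding t_def by (intro mcong_mult mcong_sym[OF u'(2)] mcong_refl)
          also have "mcong M \<dots> (R (u' \<otimes> g))" using mcong_sym[OF homM[OF Mq' u'(1) gc]] .
          finally have "mcong M (Z (g \<otimes> u)) (Z (u' \<otimes> g))" using Z_dep[OF Mq'] gc u(1) u'(1) by simp
          moreover have "mcong M (Z (g \<otimes> u)) (Z g + R g * 0)"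
            by (rule mcong_trans[OF cocM[OF Mq' gc u(1)]]) (intro mcong_add mcong_mult uz mcong_refl)
          moreover have "mcong M (Z (u' \<otimes> g)) (0 + Mat 1 t 0 1 * Z g)"
            by (rule mcong_trans[OF cocM[OF Mq' u'(1) gc]]) (unfold t_def, intro mcong_add mcong_mult u'(2,4) mcong_refl)
          ultimately have "mcong M (Z g + R g * 0) (0 + Mat 1 t 0 1 * Z g)" using mcong_trans mcong_sym by blast
          then have tz: "M dvd t * m21 (Z g)" "M dvd t * m22 (Z g)" by (simp_all add: mcong_def)
          have pM: "int p dvd M" unfolding M_def using en by simp
          have "\<not> int p dvd t"
            by (rule contrapos_nn[of "int p dvd m11 (R g) * b"], use pd u(3) in \<open>simp add: p_dvd_mult\<close>, use dvd_trans[OF pM ta] in Groebner_Basis.algebra)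
          then show ?thesis using tz cn by blast
        qed
        with r1 show ?thesis by (simp add: mcong_def)
      qed
    qed
  qed
  then have "mcong M (Z g) 0" using g by (metis le0 one_dvd power_0)
  then show ?thesis by (simp add: M_def e_def)
qed

end

lemma N_vanish:
  assumes "\<not> int p dvd l1 - 1"
    and "\<not> int p dvd l2 - 1 \<or> (\<exists>u\<in>carrier G. \<exists>b. mcong q (R u) (Mat 1 b 0 1) \<and> \<not> int p dvd b \<and> mcong q (Z u) 0)"
    and "g \<in> N"
  shows "mcong q (Z g) 0"
proof -
  have "j \<le> n \<Longrightarrow> \<forall>g\<in>N. mcong (int p ^ j) (Z g) 0" for j
  proof (induction j)
    case 0
    then show ?case by (simp add: mcong_def)
  next
    case (Suc j)
    then have "j < n" "\<And>g. g \<in> N \<Longrightarrow> mcong (int p ^ j) (Z g) 0" by auto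
    then show ?case using N_vanish_Suc[OF _ _ assms(1,2)] by blast
  qed
  then show ?thesis using assms(3) by blast
qed

end

section \<open>Elements of p-power order and the Sylow subgroup\<close>

lemma frobenius_iter:
  fixes P Q :: mat2
  assumes "P * Q = Q * P" "Factorial_Ring.prime p"
  shows "mcong (int p) ((P + Q) ^ (p ^ a)) (P ^ (p ^ a) + Q ^ (p ^ a))"
proof (induction a)
  case (Suc a)
  have c: "P ^ (p ^ a) * Q ^ (p ^ a) = Q ^ (p ^ a) * P ^ (p ^ a)"
    using assms(1) by (metis power_commuting_commutes)
  have "(P + Q) ^ (p ^ Suc a) = ((P + Q) ^ (p ^ a)) ^ p" by (simp add: power_mult[symmetric] mult.commute)
  also have "mcong (int p) \<dots> ((P ^ (p ^ a) + Q ^ (p ^ a)) ^ p)" by (rule mcong_pow[OF Suc])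
  also have "mcong (int p) \<dots> ((P ^ (p ^ a)) ^ p + (Q ^ (p ^ a)) ^ p)" by (rule frobenius_mat2[OF c assms(2)])
  finally show ?case by (simp add: power_mult[symmetric] mult.commute)
qed simp

lemma det2_pow: "det2 (P ^ m) = det2 P ^ m"
  by (induction m) (simp_all add: det2_mult, simp add: det2_def)

lemma mcong_sum: "(\<And>x. x \<in> A \<Longrightarrow> mcong M (f x) (g x)) \<Longrightarrow> mcong M (sum f A) (sum g A)"
  by (induction A rule: infinite_finite_induct) (auto intro: mcong_add)

context local_rep
begin

text \<open>The determinant is its own \<open>p^a\<close>-th power modulo \<open>p\<close>, hence 1.
  By Frobenius \<open>R s - 1\<close> is nilpotent modulo \<open>p\<close>, so its determinant
  \<open>det2 (R s) - tr2 (R s) + 1\<close> is 0.\<close>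

lemma p_element:
  assumes s: "s \<in> carrier G" "s [^] (p ^ a) = \<one>"
  shows "int p dvd det2 (R s) - 1" "int p dvd tr2 (R s) - 2"
proof -
  define P where "P = R s - 1"
  have one: "mcong (int p) (R s ^ (p ^ a)) 1"
    using mcong_trans[OF mcong_sym[OF rho_pow[OF p_dvd_q s(1), of "p ^ a"]]] mcong_dvd[OF rho_one p_dvd_q] s(2) by simp
  have "int p dvd det2 (R s) ^ (p ^ a) - 1" using mcong_det[OF one] by (simp add: det2_pow) (simp add: det2_def)
  from dvd_diff[OF this fermat_iter[OF prime, of "det2 (R s)" a]]
  show d: "int p dvd det2 (R s) - 1" by simp
  have "mcong (int p) ((P + 1) ^ (p ^ a)) (P ^ (p ^ a) + 1 ^ (p ^ a))" by (rule frobenius_iter[OF _ prime]) simp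
  then have "mcong (int p) (P ^ (p ^ a) + 1) (R s ^ (p ^ a))" using mcong_sym by (simp add: P_def)
  from mcong_diff[OF mcong_trans[OF this one] mcong_refl[of _ 1]]
  have "mcong (int p) (P ^ (p ^ a)) 0" by simp
  from mcong_det[OF this] have "int p dvd det2 P ^ (p ^ a)" by (simp add: det2_pow) (simp add: det2_def)
  then have "int p dvd det2 P" using prime_int prime_dvd_power by blast
  moreover have "det2 P = det2 (R s) - tr2 (R s) + 1" by (simp add: P_def det2_def tr2_def algebra_simps)
  ultimately show "int p dvd tr2 (R s) - 2" using d by Groebner_Basis.algebra
qed

text \<open>Unipotence modulo \<open>p\<close>, expressed by the characteristic polynomial, which is
  unchanged under conjugation and change of basis.\<close>

definition unip :: "'a set" where
  "unip = {s \<in> carrier G. int p dvd det2 (R s) - 1 \<and> int p dvd tr2 (R s) - 2}"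

lemma unip_square_zero:
  assumes "s \<in> unip" shows "mcong (int p) ((R s - 1) * (R s - 1)) 0"
proof -
  have d: "int p dvd det2 (R s) - 1" "int p dvd tr2 (R s) - 2" using assms by (auto simp: unip_def)
  have "(R s - 1) * (R s - 1) = 0 + of_int (1 - det2 (R s)) * 1 + of_int (tr2 (R s) - 2) * R s"
    by (simp add: mat2_eq_iff det2_def tr2_def algebra_simps)
  also have "mcong (int p) \<dots> (0 + of_int (1 - det2 (R s)) * 1)" by (rule mcong_absorb[OF d(2)])
  also have "mcong (int p) \<dots> 0" using d(1) by (intro mcong_absorb) (simp add: dvd_diff_commute)
  finally show ?thesis .
qed

end

context local_cocycle
begin

text \<open>Corestriction to a Sylow \<open>p\<close>-subgroup is multiplication by a unit.\<close>

lemma sylow_trivial: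
  assumes v: "\<And>s a. s \<in> carrier G \<Longrightarrow> s [^] (p ^ a) = \<one> \<Longrightarrow> mcong q (Z s) 0"
  shows trivial_cocycle
proof -
  have ord0: "Coset.order G \<noteq> 0" using fin by (simp add: order_gt_0_iff_finite)
  define a where "a = multiplicity p (Coset.order G)"
  obtain m where m: "Coset.order G = p ^ a * m" "\<not> p dvd m"
    using multiplicity_decompose'[of "Coset.order G" p] ord0 prime unfolding a_def by (metis not_prime_unit)
  obtain H where H: "subgroup H G" "card H = p ^ a" using sylow_thm[OF prime is_group m(1) fin] by blast
  interpret H: subgroup H G by (rule H(1))
  have Hc: "H \<subseteq> carrier G" by (rule H.subset)
  have ZH: "mcong q (Z h) 0" if "h \<in> H" for h
  proof (rule v)
    show "h \<in> carrier G" using that Hc by blast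
    interpret GH: group "G\<lparr>carrier := H\<rparr>" using H(1) is_group by (rule subgroup.subgroup_is_group)
    have "h [^]\<^bsub>G\<lparr>carrier := H\<rparr>\<^esub> Coset.order (G\<lparr>carrier := H\<rparr>) = \<one>\<^bsub>G\<lparr>carrier := H\<rparr>\<^esub>"
      using that by (intro GH.pow_order_eq_1) auto
    then show "h [^] (p ^ a) = \<one>" using H(2) by (simp add: Coset.order_def nat_pow_def)
  qed
  have "card (rcosets H) * card H = Coset.order G" using lagrange[OF H(1)] .
  then have cm: "card (rcosets H) = m" using m(1) H(2) p5 by simp
  \<comment> \<open>The value at a coset is \<open>Z (inv x)\<close> for a representative
    \<open>x\<close>; another representative changes it by the action on a value of \<open>Z\<close>
    on \<open>H\<close>, which is 0.\<close>
  define f where "f C = Z (inv (SOME x. x \<in> carrier G \<and> C = H #> x))" for C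
  have f: "mcong q (f (H #> x)) (Z (inv x))" if x: "x \<in> carrier G" for x
  proof -
    define y where "y = (SOME y. y \<in> carrier G \<and> H #> x = H #> y)"
    have "y \<in> carrier G \<and> H #> x = H #> y" unfolding y_def by (rule someI[of _ x]) (use x in auto)
    then have y: "y \<in> carrier G" "H #> x = H #> y" by auto
    then have "x \<in> H #> y" using x rcos_self[OF x H(1)] by simp
    then obtain h where h: "h \<in> H" "x = h \<otimes> y" unfolding r_coset_def by blast
    have hc: "h \<in> carrier G" using h Hc by blast
    have "inv x = inv y \<otimes> inv h" using h hc y by (simp add: inv_mult_group)
    then have "mcong q (Z (inv x)) (Z (inv y) + R (inv y) * Z (inv h))" using coc[of "inv y" "inv h"] y hc by simp
    also have "mcong q \<dots> (Z (inv y) + R (inv y) * 0)" using h by (intro mcong_add mcong_mult ZH mcong_refl) simp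
    finally show ?thesis using mcong_sym by (simp add: f_def y_def)
  qed
  \<comment> \<open>Summing the cocycle relation over the cosets gives
    \<open>S = m * Z g + R g * S\<close> with index \<open>m\<close> prime to \<open>p\<close>. Thus
    \<open>Z\<close> is the coboundary of \<open>- S / m\<close>.\<close>
  define S where "S = (\<Sum>C\<in>rcosets H. f C)"
  have "mcong q (Z g) ((R g - 1) * (of_int w * S))" if w: "q dvd (- int m) * w - 1" and g: "g \<in> carrier G" for g w
  proof -
    have bij: "bij_betw (\<lambda>C. C #> inv g) (rcosets H) (rcosets H)"
    proof (rule bij_betw_byWitness[where f' = "\<lambda>C. C #> g"])
      show "\<forall>C\<in>rcosets H. C #> inv g #> g = C" "\<forall>C\<in>rcosets H. C #> g #> inv g = C"
        using g rcosets_subset_PowG[OF H(1)] by (auto simp: coset_mult_assoc coset_mult_one)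
      show "(\<lambda>C. C #> inv g) ` (rcosets H) \<subseteq> (rcosets H)" "(\<lambda>C. C #> g) ` (rcosets H) \<subseteq> (rcosets H)"
        using g Hc by (auto simp: RCOSETS_def coset_mult_assoc intro!: bexI)
    qed
    have "mcong q (f (C #> inv g)) (Z g + R g * f C)" if C: "C \<in> rcosets H" for C
    proof -
      obtain x where x: "x \<in> carrier G" "C = H #> x" using C by (auto simp: RCOSETS_def)
      have "C #> inv g = H #> (x \<otimes> inv g)" using x g Hc by (simp add: coset_mult_assoc)
      then have "mcong q (f (C #> inv g)) (Z (inv (x \<otimes> inv g)))" using f[of "x \<otimes> inv g"] x g by simp
      also have "inv (x \<otimes> inv g) = g \<otimes> inv x" using x g by (simp add: inv_mult_group)
      also have "mcong q (Z (g \<otimes> inv x)) (Z g + R g * Z (inv x))" using x g by (intro coc) auto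
      also have "mcong q \<dots> (Z g + R g * f C)" unfolding x(2) by (intro mcong_add mcong_mult mcong_refl mcong_sym[OF f] x(1))
      finally show ?thesis .
    qed
    then have "mcong q (\<Sum>C\<in>rcosets H. f (C #> inv g)) (\<Sum>C\<in>rcosets H. Z g + R g * f C)" by (rule mcong_sum)
    also have "(\<Sum>C\<in>rcosets H. f (C #> inv g)) = S" unfolding S_def by (rule sum.reindex_bij_betw[OF bij])
    also have "(\<Sum>C\<in>rcosets H. Z g + R g * f C) = of_int (int m) * Z g + R g * S"
      using cm by (simp add: sum.distrib sum_distrib_left S_def)
    finally have "mcong q (of_int w * (S - (of_int (int m) * Z g + R g * S))) 0"
      using mcong_mult[OF mcong_refl, of q _ 0 "of_int w"] mcong_diff_0 by simp
    also have "of_int w * (S - (of_int (int m) * Z g + R g * S)) = of_int (- int m * w - 1) * Z g + (Z g - (R g - 1) * (of_int w * S))"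
      by (simp add: mat2_eq_iff algebra_simps)
    finally have "mcong q ((Z g - (R g - 1) * (of_int w * S)) + of_int (- int m * w - 1) * Z g) 0" by (simp only: add.commute)
    from mcong_trans[OF mcong_sym[OF mcong_absorb[OF w]] this] show ?thesis using mcong_diff_0 by blast
  qed
  moreover obtain w where "q dvd (- int m) * w - 1" using inverse_mod[of "- int m" n] m(2) by auto
  ultimately show ?thesis unfolding trivial_cocycle_def by blast
qed

end

context local_rep
begin

text \<open>For traceless two by two matrices \<open>P Q + Q P\<close> is the scalar trace of
  \<open>P Q\<close>, here written in the entries. For nilpotent \<open>P\<close> and
  \<open>Q\<close> this trace detects distinct axes, and \<open>no_two_transvections\<close> makes
  it vanish.\<close>

lemma unip_pair:
  assumes ns: no_scalars and s: "s \<in> unip" "s' \<in> unip"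
  shows "int p dvd 2 * (m11 (R s) - 1) * (m11 (R s') - 1) + m12 (R s) * m21 (R s') + m21 (R s) * m12 (R s')"
proof -
  define D where "D s = Mat (m11 (R s) - 1) (m12 (R s)) (m21 (R s)) (1 - m11 (R s))" for s
  have D: "mcong (int p) (R s) (1 + D s)" "mcong (int p) (D s * D s) 0" if "s \<in> unip" for s
  proof -
    have tr: "int p dvd m11 (R s) + m22 (R s) - 2" using that by (simp add: unip_def tr2_def)
    then have "int p dvd m22 (R s) - (1 + (1 - m11 (R s)))" by Groebner_Basis.algebra
    then show 1: "mcong (int p) (R s) (1 + D s)" by (simp add: mcong_def D_def)
    then have "mcong (int p) (D s) (R s - 1)" using mcong_sym[OF mcong_diff[OF 1 mcong_refl[of _ 1]]] by simp
    from mcong_mult[OF this this] show "mcong (int p) (D s * D s) 0" using unip_square_zero[OF that] mcong_trans by blast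
  qed
  have "D s * D s' + D s' * D s = of_int (2 * (m11 (R s) - 1) * (m11 (R s') - 1) + m12 (R s) * m21 (R s') + m21 (R s) * m12 (R s'))"
    unfolding of_int_mat2 by (simp add: D_def mat2_eq_iff algebra_simps)
  then show ?thesis using no_two_transvections[OF ns _ _ D(1)[OF s(1)] D(1)[OF s(2)] D(2)[OF s(1)] D(2)[OF s(2)]] s
    by (auto simp: unip_def)
qed

end

context diagonal_cocycle
begin

lemma upper_trivial:
  assumes U: "unip \<subseteq> upper" and NV: "\<And>g. g \<in> N \<Longrightarrow> mcong q (Z g) 0"
    and u: "unip \<subseteq> N \<or> (\<exists>u\<in>carrier G. \<exists>b. mcong q (R u) (Mat 1 b 0 1) \<and> \<not> int p dvd b \<and> mcong q (Z u) 0)"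
  shows trivial_cocycle
proof (rule sylow_trivial)
  fix s a assume s: "s \<in> carrier G" "s [^] (p ^ a) = \<one>"
  then have su: "s \<in> unip" using p_element by (simp add: unip_def)
  show "mcong q (Z s) 0"
  proof (cases "unip \<subseteq> N")
    case True
    then show ?thesis using NV su by blast
  next
    case False
    with u obtain u b where u: "u \<in> carrier G" "mcong q (R u) (Mat 1 b 0 1)" "\<not> int p dvd b" "mcong q (Z u) 0" by blast
    obtain c where c: "int p dvd b * c - 1" using inverse_mod[OF u(3), of 1] by auto
    obtain k where k: "int p dvd m12 (R s) * c - int k" using exists_nat_mod[of 1 "m12 (R s) * c"] by auto
    have kb: "int p dvd m12 (R s) - int k * b" using c k by Groebner_Basis.algebra
    define v where "v = u [^] k"
    have v: "v \<in> carrier G" "mcong (int p) (R v) (Mat 1 (int k * b) 0 1)" "mcong q (Z v) 0"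
      unfolding v_def using u mcong_dvd[OF u(2) p_dvd_q] by (auto intro: transvection_pow p_dvd_q Z_pow_trivial)
    have "mcong (int p) (R s) (Mat 1 (int k * b) 0 1)" using su U kb by (auto simp: upper_def mcong_def)
    then have sv: "mcong (int p) (R s) (R v)" using v(2) mcong_trans mcong_sym by blast
    define h where "h = inv v \<otimes> s"
    have h: "h \<in> carrier G" "s = v \<otimes> h" using s v by (auto simp: h_def m_assoc[symmetric])
    have "mcong (int p) (R h) (R (inv v) * R s)" unfolding h_def using s v by (intro homM p_dvd_q) auto
    also have "mcong (int p) \<dots> (R (inv v) * R v)" by (intro mcong_mult sv mcong_refl)
    also have "mcong (int p) \<dots> 1" using rho_inv(1)[OF p_dvd_q v(1)] .
    finally have "mcong q (Z h) 0" using NV h by (simp add: N_def)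
    have "mcong q (Z s) (Z v + R v * Z h)" unfolding h(2) using coc v h by blast
    also have "mcong q \<dots> (0 + R v * 0)" by (intro mcong_add mcong_mult v \<open>mcong q (Z h) 0\<close> mcong_refl)
    finally show ?thesis by simp
  qed
qed

text \<open>Local triviality annihilates the second row of \<open>Z u\<close>, so \<open>u\<close>
  fixes \<open>Z u\<close> and the cocycle is additive on powers of \<open>u\<close>. Conjugation by
  \<open>\<tau>\<close> has the effect of the power \<open>r\<close> on \<open>u\<close>, whence
  \<open>l1\<close> and \<open>r\<close> act alike on the first row; \<open>l1 - r\<close> is a unit
  when \<open>l2 \<noteq> 1\<close>.\<close>

lemma transvection_vanish:
  assumes u: "u \<in> carrier G" "mcong q (R u) (Mat 1 b 0 1)" and l2: "\<not> int p dvd l2 - 1"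
  shows "mcong q (Z u) 0"
proof -
  obtain W where W: "mcong q (Z u) ((R u - 1) * W)" using loc u by blast
  also have "mcong q \<dots> ((Mat 1 b 0 1 - 1) * W)" by (intro mcong_mult mcong_diff u mcong_refl)
  finally have r2: "q dvd m21 (Z u)" "q dvd m22 (Z u)" by (simp_all add: mcong_def)
  obtain k where k: "q dvd r - int k" using exists_nat_mod by blast
  have uZ: "mcong q (R u * (of_nat m * Z u)) (of_nat m * Z u)" for m
  proof -
    have "mcong q (R u * (of_nat m * Z u)) (Mat 1 b 0 1 * (of_nat m * Z u))" by (intro mcong_mult u mcong_refl)
    also have "mcong q \<dots> (of_nat m * Z u)" using r2 by (simp add: mcong_def)
    finally show ?thesis .
  qed
  have pw: "mcong q (Z (u [^] m)) (of_nat m * Z u)" for m :: nat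
  proof (induction m)
    case 0
    then show ?case using Z_one by simp
  next
    case (Suc m)
    have "u [^] Suc m = u \<otimes> u [^] m" using u(1) by (rule nat_pow_Suc2)
    then have "mcong q (Z (u [^] Suc m)) (Z u + R u * Z (u [^] m))" using coc u by simp
    also have "mcong q \<dots> (Z u + R u * (of_nat m * Z u))" by (intro mcong_add mcong_mult Suc mcong_refl)
    also have "mcong q \<dots> (Z u + of_nat m * Z u)" by (intro mcong_add uZ mcong_refl)
    finally show ?case by (simp add: distrib_right)
  qed
  have e: "q dvd m11 (R u) - 1" "q dvd m12 (R u) - b" "q dvd m21 (R u)" "q dvd m22 (R u) - 1"
    using u(2) by (simp_all add: mcong_def)
  define K where "K = q"
  have "K dvd r * m12 (R u) - int k * b" using e(2) k unfolding K_def[symmetric] by Groebner_Basis.algebra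
  then have "mcong q (R (cj u)) (Mat 1 (int k * b) 0 1)"
    using mcong_trans[OF cj_rho[OF dvd_refl u(1)], of "Mat 1 (int k * b) 0 1"] e by (simp add: mcong_def K_def)
  then have "mcong q (R (cj u)) (R (u [^] k))" using transvection_pow[OF dvd_refl u] mcong_trans mcong_sym by blast
  then have "mcong q (Z (cj u)) (Z (u [^] k))" using u by (intro Z_dep) auto
  from mcong_trans[OF mcong_sym[OF cj_Z[OF dvd_refl u(1)]] mcong_trans[OF this pw]]
  have "K dvd l1 * m11 (Z u) - int k * m11 (Z u)" "K dvd l1 * m12 (Z u) - int k * m12 (Z u)" by (simp_all add: mcong_def K_def)
  then have "K dvd (l1 - r) * m11 (Z u)" "K dvd (l1 - r) * m12 (Z u)" using k unfolding K_def[symmetric] by (Groebner_Basis.algebra)+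
  moreover have "\<not> int p dvd l1 - r"
  proof
    assume "int p dvd l1 - r"
    then have "int p dvd l1 * (l2 - 1)" using rM[OF p_dvd_q] by Groebner_Basis.algebra
    then show False using l2 l_unit by (simp add: p_dvd_mult)
  qed
  ultimately have "q dvd m11 (Z u)" "q dvd m12 (Z u)" unfolding K_def using cancel by blast+
  then show ?thesis using r2 by (simp add: mcong_def)
qed

lemma upper_A:
  assumes l: "\<not> int p dvd l1 - 1" "\<not> int p dvd l2 - 1" and U: "unip \<subseteq> upper"
  shows trivial_cocycle
proof (rule upper_trivial[OF U])
  show "mcong q (Z g) 0" if "g \<in> N" for g using that l N_vanish by blast
  show "unip \<subseteq> N \<or> (\<exists>u\<in>carrier G. \<exists>b. mcong q (R u) (Mat 1 b 0 1) \<and> \<not> int p dvd b \<and> mcong q (Z u) 0)"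
  proof (cases "unip \<subseteq> N")
    case False
    then obtain s where "s \<in> upper" "\<not> int p dvd m12 (R s)" using U N_iff by blast
    then obtain u b where u: "u \<in> carrier G" "mcong q (R u) (Mat 1 b 0 1)" "\<not> int p dvd b" by (rule lift_transvection)
    with transvection_vanish[OF u(1,2) l(2)] show ?thesis by blast
  qed simp
qed

text \<open>For \<open>s\<close> with upper left entry \<open>a\<close>, applying
  \<open>unip_pair\<close> to \<open>s\<close> and \<open>cj s\<close> gives
  \<open>(r - 1)^2 (a - 1)^2 = 0\<close> modulo \<open>p\<close>. So every unipotent element has
  diagonal entries 1 and an off-diagonal entry 0, that is, its axis is an axis of
  \<open>\<tau>\<close>. A second use of \<open>unip_pair\<close> rules out elements with different
  axes.\<close>

lemma unip_dichotomy:
  assumes ns: no_scalars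
  shows "unip \<subseteq> upper \<or> (\<forall>s\<in>unip. int p dvd m11 (R s) - 1 \<and> int p dvd m12 (R s) \<and> int p dvd m22 (R s) - 1)"
proof -
  have rp: "int p dvd r * l2 - l1" "int p dvd r' * l1 - l2" using rM[OF p_dvd_q] by auto
  then have "int p dvd l1 * (r * r' - 1)" by Groebner_Basis.algebra
  then have rr: "int p dvd r * r' - 1" using l_unit by (simp add: p_dvd_mult)
  have x: "int p dvd m11 (R s) - 1 \<and> int p dvd m22 (R s) - 1 \<and> int p dvd m12 (R s) * m21 (R s)" if s: "s \<in> unip" for s
  proof -
    define a b c d where "a = m11 (R s)" "b = m12 (R s)" "c = m21 (R s)" "d = m22 (R s)"
    have sc: "s \<in> carrier G" using s by (simp add: unip_def)
    have dt: "int p dvd a * d - b * c - 1" "int p dvd a + d - 2" using s by (auto simp: unip_def det2_def tr2_def a_b_c_d_def)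
    have cs: "mcong (int p) (R (cj s)) (Mat a (r * b) (r' * c) d)" using cj_rho[OF p_dvd_q sc] by (simp add: a_b_c_d_def)
    have e: "int p dvd m11 (R (cj s)) - a" "int p dvd m12 (R (cj s)) - r * b" "int p dvd m21 (R (cj s)) - r' * c" "int p dvd m22 (R (cj s)) - d"
      using cs by (simp_all add: mcong_def)
    have "int p dvd det2 (R (cj s)) - 1" unfolding det2_def using e dt(1) rr by Groebner_Basis.algebra
    moreover have "int p dvd tr2 (R (cj s)) - 2" unfolding tr2_def using e dt(2) by Groebner_Basis.algebra
    ultimately have "cj s \<in> unip" using sc by (simp add: unip_def)
    from unip_pair[OF ns s this, folded a_b_c_d_def]
    have "int p dvd (r - 1) * ((r - 1) * ((a - 1) * (a - 1)))" using e rr dt by Groebner_Basis.algebra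
    then have a: "int p dvd a - 1" using rr_unit(1) by (simp add: p_dvd_mult)
    moreover have "int p dvd d - 1" using a dt(2) by Groebner_Basis.algebra
    moreover have "int p dvd b * c" using a dt by Groebner_Basis.algebra
    ultimately show ?thesis by (simp add: a_b_c_d_def)
  qed
  show ?thesis
  proof (cases "\<forall>s\<in>unip. int p dvd m21 (R s)")
    case True
    then have "unip \<subseteq> upper" using x by (auto simp: upper_def unip_def)
    then show ?thesis ..
  next
    case False
    then obtain s where s: "s \<in> unip" "\<not> int p dvd m21 (R s)" by blast
    have s12: "int p dvd m12 (R s)" using x[OF s(1)] s(2) by (simp add: p_dvd_mult)
    have "int p dvd m12 (R s')" if s': "s' \<in> unip" for s'
    proof -
      have "int p dvd m11 (R s) - 1" using x[OF s(1)] by blast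
      then have "int p dvd m21 (R s) * m12 (R s')" using unip_pair[OF ns s(1) s'] s12 by Groebner_Basis.algebra
      then show ?thesis using s(2) by (simp add: p_dvd_mult)
    qed
    then show ?thesis using x by blast
  qed
qed

end

context local_cocycle
begin

lemma diagonalI:
  assumes t: "\<tau> \<in> carrier G" "mcong q (R \<tau>) (Mat l1 0 0 l2)" and ne: "\<not> int p dvd l1 - l2" "\<not> int p dvd l1 + l2"
  obtains W r r' where "diagonal_cocycle G R p n (\<lambda>g. Z g - (R g - 1) * W) \<tau> l1 l2 r r'"
proof -
  have "q dvd det2 (R \<tau>) - l1 * l2" using mcong_det[OF t(2)] by (simp add: det2_def)
  then have d: "int p dvd det2 (R \<tau>) - l1 * l2" using p_dvd_q dvd_trans by blast
  have "\<not> int p dvd l1 * l2"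
    by (rule contrapos_nn[of "int p dvd det2 (R \<tau>)"], use det_unit t in blast, use d in Groebner_Basis.algebra)
  then have u: "\<not> int p dvd l1" "\<not> int p dvd l2" by (auto simp: p_dvd_mult)
  obtain u1 u2 where i: "q dvd l1 * u1 - 1" "q dvd l2 * u2 - 1" using inverse_mod u by meson
  define K where "K = q"
  note i = i[folded K_def]
  have r: "K dvd l1 * u2 * l2 - l1" "K dvd l2 * u1 * l1 - l2" using i by (Groebner_Basis.algebra)+
  obtain W where W: "mcong q (Z \<tau>) ((R \<tau> - 1) * W)" using loc t by blast
  interpret S: local_cocycle G R p n "\<lambda>g. Z g - (R g - 1) * W" by (rule shift)
  have "diagonal_cocycle G R p n (\<lambda>g. Z g - (R g - 1) * W) \<tau> l1 l2 (l1 * u2) (l2 * u1)"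
    by unfold_locales (use t ne r[unfolded K_def] W mcong_diff_0 in auto)
  then show thesis by (rule that)
qed

lemma case_A:
  assumes ns: no_scalars and t: "\<tau> \<in> carrier G" "mcong q (R \<tau>) (Mat l1 0 0 l2)"
    and ne: "\<not> int p dvd l1 - l2" "\<not> int p dvd l1 + l2" "\<not> int p dvd l1 - 1" "\<not> int p dvd l2 - 1"
  shows trivial_cocycle
proof -
  obtain W r r' where "diagonal_cocycle G R p n (\<lambda>g. Z g - (R g - 1) * W) \<tau> l1 l2 r r'"
    using diagonalI[OF t ne(1,2)] .
  then interpret D: diagonal_cocycle G R p n "\<lambda>g. Z g - (R g - 1) * W" \<tau> l1 l2 r r' .
  from D.unip_dichotomy[OF ns] show ?thesis
  proof
    assume "unip \<subseteq> D.upper"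
    from D.upper_A[OF ne(3,4) this] show ?thesis by (rule shift_trivial)
  next
    assume lower: "\<forall>s\<in>unip. int p dvd m11 (R s) - 1 \<and> int p dvd m12 (R s) \<and> int p dvd m22 (R s) - 1"
    \<comment> \<open>Interchanging the two basis vectors exchanges \<open>l1\<close> and
      \<open>l2\<close> and makes the lower triangular case upper triangular.\<close>
    define Q where "Q = Mat 0 1 1 0"
    have "\<not> int p dvd det2 Q" using p_not_dvd_small by (simp add: Q_def det2_def)
    then obtain R' Z' where LC: "local_cocycle G R' p n Z'"
      and tr: "local_cocycle.trivial_cocycle G R' p n Z' \<Longrightarrow> trivial_cocycle"
      and Q: "\<And>g. g \<in> carrier G \<Longrightarrow> mcong q (Q * R' g) (R g * Q)"
      using change_of_basis[of Q] by metis
    interpret C: local_cocycle G R' p n Z' by (rule LC)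
    have sw: "M dvd m11 (R' g) - m22 (R g)" "M dvd m12 (R' g) - m21 (R g)" "M dvd m21 (R' g) - m12 (R g)" "M dvd m22 (R' g) - m11 (R g)"
      if "M dvd q" "g \<in> carrier G" for M g
      using mcong_dvd[OF Q[OF that(2)] that(1)] by (auto simp: Q_def mcong_def)
    have "mcong q (R' \<tau>) (Mat (m22 (R \<tau>)) (m21 (R \<tau>)) (m12 (R \<tau>)) (m11 (R \<tau>)))"
      using sw[OF dvd_refl t(1)] by (simp add: mcong_def)
    also have "mcong q \<dots> (Mat l2 0 0 l1)" using t(2) by (auto simp: mcong_def)
    finally have t': "mcong q (R' \<tau>) (Mat l2 0 0 l1)" .
    have ne': "\<not> int p dvd l2 - l1" "\<not> int p dvd l2 + l1" using ne by (simp_all add: dvd_diff_commute add.commute)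
    obtain W' s s' where "diagonal_cocycle G R' p n (\<lambda>g. Z' g - (R' g - 1) * W') \<tau> l2 l1 s s'"
      using C.diagonalI[OF t(1) t' ne'] .
    then interpret D': diagonal_cocycle G R' p n "\<lambda>g. Z' g - (R' g - 1) * W'" \<tau> l2 l1 s s' .
    have "C.unip \<subseteq> D'.upper"
    proof
      fix g assume "g \<in> C.unip"
      then have g: "g \<in> carrier G" "int p dvd det2 (R' g) - 1" "int p dvd tr2 (R' g) - 2" by (auto simp: C.unip_def)
      note e = sw[OF p_dvd_q g(1)]
      have "int p dvd det2 (R g) - 1" using g(2) e unfolding det2_def by Groebner_Basis.algebra
      moreover have "int p dvd tr2 (R g) - 2" using g(3) e unfolding tr2_def by Groebner_Basis.algebra
      ultimately have l: "int p dvd m11 (R g) - 1" "int p dvd m12 (R g)" "int p dvd m22 (R g) - 1"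
        using lower g(1) by (auto simp: unip_def)
      have "int p dvd m11 (R' g) - 1" "int p dvd m21 (R' g)" "int p dvd m22 (R' g) - 1" using l e by (Groebner_Basis.algebra)+
      then show "g \<in> D'.upper" using g by (simp add: D'.upper_def)
    qed
    from D'.upper_A[OF ne(4,3) this] show ?thesis by (intro tr) (rule C.shift_trivial)
  qed
qed

end

section \<open>The case where the eigenvalue 1 cannot be avoided\<close>

context diagonal_cocycle
begin

lemma tau_pow: "M dvd q \<Longrightarrow> mcong M (R (\<tau> [^] (k::nat))) (Mat (l1 ^ k) 0 0 (l2 ^ k))"
proof -
  assume M: "M dvd q"
  have "Mat l1 0 0 l2 ^ k = Mat (l1 ^ k) 0 0 (l2 ^ k)" by (induction k) (simp_all add: mat2_eq_iff)
  then show ?thesis using mcong_trans[OF rho_pow[OF M tG] mcong_pow[OF mcong_dvd[OF rt M]]] by metis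
qed

lemma tau_mult_entries:
  assumes g: "g \<in> carrier G" and l2: "l2 = 1"
  shows "mcong (int p) (R (\<tau> [^] (k::nat) \<otimes> g)) (Mat (l1 ^ k * m11 (R g)) (l1 ^ k * m12 (R g)) (m21 (R g)) (m22 (R g)))"
proof -
  have "mcong (int p) (R (\<tau> [^] k \<otimes> g)) (R (\<tau> [^] k) * R g)" using g tG by (intro homM p_dvd_q) auto
  also have "mcong (int p) \<dots> (Mat (l1 ^ k) 0 0 (l2 ^ k) * R g)" by (intro mcong_mult tau_pow p_dvd_q mcong_refl)
  also have "\<dots> = Mat (l1 ^ k * m11 (R g)) (l1 ^ k * m12 (R g)) (m21 (R g)) (m22 (R g))" using l2 by (simp add: mat2_eq_iff)
  finally show ?thesis .
qed

context
  assumes l2: "l2 = 1"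
    and fixed: "\<And>g. g \<in> carrier G \<Longrightarrow> \<not> int p dvd (det2 (R g))^2 - 1 \<Longrightarrow> int p dvd det2 (R g) - tr2 (R g) + 1"
begin

text \<open>Among \<open>g, \<tau> g, \<tau>\<^sup>2 g, \<tau>\<^sup>3 g\<close> there are two elements \<open>\<tau>\<^sup>i g, \<tau>\<^sup>j g\<close> with \<open>0 < j - i \<le> 2\<close> whose determinants are
  not \<open>\<plusminus>1\<close>; both have the eigenvalue \<open>1\<close>.\<close>

lemma entries:
  assumes g: "g \<in> carrier G"
  shows "int p dvd m22 (R g) - 1" "int p dvd m12 (R g) * m21 (R g)"
proof -
  define a b c d where "a = m11 (R g)" "b = m12 (R g)" "c = m21 (R g)" "d = m22 (R g)"
  define D where "D = a * d - b * c"
  \<comment> \<open>Modulo \<open>p\<close>, \<open>good k\<close> says that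
    \<open>\<tau>^k g\<close> has the eigenvalue 1, and \<open>bad k\<close> that its determinant is
    1 or -1.\<close>
  define good where "good k \<longleftrightarrow> int p dvd l1 ^ k * (D - a) - (d - 1)" for k
  define bad where "bad k \<longleftrightarrow> int p dvd (l1 ^ k * D)^2 - 1" for k
  have l: "\<not> int p dvd l1" "\<not> int p dvd l1 - 1" "\<not> int p dvd l1 + 1" using l_unit ne ne2 l2 by auto
  have gb: "good k \<or> bad k" for k
  proof (cases "bad k")
    case False
    define y where "y = R (\<tau> [^] k \<otimes> g)"
    define L where "L = l1 ^ k"
    have e: "int p dvd m11 y - L * a" "int p dvd m12 y - L * b" "int p dvd m21 y - c" "int p dvd m22 y - d"
      using tau_mult_entries[OF g l2, of k] by (simp_all add: mcong_def y_def a_b_c_d_def L_def)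
    have "\<not> int p dvd (det2 y)^2 - 1"
      by (rule contrapos_nn[of "int p dvd (L * D)^2 - 1"], use False in \<open>simp add: bad_def L_def\<close>, unfold det2_def D_def, use e in Groebner_Basis.algebra)
    then have "int p dvd det2 y - tr2 y + 1" using fixed[of "\<tau> [^] k \<otimes> g"] g tG by (simp add: y_def)
    then have "int p dvd L * (D - a) - (d - 1)" using e unfolding det2_def tr2_def D_def by Groebner_Basis.algebra
    then show ?thesis by (simp add: good_def L_def)
  qed simp
  have bb: "\<not> (bad k \<and> bad (Suc k))" for k
  proof
    assume bad: "bad k \<and> bad (Suc k)"
    define L where "L = l1 ^ k * D"
    have "int p dvd L^2 - 1" "int p dvd (l1 * L)^2 - 1" using bad by (simp_all add: bad_def L_def mult.assoc)
    then have "int p dvd (l1 - 1) * (l1 + 1)" by Groebner_Basis.algebra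
    then show False using l by (simp add: p_dvd_mult)
  qed
  have g1: "int p dvd D - a" if "good k" "good (Suc k)" for k
  proof -
    define L where "L = l1 ^ k"
    have "int p dvd L * (D - a) - (d - 1)" "int p dvd l1 * L * (D - a) - (d - 1)" using that by (simp_all add: good_def L_def)
    then have "int p dvd L * ((l1 - 1) * (D - a))" by Groebner_Basis.algebra
    moreover have "\<not> int p dvd L" using l(1) prime_int unfolding L_def by (metis prime_dvd_power)
    ultimately show ?thesis using l by (simp add: p_dvd_mult)
  qed
  have g2: "int p dvd D - a" if "good k" "good (Suc (Suc k))" for k
  proof -
    define L where "L = l1 ^ k"
    have "int p dvd L * (D - a) - (d - 1)" "int p dvd l1 * l1 * L * (D - a) - (d - 1)"
      using that by (simp_all add: good_def L_def mult.assoc)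
    then have "int p dvd L * ((l1 - 1) * ((l1 + 1) * (D - a)))" by Groebner_Basis.algebra
    moreover have "\<not> int p dvd L" using l(1) prime_int unfolding L_def by (metis prime_dvd_power)
    ultimately show ?thesis using l by (simp add: p_dvd_mult)
  qed
  have Da: "int p dvd D - a"
    using gb[of 0] gb[of "Suc 0"] gb[of "Suc (Suc 0)"] gb[of "Suc (Suc (Suc 0))"]
      bb[of 0] bb[of "Suc 0"] bb[of "Suc (Suc 0)"] g1[of 0] g1[of "Suc 0"] g1[of "Suc (Suc 0)"] g2[of 0] g2[of "Suc 0"] by argo
  from gb[of 0] gb[of "Suc 0"] bb[of 0] obtain k where "good k" by blast
  then have "int p dvd d - 1" using Da unfolding good_def by (metis dvd_mult dvd_diffD dvd_diff_commute dvd_diff_right_iff diff_0_right)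
  moreover have "int p dvd b * c" using calculation Da unfolding D_def by Groebner_Basis.algebra
  ultimately show "int p dvd m22 (R g) - 1" "int p dvd m12 (R g) * m21 (R g)" by (simp_all add: a_b_c_d_def)
qed

lemma case_C:
  assumes nf: fixes_no_vector
  shows trivial_cocycle
proof -
  \<comment> \<open>Otherwise the whole group would fix the second basis vector modulo
    \<open>p\<close>.\<close>
  have "\<exists>g\<in>carrier G. \<not> int p dvd m12 (R g)"
  proof (rule ccontr)
    assume "\<not> (\<exists>g\<in>carrier G. \<not> int p dvd m12 (R g))"
    then have "\<forall>g\<in>carrier G. mcong (int p) (R g * Mat 0 0 1 0) (Mat 0 0 1 0)"
      using entries by (simp add: mcong_def)
    then have "mcong (int p) (Mat 0 0 1 0) 0" using nf unfolding fixes_no_vector_def by blast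
    then show False using p_not_dvd_small by (simp add: mcong_def)
  qed
  then obtain g where g: "g \<in> carrier G" "\<not> int p dvd m12 (R g)" by blast
  \<comment> \<open>The lower right entries of \<open>h\<close>, \<open>g\<close> and
    \<open>h \<otimes> g\<close> are all 1 modulo \<open>p\<close>, so the lower left entry of
    \<open>h\<close> times the nonzero upper right entry of \<open>g\<close> must vanish.\<close>
  have low: "int p dvd m21 (R h)" if h: "h \<in> carrier G" for h
  proof -
    have g21: "int p dvd m21 (R g)" using entries(2)[OF g(1)] g(2) by (simp add: p_dvd_mult)
    have e: "int p dvd m22 (R (h \<otimes> g)) - (m21 (R h) * m12 (R g) + m22 (R h) * m22 (R g))"
      using homM[OF p_dvd_q h g(1)] by (simp add: mcong_def)
    have "int p dvd m21 (R h) * m12 (R g)" using e entries(1)[of "h \<otimes> g"] entries(1)[OF h] entries(1)[OF g(1)] g(1) h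
      by simp Groebner_Basis.algebra
    then show ?thesis using g(2) by (simp add: p_dvd_mult)
  qed
  have U: "unip \<subseteq> upper"
  proof
    fix s assume s: "s \<in> unip"
    then have sc: "s \<in> carrier G" "int p dvd tr2 (R s) - 2" by (auto simp: unip_def)
    have "int p dvd m11 (R s) - 1" using sc(2) entries(1)[OF sc(1)] unfolding tr2_def by Groebner_Basis.algebra
    then show "s \<in> upper" using sc low entries by (simp add: upper_def)
  qed
  obtain x where x: "mcong (int p ^ 1) (R (cj g \<otimes> inv g)) (Mat 1 x 0 1)" "int p ^ 1 dvd x * m22 (R g) - (r - 1) * m12 (R g)"
    using quotient_triangular(1)[of 1 g] n0 g(1) low by auto
  have xu: "\<not> int p dvd x"
    by (rule contrapos_nn[of "int p dvd (r - 1) * m12 (R g)"], use rr_unit g in \<open>simp add: p_dvd_mult\<close>, use x(2) in \<open>unfold power_one_right, Groebner_Basis.algebra\<close>)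
  have yu: "cj g \<otimes> inv g \<in> upper" "\<not> int p dvd m12 (R (cj g \<otimes> inv g))"
  proof -
    have e: "int p dvd m11 (R (cj g \<otimes> inv g)) - 1" "int p dvd m12 (R (cj g \<otimes> inv g)) - x"
      "int p dvd m21 (R (cj g \<otimes> inv g))" "int p dvd m22 (R (cj g \<otimes> inv g)) - 1"
      using x(1) by (simp_all add: mcong_def)
    show "cj g \<otimes> inv g \<in> upper" using e g(1) by (simp add: upper_def)
    show "\<not> int p dvd m12 (R (cj g \<otimes> inv g))"
      by (rule contrapos_nn[of "int p dvd x"], use xu in simp, use e(2) in Groebner_Basis.algebra)
  qed
  obtain u b where u: "u \<in> carrier G" "mcong q (R u) (Mat 1 b 0 1)" "\<not> int p dvd b"
    using lift_transvection[OF yu] .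
  obtain W where W: "mcong q (Z u) ((R u - 1) * W)" using loc u(1) by blast
  \<comment> \<open>The coboundary at \<open>u\<close> depends only on the second row of
    \<open>W\<close>. Dropping the first row leaves vectors fixed by \<open>\<tau>\<close>, since
    \<open>l2 = 1\<close>, so \<open>Z\<close> can be made to vanish at \<open>u\<close> without
    losing its vanishing at \<open>\<tau>\<close>.\<close>
  define V where "V = Mat 0 0 (m21 W) (m22 W)"
  have "mcong q ((R u - 1) * W) ((Mat 1 b 0 1 - 1) * W)" by (intro mcong_mult mcong_diff u(2) mcong_refl)
  also have "(Mat 1 b 0 1 - 1) * W = (Mat 1 b 0 1 - 1) * V" by (simp add: V_def mat2_eq_iff)
  also have "mcong q \<dots> ((R u - 1) * V)" by (intro mcong_mult mcong_diff mcong_sym[OF u(2)] mcong_refl)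
  finally have uV: "mcong q (Z u) ((R u - 1) * V)" using W mcong_trans by blast
  have "mcong q ((R \<tau> - 1) * V) ((Mat l1 0 0 1 - 1) * V)" using rt l2 by (intro mcong_mult mcong_diff mcong_refl) simp
  also have "(Mat l1 0 0 1 - 1) * V = 0" by (simp add: V_def mat2_eq_iff)
  finally have tV: "mcong q ((R \<tau> - 1) * V) 0" .
  interpret S: local_cocycle G R p n "\<lambda>g. Z g - (R g - 1) * V" by (rule shift)
  have Zt': "mcong q (Z \<tau> - (R \<tau> - 1) * V) 0" using mcong_diff[OF Zt tV] by simp
  interpret D: diagonal_cocycle G R p n "\<lambda>g. Z g - (R g - 1) * V" \<tau> l1 l2 r r'
    by unfold_locales (use tG rt r r' ne ne2 Zt' in auto)
  have Du: "mcong q (Z u - (R u - 1) * V) 0" using uV mcong_diff_0 by blast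
  have eU: "D.upper = upper" by (simp add: D.upper_def upper_def)
  have ex: "\<exists>u\<in>carrier G. \<exists>b. mcong q (R u) (Mat 1 b 0 1) \<and> \<not> int p dvd b \<and> mcong q (Z u - (R u - 1) * V) 0"
    using u Du by blast
  have l1: "\<not> int p dvd l1 - 1" using ne l2 by simp
  show ?thesis
  proof (rule shift_trivial[of V], rule D.upper_trivial)
    show "unip \<subseteq> D.upper" using U eU by simp
    show "mcong q (Z g - (R g - 1) * V) 0" if "g \<in> D.N" for g using D.N_vanish[OF l1 disjI2[OF ex] that] .
    show "unip \<subseteq> D.N \<or> (\<exists>u\<in>carrier G. \<exists>b. mcong q (R u) (Mat 1 b 0 1) \<and> \<not> int p dvd b \<and> mcong q (Z u - (R u - 1) * V) 0)"
      using ex by blast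
  qed
qed

end

end

section \<open>Diagonalisation and the theorem on matrix groups\<close>

lemma diag_pow: "Mat l1 0 0 l2 ^ k = Mat (l1 ^ k) 0 0 (l2 ^ k)"
  by (induction k) (simp_all add: mat2_eq_iff)

context local_rep
begin

lemma split_eigenvalues:
  assumes ns: no_scalars and g: "g \<in> carrier G" and d: "\<not> int p dvd (det2 (R g))^2 - 1"
  obtains l1 l2 where "q dvd l1 + l2 - tr2 (R g)" "q dvd l1 * l2 - det2 (R g)" "\<not> int p dvd l1 - l2" "\<not> int p dvd l1 + l2"
proof -
  define t \<delta> where "t = tr2 (R g)" "\<delta> = det2 (R g)"
  obtain k1 k2 where k: "int p dvd k1 + k2 - t" "int p dvd k1 * k2 - \<delta>" "\<not> int p dvd k1 - k2"
  proof -
    have "\<not> int p dvd det2 (R g) - 1" by (rule contrapos_nn[OF d]) Groebner_Basis.algebra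
    from distinct_eigenvalues[OF ns g this] that show thesis by (auto simp: t_\<delta>_def)
  qed
  have "int p dvd k1^2 - t * k1 + \<delta>" using k(1,2) by Groebner_Basis.algebra
  moreover have "\<not> int p dvd 2 * k1 - t"
    by (rule contrapos_nn[of "int p dvd k1 - k2"], use k(3) in simp, use k(1) in Groebner_Basis.algebra)
  ultimately obtain m where m: "int p dvd m - k1" "q dvd m^2 - t * m + \<delta>" using hensel_quadratic[OF prime] by blast
  have "\<not> int p dvd m - (t - m)"
    by (rule contrapos_nn[of "int p dvd k1 - k2"], use k(3) in simp, use k(1) m(1) in Groebner_Basis.algebra)
  moreover have "q dvd m * (t - m) - \<delta>"
  proof -
    have "m * (t - m) - \<delta> = - (m^2 - t * m + \<delta>)" by (simp add: algebra_simps power2_eq_square)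
    then show ?thesis using m(2) by (simp only: dvd_minus_iff)
  qed
  \<comment> \<open>Trace 0 would make \<open>g \<otimes> g\<close> the scalar
    \<open>- \<delta>\<close> modulo \<open>p\<close>.\<close>
  moreover have "\<not> int p dvd m + (t - m)"
  proof
    assume "int p dvd m + (t - m)"
    then have t: "int p dvd t" by simp
    have "mcong (int p) (R (g \<otimes> g)) (R g * R g)" using g by (intro homM p_dvd_q)
    also have "R g * R g = of_int (- \<delta>) + of_int t * R g"
      by (simp add: mat2_eq_iff t_\<delta>_def det2_def tr2_def algebra_simps)
    also have "mcong (int p) \<dots> (of_int (- \<delta>))" using t by (rule mcong_absorb)
    finally have "int p dvd - \<delta> - 1" using ns g unfolding no_scalars_def by blast
    then have "int p dvd \<delta>^2 - 1" by Groebner_Basis.algebra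
    then show False using d by (simp add: t_\<delta>_def)
  qed
  ultimately show thesis using that[of m "t - m"] by (simp add: t_\<delta>_def)
qed

end

context local_cocycle
begin

lemma diagonalise:
  assumes g: "g \<in> carrier G"
    and l: "q dvd l1 + l2 - tr2 (R g)" "q dvd l1 * l2 - det2 (R g)" "\<not> int p dvd l1 - l2"
  obtains R' Z' where "local_cocycle G R' p n Z'"
    "local_cocycle.trivial_cocycle G R' p n Z' \<Longrightarrow> trivial_cocycle"
    "mcong q (R' g) (Mat l1 0 0 l2)"
    "\<And>g. g \<in> carrier G \<Longrightarrow> int p dvd det2 (R' g) - det2 (R g)"
    "\<And>g. g \<in> carrier G \<Longrightarrow> int p dvd tr2 (R' g) - tr2 (R g)"
    "no_scalars \<Longrightarrow> local_rep.no_scalars G R' p" "fixes_no_vector \<Longrightarrow> local_rep.fixes_no_vector G R' p"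
proof -
  obtain Q where Q: "\<not> int p dvd det2 Q" "mcong q (R g * Q) (Q * Mat l1 0 0 l2)"
    using eigenbasis[OF prime n0 l] by blast
  obtain R' Z' where C: "local_cocycle G R' p n Z'"
    "local_cocycle.trivial_cocycle G R' p n Z' \<Longrightarrow> trivial_cocycle"
    "no_scalars \<Longrightarrow> local_rep.no_scalars G R' p" "fixes_no_vector \<Longrightarrow> local_rep.fixes_no_vector G R' p"
    and e: "\<And>g. g \<in> carrier G \<Longrightarrow> mcong q (Q * R' g) (R g * Q)"
    by (rule change_of_basis[OF Q(1)]) (rule that)
  have cp: "coprime (det2 Q) q" using Q(1) prime_int by (metis coprime_commute coprime_power_left_iff prime_imp_coprime)
  have "mcong q (Q * R' g) (Q * Mat l1 0 0 l2)" using e[OF g] Q(2) by (rule mcong_trans)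
  from mcong_mult[OF mcong_refl[of _ "adj2 Q"] this]
  have "mcong q (of_int (det2 Q) * R' g) (of_int (det2 Q) * Mat l1 0 0 l2)" by (simp only: mult.assoc[symmetric] adj2_mult)
  then have d: "mcong q (R' g) (Mat l1 0 0 l2)" using cp by (rule mcong_cancel)
  have dt: "int p dvd det2 (R' h) - det2 (R h)" if "h \<in> carrier G" for h
  proof -
    have "int p dvd det2 (Q * R' h) - det2 (R h * Q)" using dvd_trans[OF p_dvd_q mcong_det[OF e[OF that]]] .
    then have "int p dvd det2 Q * (det2 (R' h) - det2 (R h))" by (simp add: det2_mult algebra_simps)
    then show ?thesis using Q(1) by (simp add: p_dvd_mult)
  qed
  have tr: "int p dvd tr2 (R' h) - tr2 (R h)" if "h \<in> carrier G" for h
  proof -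
    have "mcong q (adj2 Q * (Q * R' h)) (adj2 Q * (R h * Q))" by (intro mcong_mult mcong_refl e that)
    then have "mcong q (of_int (det2 Q) * R' h) (adj2 Q * (R h * Q))" by (simp only: mult.assoc[symmetric] adj2_mult)
    then have "mcong (int p) (of_int (det2 Q) * R' h) (adj2 Q * (R h * Q))" using p_dvd_q by (rule mcong_dvd)
    then have "int p dvd det2 Q * m11 (R' h) - m11 (adj2 Q * (R h * Q))" "int p dvd det2 Q * m22 (R' h) - m22 (adj2 Q * (R h * Q))"
      by (simp_all add: mcong_def)
    from dvd_add[OF this] have "int p dvd det2 Q * (tr2 (R' h) - tr2 (R h))"
      by (simp add: adj2_def tr2_def det2_def algebra_simps)
    then show ?thesis using Q(1) by (simp add: p_dvd_mult)
  qed
  show thesis using that[OF C(1,2) d dt tr C(3,4)] .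
qed

lemma eigenvalue_one:
  assumes "\<And>g. g \<in> carrier G \<Longrightarrow> \<not> int p dvd (det2 (R g))^2 - 1 \<Longrightarrow> int p dvd det2 (R g) - tr2 (R g) + 1"
    and g: "g \<in> carrier G"
    and l: "q dvd l1 + l2 - tr2 (R g)" "q dvd l1 * l2 - det2 (R g)" "\<not> int p dvd l1 - l2" "\<not> int p dvd l1 + l2"
    and one: "int p dvd l2 - 1" and nf: fixes_no_vector
  shows trivial_cocycle
proof -
  obtain R' Z' where C: "local_cocycle G R' p n Z'"
    "local_cocycle.trivial_cocycle G R' p n Z' \<Longrightarrow> trivial_cocycle"
    "mcong q (R' g) (Mat l1 0 0 l2)"
    and dt: "\<And>g. g \<in> carrier G \<Longrightarrow> int p dvd det2 (R' g) - det2 (R g)"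
    and tr: "\<And>g. g \<in> carrier G \<Longrightarrow> int p dvd tr2 (R' g) - tr2 (R g)"
    and nf': "local_rep.fixes_no_vector G R' p"
    by (rule diagonalise[OF g l(1,2,3)]) (rule that, use nf in auto)
  interpret C: local_cocycle G R' p n Z' by (rule C)
  \<comment> \<open>The power \<open>p^(n - 1)\<close> turns an eigenvalue that is 1 modulo
    \<open>p\<close> into one that is 1 modulo \<open>p^n\<close>, and by Fermat leaves the other
    unchanged modulo \<open>p\<close>. So \<open>case_C\<close> applies with second eigenvalue
    exactly 1.\<close>
  define k where "k = p ^ (n - 1)"
  define \<tau> where "\<tau> = g [^] k"
  have t: "\<tau> \<in> carrier G" using g by (simp add: \<tau>_def)
  have "mcong (int p) (Mat l2 0 0 l2) (of_int 1)" using one by (simp add: mcong_def)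
  from mcong_scalar_pow_iter[OF this, of "n - 1"] have l2: "q dvd l2 ^ k - 1"
    using n0 by (simp add: diag_pow k_def mcong_def)
  have "mcong q (R' \<tau>) (R' g ^ k)" unfolding \<tau>_def by (intro C.rho_pow g dvd_refl)
  also have "mcong q \<dots> (Mat l1 0 0 l2 ^ k)" by (rule mcong_pow[OF C(3)])
  also have "mcong q \<dots> (Mat (l1 ^ k) 0 0 1)" using l2 by (simp add: diag_pow mcong_def)
  finally have rt: "mcong q (R' \<tau>) (Mat (l1 ^ k) 0 0 1)" .
  define L where "L = l1 ^ k"
  have L: "int p dvd L - l1" unfolding L_def k_def by (rule fermat_iter[OF prime])
  have ne: "\<not> int p dvd L - 1" "\<not> int p dvd L + 1"
  proof -
    show "\<not> int p dvd L - 1"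
      by (rule contrapos_nn[of "int p dvd l1 - l2"], use l in simp, use L one in Groebner_Basis.algebra)
    show "\<not> int p dvd L + 1"
      by (rule contrapos_nn[of "int p dvd l1 + l2"], use l in simp, use L one in Groebner_Basis.algebra)
  qed
  obtain W r r' where "diagonal_cocycle G R' p n (\<lambda>g. Z' g - (R' g - 1) * W) \<tau> L 1 r r'"
    using C.diagonalI[OF t rt[folded L_def] ne] .
  then interpret D: diagonal_cocycle G R' p n "\<lambda>g. Z' g - (R' g - 1) * W" \<tau> L 1 r r' .
  have "D.trivial_cocycle"
  proof (rule D.case_C[OF refl _ nf'])
    fix h assume h: "h \<in> carrier G" "\<not> int p dvd (det2 (R' h))^2 - 1"
    note e = dt[OF h(1)] tr[OF h(1)]
    have "\<not> int p dvd (det2 (R h))^2 - 1" by (rule contrapos_nn[OF h(2)]) (use e in Groebner_Basis.algebra)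
    then have "int p dvd det2 (R h) - tr2 (R h) + 1" using assms(1) h(1) by blast
    then show "int p dvd det2 (R' h) - tr2 (R' h) + 1" using e by Groebner_Basis.algebra
  qed
  then show ?thesis by (intro C(2)) (rule C.shift_trivial)
qed

theorem locally_trivial_cocycle_trivial:
  assumes nf: fixes_no_vector and d: "\<exists>g\<in>carrier G. \<not> int p dvd (det2 (R g))^2 - 1"
  shows trivial_cocycle
proof (cases no_scalars)
  case False
  then show ?thesis by (rule scalar_trivial)
next
  case ns: True
  \<comment> \<open>Both numbers are the value of the characteristic polynomial at 1, modulo
    \<open>p\<close>.\<close>
  have red: "int p dvd (l1 - 1) * (l2 - 1) \<longleftrightarrow> int p dvd det2 (R g) - tr2 (R g) + 1"
    if "q dvd l1 + l2 - tr2 (R g)" "q dvd l1 * l2 - det2 (R g)" for g l1 l2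
  proof -
    have e: "int p dvd l1 + l2 - tr2 (R g)" "int p dvd l1 * l2 - det2 (R g)" using that p_dvd_q dvd_trans by blast+
    show ?thesis
    proof
      assume "int p dvd (l1 - 1) * (l2 - 1)"
      then show "int p dvd det2 (R g) - tr2 (R g) + 1" using e by Groebner_Basis.algebra
    next
      assume "int p dvd det2 (R g) - tr2 (R g) + 1"
      then show "int p dvd (l1 - 1) * (l2 - 1)" using e by Groebner_Basis.algebra
    qed
  qed
  show ?thesis
  proof (cases "\<exists>g\<in>carrier G. \<not> int p dvd (det2 (R g))^2 - 1 \<and> \<not> int p dvd det2 (R g) - tr2 (R g) + 1")
    case True
    then obtain g where g: "g \<in> carrier G" "\<not> int p dvd (det2 (R g))^2 - 1"
      "\<not> int p dvd det2 (R g) - tr2 (R g) + 1" by blast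
    obtain l1 l2 where l: "q dvd l1 + l2 - tr2 (R g)" "q dvd l1 * l2 - det2 (R g)" "\<not> int p dvd l1 - l2" "\<not> int p dvd l1 + l2"
      using split_eigenvalues[OF ns g(1,2)] .
    have l': "\<not> int p dvd l1 - 1" "\<not> int p dvd l2 - 1" using red[OF l(1,2)] g(3) by (auto simp: p_dvd_mult)
    obtain R' Z' where C: "local_cocycle G R' p n Z'"
      "local_cocycle.trivial_cocycle G R' p n Z' \<Longrightarrow> trivial_cocycle"
      "mcong q (R' g) (Mat l1 0 0 l2)" "local_rep.no_scalars G R' p"
      by (rule diagonalise[OF g(1) l(1,2,3)]) (rule that, use ns in auto)
    interpret C: local_cocycle G R' p n Z' by (rule C)
    show ?thesis using C.case_A[OF C(4) g(1) C(3) l(3,4) l'] by (rule C(2))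
  next
    case False
    then have fixed: "\<And>g. g \<in> carrier G \<Longrightarrow> \<not> int p dvd (det2 (R g))^2 - 1 \<Longrightarrow> int p dvd det2 (R g) - tr2 (R g) + 1"
      by blast
    obtain g where g: "g \<in> carrier G" "\<not> int p dvd (det2 (R g))^2 - 1" using d by blast
    obtain l1 l2 where l: "q dvd l1 + l2 - tr2 (R g)" "q dvd l1 * l2 - det2 (R g)" "\<not> int p dvd l1 - l2" "\<not> int p dvd l1 + l2"
      using split_eigenvalues[OF ns g(1,2)] .
    have "int p dvd l1 - 1 \<or> int p dvd l2 - 1" using red[OF l(1,2)] fixed[OF g] by (simp add: p_dvd_mult)
    then show ?thesis
    proof
      assume "int p dvd l2 - 1"
      with eigenvalue_one[OF fixed g(1) l] nf show ?thesis by blast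
    next
      assume 1: "int p dvd l1 - 1"
      have "q dvd l2 + l1 - tr2 (R g)" "q dvd l2 * l1 - det2 (R g)" "\<not> int p dvd l2 - l1" "\<not> int p dvd l2 + l1"
        using l by (simp_all add: add.commute mult.commute dvd_diff_commute)
      from eigenvalue_one[OF fixed g(1) this 1 nf] show ?thesis by blast
    qed
  qed
qed

end

section \<open>Automorphisms of an algebraic closure\<close>

locale algebraic_over =
  fixes k :: "'a::field_char_0 set"
  assumes k01 [simp, intro]: "0 \<in> k" "1 \<in> k"
    and k_add: "x \<in> k \<Longrightarrow> y \<in> k \<Longrightarrow> x + y \<in> k" and k_mult: "x \<in> k \<Longrightarrow> y \<in> k \<Longrightarrow> x * y \<in> k"
    and k_uminus: "x \<in> k \<Longrightarrow> - x \<in> k" and k_inverse: "x \<in> k \<Longrightarrow> inverse x \<in> k"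
    and alg: "\<exists>r. r \<noteq> 0 \<and> (\<forall>i. poly.coeff r i \<in> k) \<and> poly r x = 0"
    and ac: "degree (r :: 'a poly) > 0 \<Longrightarrow> \<exists>z. poly r z = 0"
begin

text \<open>The graph of an embedding over \<open>k\<close> of a ring between \<open>k\<close> and the algebraic closure. The notion is
  symmetric in the two components.\<close>

definition graph :: "('a \<times> 'a) set \<Rightarrow> bool" where
  "graph R \<longleftrightarrow> (\<forall>c\<in>k. (c, c) \<in> R) \<and> (\<forall>x x' y y'. (x, x') \<in> R \<longrightarrow> (y, y') \<in> R \<longrightarrow> (x + y, x' + y') \<in> R \<and> (x * y, x' * y') \<in> R)
     \<and> (\<forall>y. (0, y) \<in> R \<longrightarrow> y = 0)"

lemma graphD:
  assumes "graph R"
  shows "c \<in> k \<Longrightarrow> (c, c) \<in> R" "(x, x') \<in> R \<Longrightarrow> (y, y') \<in> R \<Longrightarrow> (x + y, x' + y') \<in> R"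
    "(x, x') \<in> R \<Longrightarrow> (y, y') \<in> R \<Longrightarrow> (x * y, x' * y') \<in> R" "(0, y) \<in> R \<Longrightarrow> y = 0"
  using assms unfolding graph_def by blast+

lemma graph_diff:
  assumes "graph R" "(x, x') \<in> R" "(y, y') \<in> R" shows "(x - y, x' - y') \<in> R"
proof -
  have "(- 1, - 1) \<in> R" using graphD(1)[OF assms(1)] k_uminus k01 by blast
  from graphD(2)[OF assms(1,2) graphD(3)[OF assms(1) this assms(3)]] show ?thesis by simp
qed

lemma graph_sum:
  assumes "graph R" "\<And>i. i \<in> I \<Longrightarrow> (f i, g i) \<in> R" shows "(sum f I, sum g I) \<in> R"
  using assms(2)
  by (induction I rule: infinite_finite_induct) (auto intro: graphD(1,2)[OF assms(1)])

definition poly_rel :: "('a \<times> 'a) set \<Rightarrow> 'a poly \<Rightarrow> 'a poly \<Rightarrow> bool" where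
  "poly_rel R p p' \<longleftrightarrow> (\<forall>i. (poly.coeff p i, poly.coeff p' i) \<in> R)"

lemma poly_rel_add: "graph R \<Longrightarrow> poly_rel R p p' \<Longrightarrow> poly_rel R s s' \<Longrightarrow> poly_rel R (p + s) (p' + s')"
  by (simp add: poly_rel_def graphD)

lemma poly_rel_diff: "graph R \<Longrightarrow> poly_rel R p p' \<Longrightarrow> poly_rel R s s' \<Longrightarrow> poly_rel R (p - s) (p' - s')"
  by (simp add: poly_rel_def graph_diff)

lemma poly_rel_mult: "graph R \<Longrightarrow> poly_rel R p p' \<Longrightarrow> poly_rel R s s' \<Longrightarrow> poly_rel R (p * s) (p' * s')"
  unfolding poly_rel_def coeff_mult by (intro allI graph_sum graphD) auto

lemma poly_rel_const: "graph R \<Longrightarrow> (x, x') \<in> R \<Longrightarrow> poly_rel R [:x:] [:x':]"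
  using graphD(1)[of R 0] by (auto simp: poly_rel_def coeff_pCons split: nat.split)

lemma poly_rel_X: "graph R \<Longrightarrow> poly_rel R [:0, 1:] [:0, 1:]"
  using graphD(1)[of R 0] graphD(1)[of R 1] by (auto simp: poly_rel_def coeff_pCons split: nat.split)

lemma poly_rel_power: "graph R \<Longrightarrow> poly_rel R p p' \<Longrightarrow> poly_rel R (p ^ i) (p' ^ i)"
  by (induction i) (auto intro: poly_rel_mult poly_rel_const[of _ 1 1, simplified one_pCons[symmetric]] graphD(1))

lemma poly_rel_k: "graph R \<Longrightarrow> (\<And>i. poly.coeff r i \<in> k) \<Longrightarrow> poly_rel R r r"
  by (simp add: poly_rel_def graphD)

lemma poly_rel_poly:
  assumes "graph R" "poly_rel R p p'" "(x, x') \<in> R" shows "(poly p x, poly p' x') \<in> R"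
proof -
  define d where "d = max (degree p) (degree p')"
  have pw: "(x ^ i, x' ^ i) \<in> R" for i
    by (induction i) (auto intro: graphD(1,3)[OF assms(1)] assms(3))
  have ev: "poly s y = (\<Sum>i\<le>d. poly.coeff s i * y ^ i)" if "degree s \<le> d" for s and y :: 'a
    unfolding poly_altdef by (rule sum.mono_neutral_left) (use that in \<open>auto simp: coeff_eq_0\<close>)
  have "poly p x = (\<Sum>i\<le>d. poly.coeff p i * x ^ i)" "poly p' x' = (\<Sum>i\<le>d. poly.coeff p' i * x' ^ i)"
    by (rule ev; simp add: d_def)+
  moreover have "(\<Sum>i\<le>d. poly.coeff p i * x ^ i, \<Sum>i\<le>d. poly.coeff p' i * x' ^ i) \<in> R"
    by (intro graph_sum graphD(3)[OF assms(1)] assms(1) pw) (use assms(2) in \<open>auto simp: poly_rel_def\<close>)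
  ultimately show ?thesis by simp
qed

text \<open>A nonzero algebraic \<open>x\<close> is a root of a polynomial over \<open>k\<close>
  with nonzero constant term. The relation fixes its coefficients, so if \<open>x\<close> were
  related to 0, then the value 0 at \<open>x\<close> would be related to that constant term.\<close>

lemma graph_inj:
  assumes R: "graph R" and x: "(x, 0) \<in> R" shows "x = 0"
proof (rule ccontr)
  assume "x \<noteq> 0"
  obtain r where r: "r \<noteq> 0" "\<forall>i. poly.coeff r i \<in> k" "poly r x = 0" using alg by blast
  have "\<exists>r. r \<noteq> 0 \<and> (\<forall>i. poly.coeff r i \<in> k) \<and> poly r x = 0 \<and> poly.coeff r 0 \<noteq> 0" using r
  proof (induction "degree r" arbitrary: r rule: less_induct)
    case less
    show ?case
    proof (cases "poly.coeff r 0 = 0")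
      case True
      obtain a r' where r': "r = pCons a r'" by (cases r)
      have "a = 0" using True r' by simp
      then have "r' \<noteq> 0" "poly r' x = 0" using less.prems \<open>x \<noteq> 0\<close> r' by auto
      moreover have "degree r' < degree r" using r' \<open>r' \<noteq> 0\<close> by simp
      moreover have "poly.coeff r' i \<in> k" for i using less.prems(2)[rule_format, of "Suc i"] r' by simp
      ultimately show ?thesis using less.hyps by blast
    qed (use less.prems in blast)
  qed
  then obtain r where r: "\<forall>i. poly.coeff r i \<in> k" "poly r x = 0" "poly.coeff r 0 \<noteq> 0" by blast
  have "(poly r x, poly r 0) \<in> R" using r by (intro poly_rel_poly[OF R] poly_rel_k R x) auto
  then show False using r graphD(4)[OF R] by (simp add: poly_0_coeff_0)
qed

lemma graph_converse: "graph R \<Longrightarrow> graph (R\<inverse>)"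
  unfolding graph_def[of "R\<inverse>"] using graphD graph_inj by auto

definition extend :: "('a \<times> 'a) set \<Rightarrow> 'a \<Rightarrow> 'a \<Rightarrow> ('a \<times> 'a) set" where
  "extend R z w = {(poly p z, poly p' w) | p p'. poly_rel R p p'}"

lemma extend_subset: "graph R \<Longrightarrow> R \<subseteq> extend R z w"
proof (rule subrelI)
  fix x y assume "graph R" "(x, y) \<in> R"
  then have "poly_rel R [:x:] [:y:]" by (rule poly_rel_const)
  then show "(x, y) \<in> extend R z w" unfolding extend_def by force
qed

lemma extend_mem: "graph R \<Longrightarrow> (z, w) \<in> extend R z w"
  using poly_rel_X[of R] unfolding extend_def by force

text \<open>The point is well-definedness: \<open>p(z) = 0\<close> must imply
  \<open>p'(w) = 0\<close>. The domain of \<open>R\<close> is only required to be a ring, so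
  \<open>m\<close> is not made monic; division is replaced by pseudo-division, which lowers the
  degree after multiplication by a leading coefficient.\<close>

lemma graph_extend:
  assumes R: "graph R" and m: "m \<noteq> 0" "poly_rel R m m'" "poly m z = 0" "poly m' w = 0"
    and min: "\<And>p p'. poly_rel R p p' \<Longrightarrow> p \<noteq> 0 \<Longrightarrow> poly p z = 0 \<Longrightarrow> degree m \<le> degree p"
  shows "graph (extend R z w)"
proof -
  have lead: "poly.coeff m' (degree m) \<noteq> 0"
    using graph_inj[OF R, of "lead_coeff m"] m(1,2) unfolding poly_rel_def by (metis leading_coeff_0_iff)
  have zero: "poly p z = 0 \<longrightarrow> poly p' w = 0" if "poly_rel R p p'" for p p' using that
  proof (induction "degree p" arbitrary: p p' rule: less_induct)
    case less
    show ?case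
    proof (cases "p = 0")
      case True
      then have "p' = 0" using less.prems graphD(4)[OF R] unfolding poly_rel_def by (auto intro: poly_eqI)
      then show ?thesis by simp
    next
      case False
      show ?thesis
      proof
        assume pz: "poly p z = 0"
        define d where "d = degree p - degree m"
        have dp: "degree p = d + degree m" using min[OF less.prems False pz] by (simp add: d_def)
        define a b a' b' where "a = lead_coeff m" "b = lead_coeff p" "a' = poly.coeff m' (degree m)"
          "b' = poly.coeff p' (degree p)"
        have ab: "(a, a') \<in> R" "(b, b') \<in> R" using m less.prems by (auto simp: a_b_a'_b'_def poly_rel_def)
        \<comment> \<open>One step of pseudo-division, carried out simultaneously in both
          components.\<close>
        define s s' where "s = [:a:] * p - [:b:] * ([:0, 1:] ^ d * m)" "s' = [:a':] * p' - [:b':] * ([:0, 1:] ^ d * m')"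
        have rel: "poly_rel R s s'" unfolding s_s'_def
          by (intro poly_rel_diff poly_rel_mult poly_rel_const poly_rel_power poly_rel_X R ab less.prems m)
        have sz: "poly s z = 0" using pz m by (simp add: s_s'_def)
        have dX: "degree ([:0, 1:] ^ d * m) = degree p"
          using m(1) dp by (simp add: degree_mult_eq degree_power_eq)
        have cX: "lead_coeff ([:0, 1:] ^ d * m) = a" by (simp add: lead_coeff_mult lead_coeff_power a_b_a'_b'_def)
        have "poly.coeff s (degree p) = 0" using cX dX by (simp add: s_s'_def a_b_a'_b'_def)
        moreover have "degree s \<le> degree p" unfolding s_s'_def
          by (rule degree_diff_le) (simp_all add: dX)
        ultimately have "s = 0 \<or> degree s < degree p"
          by (metis le_neq_implies_less leading_coeff_0_iff)
        then have "poly s' w = 0"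
        proof
          assume "s = 0"
          then have "s' = 0" using rel graphD(4)[OF R] unfolding poly_rel_def by (auto intro: poly_eqI)
          then show ?thesis by simp
        qed (use less.hyps rel sz in blast)
        then have "a' * poly p' w = 0" using m by (simp add: s_s'_def)
        then show "poly p' w = 0" using lead by (simp add: a_b_a'_b'_def)
      qed
    qed
  qed
  show ?thesis unfolding graph_def
  proof (intro conjI ballI allI impI)
    fix c assume "c \<in> k"
    then show "(c, c) \<in> extend R z w" using extend_subset[OF R] graphD(1)[OF R] by blast
  next
    fix x x' y y' assume "(x, x') \<in> extend R z w" "(y, y') \<in> extend R z w"
    then obtain p p' s s' where ps: "x = poly p z" "x' = poly p' w" "poly_rel R p p'" "y = poly s z" "y' = poly s' w" "poly_rel R s s'"
      unfolding extend_def by blast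
    have "(poly (p + s) z, poly (p' + s') w) \<in> extend R z w" "(poly (p * s) z, poly (p' * s') w) \<in> extend R z w"
      unfolding extend_def using poly_rel_add[OF R ps(3,6)] poly_rel_mult[OF R ps(3,6)] by blast+
    then show "(x + y, x' + y') \<in> extend R z w" "(x * y, x' * y') \<in> extend R z w" using ps by simp_all
  next
    fix y assume "(0, y) \<in> extend R z w"
    then obtain p p' where "0 = poly p z" "y = poly p' w" "poly_rel R p p'" unfolding extend_def by blast
    then show "y = 0" using zero by metis
  qed
qed

lemma minimal_polynomial:
  assumes R: "graph R"
  obtains m m' where "m \<noteq> 0" "poly_rel R m m'" "poly m z = 0"
    "\<And>p p'. poly_rel R p p' \<Longrightarrow> p \<noteq> 0 \<Longrightarrow> poly p z = 0 \<Longrightarrow> degree m \<le> degree p"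
proof -
  define P where "P m \<longleftrightarrow> m \<noteq> 0 \<and> (\<exists>m'. poly_rel R m m') \<and> poly m z = 0" for m
  obtain r where "r \<noteq> 0" "\<forall>i. poly.coeff r i \<in> k" "poly r z = 0" using alg by blast
  then have "P r" using poly_rel_k[OF R] by (auto simp: P_def)
  from ex_has_least_nat[of P r degree, OF this]
  obtain m where "P m" "\<forall>y. P y \<longrightarrow> degree m \<le> degree y" by blast
  then show thesis using that unfolding P_def by blast
qed

lemma maximal_graph_total:
  assumes R: "graph R" and max: "\<And>S. graph S \<Longrightarrow> R \<subseteq> S \<Longrightarrow> S = R"
  shows "\<exists>w. (z, w) \<in> R"
proof -
  obtain m m' where m: "m \<noteq> 0" "poly_rel R m m'" "poly m z = 0"
    and min: "\<And>p p'. poly_rel R p p' \<Longrightarrow> p \<noteq> 0 \<Longrightarrow> poly p z = 0 \<Longrightarrow> degree m \<le> degree p"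
    by (rule minimal_polynomial[OF R, of z]) (rule that)
  have "degree m > 0" using m(1,3) by (metis degree_0_id gr0I mult_eq_0_iff poly_pCons poly_0 add_0_right mult_zero_right pCons_0_0)
  moreover have "poly.coeff m' (degree m) \<noteq> 0"
    using graph_inj[OF R, of "lead_coeff m"] m(1,2) unfolding poly_rel_def by (metis leading_coeff_0_iff)
  ultimately have "degree m' > 0" using le_degree by (metis gr_zeroI leD)
  then obtain w where w: "poly m' w = 0" using ac by blast
  have "extend R z w = R" by (intro max extend_subset[OF R] graph_extend[OF R m w min])
  then show ?thesis using extend_mem[OF R] by blast
qed

lemma graph_functional:
  assumes "graph R" "(x, y) \<in> R" "(x, y') \<in> R" shows "y = y'"
  using graph_diff[OF assms] graphD(4)[OF assms(1), of "y - y'"] by simp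

text \<open>A maximal graph is total by \<open>maximal_graph_total\<close>. Its converse is again a
  maximal graph, and totality of the converse is surjectivity.\<close>

lemma extend_to_automorphism:
  assumes R0: "graph R0"
  obtains \<tau> where "field_automorphism \<tau>" "\<And>c. c \<in> k \<Longrightarrow> \<tau> c = c" "\<And>x y. (x, y) \<in> R0 \<Longrightarrow> \<tau> x = y"
proof -
  define \<A> where "\<A> = {R. graph R \<and> R0 \<subseteq> R}"
  have "\<exists>M\<in>\<A>. \<forall>S\<in>\<A>. M \<subseteq> S \<longrightarrow> S = M"
  proof (rule subset_Zorn_nonempty)
    show "\<A> \<noteq> {}" using R0 by (auto simp: \<A>_def)
    fix C assume C: "C \<noteq> {}" "subset.chain \<A> C"
    then have g: "\<And>R. R \<in> C \<Longrightarrow> graph R \<and> R0 \<subseteq> R" unfolding \<A>_def subset.chain_def by blast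
    have "graph (\<Union>C)" unfolding graph_def
    proof (intro conjI ballI allI impI)
      fix c assume "c \<in> k"
      then show "(c, c) \<in> \<Union>C" using C(1) g graphD(1) by blast
    next
      fix x x' y y' assume "(x, x') \<in> \<Union>C" "(y, y') \<in> \<Union>C"
      then obtain S T where ST: "S \<in> C" "T \<in> C" "(x, x') \<in> S" "(y, y') \<in> T" by blast
      then have "S \<subseteq> T \<or> T \<subseteq> S" using C(2) unfolding subset.chain_def by blast
      then obtain U where "U \<in> C" "(x, x') \<in> U" "(y, y') \<in> U" using ST by blast
      then show "(x + y, x' + y') \<in> \<Union>C" "(x * y, x' * y') \<in> \<Union>C" using g graphD(2,3) by blast+
    next
      fix y assume "(0, y) \<in> \<Union>C"
      then show "y = 0" using g graphD(4) by blast
    qed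
    then show "\<Union>C \<in> \<A>" using C(1) g unfolding \<A>_def by blast
  qed
  then obtain M where MA: "M \<in> \<A>" "\<forall>S\<in>\<A>. M \<subseteq> S \<longrightarrow> S = M" by blast
  have M: "graph M" "R0 \<subseteq> M" using MA(1) by (auto simp: \<A>_def)
  have M3: "S = M" if "graph S" "R0 \<subseteq> S" "M \<subseteq> S" for S using MA(2) that by (simp add: \<A>_def)
  have tot: "\<exists>w. (z, w) \<in> M" for z
    by (rule maximal_graph_total[OF M(1)], rule M3) (use M(2) in auto)
  have sur: "\<exists>w. (w, z) \<in> M" for z
  proof -
    have "\<exists>w. (z, w) \<in> M\<inverse>"
    proof (rule maximal_graph_total[OF graph_converse[OF M(1)]])
      fix S assume S: "graph S" "M\<inverse> \<subseteq> S"
      have "S\<inverse> = M" by (rule M3[OF graph_converse[OF S(1)]]) (use S M(2) in auto)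
      then show "S = M\<inverse>" by (metis converse_converse)
    qed
    then show ?thesis by simp
  qed
  define \<tau> where "\<tau> x = (THE y. (x, y) \<in> M)" for x
  have t: "\<tau> x = y \<longleftrightarrow> (x, y) \<in> M" for x y
  proof -
    obtain w where w: "(x, w) \<in> M" using tot by blast
    have "\<tau> x = w" unfolding \<tau>_def using w graph_functional[OF M(1)] by blast
    then show ?thesis using w graph_functional[OF M(1)] by blast
  qed
  have ti: "(x, \<tau> x) \<in> M" for x using t by blast
  have "inj \<tau>"
  proof (rule injI)
    fix x y assume "\<tau> x = \<tau> y"
    then show "x = y" using graph_functional[OF graph_converse[OF M(1)], of "\<tau> x" x y] ti[of x] ti[of y] by simp
  qed
  moreover have "surj \<tau>" using sur t by (metis surjI)
  ultimately have "field_automorphism \<tau>" unfolding field_automorphism_def bij_def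
    using graphD(2,3)[OF M(1) ti ti] t by blast
  moreover have "\<tau> c = c" if "c \<in> k" for c using t graphD(1)[OF M(1) that] by blast
  moreover have "\<tau> x = y" if "(x, y) \<in> R0" for x y using t that M(2) by blast
  ultimately show thesis by (rule that)
qed

text \<open>In characteristic \<open>0\<close> the minimal polynomial of \<open>x\<close> has no multiple root, hence another root if \<open>x \<notin> k\<close>.\<close>

theorem moving_automorphism:
  assumes x: "x \<notin> k"
  obtains \<tau> where "field_automorphism \<tau>" "\<And>c. c \<in> k \<Longrightarrow> \<tau> c = c" "\<tau> x \<noteq> x"
proof -
  define R where "R = {(c, c) | c. c \<in> k}"
  have R: "graph R" unfolding graph_def R_def using k_add k_mult by auto
  obtain m m' where m: "m \<noteq> 0" "poly_rel R m m'" "poly m x = 0"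
    and min: "\<And>p p'. poly_rel R p p' \<Longrightarrow> p \<noteq> 0 \<Longrightarrow> poly p x = 0 \<Longrightarrow> degree m \<le> degree p"
    by (rule minimal_polynomial[OF R, of x]) (rule that)
  have mk: "poly.coeff m i \<in> k" "m' = m" for i using m(2) unfolding poly_rel_def R_def by (auto intro: poly_eqI)
  obtain s where s: "m = [:- x, 1:] * s" using m(3) by (metis dvdE poly_eq_0_iff_dvd)
  have s0: "s \<noteq> 0" using m s by auto
  have ds: "degree m = Suc (degree s)" using s0 unfolding s by (subst degree_mult_eq) auto
  have "degree s > 0"
  proof (rule ccontr)
    assume "\<not> degree s > 0"
    then obtain c where c: "s = [:c:]" by (metis degree_eq_zeroE gr0I)
    then have "poly.coeff m 0 = - x * c" "poly.coeff m 1 = c" "c \<noteq> 0" using s s0 by auto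
    then have "x = - (poly.coeff m 0) * inverse (poly.coeff m 1)" by simp
    then have "x \<in> k" using mk(1) k_uminus k_mult k_inverse by metis
    then show False using x by simp
  qed
  then obtain w where w: "poly s w = 0" using ac by blast
  have "w \<noteq> x"
  proof
    assume "w = x"
    then have "poly (pderiv m) x = 0" using w unfolding s pderiv_mult by (simp add: pderiv_pCons del: mult_pCons_left)
    moreover have "pderiv m \<noteq> 0" using ds by (simp add: pderiv_eq_0_iff)
    moreover have "poly_rel R (pderiv m) (pderiv m)"
    proof (intro poly_rel_k R)
      fix i
      have "of_nat j \<in> k" for j by (induction j) (auto intro: k_add)
      then show "poly.coeff (pderiv m) i \<in> k" unfolding coeff_pderiv by (intro k_mult mk)
    qed
    ultimately have "degree m \<le> degree (pderiv m)" using min by blast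
    then show False using ds by (simp add: degree_pderiv)
  qed
  have "poly m' w = 0" using w mk(2) s by simp
  then have G: "graph (extend R x w)" by (intro graph_extend[OF R m _ min])
  obtain \<tau> where "field_automorphism \<tau>" "\<And>c. c \<in> k \<Longrightarrow> \<tau> c = c" "\<And>a b. (a, b) \<in> extend R x w \<Longrightarrow> \<tau> a = b"
    by (rule extend_to_automorphism[OF G]) (rule that)
  then show thesis using that extend_mem[OF R] \<open>w \<noteq> x\<close> by metis
qed

end

section \<open>Fields in a type viewed as ring records\<close>

abbreviation type_ring :: "'a::field ring" where "type_ring \<equiv> ring_of_type_algebra"

lemma type_ring_simps [simp]:
  "carrier type_ring = UNIV" "x \<otimes>\<^bsub>type_ring\<^esub> y = x * y" "x \<oplus>\<^bsub>type_ring\<^esub> y = x + y"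
  "\<one>\<^bsub>type_ring\<^esub> = 1" "\<zero>\<^bsub>type_ring\<^esub> = 0"
  by (simp_all add: ring_of_type_algebra_def)

lemma type_ring_field: "field type_ring" by (rule field_from_type_algebra)

lemma type_ring_a_inv [simp]: "\<ominus>\<^bsub>type_ring\<^esub> x = - x"
proof -
  interpret L: field "type_ring :: 'a ring" by (rule type_ring_field)
  show ?thesis by (rule L.minus_equality) auto
qed

lemma type_ring_inv [simp]: "x \<noteq> 0 \<Longrightarrow> inv\<^bsub>type_ring\<^esub> x = inverse x"
proof -
  assume "x \<noteq> 0"
  interpret L: field "type_ring :: 'a ring" by (rule type_ring_field)
  show ?thesis by (rule L.inv_char) (use \<open>x \<noteq> 0\<close> in auto)
qed

lemma type_ring_pow [simp]: "x [^]\<^bsub>type_ring\<^esub> (m::nat) = x ^ m"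
proof -
  interpret L: field "type_ring :: 'a ring" by (rule type_ring_field)
  show ?thesis by (induction m) (simp_all add: mult.commute)
qed

text \<open>Polynomials of ring records are lists with the leading coefficient first, hence the
  reversal.\<close>

lemma type_ring_eval: "ring.eval type_ring p x = poly (Poly (rev p)) x"
proof -
  interpret L: field "type_ring :: 'a ring" by (rule type_ring_field)
  show ?thesis by (induction p) (auto simp: Poly_append poly_monom)
qed

lemma type_ring_subfieldD:
  assumes "subfield k (type_ring :: 'a::field ring)"
  shows "0 \<in> k" "1 \<in> k" "x \<in> k \<Longrightarrow> y \<in> k \<Longrightarrow> x + y \<in> k" "x \<in> k \<Longrightarrow> y \<in> k \<Longrightarrow> x * y \<in> k"
    "x \<in> k \<Longrightarrow> - x \<in> k" "x \<in> k \<Longrightarrow> inverse x \<in> k"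
proof -
  interpret L: field "type_ring :: 'a ring" by (rule type_ring_field)
  interpret k: subfield k "type_ring :: 'a ring" by (rule assms)
  note s = subringE[OF subfieldE(1)[OF assms]]
  show "0 \<in> k" "1 \<in> k" "x \<in> k \<Longrightarrow> y \<in> k \<Longrightarrow> x + y \<in> k" "x \<in> k \<Longrightarrow> y \<in> k \<Longrightarrow> x * y \<in> k"
    "x \<in> k \<Longrightarrow> - x \<in> k" using s(2,3) s(5)[of x] s(6,7)[of x y] by auto
  show "x \<in> k \<Longrightarrow> inverse x \<in> k"
    using L.subfield_m_inv(1)[OF assms, of x] \<open>0 \<in> k\<close> by (cases "x = 0") auto
qed

lemma algebraic_overI:
  fixes k :: "'a::field_char_0 set"
  assumes k: "subfield k (type_ring :: 'a ring)" and c: "algebraic_closure (type_ring :: 'a ring) k"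
  shows "algebraic_over k"
proof -
  interpret C: algebraic_closure "type_ring :: 'a ring" k by (rule c)
  show ?thesis
  proof (unfold_locales)
    fix x :: 'a
    obtain p where p: "p \<in> carrier (k[X]\<^bsub>type_ring\<^esub>)" "p \<noteq> []" "ring.eval type_ring p x = \<zero>\<^bsub>type_ring\<^esub>"
      by (rule C.algebraicE[OF subfieldE(1)[OF k], of x]) (use C.algebraic_extension[of x] in auto)
    have pp: "set p \<subseteq> k" "hd p \<noteq> 0" using p(1,2) by (auto simp: univ_poly_def polynomial_def)
    have "Poly (rev p) \<noteq> 0"
    proof
      assume "Poly (rev p) = 0"
      then obtain m where "rev p = replicate m 0" by (auto simp: Poly_eq_0)
      then have "hd p = 0" using p(2) by (metis hd_in_set set_rev set_replicate_conv_if singletonD empty_iff)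
      then show False using pp by simp
    qed
    moreover have "poly.coeff (Poly (rev p)) i \<in> k" for i
    proof (cases "i < length p")
      case True
      then have "rev p ! i \<in> set p" by (metis length_rev nth_mem set_rev)
      then show ?thesis using pp True by (auto simp: nth_default_def)
    qed (use type_ring_subfieldD[OF k] in \<open>auto simp: nth_default_def\<close>)
    ultimately show "\<exists>r. r \<noteq> 0 \<and> (\<forall>i. poly.coeff r i \<in> k) \<and> poly r x = 0"
      using p(3) by (intro exI[of _ "Poly (rev p)"]) (simp add: type_ring_eval)
  next
    fix r :: "'a poly" assume r: "degree r > 0"
    define P where "P = rev (coeffs r)"
    have P: "P \<in> carrier (poly_ring (type_ring :: 'a ring))"
      using r by (auto simp: P_def univ_poly_def polynomial_def hd_rev last_coeffs_eq_coeff_degree)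
    have "C.splitted P" by (rule C.roots_over_carrier[OF P])
    then have "size (C.roots P) > 0" using r length_coeffs_degree[of r] by (cases "r = 0") (auto simp: C.splitted_def P_def)
    then obtain x where "x \<in># C.roots P" by (metis size_eq_0_iff_empty multiset_nonemptyE less_numeral_extra(3))
    then have "C.is_root P x" using C.roots_mem_iff_is_root[OF P] by blast
    then show "\<exists>z. poly r z = 0" by (auto simp: C.is_root_def type_ring_eval P_def)
  qed (use type_ring_subfieldD[OF k] in auto)
qed

lemma adjoin_induct [consumes 1, case_names zero one base gen uminus inverse add mult]:
  assumes "x \<in> adjoin k S"
    and "P 1" "\<And>c. c \<in> k \<Longrightarrow> P c" "\<And>c. c \<in> S \<Longrightarrow> P c" "\<And>a. P a \<Longrightarrow> P (- a)" "\<And>a. P a \<Longrightarrow> a \<noteq> 0 \<Longrightarrow> P (inverse a)"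
     "\<And>a b. P a \<Longrightarrow> P b \<Longrightarrow> P (a + b)" "\<And>a b. P a \<Longrightarrow> P b \<Longrightarrow> P (a * b)"
  shows "P x"
  using assms(1) unfolding adjoin_def
  by (induction rule: generate_field.induct) (use assms(2-) in auto)

lemma adjoin_closed:
  shows "c \<in> k \<Longrightarrow> c \<in> adjoin k S" "c \<in> S \<Longrightarrow> c \<in> adjoin k S" "1 \<in> adjoin k S" "0 \<in> adjoin k S"
    "a \<in> adjoin k S \<Longrightarrow> b \<in> adjoin k S \<Longrightarrow> a + b \<in> adjoin k S"
    "a \<in> adjoin k S \<Longrightarrow> b \<in> adjoin k S \<Longrightarrow> a * b \<in> adjoin k S"
    "a \<in> adjoin k S \<Longrightarrow> - a \<in> adjoin k S" "a \<in> adjoin k S \<Longrightarrow> inverse a \<in> adjoin k S"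
proof -
  show 1: "c \<in> k \<Longrightarrow> c \<in> adjoin k S" "c \<in> S \<Longrightarrow> c \<in> adjoin k S" unfolding adjoin_def by (auto intro: generate_field.incl)
  show o: "1 \<in> adjoin k S" unfolding adjoin_def using generate_field.one[of type_ring] by simp
  show a: "a \<in> adjoin k S \<Longrightarrow> b \<in> adjoin k S \<Longrightarrow> a + b \<in> adjoin k S" for a b
    unfolding adjoin_def using generate_field.eng_add[of a type_ring _ b] by simp
  show "a \<in> adjoin k S \<Longrightarrow> b \<in> adjoin k S \<Longrightarrow> a * b \<in> adjoin k S"
    unfolding adjoin_def using generate_field.eng_mult[of a type_ring _ b] by simp
  show m: "a \<in> adjoin k S \<Longrightarrow> - a \<in> adjoin k S" for a
    unfolding adjoin_def using generate_field.a_inv[of a type_ring] by simp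
  show z: "0 \<in> adjoin k S" using a[OF o m[OF o]] by simp
  show "a \<in> adjoin k S \<Longrightarrow> inverse a \<in> adjoin k S"
    using z unfolding adjoin_def using generate_field.m_inv[of a type_ring] by (cases "a = 0") auto
qed

section \<open>Groups acting on a free module of rank two modulo a prime power\<close>

locale torsion_rep = G: group G + M: comm_group M
  for G :: "('g, 'c) monoid_scheme" and M :: "('m, 'd) monoid_scheme" +
  fixes act :: "'g \<Rightarrow> 'm \<Rightarrow> 'm" and S T :: 'm and p n :: nat
  assumes fin: "finite (carrier G)" and prime: "Factorial_Ring.prime p" and p5: "p \<ge> 5" and n0: "n > 0"
    and act_closed: "g \<in> carrier G \<Longrightarrow> P \<in> carrier M \<Longrightarrow> act g P \<in> carrier M"
    and act_add: "g \<in> carrier G \<Longrightarrow> P \<in> carrier M \<Longrightarrow> Q \<in> carrier M \<Longrightarrow> act g (P \<otimes>\<^bsub>M\<^esub> Q) = act g P \<otimes>\<^bsub>M\<^esub> act g Q"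
    and act_mult: "g \<in> carrier G \<Longrightarrow> h \<in> carrier G \<Longrightarrow> P \<in> carrier M \<Longrightarrow> act (g \<otimes>\<^bsub>G\<^esub> h) P = act g (act h P)"
    and act_one: "P \<in> carrier M \<Longrightarrow> act \<one>\<^bsub>G\<^esub> P = P"
    and ST: "S \<in> carrier M" "T \<in> carrier M"
    and generate: "P \<in> carrier M \<Longrightarrow> \<exists>(a::int) (b::int). P = S [^]\<^bsub>M\<^esub> a \<otimes>\<^bsub>M\<^esub> T [^]\<^bsub>M\<^esub> b"
    and independent: "S [^]\<^bsub>M\<^esub> (a::int) \<otimes>\<^bsub>M\<^esub> T [^]\<^bsub>M\<^esub> (b::int) = \<one>\<^bsub>M\<^esub> \<longleftrightarrow> int p ^ n dvd a \<and> int p ^ n dvd b"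
begin

abbreviation "q \<equiv> int p ^ n"

text \<open>Vectors are first columns of matrices.\<close>

definition pt :: "mat2 \<Rightarrow> 'm" where "pt W = S [^]\<^bsub>M\<^esub> m11 W \<otimes>\<^bsub>M\<^esub> T [^]\<^bsub>M\<^esub> m21 W"

lemma pt_closed [simp, intro]: "pt W \<in> carrier M"
  using ST by (simp add: pt_def)

lemma pt_add: "pt (W + W') = pt W \<otimes>\<^bsub>M\<^esub> pt W'"
  using ST by (simp add: pt_def M.int_pow_mult M.m_ac)

lemma pt_scale: "pt (of_int c * W) = pt W [^]\<^bsub>M\<^esub> c"
  using ST by (simp add: pt_def M.int_pow_distrib M.int_pow_pow mult.commute)

lemma pt_0: "pt 0 = \<one>\<^bsub>M\<^esub>" by (simp add: pt_def)

lemma pt_uminus: "pt (- W) = inv\<^bsub>M\<^esub> pt W"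
  using pt_add[of "- W" W] pt_0 M.inv_equality[of "pt (- W)" "pt W"] by simp

lemma pt_diff: "pt (W - W') = pt W \<otimes>\<^bsub>M\<^esub> inv\<^bsub>M\<^esub> pt W'"
  using pt_add[of W "- W'"] by (simp add: pt_uminus)

lemma pt_eq_one: "pt W = \<one>\<^bsub>M\<^esub> \<longleftrightarrow> q dvd m11 W \<and> q dvd m21 W"
  using independent by (simp add: pt_def)

lemma pt_eq: "pt W = pt W' \<longleftrightarrow> q dvd m11 W - m11 W' \<and> q dvd m21 W - m21 W'"
proof -
  have "pt W = pt W' \<longleftrightarrow> pt (W - W') = \<one>\<^bsub>M\<^esub>"
    unfolding pt_diff by (metis M.inv_equality M.inv_inv M.r_inv pt_closed M.inv_closed)
  then show ?thesis by (simp add: pt_eq_one)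
qed

lemma pt_mcong: "mcong q W W' \<Longrightarrow> pt W = pt W'"
  by (simp add: pt_eq mcong_def)

lemma pt_surj:
  assumes "P \<in> carrier M" obtains W where "pt W = P" "m12 W = 0" "m22 W = 0"
proof -
  obtain a b :: int where "P = S [^]\<^bsub>M\<^esub> (a::int) \<otimes>\<^bsub>M\<^esub> T [^]\<^bsub>M\<^esub> (b::int)" using generate[OF assms] by blast
  then show thesis using that[of "Mat a 0 b 0"] by (simp add: pt_def)
qed

text \<open>The columns of \<open>R g\<close> are the coordinates of the images of \<open>S\<close>
  and \<open>T\<close>, determined only modulo \<open>q\<close>. As \<open>pt\<close> reads first
  columns, the second column is moved to the first place.\<close>

definition R :: "'g \<Rightarrow> mat2" where
  "R g = (SOME C. act g S = pt C \<and> act g T = pt (Mat (m12 C) 0 (m22 C) 0))"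

lemma rho:
  assumes "g \<in> carrier G"
  shows "act g S = pt (R g)" "act g T = pt (Mat (m12 (R g)) 0 (m22 (R g)) 0)"
proof -
  obtain U where U: "pt U = act g S" using pt_surj act_closed[OF assms ST(1)] by metis
  obtain V where V: "pt V = act g T" using pt_surj act_closed[OF assms ST(2)] by metis
  have "\<exists>C. act g S = pt C \<and> act g T = pt (Mat (m12 C) 0 (m22 C) 0)"
    by (rule exI[of _ "Mat (m11 U) (m11 V) (m21 U) (m21 V)"]) (use U V in \<open>simp add: pt_def\<close>)
  from someI_ex[OF this, folded R_def]
  show "act g S = pt (R g)" "act g T = pt (Mat (m12 (R g)) 0 (m22 (R g)) 0)" by auto
qed

lemma act_int_pow:
  assumes "g \<in> carrier G" "P \<in> carrier M" shows "act g (P [^]\<^bsub>M\<^esub> (c::int)) = act g P [^]\<^bsub>M\<^esub> c"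
proof -
  interpret group_hom M M "act g"
    by unfold_locales (use act_closed act_add assms in \<open>auto simp: hom_def\<close>)
  show ?thesis by (rule hom_int_pow[OF assms(2)])
qed

lemma act_pt:
  assumes g: "g \<in> carrier G" shows "act g (pt W) = pt (R g * W)"
proof -
  define V where "V = Mat (m12 (R g)) 0 (m22 (R g)) 0"
  have "act g (pt W) = act g S [^]\<^bsub>M\<^esub> m11 W \<otimes>\<^bsub>M\<^esub> act g T [^]\<^bsub>M\<^esub> m21 W"
    using ST g by (simp add: pt_def act_add act_int_pow)
  also have "\<dots> = pt (of_int (m11 W) * R g + of_int (m21 W) * V)"
    using g by (simp add: pt_add pt_scale rho V_def)
  also have "\<dots> = pt (R g * W)" by (simp add: pt_eq V_def algebra_simps)
  finally show ?thesis .
qed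

lemma mcong_pt:
  assumes "\<And>W. pt (P * W) = pt (Q * W)" shows "mcong q P Q"
  using assms[of 1] assms[of "Mat 0 0 1 0"] by (simp add: pt_eq mcong_def)

sublocale rep: local_rep G R p n
proof unfold_locales
  fix g h assume gh: "g \<in> carrier G" "h \<in> carrier G"
  show "mcong q (R (g \<otimes>\<^bsub>G\<^esub> h)) (R g * R h)"
  proof (rule mcong_pt)
    fix W show "pt (R (g \<otimes>\<^bsub>G\<^esub> h) * W) = pt (R g * R h * W)"
      using gh act_mult[of g h "pt W"] by (simp add: act_pt mult.assoc)
  qed
next
  show "mcong q (R \<one>\<^bsub>G\<^esub>) 1" by (rule mcong_pt) (use act_one act_pt[of "\<one>\<^bsub>G\<^esub>"] in auto)
qed (use fin prime p5 n0 in auto)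

lemma fixes_no_vectorI:
  assumes "\<And>P. P \<in> carrier M \<Longrightarrow> P [^]\<^bsub>M\<^esub> int p = \<one>\<^bsub>M\<^esub> \<Longrightarrow> (\<forall>g\<in>carrier G. act g P = P) \<Longrightarrow> P = \<one>\<^bsub>M\<^esub>"
  shows "rep.fixes_no_vector"
  unfolding rep.fixes_no_vector_def
proof (intro allI impI)
  fix W assume W: "\<forall>g\<in>carrier G. mcong (int p) (R g * W) W"
  \<comment> \<open>Multiplication by \<open>e\<close> embeds vectors modulo \<open>p\<close> as the
    points killed by \<open>p\<close>, so a fixed vector modulo \<open>p\<close> becomes a fixed
    point.\<close>
  define e where "e = int p ^ (n - 1)"
  have qe: "q = e * int p" using n0 by (cases n) (simp_all add: e_def)
  have e0: "e \<noteq> 0" using p5 by (simp add: e_def)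
  have *: "int p dvd m11 V \<and> int p dvd m21 V"
    if V: "\<forall>g\<in>carrier G. int p dvd m11 (R g * V) - m11 V \<and> int p dvd m21 (R g * V) - m21 V" for V
  proof -
    have "pt (of_int e * V) = \<one>\<^bsub>M\<^esub>"
    proof (rule assms)
      have "pt (of_int (int p) * (of_int e * V)) = \<one>\<^bsub>M\<^esub>" unfolding pt_eq_one by (simp add: qe)
      then show "pt (of_int e * V) [^]\<^bsub>M\<^esub> int p = \<one>\<^bsub>M\<^esub>" by (simp only: pt_scale)
      show "\<forall>g\<in>carrier G. act g (pt (of_int e * V)) = pt (of_int e * V)"
      proof
        fix g assume g: "g \<in> carrier G"
        have "e * int p dvd e * (m11 (R g * V) - m11 V)" "e * int p dvd e * (m21 (R g * V) - m21 V)"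
          using V g by (auto intro!: mult_dvd_mono)
        then show "act g (pt (of_int e * V)) = pt (of_int e * V)"
          unfolding act_pt[OF g] pt_eq qe by (simp add: algebra_simps)
      qed
    qed simp
    then show ?thesis using e0 by (simp add: pt_eq_one qe)
  qed
  have "int p dvd m11 W \<and> int p dvd m21 W" by (rule *) (use W in \<open>auto simp: mcong_def\<close>)
  moreover have "int p dvd m11 (Mat (m12 W) 0 (m22 W) 0) \<and> int p dvd m21 (Mat (m12 W) 0 (m22 W) 0)"
    by (rule *) (use W in \<open>auto simp: mcong_def\<close>)
  ultimately show "mcong (int p) W 0" by (simp add: mcong_def)
qed

section \<open>Translation back to cohomology classes\<close>

definition coboundary :: "'m \<Rightarrow> 'g \<Rightarrow> 'm" where
  "coboundary W = (\<lambda>\<sigma>\<in>carrier G. act \<sigma> W \<otimes>\<^bsub>M\<^esub> inv\<^bsub>M\<^esub> W)"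

lemma coboundaries_eq: "coboundaries G M act = coboundary ` carrier M"
  unfolding coboundaries_def coboundary_def by blast

lemma coboundary_mult:
  assumes "V \<in> carrier M" "W \<in> carrier M"
  shows "coboundary V \<otimes>\<^bsub>cocycles G M act\<^esub> coboundary W = coboundary (V \<otimes>\<^bsub>M\<^esub> W)"
proof
  fix g
  show "(coboundary V \<otimes>\<^bsub>cocycles G M act\<^esub> coboundary W) g = coboundary (V \<otimes>\<^bsub>M\<^esub> W) g"
    using assms by (cases "g \<in> carrier G")
      (simp_all add: coboundary_def cocycles_def act_add act_closed M.inv_mult_group M.m_ac)
qed

lemma coset_coboundary:
  assumes W: "W \<in> carrier M"
  shows "coboundaries G M act #>\<^bsub>cocycles G M act\<^esub> coboundary W = coboundaries G M act"
proof -
  have "coboundaries G M act #>\<^bsub>cocycles G M act\<^esub> coboundary W = (\<lambda>V. coboundary (V \<otimes>\<^bsub>M\<^esub> W)) ` carrier M"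
    unfolding r_coset_def coboundaries_eq using coboundary_mult W by auto
  also have "\<dots> = coboundary ` carrier M"
  proof -
    have "(\<lambda>V. V \<otimes>\<^bsub>M\<^esub> W) ` carrier M = carrier M"
    proof (intro equalityI subsetI)
      fix V assume "V \<in> carrier M"
      then have "V = (V \<otimes>\<^bsub>M\<^esub> inv\<^bsub>M\<^esub> W) \<otimes>\<^bsub>M\<^esub> W" using W by (simp add: M.m_assoc)
      then show "V \<in> (\<lambda>V. V \<otimes>\<^bsub>M\<^esub> W) ` carrier M" using W \<open>V \<in> carrier M\<close> by (metis (no_types, lifting) M.m_closed M.inv_closed image_eqI)
    qed (use W in auto)
    from arg_cong[OF this, of "(`) coboundary"] show ?thesis by (simp only: image_image)
  qed
  finally show ?thesis by (simp add: coboundaries_eq)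
qed

lemma cocycle_coboundary:
  assumes nf: "rep.fixes_no_vector" and d: "\<exists>g\<in>carrier G. \<not> int p dvd (det2 (R g))^2 - 1"
    and Z: "Z \<in> carrier (cocycles G M act)" and loc: "\<forall>\<sigma>\<in>carrier G. \<exists>W\<in>carrier M. Z \<sigma> = act \<sigma> W \<otimes>\<^bsub>M\<^esub> inv\<^bsub>M\<^esub> W"
  shows "\<exists>W\<in>carrier M. Z = coboundary W"
proof -
  have ZM: "Z \<in> carrier G \<rightarrow>\<^sub>E carrier M"
    and Zc: "\<And>\<sigma> \<tau>. \<sigma> \<in> carrier G \<Longrightarrow> \<tau> \<in> carrier G \<Longrightarrow> Z (\<sigma> \<otimes>\<^bsub>G\<^esub> \<tau>) = Z \<sigma> \<otimes>\<^bsub>M\<^esub> act \<sigma> (Z \<tau>)"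
    using Z by (auto simp: cocycles_def)
  \<comment> \<open>The second column is chosen to be 0, so that equality of points amounts to
    congruence of matrices.\<close>
  define Y where "Y g = (SOME W. pt W = Z g \<and> m12 W = 0 \<and> m22 W = 0)" for g
  have Y: "pt (Y g) = Z g \<and> m12 (Y g) = 0 \<and> m22 (Y g) = 0" if "g \<in> carrier G" for g
    unfolding Y_def by (rule someI_ex) (use that ZM pt_surj in \<open>metis PiE_mem\<close>)
  interpret local_cocycle G R p n Y
  proof unfold_locales
    fix g h assume gh: "g \<in> carrier G" "h \<in> carrier G"
    have "pt (Y (g \<otimes>\<^bsub>G\<^esub> h)) = pt (Y g + R g * Y h)"
      using gh Y Zc act_pt[OF gh(1), of "Y h"] by (simp add: pt_add)
    then show "mcong q (Y (g \<otimes>\<^bsub>G\<^esub> h)) (Y g + R g * Y h)"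
      using Y[OF gh(1)] Y[OF gh(2)] Y[OF G.m_closed[OF gh]] unfolding pt_eq by (simp add: mcong_def)
  next
    fix g assume g: "g \<in> carrier G"
    obtain w where w: "w \<in> carrier M" "Z g = act g w \<otimes>\<^bsub>M\<^esub> inv\<^bsub>M\<^esub> w" using loc g by blast
    obtain W where W: "pt W = w" "m12 W = 0" "m22 W = 0" using pt_surj[OF w(1)] .
    have "pt (Y g) = pt ((R g - 1) * W)"
      using g Y w(2) W(1) act_pt[OF g, of W] by (simp add: left_diff_distrib pt_diff)
    then have "mcong q (Y g) ((R g - 1) * W)" using Y[OF g] W(2,3) unfolding pt_eq by (simp add: mcong_def)
    then show "\<exists>W. mcong q (Y g) ((R g - 1) * W)" ..
  qed
  have "trivial_cocycle" by (rule locally_trivial_cocycle_trivial[OF nf d])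
  then obtain W where W: "\<And>g. g \<in> carrier G \<Longrightarrow> mcong q (Y g) ((R g - 1) * W)" unfolding trivial_cocycle_def by blast
  have "Z = coboundary (pt W)"
  proof (rule extensionalityI[of _ "carrier G"])
    show "Z \<in> extensional (carrier G)" using ZM by (simp add: PiE_def)
    show "coboundary (pt W) \<in> extensional (carrier G)" by (simp add: coboundary_def)
    fix g assume g: "g \<in> carrier G"
    have "Z g = pt (Y g)" using g Y by simp
    also have "\<dots> = pt ((R g - 1) * W)" using W[OF g] by (rule pt_mcong)
    also have "\<dots> = coboundary (pt W) g" using g act_pt[OF g, of W] by (simp add: left_diff_distrib pt_diff coboundary_def)
    finally show "Z g = coboundary (pt W) g" .
  qed
  then show ?thesis by blast
qed

lemma H1_loc_trivial:
  assumes nf: "rep.fixes_no_vector" and d: "\<exists>g\<in>carrier G. \<not> int p dvd (det2 (R g))^2 - 1"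
  shows "H1_loc G M act = {\<one>\<^bsub>H1 G M act\<^esub>}"
proof -
  have one: "\<one>\<^bsub>H1 G M act\<^esub> = coboundaries G M act" by (simp add: H1_def FactGroup_def)
  define Z where "Z = coboundary \<one>\<^bsub>M\<^esub>"
  have a1: "act g \<one>\<^bsub>M\<^esub> = \<one>\<^bsub>M\<^esub>" if "g \<in> carrier G" for g
    using act_int_pow[OF that M.one_closed, of 0] by simp
  have "Z \<in> carrier (cocycles G M act)" by (auto simp: Z_def coboundary_def cocycles_def a1)
  moreover have "\<forall>\<sigma>\<in>carrier G. \<exists>W\<in>carrier M. Z \<sigma> = act \<sigma> W \<otimes>\<^bsub>M\<^esub> inv\<^bsub>M\<^esub> W" unfolding Z_def coboundary_def by (intro ballI bexI[OF _ M.one_closed]) simp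
  moreover have "coboundaries G M act #>\<^bsub>cocycles G M act\<^esub> Z = coboundaries G M act"
    unfolding Z_def by (rule coset_coboundary) simp
  ultimately have "coboundaries G M act \<in> H1_loc G M act" unfolding H1_loc_def by blast
  moreover have "C = coboundaries G M act" if "C \<in> H1_loc G M act" for C
    using that cocycle_coboundary[OF nf d] coset_coboundary unfolding H1_loc_def by blast
  ultimately show ?thesis unfolding one by blast
qed

end

section \<open>A basis of the torsion\<close>

lemma root_of_unity_exponent:
  fixes \<xi> :: "'a::field"
  assumes "Factorial_Ring.prime p" "\<xi> ^ p = 1" "\<xi> \<noteq> 1" "\<xi> ^ a = 1" shows "p dvd a"
proof (rule ccontr)
  assume "\<not> p dvd a"
  then have "coprime a p" using assms(1) by (metis coprime_commute prime_imp_coprime)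
  moreover have "a \<noteq> 0" using \<open>\<not> p dvd a\<close> by (metis dvd_0_right)
  ultimately obtain x y where "a * x = p * y + 1" using bezout_nat[of a p] by (metis coprime_iff_gcd_eq_1)
  then have "(\<xi> ^ a) ^ x = (\<xi> ^ p) ^ y * \<xi>" by (simp flip: power_mult)
  then show False using assms by simp
qed

context weil_curve
begin

lemma torsion_int_pow:
  assumes "S \<in> tors" shows "S \<up> (a::int) = S \<up> nat (a mod int p)"
proof -
  have S: "S \<in> carrier EG" "S \<up> p = \<one>\<^bsub>EG\<^esub>" using assms by (auto simp: tors_def)
  have "a = int p * (a div int p) + int (nat (a mod int p))" using p5 by simp
  then have "S \<up> a = (S \<up> int p) \<up> (a div int p) \<otimes>\<^bsub>EG\<^esub> S \<up> int (nat (a mod int p))"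
    using S(1) by (metis EG.int_pow_mult EG.int_pow_pow)
  then show ?thesis using S by (simp add: int_pow_int)
qed

text \<open>Pairing the relation with \<open>T\<close> removes the multiple of \<open>T\<close>,
  because the pairing is alternating, and leaves a power of a nontrivial \<open>p\<close>-th root of
  unity; the other exponent follows by symmetry.\<close>

lemma torsion_independent:
  assumes S: "S \<in> tors" and T: "T \<in> tors" and ne: "weil S T \<noteq> 1"
    and z: "S \<up> (a::int) \<otimes>\<^bsub>EG\<^esub> T \<up> (b::int) = \<one>\<^bsub>EG\<^esub>"
  shows "int p dvd a \<and> int p dvd b"
proof -
  have key: "p dvd a" if ST: "S \<in> tors" "T \<in> tors" "weil S T \<noteq> 1" and z: "S \<up> a \<otimes>\<^bsub>EG\<^esub> T \<up> b = \<one>\<^bsub>EG\<^esub>"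
    for S T and a b :: nat
  proof -
    have "weil (S \<up> a \<boxplus> T \<up> b) T = weil S T ^ a * weil T T ^ b"
      using ST multiple_in_tors by (simp add: weil_add_left weil_pow_left)
    moreover have "weil Infinity T = 1" using weil_pow_left[OF ST(1,2), of 0] by (simp add: one_EG)
    ultimately have "weil S T ^ a = 1" using z ST by (simp add: mult_EG one_EG weil_self)
    then show ?thesis using root_of_unity_exponent[OF p weil_root_of_unity[OF ST(1,2)] ST(3)] by blast
  qed
  define a' b' where "a' = nat (a mod int p)" "b' = nat (b mod int p)"
  have z': "S \<up> a' \<otimes>\<^bsub>EG\<^esub> T \<up> b' = \<one>\<^bsub>EG\<^esub>"
    using z unfolding torsion_int_pow[OF S] torsion_int_pow[OF T] a'_b'_def .
  moreover have "T \<up> b' \<otimes>\<^bsub>EG\<^esub> S \<up> a' = \<one>\<^bsub>EG\<^esub>"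
    using z' S T EG.m_comm[of "S \<up> a'" "T \<up> b'"] by (simp add: tors_def)
  moreover have "weil T S \<noteq> 1" using ne weil_swap[OF S T] by (metis inverse_1 inverse_inverse_eq)
  ultimately have "p dvd a'" "p dvd b'" using key S T ne by blast+
  moreover have "int a' = a mod int p" "int b' = b mod int p" using p5 by (simp_all add: a'_b'_def)
  ultimately show ?thesis by (metis dvd_mod_iff dvd_refl int_dvd_int_iff)
qed

text \<open>Two \<open>p\<close>-torsion points with nontrivial pairing are divided by
  \<open>p^(n - 1)\<close>. Independence modulo \<open>p\<close> lifts to \<open>p^n\<close> one
  power at a time, and independent points generate because the torsion has exactly
  \<open>p^(2 n)\<close> elements.\<close>

theorem torsion_basis:
  assumes n0: "n > 0"
  obtains S T where "S \<in> carrier EG" "T \<in> carrier EG"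
    "\<And>(a::int) (b::int). S \<up> a \<otimes>\<^bsub>EG\<^esub> T \<up> b = \<one>\<^bsub>EG\<^esub> \<longleftrightarrow> int p ^ n dvd a \<and> int p ^ n dvd b"
    "\<And>P. P \<in> carrier EG \<Longrightarrow> P \<up> (p ^ n) = \<one>\<^bsub>EG\<^esub> \<Longrightarrow> \<exists>(a::int) (b::int). P = S \<up> a \<otimes>\<^bsub>EG\<^esub> T \<up> b"
    "S \<up> (p ^ (n - 1)) \<in> tors" "T \<up> (p ^ (n - 1)) \<in> tors" "weil (S \<up> (p ^ (n - 1))) (T \<up> (p ^ (n - 1))) \<noteq> 1"
proof -
  define e where "e = p ^ (n - 1)"
  have pe: "p ^ n = e * p" using n0 by (cases n) (simp_all add: e_def)
  have e1: "e \<ge> 1" using p5 by (simp add: e_def)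
  obtain S1 T1 where ST1: "S1 \<in> tors" "T1 \<in> tors" "weil S1 T1 \<noteq> 1" using weil_nontrivial by blast
  have "S1 \<in> carrier EG" "T1 \<in> carrier EG" using ST1 by (auto simp: tors_def)
  then obtain S T where ST: "S \<in> carrier EG" "S \<up> e = S1" "T \<in> carrier EG" "T \<up> e = T1"
    using multiplication_surj[OF e1] by meson
  have top: "U \<up> int (p ^ n) = \<one>\<^bsub>EG\<^esub>" if "U \<in> carrier EG" "U \<up> e \<in> tors" for U
    using that EG.nat_pow_pow[of U e p] by (simp only: int_pow_int pe) (simp add: tors_def)
  have S: "S \<up> int (p ^ n) = \<one>\<^bsub>EG\<^esub>" "T \<up> int (p ^ n) = \<one>\<^bsub>EG\<^esub>" using top ST ST1 by auto
  define f where "f = (\<lambda>(a::int, b::int). S \<up> a \<otimes>\<^bsub>EG\<^esub> T \<up> b)"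
  have ind: "j \<le> n \<Longrightarrow> int p ^ j dvd a \<and> int p ^ j dvd b" if z: "f (a, b) = \<one>\<^bsub>EG\<^esub>" for a b j
  proof (induction j)
    case (Suc j)
    then have "int p ^ j dvd a" "int p ^ j dvd b" by auto
    then obtain a' b' where ab: "a = int p ^ j * a'" "b = int p ^ j * b'" by (elim dvdE) blast
    \<comment> \<open>Multiplying the relation by \<open>p^(n - 1 - j)\<close> turns it into a
      relation between \<open>S1\<close> and \<open>T1\<close> with coefficients \<open>a'\<close>
      and \<open>b'\<close>.\<close>
    define i where "i = int p ^ (n - 1 - j)"
    have "int p ^ j * i = int e" using Suc.prems by (simp add: i_def e_def flip: power_add)
    then have ei: "a * i = int e * a'" "b * i = int e * b'" by (simp_all add: ab ac_simps)
    have "(S \<up> a \<otimes>\<^bsub>EG\<^esub> T \<up> b) \<up> i = \<one>\<^bsub>EG\<^esub>" using z by (simp add: f_def)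
    then have "S \<up> (a * i) \<otimes>\<^bsub>EG\<^esub> T \<up> (b * i) = \<one>\<^bsub>EG\<^esub>" using ST by (simp add: EG.int_pow_distrib EG.int_pow_pow)
    then have "S1 \<up> a' \<otimes>\<^bsub>EG\<^esub> T1 \<up> b' = \<one>\<^bsub>EG\<^esub>" unfolding ei using ST
      by (simp flip: EG.int_pow_pow add: int_pow_int)
    then have "int p dvd a' \<and> int p dvd b'" by (rule torsion_independent[OF ST1])
    then show ?case by (auto simp: ab mult.commute[of "int p"] intro!: mult_dvd_mono)
  qed simp
  have indep: "f (a, b) = \<one>\<^bsub>EG\<^esub> \<longleftrightarrow> int p ^ n dvd a \<and> int p ^ n dvd b" for a b
  proof
    assume "int p ^ n dvd a \<and> int p ^ n dvd b"
    then obtain a' b' where "a = int (p ^ n) * a'" "b = int (p ^ n) * b'" by (auto elim!: dvdE)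
    then show "f (a, b) = \<one>\<^bsub>EG\<^esub>" using ST S by (simp add: f_def flip: EG.int_pow_pow del: of_nat_power)
  qed (use ind in blast)
  define V where "V = {P\<in>carrier EG. P \<up> (p ^ n) = \<one>\<^bsub>EG\<^esub>}"
  define D where "D = {0..<int p ^ n} \<times> {0..<int p ^ n}"
  have cV: "card V = (p ^ n)^2" unfolding V_def using p5 by (intro card_torsion) simp
  have fV: "f ` D \<subseteq> V"
  proof
    fix P assume "P \<in> f ` D"
    then obtain a b :: int where P: "P = S \<up> (a::int) \<otimes>\<^bsub>EG\<^esub> T \<up> (b::int)" by (auto simp: f_def)
    have "P \<up> int (p ^ n) = (S \<up> int (p ^ n)) \<up> a \<otimes>\<^bsub>EG\<^esub> (T \<up> int (p ^ n)) \<up> b"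
      unfolding P using ST by (simp add: EG.int_pow_distrib EG.int_pow_pow mult.commute del: of_nat_power)
    then have "P \<up> int (p ^ n) = \<one>\<^bsub>EG\<^esub>" using S by (simp del: of_nat_power)
    then show "P \<in> V" using P ST by (simp add: V_def int_pow_int del: of_nat_power)
  qed
  have "inj_on f D"
  proof (rule inj_onI)
    fix u v assume uv: "u \<in> D" "v \<in> D" "f u = f v"
    obtain a b a' b' where ab: "u = (a, b)" "v = (a', b')" by (cases u, cases v)
    have fc: "f (a, b) \<in> carrier EG" for a b using ST by (simp add: f_def)
    have "f (a - a', b - b') \<otimes>\<^bsub>EG\<^esub> f (a', b') = f (a, b)"
    proof -
      have "f (a - a', b - b') \<otimes>\<^bsub>EG\<^esub> f (a', b') =
        (S \<up> (a - a') \<otimes>\<^bsub>EG\<^esub> S \<up> a') \<otimes>\<^bsub>EG\<^esub> (T \<up> (b - b') \<otimes>\<^bsub>EG\<^esub> T \<up> b')"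
        using ST by (simp add: f_def EG.m_ac)
      then show ?thesis using ST by (simp add: f_def flip: EG.int_pow_mult)
    qed
    then have "f (a - a', b - b') = \<one>\<^bsub>EG\<^esub>" using uv(3) ab fc EG.l_cancel_one' EG.r_cancel_one' by metis
    then have d: "int p ^ n dvd a - a'" "int p ^ n dvd b - b'" using indep by auto
    have "a = a'" "b = b'"
      using d uv(1,2) unfolding ab D_def by (auto simp: mod_eq_dvd_iff[symmetric])
    then show "u = v" using ab by simp
  qed
  then have "card (f ` D) = card V" using cV by (simp add: card_image D_def card_cartesian_product nat_power_eq power2_eq_square)
  moreover have "finite V" using cV p5 by (metis card.infinite power_eq_0_iff not_numeral_le_zero zero_neq_numeral)
  ultimately have "f ` D = V" using fV by (intro card_subset_eq)
  then have gen: "\<exists>(a::int) (b::int). P = S \<up> a \<otimes>\<^bsub>EG\<^esub> T \<up> b" if "P \<in> carrier EG" "P \<up> (p ^ n) = \<one>\<^bsub>EG\<^esub>" for P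
    using that unfolding V_def f_def by force
  show thesis
  proof (rule that[OF ST(1,3) _ gen])
    show "S \<up> a \<otimes>\<^bsub>EG\<^esub> T \<up> b = \<one>\<^bsub>EG\<^esub> \<longleftrightarrow> int p ^ n dvd a \<and> int p ^ n dvd b" for a b :: int
      using indep[of a b] by (simp add: f_def)
    show "S \<up> (p ^ (n - 1)) \<in> tors" "T \<up> (p ^ (n - 1)) \<in> tors"
      "weil (S \<up> (p ^ (n - 1))) (T \<up> (p ^ (n - 1))) \<noteq> 1"
      unfolding e_def[symmetric] ST(2,4) by (rule ST1)+
  qed
qed

end

section \<open>Reduction to a short Weierstrass equation\<close>

locale elliptic =
  fixes a1 a2 a3 a4 a6 :: "'a::field_char_0"
  assumes discriminant: "discriminant (Weierstrass a1 a2 a3 a4 a6) \<noteq> 0"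
begin

abbreviation "W \<equiv> Weierstrass a1 a2 a3 a4 a6"
abbreviation "WG \<equiv> point_group W UNIV"

text \<open>After completing the square in \<open>y\<close> the coefficient of \<open>x^2\<close> is
  \<open>a2 + a1^2 / 4\<close>; shifting \<open>x\<close> by a third of it removes this
  term.\<close>

definition "sx = (a1^2 + 4 * a2) / 12"
definition "A = a4 + a1 * a3 / 2 - 3 * sx^2"
definition "B = 2 * sx^3 - (a4 + a1 * a3 / 2) * sx + (a3 / 2)^2 + a6"

fun to_short :: "'a point \<Rightarrow> 'a point" where
  "to_short Infinity = Infinity"
| "to_short (Affine x y) = Affine (x + sx) (y + a1 / 2 * x + a3 / 2)"

text \<open>The coefficients are re-expressed through \<open>a1 / 2\<close>, \<open>a3 / 2\<close>
  and the shift, so that the change of coordinates has no denominators and its identities can be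
  settled by polynomial algebra.\<close>

lemma halves:
  obtains s t c A' B' where "sx = c" "A = A'" "B = B'" "a1 = 2 * s" "a3 = 2 * t" "a2 = 3 * c - s^2" "A' = a4 + 2 * s * t - 3 * c^2"
    "B' = 2 * c^3 - (a4 + 2 * s * t) * c + t^2 + a6" "\<And>x y. to_short (Affine x y) = Affine (x + c) (y + s * x + t)"
proof (rule that[of sx A B "a1 / 2" "a3 / 2"])
  show "a1 = 2 * (a1 / 2)" "a3 = 2 * (a3 / 2)" by simp_all
  have "12 * sx = a1^2 + 4 * a2" by (simp add: sx_def)
  then show "a2 = 3 * sx - (a1 / 2)^2" by (simp add: power_divide field_simps)
  show "A = a4 + 2 * (a1 / 2) * (a3 / 2) - 3 * sx^2" "B = 2 * sx^3 - (a4 + 2 * (a1 / 2) * (a3 / 2)) * sx + (a3 / 2)^2 + a6"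
    by (simp_all add: A_def B_def)
qed simp_all

lemma short_discriminant: "discriminant W = - 16 * (4 * A^3 + 27 * B^2)"
proof -
  obtain s t c A' B' where cs: "sx = c" "A = A'" "B = B'" and st: "a1 = 2 * s" "a3 = 2 * t" "a2 = 3 * c - s^2" "A' = a4 + 2 * s * t - 3 * c^2"
    "B' = 2 * c^3 - (a4 + 2 * s * t) * c + t^2 + a6" by (rule halves) (rule that)
  show ?thesis unfolding discriminant.simps Let_def cs unfolding st by Groebner_Basis.algebra
qed

sublocale short: short_curve A B
proof
  show "4 * A^3 + 27 * B^2 \<noteq> 0"
  proof
    assume "4 * A^3 + 27 * B^2 = 0"
    then show False using discriminant unfolding short_discriminant by simp
  qed
qed

abbreviation "SG \<equiv> short.EG"

lemma on_curve_to_short: "on_curve short.E (to_short P) \<longleftrightarrow> on_curve W P"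
proof (cases P)
  case (Affine x y)
  obtain s t c A' B' where cs: "sx = c" "A = A'" "B = B'" and st: "a1 = 2 * s" "a3 = 2 * t" "a2 = 3 * c - s^2" "A' = a4 + 2 * s * t - 3 * c^2"
    "B' = 2 * c^3 - (a4 + 2 * s * t) * c + t^2 + a6" and ts: "\<And>x y. to_short (Affine x y) = Affine (x + c) (y + s * x + t)" by (rule halves) (rule that)
  have "(y + s * x + t)^2 - ((x + c)^3 + A' * (x + c) + B') =
    (y^2 + a1 * x * y + a3 * y) - (x^3 + a2 * x^2 + a4 * x + a6)"
    unfolding st by Groebner_Basis.algebra
  then show ?thesis unfolding Affine ts on_curve.simps cs by (simp del: to_short.simps) (metis eq_iff_diff_eq_0)
qed simp

lemma inj_to_short: "inj to_short"
proof (rule injI)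
  fix P Q assume "to_short P = to_short Q"
  then show "P = Q" by (cases P; cases Q) auto
qed

lemma to_short_surj: "\<exists>Q. P = to_short Q"
proof (cases P)
  case (Affine x y)
  have "P = to_short (Affine (x - sx) (y - a1 / 2 * (x - sx) - a3 / 2))" by (simp add: Affine)
  then show ?thesis ..
qed (auto intro: exI[of _ Infinity])

lemma to_short_add:
  assumes "on_curve W P" "on_curve W Q"
  shows "to_short (point_add W P Q) = point_add short.E (to_short P) (to_short Q)"
proof (cases P; cases Q)
  fix x1 y1 x2 y2 assume PQ: "P = Affine x1 y1" "Q = Affine x2 y2"
  obtain s t c A' B' where cs: "sx = c" "A = A'" "B = B'" and st: "a1 = 2 * s" "a3 = 2 * t" "a2 = 3 * c - s^2" "A' = a4 + 2 * s * t - 3 * c^2"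
    "B' = 2 * c^3 - (a4 + 2 * s * t) * c + t^2 + a6" and ts: "\<And>x y. to_short (Affine x y) = Affine (x + c) (y + s * x + t)" by (rule halves) (rule that)
  define Y1 Y2 where "Y1 = y1 + s * x1 + t" "Y2 = y2 + s * x2 + t"
  show ?thesis
  proof (cases "x1 = x2 \<and> y1 + y2 + a1 * x2 + a3 = 0")
    case True
    then have "Y1 + Y2 = 0" by (simp add: Y1_Y2_def st algebra_simps)
    then show ?thesis using True unfolding PQ ts by (simp add: point_add_short Y1_Y2_def del: to_short.simps(2))
  next
    case False
    have nc: "\<not> (x1 + c = x2 + c \<and> Y1 + Y2 = 0)" using False by (simp add: Y1_Y2_def st algebra_simps)
    define l where "l = (if x1 = x2 then (3 * x1^2 + 2 * a2 * x1 + a4 - a1 * y1) / (2 * y1 + a1 * x1 + a3) else (y2 - y1) / (x2 - x1))"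
    define L where "L = (if x1 + c = x2 + c then (3 * (x1 + c)^2 + A') / (2 * Y1) else (Y2 - Y1) / ((x2 + c) - (x1 + c)))"
    have "L = l + s"
    proof (cases "x1 = x2")
      case True
      have "on_curve short.E (Affine (x1 + c) Y1)" "on_curve short.E (Affine (x2 + c) Y2)"
        using assms on_curve_to_short[of P] on_curve_to_short[of Q] by (simp_all add: PQ ts Y1_Y2_def del: on_curve.simps to_short.simps)
      then have "Y1^2 = Y2^2" using True by simp
      then have "Y1 = Y2" using nc True by (metis power2_eq_iff add.left_inverse)
      then have D: "Y1 \<noteq> 0" using nc True by auto
      have d: "2 * y1 + a1 * x1 + a3 = 2 * Y1" by (simp add: Y1_Y2_def st algebra_simps)
      have "3 * (x1 + c)^2 + A' = (3 * x1^2 + 2 * a2 * x1 + a4 - a1 * y1) + s * (2 * Y1)"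
        unfolding Y1_Y2_def st by Groebner_Basis.algebra
      then have "L = ((3 * x1^2 + 2 * a2 * x1 + a4 - a1 * y1) + s * (2 * Y1)) / (2 * Y1)" using True by (simp add: L_def)
      moreover have "l = (3 * x1^2 + 2 * a2 * x1 + a4 - a1 * y1) / (2 * Y1)" unfolding l_def d by (rule if_P[OF True])
      ultimately show ?thesis using D by (simp only: add_divide_distrib) simp
    next
      case False
      then show ?thesis by (simp add: L_def l_def Y1_Y2_def divide_simps) (simp add: algebra_simps)
    qed
    define x3 where "x3 = l^2 + a1 * l - a2 - x1 - x2"
    have X3: "L^2 - (x1 + c) - (x2 + c) = x3 + c"
      unfolding \<open>L = l + s\<close> x3_def st by Groebner_Basis.algebra
    have "point_add W P Q = Affine x3 (- (l * (x3 - x1) + y1) - a1 * x3 - a3)"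
      using False unfolding PQ by (simp add: Let_def l_def x3_def)
    then have 1: "to_short (point_add W P Q) = Affine (x3 + c) (- (l * (x3 - x1) + y1) - a1 * x3 - a3 + s * x3 + t)"
      by (simp add: ts del: to_short.simps(2))
    have "point_add short.E (to_short P) (to_short Q) = Affine (x3 + c) (- (L * ((x3 + c) - (x1 + c)) + Y1))"
      unfolding PQ ts Y1_Y2_def[symmetric] point_add_short if_not_P[OF nc] cs unfolding Let_def L_def[symmetric] unfolding X3 by (rule refl)
    also have "- (L * ((x3 + c) - (x1 + c)) + Y1) = - (l * (x3 - x1) + y1) - a1 * x3 - a3 + s * x3 + t"
      unfolding \<open>L = l + s\<close> Y1_Y2_def st by Groebner_Basis.algebra
    finally show ?thesis using 1 by simp
  qed
qed auto

lemma carrier_WG: "carrier WG = {P. on_curve W P}" by (simp add: point_group_def)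
lemma mult_WG: "P \<otimes>\<^bsub>WG\<^esub> Q = point_add W P Q" by (simp add: point_group_def)
lemma one_WG: "\<one>\<^bsub>WG\<^esub> = Infinity" by (simp add: point_group_def)
lemmas WG_simps = carrier_WG mult_WG one_WG

lemma WG_closed: "on_curve W P \<Longrightarrow> on_curve W Q \<Longrightarrow> on_curve W (point_add W P Q)"
  using to_short_add short.point_add_closed on_curve_to_short by metis

lemma to_short_iff: "P \<in> carrier WG \<longleftrightarrow> to_short P \<in> carrier SG"
  by (simp add: carrier_WG short.carrier_EG on_curve_to_short)

sublocale WG: comm_group WG
proof -
  interpret EG: comm_group SG by (rule short.comm_group_EG)
  have m: "to_short (P \<otimes>\<^bsub>WG\<^esub> Q) = to_short P \<otimes>\<^bsub>SG\<^esub> to_short Q" if "P \<in> carrier WG" "Q \<in> carrier WG" for P Q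
    using that by (simp add: WG_simps short.mult_EG to_short_add)
  have c: "P \<otimes>\<^bsub>WG\<^esub> Q \<in> carrier WG" if "P \<in> carrier WG" "Q \<in> carrier WG" for P Q
    using that by (simp add: WG_simps WG_closed)
  show "comm_group WG"
  proof (rule comm_groupI)
    fix P Q S assume PQS: "P \<in> carrier WG" "Q \<in> carrier WG" "S \<in> carrier WG"
    show "P \<otimes>\<^bsub>WG\<^esub> Q \<in> carrier WG" using PQS c by blast
    have "to_short (P \<otimes>\<^bsub>WG\<^esub> Q \<otimes>\<^bsub>WG\<^esub> S) = to_short (P \<otimes>\<^bsub>WG\<^esub> (Q \<otimes>\<^bsub>WG\<^esub> S))"
      using PQS by (simp add: m c EG.m_assoc to_short_iff)
    then show "P \<otimes>\<^bsub>WG\<^esub> Q \<otimes>\<^bsub>WG\<^esub> S = P \<otimes>\<^bsub>WG\<^esub> (Q \<otimes>\<^bsub>WG\<^esub> S)" by (rule injD[OF inj_to_short])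
    have "to_short (P \<otimes>\<^bsub>WG\<^esub> Q) = to_short (Q \<otimes>\<^bsub>WG\<^esub> P)"
      using PQS m EG.m_comm to_short_iff by metis
    then show "P \<otimes>\<^bsub>WG\<^esub> Q = Q \<otimes>\<^bsub>WG\<^esub> P" by (rule injD[OF inj_to_short])
    obtain R where R: "inv\<^bsub>SG\<^esub> (to_short P) = to_short R" using to_short_surj by blast
    have "R \<in> carrier WG" using PQS R to_short_iff EG.inv_closed by metis
    moreover have "to_short (R \<otimes>\<^bsub>WG\<^esub> P) = to_short \<one>\<^bsub>WG\<^esub>"
      using m[OF \<open>R \<in> carrier WG\<close> PQS(1)] PQS(1) EG.l_inv[of "to_short P"] to_short_iff by (simp add: R one_WG short.one_EG)
    then have "R \<otimes>\<^bsub>WG\<^esub> P = \<one>\<^bsub>WG\<^esub>" by (rule injD[OF inj_to_short])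
    ultimately show "\<exists>R\<in>carrier WG. R \<otimes>\<^bsub>WG\<^esub> P = \<one>\<^bsub>WG\<^esub>" by blast
  qed (auto simp: WG_simps)
qed

lemma to_short_hom: "group_hom WG SG to_short"
proof -
  interpret EG: comm_group SG by (rule short.comm_group_EG)
  show ?thesis
    by unfold_locales (auto simp: hom_def WG_simps short.EG_simps on_curve_to_short to_short_add)
qed

lemma to_short_nat_pow: "P \<in> carrier WG \<Longrightarrow> to_short (P [^]\<^bsub>WG\<^esub> (m::nat)) = to_short P [^]\<^bsub>SG\<^esub> m"
  using group_hom.hom_nat_pow[OF to_short_hom] .

lemma to_short_int_pow: "P \<in> carrier WG \<Longrightarrow> to_short (P [^]\<^bsub>WG\<^esub> (m::int)) = to_short P [^]\<^bsub>SG\<^esub> m"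
  using group_hom.hom_int_pow[OF to_short_hom] .

lemma to_short_one_iff: "to_short P = \<one>\<^bsub>SG\<^esub> \<longleftrightarrow> P = \<one>\<^bsub>WG\<^esub>"
  by (cases P) (simp_all add: one_WG short.one_EG)

context
  fixes \<tau> :: "'a \<Rightarrow> 'a"
  assumes \<tau>: "field_automorphism \<tau>" and fix_coeffs: "\<tau> a1 = a1" "\<tau> a2 = a2" "\<tau> a3 = a3" "\<tau> a4 = a4" "\<tau> a6 = a6"
begin

lemma aut_short: "\<tau> sx = sx" "\<tau> A = A" "\<tau> B = B"
proof -
  show s: "\<tau> sx = sx" by (simp add: sx_def field_automorphism_simps[OF \<tau>] fix_coeffs)
  show "\<tau> A = A" "\<tau> B = B" by (simp_all add: A_def B_def field_automorphism_simps[OF \<tau>] fix_coeffs s)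
qed

lemma to_short_map: "to_short (map_point \<tau> P) = map_point \<tau> (to_short P)"
  by (cases P) (simp_all add: field_automorphism_simps[OF \<tau>] fix_coeffs aut_short)

lemma map_closed: "P \<in> carrier WG \<Longrightarrow> map_point \<tau> P \<in> carrier WG"
  using short.aut_on_curve[OF \<tau> aut_short(2,3), of "to_short P"] to_short_map
  by (simp add: to_short_iff short.carrier_EG)

lemma map_add:
  assumes "P \<in> carrier WG" "Q \<in> carrier WG"
  shows "map_point \<tau> (P \<otimes>\<^bsub>WG\<^esub> Q) = map_point \<tau> P \<otimes>\<^bsub>WG\<^esub> map_point \<tau> Q"
proof -
  have "to_short (map_point \<tau> (P \<otimes>\<^bsub>WG\<^esub> Q)) = to_short (map_point \<tau> P \<otimes>\<^bsub>WG\<^esub> map_point \<tau> Q)"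
    using assms map_closed[of P] map_closed[of Q] short.aut_point_add[OF \<tau> aut_short(2,3), of "to_short P" "to_short Q"]
    by (simp add: WG_simps to_short_map to_short_add)
  then show ?thesis by (rule injD[OF inj_to_short])
qed

lemma map_nat_pow: "P \<in> carrier WG \<Longrightarrow> map_point \<tau> (P [^]\<^bsub>WG\<^esub> (m::nat)) = map_point \<tau> P [^]\<^bsub>WG\<^esub> m"
proof (induction m)
  case 0
  then show ?case by (simp add: one_WG)
next
  case (Suc m)
  then show ?case by (simp add: map_add)
qed

end

end

section \<open>The Galois action on torsion points\<close>

locale elliptic_galois = elliptic a1 a2 a3 a4 a6 + algebraic_over k
  for a1 a2 a3 a4 a6 :: "'a::field_char_0" and k :: "'a set" +
  fixes p n :: nat
  assumes coeffs: "a1 \<in> k" "a2 \<in> k" "a3 \<in> k" "a4 \<in> k" "a6 \<in> k"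
    and p: "Factorial_Ring.prime p" and p5: "p \<ge> 5" and n0: "n > 0"
begin

sublocale short: weil_curve A B p
  by unfold_locales (use ac p p5 in auto)

definition aut :: "('a \<Rightarrow> 'a) \<Rightarrow> bool" where
  "aut \<tau> \<longleftrightarrow> field_automorphism \<tau> \<and> (\<forall>c\<in>k. \<tau> c = c)"

lemma autD:
  assumes "aut \<tau>"
  shows "field_automorphism \<tau>" "c \<in> k \<Longrightarrow> \<tau> c = c" "\<tau> a1 = a1" "\<tau> a2 = a2" "\<tau> a3 = a3" "\<tau> a4 = a4" "\<tau> a6 = a6"
  using assms coeffs by (auto simp: aut_def)

lemma aut_inv: "aut \<tau> \<Longrightarrow> aut (finv \<tau>)"
  using field_automorphism_inv field_automorphism_inv_apply(2) unfolding aut_def by metis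

lemma aut_comp: "aut \<tau> \<Longrightarrow> aut \<tau>' \<Longrightarrow> aut (\<tau> \<circ> \<tau>')"
  unfolding aut_def field_automorphism_def by (auto intro: bij_comp)

lemma aut_id: "aut id" by (simp add: aut_def field_automorphism_def)

lemma aut_fixed: "(\<And>\<tau>. aut \<tau> \<Longrightarrow> \<tau> x = x) \<Longrightarrow> x \<in> k"
  using moving_automorphism unfolding aut_def by metis

abbreviation "T \<equiv> torsion_group W (p ^ n)"
abbreviation "K \<equiv> torsion_field k W (p ^ n)"
abbreviation "Gal \<equiv> galois_group K k"

lemma T_simps:
  "carrier T = {P \<in> carrier WG. P [^]\<^bsub>WG\<^esub> (p ^ n) = \<one>\<^bsub>WG\<^esub>}" "P \<otimes>\<^bsub>T\<^esub> Q = P \<otimes>\<^bsub>WG\<^esub> Q" "\<one>\<^bsub>T\<^esub> = \<one>\<^bsub>WG\<^esub>"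
  by (simp_all add: torsion_group_def)

lemma T_subgroup: "subgroup (carrier T) WG"
proof (rule WG.subgroupI)
  show "carrier T \<noteq> {}" using WG.one_closed by (auto simp: T_simps)
qed (auto simp: T_simps WG.nat_pow_inv WG.pow_mult_distrib WG.m_comm)

lemma T_eq: "T = WG\<lparr>carrier := carrier T\<rparr>" by (simp add: torsion_group_def)

sublocale T: comm_group T
proof (rule group.group_comm_groupI)
  show "group T" by (subst T_eq) (rule WG.subgroup_imp_group[OF T_subgroup])
qed (simp add: T_simps WG.m_comm)

lemma T_int_pow: "P \<in> carrier T \<Longrightarrow> P [^]\<^bsub>T\<^esub> (c::int) = P [^]\<^bsub>WG\<^esub> c"
  using WG.int_pow_consistent[OF T_subgroup, of P c] T_eq by simp

lemma finite_T: "finite (carrier T)"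
proof -
  define V where "V = {P\<in>carrier short.EG. P [^]\<^bsub>SG\<^esub> (p ^ n) = \<one>\<^bsub>SG\<^esub>}"
  have "card V = (p ^ n)^2" unfolding V_def using p5 by (intro short.card_torsion) simp
  then have "card V > 0" using p5 by simp
  then have "finite V" by (rule card_ge_0_finite)
  moreover have "to_short ` carrier T \<subseteq> V"
    unfolding V_def by (auto simp: T_simps to_short_iff[symmetric] to_short_nat_pow[symmetric] to_short_one_iff)
  ultimately have "finite (to_short ` carrier T)" by (rule rev_finite_subset)
  then show ?thesis using inj_on_subset[OF inj_to_short subset_UNIV] by (rule finite_imageD)
qed

lemma aut_T:
  assumes t: "aut \<tau>" and P: "P \<in> carrier T" shows "map_point \<tau> P \<in> carrier T"
proof -
  have "map_point \<tau> P [^]\<^bsub>WG\<^esub> (p ^ n) = map_point \<tau> (P [^]\<^bsub>WG\<^esub> (p ^ n))"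
    using P by (intro map_nat_pow[OF autD(1,3-7)[OF t], symmetric]) (simp add: T_simps)
  also have "\<dots> = \<one>\<^bsub>WG\<^esub>" using P by (simp add: T_simps one_WG)
  finally show ?thesis using map_closed[OF autD(1,3-7)[OF t]] P by (simp add: T_simps)
qed

lemma coordinates_in_K: "P \<in> carrier T \<Longrightarrow> set_point P \<subseteq> K"
  unfolding torsion_field_def using adjoin_closed(2) by blast

lemma K_induct [consumes 1, case_names one base gen uminus inverse add mult]:
  assumes "x \<in> K"
    and "Q 1" "\<And>c. c \<in> k \<Longrightarrow> Q c" "\<And>P c. P \<in> carrier T \<Longrightarrow> c \<in> set_point P \<Longrightarrow> Q c"
    "\<And>a. Q a \<Longrightarrow> Q (- a)" "\<And>a. Q a \<Longrightarrow> a \<noteq> 0 \<Longrightarrow> Q (inverse a)"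
    "\<And>a b. Q a \<Longrightarrow> Q b \<Longrightarrow> Q (a + b)" "\<And>a b. Q a \<Longrightarrow> Q b \<Longrightarrow> Q (a * b)"
  shows "Q x"
  using assms(1) unfolding torsion_field_def
  by (induction rule: adjoin_induct) (use assms(2-) in auto)

lemma K_field: "1 \<in> K" "0 \<in> K" "c \<in> k \<Longrightarrow> c \<in> K" "a \<in> K \<Longrightarrow> b \<in> K \<Longrightarrow> a + b \<in> K" "a \<in> K \<Longrightarrow> b \<in> K \<Longrightarrow> a * b \<in> K"
    "a \<in> K \<Longrightarrow> - a \<in> K" "a \<in> K \<Longrightarrow> inverse a \<in> K"
  unfolding torsion_field_def by (auto intro: adjoin_closed)

lemma aut_K:
  assumes t: "aut \<tau>" and x: "x \<in> K" shows "\<tau> x \<in> K"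
  using x
proof (induction rule: K_induct)
  case (gen P c)
  then have "\<tau> c \<in> set_point (map_point \<tau> P)" by (simp add: point.set_map)
  then show ?case using coordinates_in_K[OF aut_T[OF t gen(1)]] by blast
qed (use K_field autD(2)[OF t] in \<open>auto simp: field_automorphism_simps[OF autD(1)[OF t]]\<close>)

lemma restrict_in_Gal:
  assumes t: "aut \<tau>" shows "restrict \<tau> K \<in> carrier Gal"
proof -
  note s = field_automorphism_simps[OF autD(1)[OF t]]
  have "bij_betw \<tau> K K"
  proof (rule bij_betw_byWitness[where f' = "finv \<tau>"])
    show "\<tau> ` K \<subseteq> K" "finv \<tau> ` K \<subseteq> K" using aut_K[OF t] aut_K[OF aut_inv[OF t]] by auto
  qed (use field_automorphism_inv_apply[OF autD(1)[OF t]] in auto)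
  then have "restrict \<tau> K \<in> Bij K" by (simp add: Bij_def bij_betw_restrict_eq)
  then show ?thesis
    unfolding galois_group_def using aut_K[OF t] K_field autD(2)[OF t] by (auto simp: ring_hom_def s)
qed

text \<open>The pairing takes values in the closure and is equivariant for automorphisms of the
  whole of it. Galois elements are therefore handled as restrictions of such automorphisms, and the
  root of unity never has to be located in \<open>K\<close>.\<close>

lemma Gal_extends:
  assumes "\<sigma> \<in> carrier Gal" obtains \<tau> where "aut \<tau>" "\<sigma> = restrict \<tau> K"
proof -
  have s: "\<sigma> \<in> extensional K" "\<And>x y. x \<in> K \<Longrightarrow> y \<in> K \<Longrightarrow> \<sigma> (x + y) = \<sigma> x + \<sigma> y"
    "\<And>x y. x \<in> K \<Longrightarrow> y \<in> K \<Longrightarrow> \<sigma> (x * y) = \<sigma> x * \<sigma> y" "\<And>c. c \<in> k \<Longrightarrow> \<sigma> c = c"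
    using assms by (auto simp: galois_group_def Bij_def ring_hom_def)
  define R where "R = {(x, \<sigma> x) | x. x \<in> K}"
  have "graph R" unfolding graph_def R_def using s(2-4) K_field by fastforce
  then obtain \<tau> where t: "field_automorphism \<tau>" "\<And>c. c \<in> k \<Longrightarrow> \<tau> c = c" "\<And>x y. (x, y) \<in> R \<Longrightarrow> \<tau> x = y"
    by (rule extend_to_automorphism) (rule that)
  have "\<sigma> = restrict \<tau> K"
    using s(1) t(3) by (intro extensionalityI[of _ K]) (auto simp: R_def)
  moreover have "aut \<tau>" using t(1,2) by (simp add: aut_def)
  ultimately show thesis using that by blast
qed

lemma carrier_Gal: "carrier Gal = {restrict \<tau> K | \<tau>. aut \<tau>}"
  using restrict_in_Gal Gal_extends by blast

lemma mult_Gal: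
  assumes "aut \<tau>" "aut \<tau>'" shows "restrict \<tau> K \<otimes>\<^bsub>Gal\<^esub> restrict \<tau>' K = restrict (\<tau> \<circ> \<tau>') K"
proof -
  have "restrict \<tau> K \<in> Bij K" "restrict \<tau>' K \<in> Bij K" using restrict_in_Gal assms by (auto simp: galois_group_def)
  then show ?thesis using aut_K[OF assms(2)] by (auto simp: galois_group_def BijGroup_def compose_def)
qed

lemma one_Gal: "\<one>\<^bsub>Gal\<^esub> = restrict id K"
  by (auto simp: galois_group_def BijGroup_def)

lemma group_Gal: "group Gal"
proof (rule groupI)
  show "\<one>\<^bsub>Gal\<^esub> \<in> carrier Gal" unfolding one_Gal by (rule restrict_in_Gal[OF aut_id])
next
  fix f g assume "f \<in> carrier Gal" "g \<in> carrier Gal"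
  then show "f \<otimes>\<^bsub>Gal\<^esub> g \<in> carrier Gal" unfolding carrier_Gal using mult_Gal aut_comp by auto
next
  fix f g h assume "f \<in> carrier Gal" "g \<in> carrier Gal" "h \<in> carrier Gal"
  then show "f \<otimes>\<^bsub>Gal\<^esub> g \<otimes>\<^bsub>Gal\<^esub> h = f \<otimes>\<^bsub>Gal\<^esub> (g \<otimes>\<^bsub>Gal\<^esub> h)"
    unfolding carrier_Gal by (auto simp: mult_Gal aut_comp comp_assoc)
next
  fix f assume "f \<in> carrier Gal"
  then obtain \<tau> where t: "aut \<tau>" "f = restrict \<tau> K" by (auto simp: carrier_Gal)
  then show "\<one>\<^bsub>Gal\<^esub> \<otimes>\<^bsub>Gal\<^esub> f = f" unfolding one_Gal using mult_Gal[OF aut_id t(1)] by simp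
  have "finv \<tau> \<circ> \<tau> = id" using field_automorphism_inv_apply[OF autD(1)[OF t(1)]] by auto
  then have "restrict (finv \<tau>) K \<otimes>\<^bsub>Gal\<^esub> f = \<one>\<^bsub>Gal\<^esub>" unfolding t(2) one_Gal mult_Gal[OF aut_inv[OF t(1)] t(1)] by simp
  then show "\<exists>g\<in>carrier Gal. g \<otimes>\<^bsub>Gal\<^esub> f = \<one>\<^bsub>Gal\<^esub>" using restrict_in_Gal[OF aut_inv[OF t(1)]] by blast
qed

lemma map_restrict: "P \<in> carrier T \<Longrightarrow> map_point (restrict \<tau> K) P = map_point \<tau> P"
  by (rule point.map_cong0) (use coordinates_in_K in auto)

lemma finite_Gal: "finite (carrier Gal)"
proof -
  define f where "f \<sigma> = (\<lambda>P\<in>carrier T. map_point \<sigma> P)" for \<sigma> :: "'a \<Rightarrow> 'a"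
  have "inj_on f (carrier Gal)"
  proof (rule inj_onI)
    fix \<sigma> \<sigma>' assume s: "\<sigma> \<in> carrier Gal" "\<sigma>' \<in> carrier Gal" "f \<sigma> = f \<sigma>'"
    obtain \<tau> \<tau>' where t: "aut \<tau>" "\<sigma> = restrict \<tau> K" "aut \<tau>'" "\<sigma>' = restrict \<tau>' K" using s(1,2) by (auto simp: carrier_Gal)
    have m: "map_point \<tau> P = map_point \<tau>' P" if "P \<in> carrier T" for P
    proof -
      have "map_point \<sigma> P = map_point \<sigma>' P" using fun_cong[OF s(3), of P] that by (simp add: f_def)
      then show ?thesis unfolding t(2,4) map_restrict[OF that] .
    qed
    have "\<tau> x = \<tau>' x" if "x \<in> K" for x using that
    proof (induction rule: K_induct)
      case (gen P c)
      then show ?case using m[OF gen(1)] by (cases P) auto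
    qed (use autD(2)[OF t(1)] autD(2)[OF t(3)] in \<open>simp_all add: field_automorphism_simps[OF autD(1)[OF t(1)]] field_automorphism_simps[OF autD(1)[OF t(3)]]\<close>)
    then show "\<sigma> = \<sigma>'" unfolding t by (intro restrict_ext)
  qed
  moreover have "f ` carrier Gal \<subseteq> carrier T \<rightarrow>\<^sub>E carrier T"
    by (auto simp: f_def carrier_Gal map_restrict aut_T)
  moreover have "finite (carrier T \<rightarrow>\<^sub>E carrier T)" using finite_T by (intro finite_PiE)
  ultimately show ?thesis by (meson finite_subset finite_imageD)
qed

lemma k_points:
  assumes "P \<in> carrier WG" shows "P \<in> carrier (point_group W k) \<longleftrightarrow> (\<forall>\<tau>. aut \<tau> \<longrightarrow> map_point \<tau> P = P)"
proof -
  have "set_point P \<subseteq> k \<longleftrightarrow> (\<forall>\<tau>. aut \<tau> \<longrightarrow> map_point \<tau> P = P)"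
  proof
    assume "set_point P \<subseteq> k"
    then show "\<forall>\<tau>. aut \<tau> \<longrightarrow> map_point \<tau> P = P" using autD(2) by (cases P) auto
  next
    assume f: "\<forall>\<tau>. aut \<tau> \<longrightarrow> map_point \<tau> P = P"
    show "set_point P \<subseteq> k"
    proof (cases P)
      case (Affine x y)
      then have "\<tau> x = x \<and> \<tau> y = y" if "aut \<tau>" for \<tau> using f that by auto
      then show ?thesis using aut_fixed Affine by simp
    qed simp
  qed
  then show ?thesis using assms by (simp add: point_group_def)
qed

text \<open>The orders of rational points are taken in the record for \<open>k\<close>, so this
  record has to be recognised as a group. Closure under the group law follows from the description
  of rational points as fixed points in \<open>k_points\<close>.\<close>

lemma k_group: "group (point_group W k)" and k_pow: "P [^]\<^bsub>point_group W k\<^esub> (m::nat) = P [^]\<^bsub>WG\<^esub> m"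
proof -
  have e: "point_group W k = WG\<lparr>carrier := carrier (point_group W k)\<rparr>" by (simp add: point_group_def)
  have s: "carrier (point_group W k) \<subseteq> carrier WG" by (auto simp: point_group_def)
  have "subgroup (carrier (point_group W k)) WG"
  proof (rule WG.subgroupI[OF s])
    have "Infinity \<in> carrier (point_group W k)" by (simp add: point_group_def)
    then show "carrier (point_group W k) \<noteq> {}" by blast
  next
    fix P assume P: "P \<in> carrier (point_group W k)"
    then have Pc: "P \<in> carrier WG" using s by blast
    have "map_point \<tau> (inv\<^bsub>WG\<^esub> P) = inv\<^bsub>WG\<^esub> P" if t: "aut \<tau>" for \<tau>
    proof -
      note a = autD(1,3-7)[OF t]
      have "map_point \<tau> P = P" using P k_points[OF Pc] t by blast
      then have "map_point \<tau> (inv\<^bsub>WG\<^esub> P) \<otimes>\<^bsub>WG\<^esub> P = \<one>\<^bsub>WG\<^esub>"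
        using map_add[OF a, of "inv\<^bsub>WG\<^esub> P" P] Pc by (simp add: one_WG)
      then show ?thesis by (rule WG.inv_equality[symmetric]) (use Pc map_closed[OF a] in auto)
    qed
    then show "inv\<^bsub>WG\<^esub> P \<in> carrier (point_group W k)" using k_points Pc by simp
  next
    fix P Q assume PQ: "P \<in> carrier (point_group W k)" "Q \<in> carrier (point_group W k)"
    then have c: "P \<in> carrier WG" "Q \<in> carrier WG" using s by auto
    have "map_point \<tau> (P \<otimes>\<^bsub>WG\<^esub> Q) = P \<otimes>\<^bsub>WG\<^esub> Q" if t: "aut \<tau>" for \<tau>
      using map_add[OF autD(1,3-7)[OF t] c] PQ k_points[OF c(1)] k_points[OF c(2)] t by simp
    then show "P \<otimes>\<^bsub>WG\<^esub> Q \<in> carrier (point_group W k)" using k_points[OF WG.m_closed[OF c]] by blast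
  qed
  then show "group (point_group W k)" by (subst e) (rule WG.subgroup_imp_group)
  show "P [^]\<^bsub>point_group W k\<^esub> (m::nat) = P [^]\<^bsub>WG\<^esub> m" by (subst e) (rule WG.nat_pow_consistent[symmetric])
qed

end

section \<open>Roots of unity and the conclusion for elliptic curves\<close>

lemma root_of_unity_power:
  fixes \<xi> z :: "'a::field"
  assumes p: "Factorial_Ring.prime p" and x: "\<xi> ^ p = 1" "\<xi> \<noteq> 1" and z: "z ^ p = 1"
  shows "\<exists>j. z = \<xi> ^ j"
proof -
  define f :: "'a poly" where "f = Polynomial.monom 1 p - 1"
  have p0: "p > 0" using p prime_gt_0_nat by blast
  have "poly.coeff f p = 1" using p0 by (simp add: f_def)
  then have f0: "f \<noteq> 0" by auto
  have deg: "degree f \<le> p" unfolding f_def by (rule degree_diff_le) (simp_all add: degree_monom_le)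
  have roots: "{y. poly f y = 0} = {y. y ^ p = 1}" by (auto simp: f_def poly_monom)
  have fin: "finite {y. y ^ p = (1::'a)}" using poly_roots_finite[OF f0] roots by simp
  have sub: "(\<lambda>i. \<xi> ^ i) ` {..<p} \<subseteq> {y. y ^ p = 1}"
  proof
    fix y assume "y \<in> (\<lambda>i. \<xi> ^ i) ` {..<p}"
    then obtain i where "y = \<xi> ^ i" by blast
    then have "y ^ p = (\<xi> ^ p) ^ i" by (simp flip: power_mult add: mult.commute)
    then show "y \<in> {y. y ^ p = 1}" using x by simp
  qed
  have x0: "\<xi> \<noteq> 0" using x(1) p0 by (auto simp: power_0_left)
  have "i = j" if "i < p" "j < p" "\<xi> ^ i = \<xi> ^ j" "i \<le> j" for i j
  proof -
    have "\<xi> ^ i * \<xi> ^ (j - i) = \<xi> ^ i * 1" using that(3,4) unfolding power_add[symmetric] by simp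
    then have "\<xi> ^ (j - i) = 1" using x0 by simp
    then have "p dvd j - i" by (rule root_of_unity_exponent[OF p x])
    then show ?thesis using that by (metis diff_is_0_eq dvd_imp_le le_antisym less_imp_diff_less not_less zero_less_diff)
  qed
  then have "inj_on (\<lambda>i. \<xi> ^ i) {..<p}" by (intro inj_onI) (metis lessThan_iff linear)
  then have "card ((\<lambda>i. \<xi> ^ i) ` {..<p}) = p" by (simp add: card_image)
  moreover have "card {y. y ^ p = (1::'a)} \<le> p" using card_poly_roots_bound[OF f0] deg unfolding roots by simp
  ultimately have "(\<lambda>i. \<xi> ^ i) ` {..<p} = {y. y ^ p = 1}"
    using card_mono[OF fin sub] by (intro card_subset_eq[OF fin sub]) simp
  then show ?thesis using z by blast
qed

lemma power_mod_eq:
  fixes \<xi> :: "'a::field"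
  assumes "\<xi> ^ p = 1" "int p dvd int a - int b" shows "\<xi> ^ a = \<xi> ^ b"
proof -
  have m: "\<xi> ^ c = \<xi> ^ (c mod p)" for c
  proof -
    have "\<xi> ^ c = \<xi> ^ (p * (c div p) + c mod p)" by simp
    also have "\<dots> = (\<xi> ^ p) ^ (c div p) * \<xi> ^ (c mod p)" by (simp only: power_add power_mult)
    finally show ?thesis using assms(1) by simp
  qed
  have "a mod p = b mod p" using assms(2) by (metis cong_def cong_iff_dvd_diff cong_int_iff)
  then show ?thesis using m by metis
qed

context elliptic_galois
begin

theorem H1_loc_torsion:
  assumes notors: "\<not> (\<exists>P\<in>carrier (point_group W k). group.ord (point_group W k) P = p)"
    and z: "primitive_root_of_unity p z" and zk: "z + inverse z \<notin> k"
  shows "H1_loc Gal T map_point = {\<one>\<^bsub>H1 Gal T map_point\<^esub>}"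
proof -
  obtain S0 U0 where SU0: "S0 \<in> carrier SG" "U0 \<in> carrier SG"
    and ind: "\<And>(a::int) (b::int). S0 [^]\<^bsub>SG\<^esub> a \<otimes>\<^bsub>SG\<^esub> U0 [^]\<^bsub>SG\<^esub> b = \<one>\<^bsub>SG\<^esub> \<longleftrightarrow> int p ^ n dvd a \<and> int p ^ n dvd b"
    and gen: "\<And>P. P \<in> carrier SG \<Longrightarrow> P [^]\<^bsub>SG\<^esub> (p ^ n) = \<one>\<^bsub>SG\<^esub> \<Longrightarrow> \<exists>(a::int) (b::int). P = S0 [^]\<^bsub>SG\<^esub> a \<otimes>\<^bsub>SG\<^esub> U0 [^]\<^bsub>SG\<^esub> b"
    and tors: "S0 [^]\<^bsub>SG\<^esub> (p ^ (n - 1)) \<in> short.tors" "U0 [^]\<^bsub>SG\<^esub> (p ^ (n - 1)) \<in> short.tors"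
    and ne: "short.weil (S0 [^]\<^bsub>SG\<^esub> (p ^ (n - 1))) (U0 [^]\<^bsub>SG\<^esub> (p ^ (n - 1))) \<noteq> 1"
    by (rule short.torsion_basis[OF n0]) (rule that)
  obtain S U where SU: "to_short S = S0" "to_short U = U0" using to_short_surj by metis
  have SUW: "S \<in> carrier WG" "U \<in> carrier WG" using SU SU0 by (simp_all add: to_short_iff)
  have ts: "to_short (S [^]\<^bsub>WG\<^esub> a \<otimes>\<^bsub>WG\<^esub> U [^]\<^bsub>WG\<^esub> b) = S0 [^]\<^bsub>SG\<^esub> a \<otimes>\<^bsub>SG\<^esub> U0 [^]\<^bsub>SG\<^esub> b" for a b :: int
    using SUW SU to_short_int_pow group_hom.hom_mult[OF to_short_hom] by simp
  have "S [^]\<^bsub>WG\<^esub> int (p ^ n) = \<one>\<^bsub>WG\<^esub>" "U [^]\<^bsub>WG\<^esub> int (p ^ n) = \<one>\<^bsub>WG\<^esub>"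
    using ts[of "int (p ^ n)" 0] ts[of 0 "int (p ^ n)"] ind[of "int (p ^ n)" 0] ind[of 0 "int (p ^ n)"] to_short_one_iff SUW
    by (simp_all del: of_nat_power add: of_nat_power[symmetric])
  then have SUT: "S \<in> carrier T" "U \<in> carrier T" using SUW by (simp_all add: T_simps int_pow_int del: of_nat_power)
  have Tpow: "S [^]\<^bsub>T\<^esub> a \<otimes>\<^bsub>T\<^esub> U [^]\<^bsub>T\<^esub> b = S [^]\<^bsub>WG\<^esub> a \<otimes>\<^bsub>WG\<^esub> U [^]\<^bsub>WG\<^esub> b" for a b :: int
    using SUT by (simp add: T_int_pow T_simps)
  interpret torsion_rep Gal T map_point S U p n
  proof (intro torsion_rep.intro torsion_rep_axioms.intro group_Gal T.comm_group_axioms finite_Gal p p5 n0 SUT)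
    fix \<sigma> P assume s: "\<sigma> \<in> carrier Gal" "P \<in> carrier T"
    then show "map_point \<sigma> P \<in> carrier T" by (auto simp: carrier_Gal map_restrict aut_T)
    fix Q assume Q: "Q \<in> carrier T"
    obtain \<tau> where t: "aut \<tau>" "\<sigma> = restrict \<tau> K" using Gal_extends[OF s(1)] .
    have "map_point \<tau> (P \<otimes>\<^bsub>WG\<^esub> Q) = map_point \<tau> P \<otimes>\<^bsub>WG\<^esub> map_point \<tau> Q"
      by (rule map_add[OF autD(1,3-7)[OF t(1)]]) (use s(2) Q in \<open>auto simp: T_simps\<close>)
    then show "map_point \<sigma> (P \<otimes>\<^bsub>T\<^esub> Q) = map_point \<sigma> P \<otimes>\<^bsub>T\<^esub> map_point \<sigma> Q"
      unfolding t(2) map_restrict[OF s(2)] map_restrict[OF Q] map_restrict[OF T.m_closed[OF s(2) Q]] by (simp add: T_simps)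
  next
    fix \<sigma> \<sigma>' P assume s: "\<sigma> \<in> carrier Gal" "\<sigma>' \<in> carrier Gal" "P \<in> carrier T"
    obtain \<tau> where t: "aut \<tau>" "\<sigma> = restrict \<tau> K" using Gal_extends[OF s(1)] .
    obtain \<tau>' where t': "aut \<tau>'" "\<sigma>' = restrict \<tau>' K" using Gal_extends[OF s(2)] .
    show "map_point (\<sigma> \<otimes>\<^bsub>Gal\<^esub> \<sigma>') P = map_point \<sigma> (map_point \<sigma>' P)"
      unfolding t(2) t'(2) mult_Gal[OF t(1) t'(1)] map_restrict[OF s(3)] map_restrict[OF aut_T[OF t'(1) s(3)]]
      by (simp add: point.map_comp)
  next
    fix P assume "P \<in> carrier T"
    then show "map_point \<one>\<^bsub>Gal\<^esub> P = P" unfolding one_Gal by (simp add: map_restrict point.map_id)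
    have "to_short P \<in> carrier SG" "to_short P [^]\<^bsub>SG\<^esub> (p ^ n) = \<one>\<^bsub>SG\<^esub>"
      using \<open>P \<in> carrier T\<close> by (auto simp: T_simps to_short_iff[symmetric] to_short_nat_pow[symmetric] to_short_one_iff)
    from gen[OF this] obtain a b :: int where "to_short P = to_short (S [^]\<^bsub>WG\<^esub> a \<otimes>\<^bsub>WG\<^esub> U [^]\<^bsub>WG\<^esub> b)" unfolding ts by blast
    then have "P = S [^]\<^bsub>WG\<^esub> a \<otimes>\<^bsub>WG\<^esub> U [^]\<^bsub>WG\<^esub> b" by (rule injD[OF inj_to_short])
    then show "\<exists>(a::int) (b::int). P = S [^]\<^bsub>T\<^esub> a \<otimes>\<^bsub>T\<^esub> U [^]\<^bsub>T\<^esub> b" unfolding Tpow by blast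
  next
    fix a b :: int
    show "S [^]\<^bsub>T\<^esub> a \<otimes>\<^bsub>T\<^esub> U [^]\<^bsub>T\<^esub> b = \<one>\<^bsub>T\<^esub> \<longleftrightarrow> int p ^ n dvd a \<and> int p ^ n dvd b"
      unfolding Tpow ind[symmetric] ts[symmetric] to_short_one_iff T_simps(3) ..
  qed
  have nf: "rep.fixes_no_vector"
  proof (rule fixes_no_vectorI)
    fix P assume P: "P \<in> carrier T" "P [^]\<^bsub>T\<^esub> int p = \<one>\<^bsub>T\<^esub>" "\<forall>g\<in>carrier Gal. map_point g P = P"
    have PW: "P \<in> carrier WG" using P by (simp add: T_simps)
    have "map_point \<tau> P = P" if "aut \<tau>" for \<tau>
      using P(3) restrict_in_Gal[OF that] map_restrict[OF P(1), of \<tau>] by metis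
    then have Pk: "P \<in> carrier (point_group W k)" using k_points[OF PW] by blast
    interpret kG: group "point_group W k" by (rule k_group)
    have "P [^]\<^bsub>point_group W k\<^esub> p = \<one>\<^bsub>point_group W k\<^esub>"
      using P(2) T_int_pow[OF P(1), of "int p"] by (simp add: k_pow int_pow_int T_simps) (simp add: point_group_def)
    then have "kG.ord P dvd p" using kG.pow_eq_id[OF Pk] by blast
    moreover have "kG.ord P \<noteq> p" using notors Pk by blast
    ultimately have "kG.ord P = 1" using p unfolding prime_nat_iff by blast
    then have "P = \<one>\<^bsub>point_group W k\<^esub>" using kG.ord_eq_1[OF Pk] by blast
    then show "P = \<one>\<^bsub>T\<^esub>" by (simp add: T_simps point_group_def)
  qed
  \<comment> \<open>If all determinants were 1 or -1 modulo \<open>p\<close>, every automorphism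
    over \<open>k\<close> would fix or invert the value \<open>\<xi>\<close> of the pairing. As
    \<open>z\<close> is a power of \<open>\<xi>\<close>, the sum \<open>z + inverse z\<close> would
    be fixed.\<close>
  have d: "\<exists>g\<in>carrier Gal. \<not> int p dvd (det2 (R g))^2 - 1"
  proof (rule ccontr)
    assume "\<not> (\<exists>g\<in>carrier Gal. \<not> int p dvd (det2 (R g))^2 - 1)"
    then have "int p dvd (det2 (R g) - 1) * (det2 (R g) + 1)" if "g \<in> carrier Gal" for g
      using that by (auto simp: algebra_simps power2_eq_square)
    then have det: "int p dvd det2 (R g) - 1 \<or> int p dvd det2 (R g) + 1" if "g \<in> carrier Gal" for g
      using that by (simp add: rep.p_dvd_mult)
    define e where "e = p ^ (n - 1)"
    \<comment> \<open>The pairing lives on the \<open>p\<close>-torsion, so the basis is multiplied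
      by \<open>p^(n - 1)\<close>; on the resulting points the matrix matters only modulo
      \<open>p\<close>.\<close>
    define S1 U1 where "S1 = S0 [^]\<^bsub>SG\<^esub> e" "U1 = U0 [^]\<^bsub>SG\<^esub> e"
    define \<xi> where "\<xi> = short.weil S1 U1"
    have tors1: "S1 \<in> short.tors" "U1 \<in> short.tors" and x1: "\<xi> \<noteq> 1" using tors ne unfolding S1_U1_def \<xi>_def e_def by auto
    have xp: "\<xi> ^ p = 1" unfolding \<xi>_def by (rule short.weil_root_of_unity[OF tors1])
    have x0: "\<xi> \<noteq> 0" unfolding \<xi>_def by (rule short.weil_props(1)[OF tors1])
    have tx: "\<tau> \<xi> = \<xi> \<or> \<tau> \<xi> * \<xi> = 1" if t: "aut \<tau>" for \<tau>
    proof -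
      note a = autD(1,3-7)[OF t] and s = autD(1)[OF t] aut_short(2,3)[OF autD(1,3-7)[OF t]]
      define g where "g = restrict \<tau> K"
      have g: "g \<in> carrier Gal" unfolding g_def by (rule restrict_in_Gal[OF t])
      define L where "L = R g"
      have m: "map_point \<tau> S0 = S0 [^]\<^bsub>SG\<^esub> m11 L \<otimes>\<^bsub>SG\<^esub> U0 [^]\<^bsub>SG\<^esub> m21 L"
        "map_point \<tau> U0 = S0 [^]\<^bsub>SG\<^esub> m12 L \<otimes>\<^bsub>SG\<^esub> U0 [^]\<^bsub>SG\<^esub> m22 L"
      proof -
        have "map_point \<tau> S = S [^]\<^bsub>WG\<^esub> m11 L \<otimes>\<^bsub>WG\<^esub> U [^]\<^bsub>WG\<^esub> m21 L"
          using rho(1)[OF g] unfolding g_def map_restrict[OF SUT(1)] pt_def Tpow L_def .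
        then show "map_point \<tau> S0 = S0 [^]\<^bsub>SG\<^esub> m11 L \<otimes>\<^bsub>SG\<^esub> U0 [^]\<^bsub>SG\<^esub> m21 L"
          using to_short_map[OF a, of S] ts SU(1) by metis
        have "map_point \<tau> U = S [^]\<^bsub>WG\<^esub> m12 L \<otimes>\<^bsub>WG\<^esub> U [^]\<^bsub>WG\<^esub> m22 L"
          using rho(2)[OF g] unfolding g_def map_restrict[OF SUT(2)] pt_def Tpow L_def mat2.sel .
        then show "map_point \<tau> U0 = S0 [^]\<^bsub>SG\<^esub> m12 L \<otimes>\<^bsub>SG\<^esub> U0 [^]\<^bsub>SG\<^esub> m22 L"
          using to_short_map[OF a, of U] ts SU(2) by metis
      qed
      \<comment> \<open>Natural number representatives modulo \<open>p\<close>, as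
        \<open>weil_determinant\<close> has natural exponents.\<close>
      define r where "r x = nat (x mod int p)" for x
      have ep: "(S0 [^]\<^bsub>SG\<^esub> x \<otimes>\<^bsub>SG\<^esub> U0 [^]\<^bsub>SG\<^esub> y) [^]\<^bsub>SG\<^esub> e
        = S1 [^]\<^bsub>SG\<^esub> r x \<otimes>\<^bsub>SG\<^esub> U1 [^]\<^bsub>SG\<^esub> r y" for x y :: int
      proof -
        have "(S0 [^]\<^bsub>SG\<^esub> x \<otimes>\<^bsub>SG\<^esub> U0 [^]\<^bsub>SG\<^esub> y) [^]\<^bsub>SG\<^esub> int e
          = (S0 [^]\<^bsub>SG\<^esub> int e) [^]\<^bsub>SG\<^esub> x \<otimes>\<^bsub>SG\<^esub> (U0 [^]\<^bsub>SG\<^esub> int e) [^]\<^bsub>SG\<^esub> y"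
          using SU0 by (simp add: short.EG.int_pow_distrib short.EG.int_pow_pow mult.commute)
        then show ?thesis
          unfolding int_pow_int S1_U1_def[symmetric] short.torsion_int_pow[OF tors1(1)] short.torsion_int_pow[OF tors1(2)] r_def .
      qed
      have m1: "map_point \<tau> S1 = S1 [^]\<^bsub>SG\<^esub> r (m11 L) \<otimes>\<^bsub>SG\<^esub> U1 [^]\<^bsub>SG\<^esub> r (m21 L)"
        "map_point \<tau> U1 = S1 [^]\<^bsub>SG\<^esub> r (m12 L) \<otimes>\<^bsub>SG\<^esub> U1 [^]\<^bsub>SG\<^esub> r (m22 L)"
        unfolding ep[symmetric] m[symmetric] by (simp_all add: S1_U1_def short.aut_pow[OF s])
      have w: "\<tau> \<xi> * \<xi> ^ (r (m12 L) * r (m21 L)) = \<xi> ^ (r (m11 L) * r (m22 L))"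
        unfolding \<xi>_def by (rule short.weil_determinant[OF s tors1 m1])
      have r: "int p dvd x - int (r x)" for x using p5 by (simp add: r_def minus_mod_eq_mult_div)
      define P where "P = int p"
      have r': "P dvd x - int (r x)" for x unfolding P_def by (rule r)
      from det[OF g] show ?thesis
      proof
        assume "int p dvd det2 (R g) - 1"
        then have "P dvd m11 L * m22 L - m12 L * m21 L - 1" by (simp add: det2_def L_def P_def)
        then have "P dvd int (r (m11 L)) * int (r (m22 L)) - (int (r (m12 L)) * int (r (m21 L)) + 1)"
          using r'[of "m11 L"] r'[of "m12 L"] r'[of "m21 L"] r'[of "m22 L"] by Groebner_Basis.algebra
        then have "\<xi> ^ (r (m11 L) * r (m22 L)) = \<xi> ^ (r (m12 L) * r (m21 L) + 1)"
          by (intro power_mod_eq[OF xp]) (simp only: P_def of_nat_mult of_nat_add of_nat_1)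
        then show ?thesis using w x0 by simp
      next
        assume "int p dvd det2 (R g) + 1"
        then have "P dvd m11 L * m22 L - m12 L * m21 L + 1" by (simp add: det2_def L_def P_def)
        then have "P dvd int (r (m12 L)) * int (r (m21 L)) - (int (r (m11 L)) * int (r (m22 L)) + 1)"
          using r'[of "m11 L"] r'[of "m12 L"] r'[of "m21 L"] r'[of "m22 L"] by Groebner_Basis.algebra
        then have "\<xi> ^ (r (m12 L) * r (m21 L)) = \<xi> ^ (r (m11 L) * r (m22 L) + 1)"
          by (intro power_mod_eq[OF xp]) (simp only: P_def of_nat_mult of_nat_add of_nat_1)
        then have "(\<tau> \<xi> * \<xi>) * \<xi> ^ (r (m11 L) * r (m22 L)) = 1 * \<xi> ^ (r (m11 L) * r (m22 L))" using w by (simp add: mult.assoc)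
        then show ?thesis using x0 by simp
      qed
    qed
    have "z ^ p = 1" using z by (simp add: primitive_root_of_unity_def)
    then obtain j where j: "z = \<xi> ^ j" using root_of_unity_power[OF p xp x1] by blast
    have "\<tau> (z + inverse z) = z + inverse z" if t: "aut \<tau>" for \<tau>
    proof -
      note s = field_automorphism_simps[OF autD(1)[OF t]]
      from tx[OF t] have "\<tau> \<xi> = \<xi> \<or> \<tau> \<xi> = inverse \<xi>" using x0 by (metis inverse_unique mult.commute)
      then show ?thesis
      proof
        assume "\<tau> \<xi> = inverse \<xi>"
        then show ?thesis by (simp add: j s power_inverse add.commute)
      qed (simp add: j s)
    qed
    then have "z + inverse z \<in> k" by (rule aut_fixed)
    then show False using zk by simp
  qed
  show ?thesis by (rule H1_loc_trivial[OF nf d])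
qed

end

theorem theorem1:
  fixes k :: "'a::field_char_0 set"
    and E :: "'a weierstrass"
    and \<zeta> :: 'a
    and p n :: nat
  assumes "Factorial_Ring.prime p"
    and "n > 0"
    and "number_field k"
    and "algebraic_closure ring_of_type_algebra k"
    and "elliptic_curve_over k E"
    and "primitive_root_of_unity p \<zeta>"
    and "\<not> adjoin \<rat> {\<zeta> + inverse \<zeta>} \<subseteq> k"
    and "\<not> (\<exists>P\<in>carrier (point_group E k). group.ord (point_group E k) P = p)"
  shows "let G = galois_group (torsion_field k E (p ^ n)) k;
             M = torsion_group E (p ^ n)
         in H1_loc G M map_point = {\<one>\<^bsub>H1 G M map_point\<^esub>}"
proof -
  have sk: "subfield k type_ring" using assms(3) by (simp add: number_field_def)
  interpret algebraic_over k by (rule algebraic_overI[OF sk assms(4)])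
  have nat: "of_nat m \<in> k" for m by (induction m) (auto intro: k_add)
  have int: "of_int m \<in> k" for m by (cases m rule: int_cases2) (auto intro: nat k_uminus)
  have rat: "\<rat> \<subseteq> k"
  proof
    fix x :: 'a assume "x \<in> \<rat>"
    then obtain r where "x = of_rat r" by (elim Rats_cases)
    moreover obtain a b where "r = Rat.Fract a b" "b \<noteq> 0" by (cases r) auto
    ultimately have "x = of_int a * inverse (of_int b)" by (simp add: of_rat_rat divide_inverse)
    then show "x \<in> k" using int k_mult k_inverse by metis
  qed
  have zk: "\<zeta> + inverse \<zeta> \<notin> k"
  proof
    assume z: "\<zeta> + inverse \<zeta> \<in> k"
    have "x \<in> k" if "x \<in> adjoin \<rat> {\<zeta> + inverse \<zeta>}" for x
      using that by (induction rule: adjoin_induct) (use rat z k_add k_mult k_uminus k_inverse in auto)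
    then show False using assms(7) by blast
  qed
  have z: "\<zeta> ^ p = 1" "\<And>j. 0 < j \<Longrightarrow> j < p \<Longrightarrow> \<zeta> ^ j \<noteq> 1" using assms(6) by (auto simp: primitive_root_of_unity_def)
  have "p \<noteq> 2"
  proof
    assume "p = 2"
    then have "\<zeta> = 1 \<or> \<zeta> = - 1" using z(1) by (simp add: power2_eq_1_iff)
    then have "\<zeta> + inverse \<zeta> = of_int 2 \<or> \<zeta> + inverse \<zeta> = of_int (- 2)" by auto
    then show False using zk int by metis
  qed
  moreover have "p \<noteq> 3"
  proof
    assume p3: "p = 3"
    have "(\<zeta> - 1) * (\<zeta>^2 + \<zeta> + 1) = \<zeta>^3 - 1" by (simp add: algebra_simps power2_eq_square power3_eq_cube)
    moreover have "\<zeta> \<noteq> 1" using z(2)[of 1] p3 by simp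
    ultimately have 1: "\<zeta>^2 + \<zeta> + 1 = 0" using z(1) p3 by simp
    then have z0: "\<zeta> \<noteq> 0" by auto
    have "\<zeta> * (\<zeta> + inverse \<zeta>) = \<zeta> * (- 1)"
      using 1 z0 by (simp add: distrib_left power2_eq_square) (simp add: eq_neg_iff_add_eq_0 ac_simps)
    then have "\<zeta> + inverse \<zeta> = of_int (- 1)" using z0 unfolding mult_cancel_left by simp
    then show False using zk int by metis
  qed
  moreover have "p \<noteq> 4" using assms(1) by (auto simp: prime_nat_numeral_eq)
  ultimately have p5: "p \<ge> 5" using prime_ge_2_nat[OF assms(1)] by linarith
  obtain a1 a2 a3 a4 a6 where E: "E = Weierstrass a1 a2 a3 a4 a6" by (cases E)
  interpret elliptic_galois a1 a2 a3 a4 a6 k p n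
    by unfold_locales (use assms(1,2,5) p5 in \<open>auto simp: E elliptic_curve_over_def simp del: discriminant.simps\<close>)
  show ?thesis using H1_loc_torsion[OF _ assms(6) zk] assms(8) unfolding E Let_def by blast
qed

end
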